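(* Let $\alpha$ be a real number such that $\alpha-\tfrac12$ is a non-negative integer. Suppose that $E\subset\mathbb{R}^+$ is a measurable set that is relatively dense with respect to $\mu_\alpha$, meaning that there is $\gamma>0$ such that $$\mu_\alpha(E\cap[r,r+1])\ge\gamma\,\mu_\alpha([r,r+1])\qquad\text{for all } r\ge0.$$ Let $N\ge1$ be an integer. Then there is a constant $C>0$, depending on $\alpha$, $\gamma$ and $N$ but not on the positions of the intervals below, such that: if $I_1,\dots,I_N\subset\mathbb{R}^+$ are disjoint intervals of length $1$ and $f\in L^2_\alpha(\mathbb{R}^+)$ satisfies $\operatorname{supp}\mathcal{F}_\alpha(f)\subset\bigcup_{k=1}^N I_k$, then $$\|f\|_{L^2_\alpha(\mathbb{R}^+)}\le C\,\|f\|_{L^2_\alpha(E)}.$$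
   Context: $\mathbb{R}^+=[0,\infty)$. For $\alpha>-1/2$, the measure $\mu_\alpha$ on $\mathbb{R}^+$ is $d\mu_\alpha(x)=\frac{2\pi^{\alpha+1}}{\Gamma(\alpha+1)}\,x^{2\alpha+1}\,dx$. The space $L^p_\alpha(\mathbb{R}^+)$, $1\le p<\infty$, consists of the measurable functions $f:\mathbb{R}^+\to\mathbb{R}$ with $\|f\|_{L^p_\alpha}=\left(\int_0^\infty|f(x)|^p\,d\mu_\alpha(x)\right)^{1/p}<\infty$; for measurable $E\subset\mathbb{R}^+$, $\|f\|_{L^2_\alpha(E)}=\left(\int_E|f|^2\,d\mu_\alpha\right)^{1/2}$. The modified Bessel function is $j_\alpha(x)=\Gamma(\alpha+1)\sum_{n=0}^\infty\frac{(-1)^n}{n!\,\Gamma(n+\alpha+1)}\left(\frac{x}{2}\right)^{2n}$. The Fourier–Bessel transform is $\mathcal{F}_\alpha(f)(y)=\int_0^\infty f(x)\,j_\alpha(2\pi xy)\,d\mu_\alpha(x)$ for $f \in L^1_\alpha(\mathbb{R}^+)\cap L^2_\alpha(\mathbb{R}^+)$, and it extends to an isometry of $L^2_\alpha(\mathbb{R}^+)$; for $f\in L^2_\alpha(\mathbb{R}^+)$, $\mathcal{F}_\alpha(f)$ denotes this extension. *)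

theory Defs
  imports "HOL-Analysis.Analysis"
begin

text \<open>The underlying space of \<open>fb_measure \<alpha>\<close> is the half-line: a function on it is a
  function \<open>real \<Rightarrow> real\<close> whose values at negative arguments play no role.\<close>

definition fb_measure :: "real \<Rightarrow> real measure" where
  "fb_measure \<alpha> = density (lebesgue_on {0..})
     (\<lambda>x. ennreal (2 * pi powr (\<alpha> + 1) / Gamma (\<alpha> + 1) * x powr (2 * \<alpha> + 1)))"

text \<open>Functions, not classes modulo almost everywhere equality.\<close>

definition fb_space :: "real \<Rightarrow> real \<Rightarrow> (real \<Rightarrow> real) set" where
  "fb_space \<alpha> p = {f \<in> borel_measurable (fb_measure \<alpha>).
     integrable (fb_measure \<alpha>) (\<lambda>x. \<bar>f x\<bar> powr p)}"

definition fb_norm_on :: "real \<Rightarrow> real \<Rightarrow> real set \<Rightarrow> (real \<Rightarrow> real) \<Rightarrow> real" where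
  "fb_norm_on \<alpha> p E f = (LINT x:E|fb_measure \<alpha>. \<bar>f x\<bar> powr p) powr (1 / p)"

abbreviation fb_norm :: "real \<Rightarrow> real \<Rightarrow> (real \<Rightarrow> real) \<Rightarrow> real" where
  "fb_norm \<alpha> p \<equiv> fb_norm_on \<alpha> p {0..}"

definition bessel_j :: "real \<Rightarrow> real \<Rightarrow> real" where
  "bessel_j \<alpha> x = Gamma (\<alpha> + 1) *
     (\<Sum>n. (-1) ^ n / (fact n * Gamma (real n + \<alpha> + 1)) * (x / 2) ^ (2 * n))"

definition fb_integral :: "real \<Rightarrow> (real \<Rightarrow> real) \<Rightarrow> real \<Rightarrow> real" where
  "fb_integral \<alpha> f y = (LINT x|fb_measure \<alpha>. f x * bessel_j \<alpha> (2 * pi * x * y))"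

text \<open>\<open>has_fb_transform \<alpha> f g\<close> says that \<open>g\<close> is a representative of the Fourier--Bessel transform
  of \<open>f \<in> L\<^sup>2\<close>, the transform being the continuous extension to \<open>L\<^sup>2\<close> of \<open>fb_integral\<close> on the
  dense subspace \<open>L\<^sup>1 \<inter> L\<^sup>2\<close>. By Plancherel's theorem such a \<open>g\<close> exists for
  every \<open>f \<in> L\<^sup>2\<close>, is unique up to a null set, and the condition on \<open>fb_integral \<alpha> (h n)\<close> below
  is automatic; it is stated because the integral in \<open>fb_norm\<close> is \<open>0\<close> by convention when it
  diverges.\<close>

definition has_fb_transform :: "real \<Rightarrow> (real \<Rightarrow> real) \<Rightarrow> (real \<Rightarrow> real) \<Rightarrow> bool" where
  "has_fb_transform \<alpha> f g \<longleftrightarrow> f \<in> fb_space \<alpha> 2 \<and> g \<in> fb_space \<alpha> 2 \<and>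
     (\<exists>h :: nat \<Rightarrow> real \<Rightarrow> real.
        (\<forall>n. h n \<in> fb_space \<alpha> 1 \<inter> fb_space \<alpha> 2 \<and> fb_integral \<alpha> (h n) \<in> fb_space \<alpha> 2) \<and>
        (\<lambda>n. fb_norm \<alpha> 2 (\<lambda>x. h n x - f x)) \<longlonglongrightarrow> 0 \<and>
        (\<lambda>n. fb_norm \<alpha> 2 (\<lambda>y. fb_integral \<alpha> (h n) y - g y)) \<longlonglongrightarrow> 0)"

text \<open>Inclusion \<open>supp g \<subseteq> S\<close> for an \<open>L\<^sup>2\<close> class, that is, up to null sets.\<close>

definition fb_supp_in :: "real \<Rightarrow> (real \<Rightarrow> real) \<Rightarrow> real set \<Rightarrow> bool" where
  "fb_supp_in \<alpha> g S \<longleftrightarrow> (AE y in fb_measure \<alpha>. y \<notin> S \<longrightarrow> g y = 0)"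

definition fb_relatively_dense :: "real \<Rightarrow> real \<Rightarrow> real set \<Rightarrow> bool" where
  "fb_relatively_dense \<alpha> \<gamma> E \<longleftrightarrow> (\<forall>r\<ge>0.
     measure (fb_measure \<alpha>) (E \<inter> {r..r + 1}) \<ge> \<gamma> * measure (fb_measure \<alpha>) {r..r + 1})"

end

theory Submission
  imports Defs "HOL-Complex_Analysis.Complex_Analysis" "HOL-Probability.Probability"
begin

text \<open>
  For \<open>\<alpha> = m + 1/2\<close> the Bessel function \<open>J\<^sub>\<alpha>\<close> is elementary: after the substitution
  \<open>F x = x\<^bsup>m+1\<^esup> f x\<close>, \<open>G y = y\<^bsup>m+1\<^esup> g y\<close> the weighted norms become ordinary \<open>L\<^sup>2\<close> norms, and \<open>F\<close> is, up to a
  constant, \<open>\<integral> G y * K (x * y) dy\<close> with the kernel \<open>K = hkernel m\<close>, where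
  \<open>w\<^sup>m K w = P w * e\<^bsup>2\<pi>iw\<^esup> + Q w * e\<^bsup>-2\<pi>iw\<^esup>\<close> for polynomials \<open>P\<close>, \<open>Q\<close> of degree at most \<open>m\<close>
  (\<open>hkernel_exp_poly\<close>). Hence on \<open>[j, j+1]\<close> the function \<open>F\<close>, multiplied by the harmless factor
  \<open>(x / (j+1))\<^sup>m\<close>, is an exponential sum \<open>\<Sum> e\<^bsup>i l t\<^esup> u\<^bsub>j,l\<^esub> t\<close>, \<open>t = x - j\<close>, with one frequency \<open>l = \<plusminus>2\<pi> a\<close> for each
  interval \<open>[a, a+1]\<close> and one zero frequency for the part of \<open>G\<close> below \<open>1\<close>. The coefficients are entire,
  and a Bessel inequality gives \<open>\<Sum>\<^sub>j |u\<^bsub>j,l\<^esub> w|\<^sup>2 \<le> D \<parallel>G\<parallel>\<^sup>2\<close> on a fixed complex disc, with \<open>D\<close> independent of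
  the positions of the intervals (\<open>frequency_decomposition\<close>).

  The local step is a Remez inequality that is uniform in the frequencies (\<open>exp_sum_remez\<close>,
  \<open>local_L2_estimate\<close>): an exponential sum on \<open>[0, 1]\<close> of at most \<open>n\<close> terms with bounded holomorphic
  coefficients that is small on a set of measure at least \<open>\<gamma>\<close> is small on \<open>[0, 1]\<close>. For one term this is
  compactness (Montel) and the identity theorem. In general, two frequencies at bounded distance are
  merged into one term, while for widely separated frequencies the coefficients are nearly constant at
  the scale of the oscillation, so that a bound for the coefficients of pure exponential sums
  (\<open>exp_sum_coeff_bound\<close>) reduces to single terms.

  The unit intervals on which the coefficients are much larger than \<open>F\<close> contribute little in total,
  because the coefficients are square-summable and \<open>\<parallel>G\<parallel>\<close> is bounded by \<open>\<parallel>F\<parallel>\<close>; on the others the local estimate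
  applies. Summation yields the theorem for the kernel \<open>K\<close> (\<open>relative_density_estimate\<close>).

  It remains to see that a pair \<open>f\<close>, \<open>g\<close> in the sense of the \<open>L\<^sup>2\<close> extension satisfies \<open>\<parallel>g\<parallel> \<le> \<parallel>f\<parallel>\<close> and
  that \<open>f\<close> is almost everywhere the integral transform of \<open>g\<close>, which has bounded support. Both follow by
  testing against Gaussians, which the transform permutes up to explicit factors and whose linear
  combinations are dense (\<open>fb_transform_norm_le\<close>, \<open>fb_inversion\<close>).
\<close>


section \<open>Propagation of smallness for holomorphic functions\<close>

text \<open>Radius \<open>2\<close> leaves room of width \<open>1\<close> around \<open>[0, 1]\<close>, enough for Cauchy estimates there.\<close>

definition bounded_hol :: "real \<Rightarrow> (complex \<Rightarrow> complex) \<Rightarrow> bool" where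
  "bounded_hol A u \<longleftrightarrow> u holomorphic_on ball 0 2 \<and> (\<forall>z\<in>ball 0 2. cmod (u z) \<le> A)"

text \<open>Continuity from above along the decreasing unions of the tails, all of which lie in \<open>[0, 1]\<close>.\<close>

lemma measure_limsup_ge:
  fixes E :: "nat \<Rightarrow> real set"
  assumes E: "\<And>n. E n \<in> sets borel" "\<And>n. E n \<subseteq> {0..1}" and \<gamma>: "\<And>n. measure lborel (E n) \<ge> \<gamma>"
  shows "measure lborel (\<Inter>n. \<Union>k\<in>{n..}. E k) \<ge> \<gamma>"
proof -
  let ?D = "\<lambda>n. \<Union>k\<in>{n..}. E k"
  have sub: "?D n \<subseteq> {0..1}" for n using E(2) by blast
  have fin: "emeasure lborel (?D n) \<noteq> \<infinity>" for n
    using emeasure_mono[OF sub, of lborel n] by (auto simp: top_unique)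
  have meas: "?D n \<in> sets lborel" for n using E(1) by auto
  have "(\<lambda>n. measure lborel (?D n)) \<longlonglongrightarrow> measure lborel (\<Inter>n. ?D n)"
  proof (rule Lim_measure_decseq)
    show "decseq ?D" unfolding decseq_def by (intro allI impI UN_mono) auto
    show "range ?D \<subseteq> sets lborel" using meas by blast
  qed (rule fin)
  moreover have "measure lborel (?D n) \<ge> \<gamma>" for n
  proof -
    have "measure lborel (E n) \<le> measure lborel (?D n)"
      using E(1) meas fin[of n] by (intro measure_mono_fmeasurable) (auto simp: fmeasurable_def less_top)
    with \<gamma>[of n] show ?thesis by linarith
  qed
  ultimately show ?thesis by (intro LIMSEQ_le_const[of _ _ \<gamma>]) auto
qed

text \<open>A sequence of counterexamples has, by Montel's theorem, a locally uniform limit that vanishes on the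
  limit superior of the exceptional sets. That set has positive measure, hence an accumulation point,
  and the limit is zero by the identity theorem, which contradicts the lower bound \<open>\<eta>\<close>.\<close>

lemma remez_compactness:
  fixes A \<gamma> \<eta> :: real
  assumes "\<gamma> > 0" "\<eta> > 0"
  shows "\<exists>\<epsilon>>0. \<forall>u E. bounded_hol A u \<and> E \<in> sets borel \<and> E \<subseteq> {0..1} \<and> measure lborel E \<ge> \<gamma> \<and>
    (\<forall>x\<in>E. cmod (u (of_real x)) \<le> \<epsilon>) \<longrightarrow> (\<forall>x\<in>{0..1}. cmod (u (of_real x)) \<le> \<eta>)"
proof (rule ccontr)
  assume contr: "\<not> ?thesis"
  have "\<forall>n::nat. \<exists>u E x. bounded_hol A u \<and> E \<in> sets borel \<and> E \<subseteq> {0..1} \<and> measure lborel E \<ge> \<gamma> \<and>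
    (\<forall>x\<in>E. cmod (u (of_real x)) \<le> 1 / Suc n) \<and> x \<in> {0..1} \<and> \<not> cmod (u (of_real x)) \<le> \<eta>"
  proof
    fix n :: nat
    have "1 / real (Suc n) > 0" by simp
    then show "\<exists>u E x. bounded_hol A u \<and> E \<in> sets borel \<and> E \<subseteq> {0..1} \<and> measure lborel E \<ge> \<gamma> \<and>
      (\<forall>x\<in>E. cmod (u (of_real x)) \<le> 1 / Suc n) \<and> x \<in> {0..1} \<and> \<not> cmod (u (of_real x)) \<le> \<eta>"
      using contr by blast
  qed
  then obtain u E x where u: "\<And>n. bounded_hol A (u n)" and E: "\<And>n. E n \<in> sets borel" "\<And>n. E n \<subseteq> {0..1}"
      "\<And>n. measure lborel (E n) \<ge> \<gamma>" and small: "\<And>n x. x \<in> E n \<Longrightarrow> cmod (u n (of_real x)) \<le> 1 / Suc n"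
      and x: "\<And>n. x n \<in> {0..1}" and big: "\<And>n. \<not> cmod (u n (of_real (x n))) \<le> \<eta>"
    by metis
  obtain g r where g: "g holomorphic_on ball 0 2" and r: "strict_mono (r :: nat \<Rightarrow> nat)"
    and ptw: "\<And>z. z \<in> ball 0 2 \<Longrightarrow> (\<lambda>n. u (r n) z) \<longlonglongrightarrow> g z"
    and unif: "\<And>K. compact K \<Longrightarrow> K \<subseteq> ball 0 2 \<Longrightarrow> uniform_limit K (u \<circ> r) g sequentially"
  proof (rule Montel[of "ball 0 2" "Collect (bounded_hol A)" u])
    show "\<exists>B. \<forall>h\<in>Collect (bounded_hol A). \<forall>z\<in>K. cmod (h z) \<le> B" if "K \<subseteq> ball 0 2" for K
      using that unfolding bounded_hol_def by blast
    show "range u \<subseteq> Collect (bounded_hol A)" using u by blast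
  qed (simp_all add: bounded_hol_def)
  define S where "S = (\<Inter>n. \<Union>k\<in>{n..}. E (r k))"
  have S01: "S \<subseteq> {0..1}" unfolding S_def using E(2) by blast
  have "measure lborel S \<ge> \<gamma>"
    unfolding S_def by (rule measure_limsup_ge) (use E in auto)
  with \<open>\<gamma> > 0\<close> have "infinite S"
    by (metis emeasure_lborel_countable countable_finite measure_def enn2real_0 not_less)
  define U where "U = complex_of_real ` S"
  have K: "compact (complex_of_real ` {0..1})" "complex_of_real ` {0..1} \<subseteq> ball 0 2"
    by (auto intro!: compact_continuous_image continuous_intros)
  have "infinite U" unfolding U_def using \<open>infinite S\<close> by (simp add: finite_image_iff inj_on_def)
  then obtain \<xi> where \<xi>: "\<xi> \<in> complex_of_real ` {0..1}" "\<xi> islimpt U"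
    using Heine_Borel_imp_Bolzano_Weierstrass[OF K(1), of U] S01 by (auto simp: U_def)
  \<comment> \<open>A point of \<open>S\<close> lies in infinitely many of the sets, along which the bounds tend to zero.\<close>
  have gU: "g z = 0" if zU: "z \<in> U" for z
  proof -
    obtain y where y: "y \<in> S" "z = of_real y" using zU unfolding U_def by blast
    then have "z \<in> ball 0 2" using S01 K(2) by auto
    then have lim: "(\<lambda>n. cmod (u (r n) z)) \<longlonglongrightarrow> cmod (g z)" using ptw tendsto_norm by blast
    have "cmod (g z) < e" if "e > 0" for e :: real
    proof (rule ccontr)
      assume "\<not> cmod (g z) < e"
      then have "cmod (g z) > e/2" using that by simp
      from order_tendstoD(1)[OF lim this] obtain N1 where N1: "\<And>n. n \<ge> N1 \<Longrightarrow> cmod (u (r n) z) > e/2"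
        by (auto simp: eventually_sequentially)
      obtain N2 :: nat where N2: "1 / real (Suc N2) < e/2"
        using nat_approx_posE[of "e/2"] \<open>e > 0\<close> by auto
      from y(1) obtain k where k: "k \<ge> max N1 N2" "y \<in> E (r k)" unfolding S_def by blast
      have "cmod (u (r k) z) \<le> 1 / Suc (r k)" using small k(2) y(2) by blast
      also have "\<dots> \<le> 1 / Suc N2"
        using seq_suble[OF r, of k] k(1) by (intro divide_left_mono) auto
      finally show False using N1[of k] N2 k(1) by auto
    qed
    then show "g z = 0" by (metis norm_ge_zero not_less_iff_gr_or_eq norm_eq_zero order_le_less)
  qed
  have g0: "g w = 0" if "w \<in> ball 0 2" for w
  proof (rule analytic_continuation[OF g _ _ _ _ \<xi>(2) gU that])
    show "U \<subseteq> ball 0 2" using S01 K(2) unfolding U_def by blast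
    show "\<xi> \<in> ball 0 2" using \<xi>(1) K(2) by blast
  qed auto
  from uniform_limitD[OF unif[OF K] \<open>\<eta> > 0\<close>] obtain n where
    "\<And>z. z \<in> complex_of_real ` {0..1} \<Longrightarrow> dist (u (r n) z) (g z) < \<eta>"
    by (auto simp: eventually_sequentially)
  then have "dist (u (r n) (of_real (x (r n)))) (g (of_real (x (r n)))) < \<eta>" using x by blast
  with g0[of "of_real (x (r n))"] K(2) x[of "r n"] have "cmod (u (r n) (of_real (x (r n)))) < \<eta>"
    by (auto simp: dist_norm)
  with big[of "r n"] show False by simp
qed

lemma sin_ge_chord:
  fixes x :: real assumes "0 \<le> x" "x \<le> pi / 2" shows "sin x \<ge> 2 / pi * x"
proof -
  have "convex_on {0..pi/2} (\<lambda>x. - sin x)"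
  proof (rule f''_ge0_imp_convex)
    show "((\<lambda>x. - sin x) has_real_derivative - cos x) (at x)" for x :: real
      by (auto intro!: derivative_eq_intros)
    show "((\<lambda>x. - cos x) has_real_derivative sin x) (at x)" for x :: real
      by (auto intro!: derivative_eq_intros)
  qed (auto intro!: sin_ge_zero)
  then have "- sin ((1 - 2 / pi * x) *\<^sub>R 0 + (2 / pi * x) *\<^sub>R (pi / 2)) \<le>
     (1 - 2 / pi * x) * - sin 0 + (2 / pi * x) * - sin (pi / 2)"
    by (rule convex_onD) (use assms in \<open>auto simp: field_simps\<close>)
  then show ?thesis by simp
qed

lemma cmod_exp_i_minus_1_ge:
  fixes \<theta> :: real assumes "\<bar>\<theta>\<bar> \<le> pi" shows "cmod (exp (\<i> * of_real \<theta>) - 1) \<ge> 2 / pi * \<bar>\<theta>\<bar>"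
proof -
  have "2 / pi * (\<bar>\<theta>\<bar> / 2) \<le> sin (\<bar>\<theta>\<bar> / 2)" by (rule sin_ge_chord) (use assms in auto)
  also have "\<dots> \<le> \<bar>sin (\<theta> / 2)\<bar>" by (cases "\<theta> \<ge> 0") auto
  finally show ?thesis unfolding dist_exp_i_1 by simp
qed

text \<open>The factor \<open>e\<^bsup>ilt\<^esup>\<close> is near \<open>1\<close> only when \<open>lt\<close> is within \<open>\<pi>\<kappa>/2\<close> of \<open>2\<pi>\<int>\<close>; at most \<open>5|l|\<close> intervals
  of length \<open>\<pi>\<kappa>/|l|\<close> in \<open>t\<close> arise in this way.\<close>

lemma measure_exp_near_1_le:
  fixes l \<kappa> :: real assumes "\<bar>l\<bar> \<ge> 1" "\<kappa> > 0"
  shows "measure lborel {t\<in>{-1..1}. cmod (exp (\<i> * of_real (l * t)) - 1) < \<kappa>} \<le> 16 * \<kappa>"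
proof -
  let ?B = "{t\<in>{-1..1}. cmod (exp (\<i> * of_real (l * t)) - 1) < \<kappa>}"
  define P where "P = {-\<lceil>\<bar>l\<bar>\<rceil>..\<lceil>\<bar>l\<bar>\<rceil>}"
  define F where "F p = {(2 * pi * of_int p) / l - pi / 2 * \<kappa> / \<bar>l\<bar>..(2 * pi * of_int p) / l + pi / 2 * \<kappa> / \<bar>l\<bar>}" for p :: int
  have sub: "?B \<subseteq> (\<Union>p\<in>P. F p)"
  proof
    fix t assume t: "t \<in> ?B"
    define p where "p = round (l * t / (2 * pi))"
    define \<theta> where "\<theta> = l * t - 2 * pi * of_int p"
    have p1: "\<bar>of_int p - l * t / (2 * pi)\<bar> \<le> 1/2"
      unfolding p_def by (rule of_int_round_abs_le)
    have "\<bar>\<theta>\<bar> = 2 * pi * \<bar>of_int p - l * t / (2 * pi)\<bar>"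
      unfolding \<theta>_def by (simp add: field_simps abs_mult flip: abs_minus_commute)
    then have th: "\<bar>\<theta>\<bar> \<le> pi" using mult_left_mono[OF p1, of "2 * pi"] by simp
    have "exp (\<i> * of_real (l * t)) = exp (\<i> * of_real \<theta>)"
    proof -
      have "exp (\<i> * of_real (l * t)) = exp (\<i> * of_real \<theta> + (2 * of_int p * pi) * \<i>)"
        by (simp add: \<theta>_def algebra_simps)
      moreover have "exp ((2 * of_int p * pi) * \<i>) = 1"
        by (rule exp_integer_2pi) auto
      ultimately show ?thesis by (simp only: exp_add mult_1_right)
    qed
    with cmod_exp_i_minus_1_ge[OF th] t have "2 / pi * \<bar>\<theta>\<bar> < \<kappa>" by simp
    then have th2: "\<bar>\<theta>\<bar> \<le> pi / 2 * \<kappa>" by (simp add: field_simps)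
    have "\<bar>t - 2 * pi * of_int p / l\<bar> = \<bar>\<theta>\<bar> / \<bar>l\<bar>"
      unfolding \<theta>_def abs_divide[symmetric] using assms(1) by (simp add: field_simps) 
    also have "\<dots> \<le> pi / 2 * \<kappa> / \<bar>l\<bar>" using th2 by (intro divide_right_mono) auto
    finally have "t \<in> F p" unfolding F_def by (auto simp: abs_le_iff)
    have "\<bar>l * t / (2 * pi)\<bar> \<le> \<bar>l\<bar> / 2"
    proof -
      have "\<bar>l * t / (2 * pi)\<bar> = \<bar>l\<bar> * \<bar>t\<bar> / (2 * pi)" by (simp add: abs_mult)
      also have "\<dots> \<le> \<bar>l\<bar> * 1 / 2" using t pi_gt3 by (intro frac_le mult_left_mono) auto
      finally show ?thesis by simp
    qed
    with p1 have "\<bar>of_int p\<bar> \<le> \<bar>l\<bar> / 2 + 1/2" by linarith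
    also have "\<dots> \<le> \<bar>l\<bar>" using assms(1) by simp
    finally have "\<bar>p\<bar> \<le> \<lceil>\<bar>l\<bar>\<rceil>" by linarith
    then have "p \<in> P" unfolding P_def by auto
    with \<open>t \<in> F p\<close> show "t \<in> (\<Union>p\<in>P. F p)" by blast
  qed
  have fin: "finite P" unfolding P_def by simp
  have "?B \<in> sets lborel" by measurable
  have FM: "(\<Union>p\<in>P. F p) \<in> fmeasurable lborel"
    unfolding F_def by (rule fmeasurable.finite_UN[OF fin]) (rule fmeasurable_compact, rule compact_Icc)
  have "measure lborel ?B \<le> measure lborel (\<Union>p\<in>P. F p)"
    by (rule measure_mono_fmeasurable) (use sub FM \<open>?B \<in> sets lborel\<close> in auto)
  also have "\<dots> \<le> (\<Sum>p\<in>P. measure lborel (F p))"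
    by (rule measure_UNION_le[OF fin]) (auto simp: F_def)
  also have "\<dots> = (\<Sum>p\<in>P. pi * \<kappa> / \<bar>l\<bar>)"
    by (rule sum.cong) (use assms in \<open>auto simp: F_def\<close>)
  also have "\<dots> = real (card P) * (pi * \<kappa> / \<bar>l\<bar>)" by simp
  also have "real (card P) \<le> 5 * \<bar>l\<bar>"
  proof -
    have "real (card P) = 2 * of_int \<lceil>\<bar>l\<bar>\<rceil> + 1" unfolding P_def by simp
    also have "\<dots> \<le> 2 * (\<bar>l\<bar> + 1) + 1" by (intro add_right_mono mult_left_mono of_int_ceiling_le_add_one) simp
    also have "2 * (y + 1) + 1 \<le> 5 * y" if "y \<ge> 1" for y :: real using that by simp
    from this[OF assms(1)] have "2 * (\<bar>l\<bar> + 1) + 1 \<le> 5 * \<bar>l\<bar>" .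
    finally show ?thesis .
  qed
  then have "real (card P) * (pi * \<kappa> / \<bar>l\<bar>) \<le> (5 * \<bar>l\<bar>) * (pi * \<kappa> / \<bar>l\<bar>)"
    by (rule mult_right_mono) (use assms in auto)
  also have "\<dots> = 5 * pi * \<kappa>" using assms by (simp add: field_simps)
  also have "\<dots> \<le> 16 * \<kappa>" using pi_approx assms by (intro mult_right_mono) auto
  finally show ?thesis .
qed

text \<open>The overlap \<open>h t\<close> of \<open>E\<close> with its translate has integral \<open>|E|\<^sup>2\<close> and is at most \<open>1\<close>, so it cannot be
  below \<open>\<gamma>\<^sup>2/4\<close> on most of the interval of length \<open>2\<close> that carries it.\<close>

lemma overlap_pigeonhole:
  fixes E :: "real set"
  assumes E: "E \<in> sets borel" "E \<subseteq> {0..1}" and \<gamma>: "measure lborel E \<ge> \<gamma>" "\<gamma> > 0"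
  defines "h \<equiv> \<lambda>t. measure lborel {x\<in>E. x + t \<in> E}"
  shows "{t\<in>{-1..1}. h t \<ge> \<gamma>\<^sup>2 / 4} \<in> sets borel" "measure lborel {t\<in>{-1..1}. h t \<ge> \<gamma>\<^sup>2 / 4} \<ge> \<gamma>\<^sup>2 / 2"
proof -
  note [measurable] = E(1)
  have finE: "emeasure lborel E \<le> 1" using emeasure_mono[OF E(2), of lborel] by simp
  have hS: "{x\<in>E. x + t \<in> E} \<in> sets borel" for t by measurable
  have finS: "emeasure lborel {x\<in>E. x + t \<in> E} \<le> 1" for t
    using emeasure_mono[of "{x\<in>E. x + t \<in> E}" E lborel] finE by (auto intro: order_trans)
  have h: "ennreal (h t) = (\<integral>\<^sup>+x. indicator E x * indicator E (x + t) \<partial>lborel)" for t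
  proof -
    have "ennreal (h t) = emeasure lborel {x\<in>E. x + t \<in> E}"
      unfolding h_def using finS[of t] by (intro emeasure_eq_ennreal_measure[symmetric]) (auto simp: top_unique)
    also have "\<dots> = (\<integral>\<^sup>+x. indicator {x\<in>E. x + t \<in> E} x \<partial>lborel)" by simp
    also have "\<dots> = (\<integral>\<^sup>+x. indicator E x * indicator E (x + t) \<partial>lborel)"
      by (intro nn_integral_cong) (auto simp: indicator_def)
    finally show ?thesis .
  qed
  have h1: "h t \<le> 1" "h t \<ge> 0" for t
  proof -
    have "ennreal (h t) = emeasure lborel {x\<in>E. x + t \<in> E}"
      unfolding h_def using finS[of t] by (intro emeasure_eq_ennreal_measure[symmetric]) (auto simp: top_unique)
    with finS[of t] have "ennreal (h t) \<le> ennreal 1" by simp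
    then show "h t \<le> 1" by (simp add: ennreal_le_iff)
  qed (simp add: h_def)
  have hm[measurable]: "h \<in> borel_measurable borel"
  proof -
    have "(\<lambda>t. ennreal (h t)) \<in> borel_measurable borel" unfolding h by measurable
    then have "(\<lambda>t. enn2real (ennreal (h t))) \<in> borel_measurable borel" by measurable
    then show ?thesis using h1(2) by simp
  qed
  let ?T = "{t\<in>{-1..1}. h t \<ge> \<gamma>\<^sup>2 / 4}"
  show T: "?T \<in> sets borel" by measurable
  have shift: "(\<integral>\<^sup>+t. indicator E (x + t) \<partial>lborel) = emeasure lborel E" for x
  proof -
    have "(\<integral>\<^sup>+t. indicator E t \<partial>lborel) = ennreal \<bar>1\<bar> * (\<integral>\<^sup>+t. indicator E (x + 1 * t) \<partial>lborel)"
      using nn_integral_real_affine[of "indicator E" 1 x] by simp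
    then show ?thesis by simp
  qed
  have "emeasure lborel E * emeasure lborel E = (\<integral>\<^sup>+x. indicator E x * (\<integral>\<^sup>+t. indicator E (x + t) \<partial>lborel) \<partial>lborel)"
    unfolding shift by (simp add: nn_integral_multc)
  also have "\<dots> = (\<integral>\<^sup>+x. \<integral>\<^sup>+t. indicator E x * indicator E (x + t) \<partial>lborel \<partial>lborel)"
    by (simp add: nn_integral_cmult)
  also have "\<dots> = (\<integral>\<^sup>+t. ennreal (h t) \<partial>lborel)"
    unfolding h by (rule lborel_pair.Fubini'[symmetric]) measurable
  also have "\<dots> = (\<integral>\<^sup>+t. ennreal (h t) * indicator {-1..1} t \<partial>lborel)"
  proof (rule nn_integral_cong)
    fix t :: real
    have "h t = 0" if "t \<notin> {-1..1}"
    proof -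
      have "x + t \<notin> E" if "x \<in> E" for x
      proof
        assume "x + t \<in> E"
        then have "x \<in> {0..1}" "x + t \<in> {0..1}" using that E(2) by blast+
        then show False using \<open>t \<notin> {-1..1}\<close> by simp
      qed
      then have "{x\<in>E. x + t \<in> E} = {}" by blast
      then show ?thesis unfolding h_def by (simp only: measure_empty)
    qed
    then show "ennreal (h t) = ennreal (h t) * indicator {-1..1} t" by (cases "t \<in> {-1..1}") auto
  qed
  also have "\<dots> \<le> (\<integral>\<^sup>+t. indicator ?T t + ennreal (\<gamma>\<^sup>2 / 4) * indicator {-1..1} t \<partial>lborel)"
  proof (rule nn_integral_mono)
    fix t :: real
    show "ennreal (h t) * indicator {-1..1} t \<le> indicator ?T t + ennreal (\<gamma>\<^sup>2 / 4) * indicator {-1..1} t"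
      using h1[of t] by (auto simp: indicator_def ennreal_leI intro: add_increasing2)
  qed
  also have "\<dots> = emeasure lborel ?T + ennreal (\<gamma>\<^sup>2 / 2)"
  proof -
    have "ennreal (\<gamma>\<^sup>2 / 4) * 2 = ennreal (\<gamma>\<^sup>2 / 2)"
      using ennreal_mult[of "\<gamma>\<^sup>2 / 4" 2] by simp
    then show ?thesis using T by (subst nn_integral_add) (auto simp: nn_integral_cmult)
  qed
  also have "emeasure lborel ?T = ennreal (measure lborel ?T)"
  proof (rule emeasure_eq_ennreal_measure)
    have "emeasure lborel ?T \<le> emeasure lborel {-1..1::real}" by (rule emeasure_mono) auto
    then show "emeasure lborel ?T \<noteq> top" by (auto simp: top_unique)
  qed
  also have "emeasure lborel E = ennreal (measure lborel E)"
    using finE by (intro emeasure_eq_ennreal_measure) (auto simp: top_unique)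
  finally have "ennreal (measure lborel E * measure lborel E) \<le> ennreal (measure lborel ?T + \<gamma>\<^sup>2 / 2)"
    by (simp add: ennreal_mult)
  then have "measure lborel E * measure lborel E \<le> measure lborel ?T + \<gamma>\<^sup>2 / 2"
    by (subst (asm) ennreal_le_iff) auto
  moreover have "\<gamma>\<^sup>2 \<le> measure lborel E * measure lborel E"
    using \<gamma> by (simp add: power2_eq_square mult_mono)
  ultimately show "measure lborel ?T \<ge> \<gamma>\<^sup>2 / 2" by simp
qed

text \<open>A form of a lemma of Zygmund, by induction on the number of terms: translating by \<open>t\<close>, multiplying by
  \<open>e\<^bsup>-i l\<^sub>k t\<^esup>\<close> and subtracting removes the \<open>k\<close>-th frequency, keeps the sum small on the overlap of
  \<open>E\<close> with its translate, and multiplies the coefficient \<open>c i\<close> by \<open>e\<^bsup>i(l\<^sub>i - l\<^sub>k)t\<^esup> - 1\<close>. Most shifts with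
  large overlap keep that factor away from zero since the gaps are at least \<open>1\<close>.\<close>

lemma exp_sum_coeff_bound:
  fixes n :: nat and \<gamma> :: real
  assumes "\<gamma> > 0"
  shows "\<exists>C>0. \<forall>(I :: 'i set) l c E s. finite I \<and> card I \<le> n \<and>
     (\<forall>i\<in>I. \<forall>k\<in>I. i \<noteq> k \<longrightarrow> \<bar>l i - l k\<bar> \<ge> 1) \<and> E \<in> sets borel \<and> E \<subseteq> {0..1} \<and> measure lborel E \<ge> \<gamma> \<and>
     (\<forall>x\<in>E. cmod (\<Sum>i\<in>I. c i * exp (\<i> * of_real (l i * x))) \<le> s) \<longrightarrow> (\<forall>i\<in>I. cmod (c i) \<le> C * s)"
  using assms
proof (induction n arbitrary: \<gamma>)
  case 0
  then show ?case by (intro exI[of _ 1]) auto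
next
  case (Suc n)
  have "\<gamma>\<^sup>2 / 4 > 0" using Suc.prems by simp
  from Suc.IH[OF this] obtain C where CC: "C > 0 \<and> (\<forall>(I :: 'i set) l c E s. finite I \<and> card I \<le> n \<and>
     (\<forall>i\<in>I. \<forall>k\<in>I. i \<noteq> k \<longrightarrow> \<bar>l i - l k\<bar> \<ge> 1) \<and> E \<in> sets borel \<and> E \<subseteq> {0..1} \<and> measure lborel E \<ge> \<gamma>\<^sup>2 / 4 \<and>
     (\<forall>x\<in>E. cmod (\<Sum>i\<in>I. c i * exp (\<i> * of_real (l i * x))) \<le> s) \<longrightarrow> (\<forall>i\<in>I. cmod (c i) \<le> C * s))" by (rule exE)
  have "C > 0" using CC by (rule conjunct1)
  note C = CC[THEN conjunct2, THEN spec, THEN spec, THEN spec, THEN spec, THEN spec, THEN mp, OF conjI, OF _ conjI,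
    OF _ _ conjI, OF _ _ _ conjI, OF _ _ _ _ conjI, OF _ _ _ _ _ conjI]
  \<comment> \<open>The shifts that make the factor smaller than \<open>\<kappa>\<close> have measure at most \<open>16 \<kappa> = \<gamma>\<^sup>2 / 4\<close>, less than the
    measure \<open>\<gamma>\<^sup>2 / 2\<close> of the shifts with large overlap.\<close>
  define \<kappa> where "\<kappa> = \<gamma>\<^sup>2 / 64"
  have "\<kappa> > 0" unfolding \<kappa>_def using Suc.prems by simp
  define D where "D = max 1 (2 * C / \<kappa>)"
  have "D > 0" unfolding D_def by simp
  show ?case
  proof (intro exI[of _ D] conjI allI impI ballI \<open>D > 0\<close>, elim conjE)
    fix I :: "'i set" and l :: "'i \<Rightarrow> real" and c E s i
    assume I: "finite I" "card I \<le> Suc n" and gap: "\<forall>i\<in>I. \<forall>k\<in>I. i \<noteq> k \<longrightarrow> \<bar>l i - l k\<bar> \<ge> 1"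
      and E: "E \<in> sets borel" "E \<subseteq> {0..1}" "measure lborel E \<ge> \<gamma>" and i: "i \<in> I"
      and small: "\<forall>x\<in>E. cmod (\<Sum>i\<in>I. c i * exp (\<i> * of_real (l i * x))) \<le> s"
    have "E \<noteq> {}" using E(3) Suc.prems by auto
    then have "s \<ge> 0" using small norm_ge_zero order_trans by blast
    show "cmod (c i) \<le> D * s"
    proof (cases "I = {i}")
      case True
      obtain x where "x \<in> E" using \<open>E \<noteq> {}\<close> by blast
      with small True have "cmod (c i * exp (\<i> * of_real (l i * x))) \<le> s" by auto
      then have "cmod (c i) \<le> 1 * s" by (simp add: norm_mult norm_exp_i_times del: of_real_mult)
      also have "\<dots> \<le> D * s" using \<open>s \<ge> 0\<close> by (intro mult_right_mono) (auto simp: D_def)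
      finally show ?thesis .
    next
      case False
      then obtain k where k: "k \<in> I" "k \<noteq> i" using i by blast
      let ?T = "{t\<in>{-1..1}. measure lborel {x\<in>E. x + t \<in> E} \<ge> \<gamma>\<^sup>2 / 4}"
      let ?B = "{t\<in>{-1..1}. cmod (exp (\<i> * of_real ((l i - l k) * t)) - 1) < \<kappa>}"
      have "\<not> ?T \<subseteq> ?B"
      proof
        assume "?T \<subseteq> ?B"
        have "\<gamma>\<^sup>2 / 2 \<le> measure lborel ?T"
          by (rule overlap_pigeonhole(2)[OF E Suc.prems])
        also have "\<dots> \<le> measure lborel ?B"
        proof (rule measure_mono_fmeasurable[OF \<open>?T \<subseteq> ?B\<close>])
          show "?T \<in> sets lborel" using overlap_pigeonhole(1)[OF E Suc.prems] by simp
          have "?B \<in> sets lborel" by measurable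
          moreover have "emeasure lborel ?B \<le> emeasure lborel {-1..1::real}" by (rule emeasure_mono) auto
          ultimately show "?B \<in> fmeasurable lborel"
            by (auto simp: fmeasurable_def intro: le_less_trans)
        qed
        also have "\<dots> \<le> 16 * \<kappa>"
          by (rule measure_exp_near_1_le) (use gap i k \<open>\<kappa> > 0\<close> in auto)
        also have "\<dots> = \<gamma>\<^sup>2 / 4" unfolding \<kappa>_def by simp
        finally show False using Suc.prems by simp
      qed
      then obtain t where "t \<in> ?T" "t \<notin> ?B" by blast
      then have t: "measure lborel {x\<in>E. x + t \<in> E} \<ge> \<gamma>\<^sup>2 / 4"
        and "\<not> cmod (exp (\<i> * of_real ((l i - l k) * t)) - 1) < \<kappa>" by blast+
      then have kt: "cmod (exp (\<i> * of_real ((l i - l k) * t)) - 1) \<ge> \<kappa>" by (simp only: not_less)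
      \<comment> \<open>The coefficients after removal of the \<open>k\<close>-th frequency.\<close>
      define d where "d a = c a * (exp (\<i> * of_real ((l a - l k) * t)) - 1)" for a
      have "\<forall>a\<in>I-{k}. cmod (d a) \<le> C * (2 * s)"
      proof (rule C)
        show "card (I - {k}) \<le> n" using I k by (simp add: card_Diff_singleton)
        note [measurable] = E(1)
        show "{x \<in> E. x + t \<in> E} \<in> sets borel" by measurable
        show "\<forall>x\<in>{x \<in> E. x + t \<in> E}. cmod (\<Sum>a\<in>I - {k}. d a * exp (\<i> * of_real (l a * x))) \<le> 2 * s"
        proof
          fix x assume x: "x \<in> {x \<in> E. x + t \<in> E}"
          let ?p = "\<lambda>x. \<Sum>i\<in>I. c i * exp (\<i> * of_real (l i * x))"
          have "exp (- (\<i> * of_real (l k * t))) * ?p (x + t) - ?p x = (\<Sum>a\<in>I. d a * exp (\<i> * of_real (l a * x)))"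
            unfolding sum_distrib_left sum_subtractf[symmetric] d_def
          proof (rule sum.cong[OF refl])
            fix a
            have "exp (- (\<i> * of_real (l k * t))) * exp (\<i> * of_real (l a * (x + t))) =
              exp (\<i> * of_real ((l a - l k) * t)) * exp (\<i> * of_real (l a * x))"
              unfolding exp_add[symmetric] by (simp add: algebra_simps)
            then show "exp (- (\<i> * of_real (l k * t))) * (c a * exp (\<i> * of_real (l a * (x + t)))) -
               c a * exp (\<i> * of_real (l a * x)) =
               c a * (exp (\<i> * of_real ((l a - l k) * t)) - 1) * exp (\<i> * of_real (l a * x))"
              by (simp only: left_diff_distrib right_diff_distrib mult.left_commute mult_1_right mult.assoc)
          qed
          also have "\<dots> = (\<Sum>a\<in>I - {k}. d a * exp (\<i> * of_real (l a * x)))"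
            using sum.remove[OF I(1) k(1), of "\<lambda>a. d a * exp (\<i> * of_real (l a * x))"] by (simp add: d_def)
          finally have eq: "exp (- (\<i> * of_real (l k * t))) * ?p (x + t) - ?p x =
             (\<Sum>a\<in>I - {k}. d a * exp (\<i> * of_real (l a * x)))" .
          have "cmod (\<Sum>a\<in>I - {k}. d a * exp (\<i> * of_real (l a * x))) \<le>
             cmod (exp (- (\<i> * of_real (l k * t))) * ?p (x + t)) + cmod (?p x)"
            unfolding eq[symmetric] by (rule norm_triangle_ineq4)
          also have "\<dots> = cmod (?p (x + t)) + cmod (?p x)" by (simp add: norm_mult)
          also have "\<dots> \<le> s + s" using small x by (intro add_mono) auto
          finally show "cmod (\<Sum>a\<in>I - {k}. d a * exp (\<i> * of_real (l a * x))) \<le> 2 * s" by simp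
        qed
      qed (use I gap t E(2) in auto)
      then have "cmod (d i) \<le> C * (2 * s)" using i k by blast
      moreover have "cmod (c i) * \<kappa> \<le> cmod (d i)"
        unfolding d_def norm_mult using kt by (intro mult_left_mono) auto
      ultimately have "cmod (c i) \<le> 2 * C / \<kappa> * s" using \<open>\<kappa> > 0\<close> by (simp add: field_simps)
      also have "\<dots> \<le> D * s" using \<open>s \<ge> 0\<close> by (intro mult_right_mono) (auto simp: D_def)
      finally show ?thesis .
    qed
  qed
qed

section \<open>Exponential sums with holomorphic coefficients\<close>

lemma bounded_hol_lipschitz:
  assumes u: "bounded_hol A u" and x: "x \<in> {0..1}" and y: "y \<in> {0..1}"
  shows "cmod (u (of_real x) - u (of_real y)) \<le> 2 * A * \<bar>x - y\<bar>"
proof -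
  have hol: "u holomorphic_on ball 0 2" and bd: "\<And>z. z \<in> ball 0 2 \<Longrightarrow> cmod (u z) \<le> A"
    using u by (auto simp: bounded_hol_def)
  have d: "cmod (deriv u z) \<le> 2 * A" if "z \<in> complex_of_real ` {0..1}" for z
  proof -
    have sub: "cball z (1/2) \<subseteq> ball 0 2"
    proof
      fix w assume "w \<in> cball z (1/2)"
      then have "cmod w \<le> cmod z + 1/2" using norm_triangle_sub[of w z] by (simp add: dist_norm norm_minus_commute)
      also have "cmod z \<le> 1" using that by auto
      finally show "w \<in> ball 0 2" by simp
    qed
    have "cmod ((deriv ^^ 1) u z) \<le> fact 1 * A / (1/2) ^ 1"
    proof (rule Cauchy_inequality)
      show "continuous_on (cball z (1/2)) u"
        using holomorphic_on_imp_continuous_on[OF hol] sub continuous_on_subset by blast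
      show "u holomorphic_on ball z (1/2)"
        using hol sub ball_subset_cball holomorphic_on_subset by blast
      show "cmod (u w) \<le> A" if "cmod (z - w) = 1/2" for w
        using that sub by (intro bd) (auto simp: dist_norm subset_iff)
    qed simp
    then show ?thesis by simp
  qed
  have "cmod (u (of_real x) - u (of_real y)) \<le> 2 * A * cmod (of_real x - of_real y)"
  proof (rule field_differentiable_bound[of "complex_of_real ` {0..1}" u "deriv u"])
    show "convex (complex_of_real ` {0..1})"
      by (intro convex_linear_image) (auto simp: bounded_linear.linear bounded_linear_of_real)
    fix z assume z: "z \<in> complex_of_real ` {0..1}"
    then have "z \<in> ball 0 2" by auto
    then show "(u has_field_derivative deriv u z) (at z within complex_of_real ` {0..1})"
      using holomorphic_derivI[OF hol open_ball] has_field_derivative_at_within by blast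
    show "cmod (deriv u z) \<le> 2 * A" using d[OF z] .
  qed (use x y in auto)
  also have "cmod (complex_of_real x - of_real y) = \<bar>x - y\<bar>" by (simp flip: of_real_diff)
  finally show ?thesis .
qed

text \<open>Cut \<open>[0, 1]\<close> into \<open>L\<close> cells and rescale each to unit length; \<open>R q\<close> is the rescaled part of \<open>E\<close> in cell \<open>q\<close>.
  The cells in which \<open>E\<close> has relative measure below \<open>\<gamma>/2\<close> carry at most half of \<open>E\<close>, and \<open>E'\<close> is the rest.\<close>

lemma grid_pigeonhole:
  fixes E :: "real set" and L :: nat
  assumes E: "E \<in> sets borel" "E \<subseteq> {0..1}" and \<gamma>: "measure lborel E \<ge> \<gamma>" "\<gamma> > 0" and L: "L > 0"
  defines "R \<equiv> \<lambda>q::nat. {y\<in>{0..1}. (real q + y) / real L \<in> E}"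
  defines "E' \<equiv> {x\<in>E. \<exists>q y. y \<in> R q \<and> measure lborel (R q) \<ge> \<gamma> / 2 \<and> x = (real q + y) / real L}"
  shows "\<And>q. R q \<in> sets borel" "E' \<in> sets borel" "measure lborel E' \<ge> \<gamma> / 2"
proof -
  note [measurable] = E(1)
  show R[measurable]: "R q \<in> sets borel" for q unfolding R_def by measurable
  define K where "K q = {x\<in>E. real q \<le> real L * x \<and> real L * x \<le> real q + 1}" for q :: nat
  have K[measurable]: "K q \<in> sets borel" for q unfolding K_def by measurable
  have KR: "K q = (\<lambda>y. (real q + y) / real L) ` R q" for q
  proof (intro set_eqI iffI)
    fix x assume "x \<in> K q"
    then have "real L * x - real q \<in> R q" "x = (real q + (real L * x - real q)) / real L"
      using L by (auto simp: K_def R_def)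
    then show "x \<in> (\<lambda>y. (real q + y) / real L) ` R q" by blast
  qed (use L in \<open>auto simp: K_def R_def\<close>)
  have fin: "A \<in> sets borel \<Longrightarrow> A \<subseteq> {0..1} \<Longrightarrow> A \<in> fmeasurable lborel" for A :: "real set"
    using emeasure_mono[of A "{0..1}" lborel] by (auto simp: fmeasurable_def intro: le_less_trans)
  have mK: "measure lborel (K q) = measure lborel (R q) / real L" for q
  proof -
    have "emeasure lborel (K q) = (\<integral>\<^sup>+x. indicator (K q) x \<partial>lborel)" by simp
    also have "\<dots> = ennreal \<bar>1 / real L\<bar> * (\<integral>\<^sup>+y. indicator (K q) (real q / real L + (1 / real L) * y) \<partial>lborel)"
      using L by (intro nn_integral_real_affine) auto
    also have "(\<integral>\<^sup>+y. indicator (K q) (real q / real L + (1 / real L) * y) \<partial>lborel) = (\<integral>\<^sup>+y. indicator (R q) y \<partial>lborel)"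
    proof (rule nn_integral_cong)
      fix y :: real
      have "real L * ((real q + y) / real L) = real q + y" using L by simp
      then have "(real q + y) / real L \<in> K q \<longleftrightarrow> y \<in> R q" by (auto simp: K_def R_def)
      moreover have "real q / real L + 1 / real L * y = (real q + y) / real L"
        by (simp add: add_divide_distrib)
      ultimately show "indicator (K q) (real q / real L + 1 / real L * y) = indicator (R q) y"
        by (simp only: indicator_def)
    qed
    also have "\<dots> = emeasure lborel (R q)" by simp
    finally have "emeasure lborel (K q) = ennreal \<bar>1 / real L\<bar> * emeasure lborel (R q)" .
    then show ?thesis by (simp add: measure_def enn2real_mult)
  qed
  define Q where "Q = {q\<in>{..<L}. measure lborel (R q) \<ge> \<gamma> / 2}"
  have E'eq: "E' = (\<Union>q\<in>{q. measure lborel (R q) \<ge> \<gamma> / 2}. K q)"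
    unfolding E'_def KR using KR by (auto simp: K_def R_def)
  show E'[measurable]: "E' \<in> sets borel" unfolding E'eq by measurable
  have E'01: "E' \<subseteq> {0..1}" using E(2) by (auto simp: E'_def)
  have cover: "E \<subseteq> (\<Union>q\<in>{..<L} - Q. K q) \<union> E'"
  proof
    fix x assume x: "x \<in> E"
    then have x01: "0 \<le> x" "x \<le> 1" using E(2) by auto
    obtain q where q: "q < L" "x \<in> K q"
    proof (cases "x = 1")
      case True
      then show ?thesis using that[of "L - 1"] L x by (auto simp: K_def of_nat_diff)
    next
      case False
      then have "real L * x < real L" using x01 L by simp
      moreover have "real L * x \<ge> 0" using x01 by simp
      ultimately show ?thesis using that[of "nat \<lfloor>real L * x\<rfloor>"] x
        by (auto simp: K_def) linarith+
    qed
    show "x \<in> (\<Union>q\<in>{..<L} - Q. K q) \<union> E'"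
    proof (cases "q \<in> Q")
      case True then show ?thesis using q unfolding E'eq Q_def by blast
    next
      case False then show ?thesis using q by blast
    qed
  qed
  have K01: "K q \<subseteq> {0..1}" for q using E(2) by (auto simp: K_def)
  let ?B = "\<Union>q\<in>{..<L} - Q. K q"
  have B: "?B \<in> sets borel" "?B \<subseteq> {0..1}" using K01 by auto
  have "\<gamma> \<le> measure lborel E" by fact
  also have "\<dots> \<le> measure lborel (?B \<union> E')"
    by (rule measure_mono_fmeasurable[OF cover]) (use E B E'01 in \<open>auto intro!: fin\<close>)
  also have "\<dots> \<le> measure lborel ?B + measure lborel E'"
    by (rule measure_Un_le) (use B in auto)
  also have "measure lborel ?B \<le> (\<Sum>q\<in>{..<L} - Q. measure lborel (K q))"
    by (rule measure_UNION_le) auto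
  also have "\<dots> \<le> (\<Sum>q\<in>{..<L} - Q. \<gamma> / 2 / real L)"
    unfolding mK by (intro sum_mono divide_right_mono) (auto simp: Q_def)
  also have "\<dots> \<le> real L * (\<gamma> / 2 / real L)"
  proof -
    have "card ({..<L} - Q) \<le> L" by (metis card_Diff_subset_Int card_lessThan card_mono diff_le_self finite_lessThan Diff_subset)
    then show ?thesis unfolding sum_constant using \<gamma>(2) by (intro mult_right_mono) auto
  qed
  also have "\<dots> = \<gamma> / 2" using L by simp
  finally show "measure lborel E' \<ge> \<gamma> / 2" by simp
qed

text \<open>Two terms whose frequencies differ by at most \<open>L\<close> form a single term with the coefficient below.\<close>

lemma bounded_hol_merge:
  assumes u: "bounded_hol A u" and v: "bounded_hol A v" and d: "\<bar>d\<bar> \<le> L" and "A \<ge> 0"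
  shows "bounded_hol (A * (1 + exp (2 * L))) (\<lambda>z. u z + exp (\<i> * of_real d * z) * v z)"
  unfolding bounded_hol_def
proof (intro conjI ballI)
  show "(\<lambda>z. u z + exp (\<i> * of_real d * z) * v z) holomorphic_on ball 0 2"
    using u v by (auto simp: bounded_hol_def intro!: holomorphic_intros)
  fix z :: complex assume z: "z \<in> ball 0 2"
  have "cmod (\<i> * of_real d * z) \<le> L * 2"
    unfolding norm_mult using z d by (auto intro!: mult_mono)
  then have "cmod (exp (\<i> * of_real d * z)) \<le> exp (2 * L)"
    by (intro order_trans[OF norm_exp]) simp
  then have "cmod (exp (\<i> * of_real d * z) * v z) \<le> exp (2 * L) * A"
    unfolding norm_mult using v z by (intro mult_mono) (auto simp: bounded_hol_def)
  moreover have "cmod (u z) \<le> A" using u z by (auto simp: bounded_hol_def)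
  ultimately show "cmod (u z + exp (\<i> * of_real d * z) * v z) \<le> A * (1 + exp (2 * L))"
    by (intro order_trans[OF norm_triangle_ineq]) (simp add: algebra_simps)
qed

text \<open>On a cell of length \<open>1/L\<close> the coefficients vary by at most \<open>2A/L\<close>, whereas the frequencies, rescaled to
  the cell, still have gaps at least \<open>1\<close>. Hence the sum is there a pure exponential sum up to an error
  of order \<open>1/L\<close>, and the bound for the coefficients of such sums applies.\<close>

lemma coeff_small_on_grid:
  fixes I :: "'i set" and L :: nat
  assumes coeff: "\<And>l c E s. (\<forall>i\<in>I. \<forall>k\<in>I. i \<noteq> k \<longrightarrow> \<bar>l i - l k\<bar> \<ge> 1) \<Longrightarrow> E \<in> sets borel \<Longrightarrow> E \<subseteq> {0..1} \<Longrightarrow>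
      measure lborel E \<ge> \<gamma> / 2 \<Longrightarrow> (\<forall>x\<in>E. cmod (\<Sum>i\<in>I. c i * exp (\<i> * of_real (l i * x))) \<le> s) \<Longrightarrow>
      (\<forall>i\<in>I. cmod (c i) \<le> C * s)"
    and gap: "\<forall>i\<in>I. \<forall>k\<in>I. i \<noteq> k \<longrightarrow> \<bar>l i - l k\<bar> \<ge> real L"
    and L: "L > 0" and A: "A > 0"
    and u: "\<forall>i\<in>I. bounded_hol A (u i)" and E: "E \<in> sets borel" "E \<subseteq> {0..1}"
    and small: "\<forall>x\<in>E. cmod (\<Sum>i\<in>I. exp (\<i> * of_real (l i * x)) * u i (of_real x)) \<le> \<epsilon>"
    and y: "y \<in> {0..1}" "(real q + y) / real L \<in> E"
    and R: "measure lborel {y\<in>{0..1}. (real q + y) / real L \<in> E} \<ge> \<gamma> / 2"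
    and i: "i \<in> I"
  shows "cmod (u i (of_real ((real q + y) / real L))) \<le> C * (\<epsilon> + card I * (2 * A / L)) + 2 * A / L"
proof -
  note [measurable] = E(1)
  let ?R = "{y\<in>{0..1}. (real q + y) / real L \<in> E}"
  let ?a = "real q / real L"
  have a: "?a \<in> {0..1}"
  proof -
    have "(real q + y) / real L \<in> {0..1}" using y(2) E(2) by blast
    moreover have "?a \<le> (real q + y) / real L" using y(1) by (intro divide_right_mono) auto
    ultimately show ?thesis by simp
  qed
  have near: "cmod (u i (of_real ((real q + y) / real L)) - u i (of_real ?a)) \<le> 2 * A / L" if "i \<in> I" "y \<in> ?R" for i y
  proof -
    have "cmod (u i (of_real ((real q + y) / real L)) - u i (of_real ?a)) \<le> 2 * A * \<bar>(real q + y) / real L - ?a\<bar>"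
      by (rule bounded_hol_lipschitz) (use u that E(2) a in auto)
    also have "\<bar>(real q + y) / real L - ?a\<bar> = y / L" using that by (simp add: add_divide_distrib)
    also have "2 * A * (y / L) \<le> 2 * A * (1 / L)" using that A by (intro mult_left_mono divide_right_mono) auto
    finally show ?thesis by simp
  qed
  define c where "c i = exp (\<i> * of_real (l i * ?a)) * u i (of_real ?a)" for i
  have "\<forall>i\<in>I. cmod (c i) \<le> C * (\<epsilon> + card I * (2 * A / L))"
  proof (rule coeff[where l = "\<lambda>i. l i / L" and E = ?R])
    show "\<forall>i\<in>I. \<forall>k\<in>I. i \<noteq> k \<longrightarrow> \<bar>l i / L - l k / L\<bar> \<ge> 1"
      using gap L by (simp add: diff_divide_distrib[symmetric])
    show "?R \<in> sets borel" by measurable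
    show "\<forall>x\<in>?R. cmod (\<Sum>i\<in>I. c i * exp (\<i> * of_real (l i / L * x))) \<le> \<epsilon> + card I * (2 * A / L)"
    proof
      fix x assume x: "x \<in> ?R"
      let ?x = "(real q + x) / real L"
      let ?f = "\<lambda>i. exp (\<i> * of_real (l i * ?x)) * u i (of_real ?x)"
      let ?g = "\<lambda>i. exp (\<i> * of_real (l i * ?x)) * (u i (of_real ?x) - u i (of_real ?a))"
      have eq: "(\<Sum>i\<in>I. c i * exp (\<i> * of_real (l i / L * x))) = (\<Sum>i\<in>I. ?f i) - (\<Sum>i\<in>I. ?g i)"
        unfolding sum_subtractf[symmetric]
      proof (rule sum.cong[OF refl])
        fix i
        have "exp (\<i> * of_real (l i * ?a)) * exp (\<i> * of_real (l i / L * x)) = exp (\<i> * of_real (l i * ?x))"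
        proof -
          have "l i * ?a + l i / L * x = l i * ?x" by (simp add: add_divide_distrib distrib_left)
          then show ?thesis by (simp only: exp_add[symmetric] distrib_left[symmetric] of_real_add[symmetric])
        qed
        moreover have "a * b * e = E * U - E * (U - b)" if "a * e = E" for a b e E U :: complex
          unfolding that[symmetric] by (simp add: algebra_simps)
        ultimately show "c i * exp (\<i> * of_real (l i / L * x)) = ?f i - ?g i"
          unfolding c_def by blast
      qed
      have "cmod (\<Sum>i\<in>I. ?g i) \<le> (\<Sum>i\<in>I. 2 * A / L)"
      proof (rule sum_norm_le)
        fix i assume "i \<in> I"
        show "cmod (?g i) \<le> 2 * A / L"
          using near[OF \<open>i \<in> I\<close> x] by (simp add: norm_mult norm_exp_i_times del: of_real_mult)
      qed
      moreover have "cmod (\<Sum>i\<in>I. ?f i) \<le> \<epsilon>" using small x by blast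
      ultimately show "cmod (\<Sum>i\<in>I. c i * exp (\<i> * of_real (l i / L * x))) \<le> \<epsilon> + card I * (2 * A / L)"
        unfolding eq by (intro order_trans[OF norm_triangle_ineq4] add_mono) auto
    qed
  qed (use R in auto)
  then have "cmod (u i (of_real ?a)) \<le> C * (\<epsilon> + card I * (2 * A / L))"
    using i by (simp add: c_def norm_mult norm_exp_i_times del: of_real_mult of_real_divide)
  moreover have "cmod (u i (of_real ((real q + y) / real L)) - u i (of_real ?a)) \<le> 2 * A / L"
    using near i y by blast
  ultimately show ?thesis
    using norm_triangle_sub[of "u i (of_real ((real q + y) / real L))" "u i (of_real ?a)"] by linarith
qed

text \<open>Induction on the number of terms, with \<open>A\<close> arbitrary because merging two terms enlarges the bound of
  the coefficients. The threshold \<open>L\<close> that separates close from distant frequencies is fixed in advance.\<close>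

lemma exp_sum_remez:
  fixes n :: nat and A \<gamma> \<eta> :: real
  assumes "A > 0" "\<gamma> > 0" "\<eta> > 0"
  shows "\<exists>\<epsilon>>0. \<forall>(I :: 'i set) l u E. finite I \<and> card I \<le> n \<and> (\<forall>i\<in>I. bounded_hol A (u i)) \<and>
     E \<in> sets borel \<and> E \<subseteq> {0..1} \<and> measure lborel E \<ge> \<gamma> \<and>
     (\<forall>x\<in>E. cmod (\<Sum>i\<in>I. exp (\<i> * of_real (l i * x)) * u i (of_real x)) \<le> \<epsilon>) \<longrightarrow>
     (\<forall>x\<in>{0..1}. cmod (\<Sum>i\<in>I. exp (\<i> * of_real (l i * x)) * u i (of_real x)) \<le> \<eta>)"
  using assms(1)
proof (induction n arbitrary: A)
  case 0
  then show ?case using \<open>\<eta> > 0\<close> by (intro exI[of _ 1]) auto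
next
  case (Suc n)
  let ?N = "real (Suc n)"
  have "\<gamma> / 2 > 0" "\<eta> / ?N > 0" using assms by auto
  from exp_sum_coeff_bound[OF this(1), of "Suc n"] obtain C where
    CC: "C > 0 \<and> (\<forall>(I :: 'i set) l c E s. finite I \<and> card I \<le> Suc n \<and>
     (\<forall>i\<in>I. \<forall>k\<in>I. i \<noteq> k \<longrightarrow> \<bar>l i - l k\<bar> \<ge> 1) \<and> E \<in> sets borel \<and> E \<subseteq> {0..1} \<and> measure lborel E \<ge> \<gamma> / 2 \<and>
     (\<forall>x\<in>E. cmod (\<Sum>i\<in>I. c i * exp (\<i> * of_real (l i * x))) \<le> s) \<longrightarrow> (\<forall>i\<in>I. cmod (c i) \<le> C * s))" by (rule exE)
  have "C > 0" using CC by (rule conjunct1)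
  from remez_compactness[OF \<open>\<gamma> / 2 > 0\<close> \<open>\<eta> / ?N > 0\<close>, of A] obtain \<epsilon>1 where
    RR: "\<epsilon>1 > 0 \<and> (\<forall>u E. bounded_hol A u \<and> E \<in> sets borel \<and> E \<subseteq> {0..1} \<and> measure lborel E \<ge> \<gamma> / 2 \<and>
    (\<forall>x\<in>E. cmod (u (of_real x)) \<le> \<epsilon>1) \<longrightarrow> (\<forall>x\<in>{0..1}. cmod (u (of_real x)) \<le> \<eta> / ?N))" by (rule exE)
  have "\<epsilon>1 > 0" using RR by (rule conjunct1)
  have \<epsilon>1: "\<forall>x\<in>{0..1}. cmod (u (of_real x)) \<le> \<eta> / ?N" if "bounded_hol A u" "E \<in> sets borel" "E \<subseteq> {0..1}"
    "measure lborel E \<ge> \<gamma> / 2" "\<forall>x\<in>E. cmod (u (of_real x)) \<le> \<epsilon>1" for u E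
    using RR[THEN conjunct2, THEN spec, THEN spec, THEN mp, OF conjI, OF that(1) conjI, OF that(2) conjI,
      OF that(3) conjI, OF that(4,5)] .
  \<comment> \<open>\<open>W / L\<close> is the error made by freezing the coefficients on cells of length \<open>1 / L\<close>.\<close>
  define W where "W = C * ?N * (2 * A) + 2 * A"
  have "W > 0" unfolding W_def using \<open>C > 0\<close> \<open>A > 0\<close> by (intro add_pos_pos mult_pos_pos) auto
  obtain L :: nat where L: "real L > 2 * W / \<epsilon>1" using reals_Archimedean2 by blast
  have "2 * W / \<epsilon>1 > 0" using \<open>W > 0\<close> \<open>\<epsilon>1 > 0\<close> by simp
  then have "L > 0" using L by (cases "L = 0") auto
  have WL: "W / L \<le> \<epsilon>1 / 2" using L \<open>L > 0\<close> \<open>\<epsilon>1 > 0\<close> by (simp add: field_simps)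
  have A': "A * (1 + exp (2 * real L)) > 0" using \<open>A > 0\<close> by (intro mult_pos_pos add_pos_pos) auto
  from Suc.IH[OF this] obtain \<epsilon>2 where
    IH: "\<epsilon>2 > 0 \<and> (\<forall>(I :: 'i set) l u E. finite I \<and> card I \<le> n \<and> (\<forall>i\<in>I. bounded_hol (A * (1 + exp (2 * real L))) (u i)) \<and>
     E \<in> sets borel \<and> E \<subseteq> {0..1} \<and> measure lborel E \<ge> \<gamma> \<and>
     (\<forall>x\<in>E. cmod (\<Sum>i\<in>I. exp (\<i> * of_real (l i * x)) * u i (of_real x)) \<le> \<epsilon>2) \<longrightarrow>
     (\<forall>x\<in>{0..1}. cmod (\<Sum>i\<in>I. exp (\<i> * of_real (l i * x)) * u i (of_real x)) \<le> \<eta>))" by (rule exE)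
  define \<epsilon> where "\<epsilon> = min \<epsilon>2 (\<epsilon>1 / (2 * C))"
  have "\<epsilon> > 0" unfolding \<epsilon>_def using IH \<open>\<epsilon>1 > 0\<close> \<open>C > 0\<close> by simp
  show ?case
  proof (intro exI[of _ \<epsilon>] conjI allI impI \<open>\<epsilon> > 0\<close>, elim conjE)
    fix I :: "'i set" and l :: "'i \<Rightarrow> real" and u E
    assume I: "finite I" "card I \<le> Suc n" and u: "\<forall>i\<in>I. bounded_hol A (u i)"
      and E: "E \<in> sets borel" "E \<subseteq> {0..1}" "measure lborel E \<ge> \<gamma>"
      and small: "\<forall>x\<in>E. cmod (\<Sum>i\<in>I. exp (\<i> * of_real (l i * x)) * u i (of_real x)) \<le> \<epsilon>"
    show "\<forall>x\<in>{0..1}. cmod (\<Sum>i\<in>I. exp (\<i> * of_real (l i * x)) * u i (of_real x)) \<le> \<eta>"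
    \<comment> \<open>Either two frequencies are closer than \<open>L\<close> and can be merged, or all coefficients are small on a
      large part of \<open>E\<close> and the case of one term applies to each of them.\<close>
    proof (cases "\<exists>i\<in>I. \<exists>k\<in>I. i \<noteq> k \<and> \<bar>l i - l k\<bar> < real L")
      case True
      then obtain i k where ik: "i \<in> I" "k \<in> I" "i \<noteq> k" "\<bar>l i - l k\<bar> < real L" by blast
      define v where "v a = (if a = i then \<lambda>z. u i z + exp (\<i> * of_real (l k - l i) * z) * u k z else u a)" for a
      have v: "bounded_hol (A * (1 + exp (2 * real L))) (v a)" if "a \<in> I" for a
      proof (cases "a = i")
        case True
        then show ?thesis unfolding v_def using bounded_hol_merge[of A "u i" "u k" "l k - l i" "real L"] u ik \<open>A > 0\<close>
          by simp
      next
        case False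
        have "A \<le> A * (1 + exp (2 * real L))" using \<open>A > 0\<close> by simp
        then show ?thesis using u that False unfolding v_def bounded_hol_def by (auto intro: order_trans)
      qed
      have eq: "(\<Sum>a\<in>I. exp (\<i> * of_real (l a * x)) * u a (of_real x)) =
        (\<Sum>a\<in>I - {k}. exp (\<i> * of_real (l a * x)) * v a (of_real x))" for x
      proof -
        have "exp (\<i> * of_real (l i * x)) * exp (\<i> * of_real (l k - l i) * of_real x) = exp (\<i> * of_real (l k * x))"
          unfolding exp_add[symmetric] by (simp add: algebra_simps)
        then have 1: "exp (\<i> * of_real (l i * x)) * v i (of_real x) =
          exp (\<i> * of_real (l i * x)) * u i (of_real x) + exp (\<i> * of_real (l k * x)) * u k (of_real x)"
          unfolding v_def by (simp only: distrib_left mult.assoc[symmetric] if_True refl)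
        have 2: "(\<Sum>a\<in>I - {k} - {i}. exp (\<i> * of_real (l a * x)) * v a (of_real x)) =
          (\<Sum>a\<in>I - {k} - {i}. exp (\<i> * of_real (l a * x)) * u a (of_real x))"
          by (rule sum.cong) (auto simp: v_def)
        show ?thesis
          using sum.remove[OF I(1) ik(2), of "\<lambda>a. exp (\<i> * of_real (l a * x)) * u a (of_real x)"]
            sum.remove[of "I - {k}" i "\<lambda>a. exp (\<i> * of_real (l a * x)) * u a (of_real x)"]
            sum.remove[of "I - {k}" i "\<lambda>a. exp (\<i> * of_real (l a * x)) * v a (of_real x)"] I(1) ik 1 2
          by (simp del: of_real_mult)
      qed
      have "finite (I - {k}) \<and> card (I - {k}) \<le> n \<and> (\<forall>i\<in>I - {k}. bounded_hol (A * (1 + exp (2 * real L))) (v i)) \<and>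
        E \<in> sets borel \<and> E \<subseteq> {0..1} \<and> measure lborel E \<ge> \<gamma> \<and>
        (\<forall>x\<in>E. cmod (\<Sum>i\<in>I - {k}. exp (\<i> * of_real (l i * x)) * v i (of_real x)) \<le> \<epsilon>2)"
        using I ik E v small unfolding eq by (auto simp: card_Diff_singleton \<epsilon>_def)
      from IH[THEN conjunct2, THEN spec, THEN spec, THEN spec, THEN spec, THEN mp, OF this]
      show ?thesis unfolding eq .
    next
      case False
      then have gap: "\<forall>i\<in>I. \<forall>k\<in>I. i \<noteq> k \<longrightarrow> \<bar>l i - l k\<bar> \<ge> real L" by force
      let ?R = "\<lambda>q::nat. {y\<in>{0..1}. (real q + y) / real L \<in> E}"
      let ?E' = "{x\<in>E. \<exists>q y. y \<in> ?R q \<and> measure lborel (?R q) \<ge> \<gamma> / 2 \<and> x = (real q + y) / real L}"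
      note grid = grid_pigeonhole[OF E \<open>\<gamma> > 0\<close> \<open>L > 0\<close>]
      have coeff: "\<forall>i\<in>I. cmod (c i) \<le> C * s" if "\<forall>i\<in>I. \<forall>k\<in>I. i \<noteq> k \<longrightarrow> \<bar>l i - l k\<bar> \<ge> 1" "E \<in> sets borel" "E \<subseteq> {0..1}"
        "measure lborel E \<ge> \<gamma> / 2" "\<forall>x\<in>E. cmod (\<Sum>i\<in>I. c i * exp (\<i> * of_real (l i * x))) \<le> s" for l c E s
        using CC[THEN conjunct2, THEN spec, THEN spec, THEN spec, THEN spec, THEN spec, THEN mp, OF conjI, OF I(1) conjI, OF I(2) conjI,
           OF that(1) conjI, OF that(2) conjI, OF that(3) conjI, OF that(4) that(5)] .
      have ui: "cmod (u i (of_real x)) \<le> \<epsilon>1" if "i \<in> I" "x \<in> ?E'" for i x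
      proof -
        from that obtain q y where q: "y \<in> ?R q" "measure lborel (?R q) \<ge> \<gamma> / 2" "x = (real q + y) / real L" by blast
        have "cmod (u i (of_real ((real q + y) / real L))) \<le> C * (\<epsilon> + card I * (2 * A / L)) + 2 * A / L"
          by (rule coeff_small_on_grid[OF coeff gap \<open>L > 0\<close> \<open>A > 0\<close> u E(1,2) small _ _ q(2) that(1)])
            (use q(1) in auto)
        also have "\<dots> \<le> C * (\<epsilon>1 / (2 * C) + ?N * (2 * A / L)) + 2 * A / L"
          using \<open>C > 0\<close> \<open>A > 0\<close> I(2) by (intro add_mono mult_left_mono mult_right_mono) (auto simp: \<epsilon>_def)
        also have "\<dots> = \<epsilon>1 / 2 + W / L"
          unfolding W_def using \<open>C > 0\<close> \<open>L > 0\<close> by (simp add: field_simps)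
        also have "\<dots> \<le> \<epsilon>1" using WL by linarith
        finally show ?thesis unfolding q(3) .
      qed
      have "\<forall>x\<in>{0..1}. cmod (u i (of_real x)) \<le> \<eta> / ?N" if "i \<in> I" for i
        by (rule \<epsilon>1[of "u i" ?E']) (use u that grid(2,3) E(2) ui[OF that] in auto)
      then have "cmod (\<Sum>i\<in>I. exp (\<i> * of_real (l i * x)) * u i (of_real x)) \<le> (\<Sum>i\<in>I. \<eta> / ?N)" if "x \<in> {0..1}" for x
        using that by (intro sum_norm_le) (simp add: norm_mult norm_exp_i_times del: of_real_mult)
      moreover have "(\<Sum>i\<in>I. \<eta> / ?N) \<le> \<eta>"
      proof -
        have "real (card I) * (\<eta> / ?N) \<le> ?N * (\<eta> / ?N)"
          using I(2) assms by (intro mult_right_mono) auto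
        then show ?thesis by simp
      qed
      ultimately show ?thesis by fastforce
    qed
  qed
qed

section \<open>The estimate on an interval of length one\<close>

lemma unit_interval_integral_square_le:
  fixes h :: "real \<Rightarrow> real"
  assumes "continuous_on {0..1} h"
  shows "(LINT t:{0..1}|lborel. h t)\<^sup>2 \<le> (LINT t:{0..1}|lborel. (h t)\<^sup>2)"
proof -
  define c where "c = (LINT t:{0..1}|lborel. h t)"
  have int: "set_integrable lborel {0..1} h" "set_integrable lborel {0..1} (\<lambda>t. (h t)\<^sup>2)"
    using assms by (auto intro!: borel_integrable_atLeastAtMost' continuous_intros)
  have "0 \<le> (LINT t:{0..1}|lborel. (h t - c)\<^sup>2)"
    unfolding set_lebesgue_integral_def by (rule Bochner_Integration.integral_nonneg) auto
  also have "\<dots> = (LINT t:{0..1}|lborel. (h t)\<^sup>2 + ((- (2 * c)) * h t + c\<^sup>2))"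
    by (intro set_lebesgue_integral_cong) (auto simp: power2_eq_square algebra_simps)
  also have "\<dots> = (LINT t:{0..1}|lborel. (h t)\<^sup>2) + ((- (2 * c)) * c + c\<^sup>2)"
  proof -
    have 1: "set_integrable lborel {0..1} (\<lambda>t. (- (2 * c)) * h t)" by (intro set_integrable_mult_right) (rule int(1))
    have 2: "set_integrable lborel {0..1} (\<lambda>t::real. c\<^sup>2)"
      by (rule borel_integrable_atLeastAtMost') simp
    have 3: "(LINT t:{0..1}|lborel. (- (2 * c)) * h t) = (- (2 * c)) * c"
      unfolding c_def by (rule set_integral_mult_right)
    have 4: "(LINT t:{0..1::real}|lborel. c\<^sup>2) = c\<^sup>2" by (subst set_integral_const) auto
    show ?thesis
      unfolding set_integral_add(2)[OF int(2) set_integral_add(1)[OF 1 2]] set_integral_add(2)[OF 1 2] 3 4 ..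
  qed
  finally show ?thesis unfolding c_def[symmetric] by (simp add: power2_eq_square)
qed

text \<open>Cauchy's formula on the circle of radius \<open>3\<close>, on which \<open>|z - w| \<ge> 1\<close>.\<close>

lemma circle_mean_bound:
  assumes u: "u holomorphic_on UNIV" and w: "cmod w < 2"
  shows "(cmod (u w))\<^sup>2 \<le> 9 * (LINT t:{0..1}|lborel. (cmod (u (3 * exp (2 * of_real pi * \<i> * of_real t))))\<^sup>2)"
proof -
  have cont: "continuous_on A u" for A using u holomorphic_on_imp_continuous_on continuous_on_subset by blast
  let ?c = "\<lambda>t::real. 3 * exp (2 * of_real pi * \<i> * of_real t) :: complex"
  define h where "h t = cmod (u (?c t))" for t
  have conth: "continuous_on {0..1} h" unfolding h_def
    by (intro continuous_intros continuous_on_compose2[OF cont[of UNIV]]) auto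
  have cp: "circlepath 0 3 = ?c" unfolding circlepath by (simp add: mult.assoc)
  have dist1: "cmod (?c t - w) \<ge> 1" for t
  proof -
    have "cmod (?c t) = 3" by (simp add: norm_mult mult.assoc)
    then show ?thesis using w norm_triangle_sub[of "?c t" w] by linarith
  qed
  have "((\<lambda>z. u z / (z - w)) has_contour_integral 2 * of_real pi * \<i> * u w) (circlepath 0 3)"
    by (rule Cauchy_integral_circlepath_simple) (use u w holomorphic_on_subset in auto)
  then have "((\<lambda>t. u (?c t) / (?c t - w) * vector_derivative (circlepath 0 3) (at t within {0..1})) has_integral 2 * of_real pi * \<i> * u w) {0..1}"
    unfolding has_contour_integral_def cp .
  then have hi: "((\<lambda>t. u (?c t) / (?c t - w) * (2 * of_real pi * \<i> * ?c t)) has_integral 2 * of_real pi * \<i> * u w) {0..1}"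
    by (rule has_integral_eq[rotated]) (simp add: vector_derivative_circlepath01 mult.assoc)
  have "cmod (2 * of_real pi * \<i> * u w) \<le> integral {0..1} (\<lambda>t. 6 * pi * h t)"
    unfolding integral_unique[OF hi, symmetric]
  proof (rule integral_norm_bound_integral)
    show "(\<lambda>t. u (?c t) / (?c t - w) * (2 * of_real pi * \<i> * ?c t)) integrable_on {0..1}" using hi by blast
    show "(\<lambda>t. 6 * pi * h t) integrable_on {0..1}"
      by (intro integrable_continuous_real continuous_intros conth)
    fix t :: real
    have "cmod (u (?c t) / (?c t - w) * (2 * of_real pi * \<i> * ?c t)) = 6 * pi * (h t / cmod (?c t - w))"
      by (simp add: norm_mult norm_divide h_def mult.assoc)
    also have "\<dots> \<le> 6 * pi * (h t / 1)"
      using dist1[of t] by (intro mult_left_mono divide_left_mono) (auto simp: h_def)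
    finally show "cmod (u (?c t) / (?c t - w) * (2 * of_real pi * \<i> * ?c t)) \<le> 6 * pi * h t" by simp
  qed
  also have "\<dots> = 6 * pi * integral {0..1} h" by simp
  also have "integral {0..1} h = (LINT t:{0..1}|lborel. h t)"
    by (intro set_borel_integral_eq_integral(2)[symmetric] borel_integrable_atLeastAtMost' conth)
  finally have "cmod (u w) \<le> 3 * (LINT t:{0..1}|lborel. h t)"
    by (simp add: norm_mult)
  then have "(cmod (u w))\<^sup>2 \<le> (3 * (LINT t:{0..1}|lborel. h t))\<^sup>2" by (intro power_mono) auto
  also have "\<dots> = 9 * (LINT t:{0..1}|lborel. h t)\<^sup>2" by (simp add: power_mult_distrib)
  also have "\<dots> \<le> 9 * (LINT t:{0..1}|lborel. (h t)\<^sup>2)"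
    using unit_interval_integral_square_le[OF conth] by simp
  finally show ?thesis unfolding h_def .
qed

text \<open>The coefficients are controlled in mean square on a circle, which bounds them uniformly on the disc by
  the norm of the sum on \<open>[0, 1]\<close>. If the sum, normalised to norm \<open>1\<close>, had little mass on \<open>E\<close>, it would by
  Chebyshev's inequality be uniformly small on a part of \<open>E\<close> of measure at least \<open>\<gamma>/2\<close>, hence at most \<open>1/2\<close>
  on \<open>[0, 1]\<close>, which contradicts the normalisation.\<close>

lemma local_L2_estimate:
  fixes n :: nat and A \<gamma> :: real
  assumes "A > 0" "\<gamma> > 0"
  shows "\<exists>c>0. \<forall>(I :: 'i set) l u E. finite I \<and> card I \<le> n \<and> (\<forall>i\<in>I. u i holomorphic_on UNIV) \<and>
     E \<in> sets borel \<and> E \<subseteq> {0..1} \<and> measure lborel E \<ge> \<gamma> \<and>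
     (\<forall>i\<in>I. (LINT t:{0..1}|lborel. (cmod (u i (3 * exp (2 * of_real pi * \<i> * of_real t))))\<^sup>2) \<le>
        A * (LINT x:{0..1}|lborel. (cmod (\<Sum>i\<in>I. exp (\<i> * of_real (l i * x)) * u i (of_real x)))\<^sup>2)) \<longrightarrow>
     c * (LINT x:{0..1}|lborel. (cmod (\<Sum>i\<in>I. exp (\<i> * of_real (l i * x)) * u i (of_real x)))\<^sup>2) \<le>
       (LINT x:E|lborel. (cmod (\<Sum>i\<in>I. exp (\<i> * of_real (l i * x)) * u i (of_real x)))\<^sup>2)"
proof -
  have "3 * sqrt A > 0" "\<gamma> / 2 > 0" "1 / 2 > (0::real)" using assms by auto
  from exp_sum_remez[OF this, of n] obtain \<epsilon> where
    ER: "\<epsilon> > 0 \<and> (\<forall>(I :: 'i set) l u E. finite I \<and> card I \<le> n \<and> (\<forall>i\<in>I. bounded_hol (3 * sqrt A) (u i)) \<and>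
     E \<in> sets borel \<and> E \<subseteq> {0..1} \<and> measure lborel E \<ge> \<gamma> / 2 \<and>
     (\<forall>x\<in>E. cmod (\<Sum>i\<in>I. exp (\<i> * of_real (l i * x)) * u i (of_real x)) \<le> \<epsilon>) \<longrightarrow>
     (\<forall>x\<in>{0..1}. cmod (\<Sum>i\<in>I. exp (\<i> * of_real (l i * x)) * u i (of_real x)) \<le> 1 / 2))" by (rule exE)
  have "\<epsilon> > 0" using ER by (rule conjunct1)
  have pos: "\<epsilon>\<^sup>2 * \<gamma> / 2 > 0" using \<open>\<epsilon> > 0\<close> assms by simp
  show ?thesis
  proof (intro exI[of _ "\<epsilon>\<^sup>2 * \<gamma> / 2"] conjI allI impI pos, elim conjE)
    fix I :: "'i set" and l :: "'i \<Rightarrow> real" and u :: "'i \<Rightarrow> complex \<Rightarrow> complex" and E :: "real set"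
    let ?V = "\<lambda>x. \<Sum>i\<in>I. exp (\<i> * of_real (l i * x)) * u i (of_real x)"
    let ?B = "LINT x:{0..1}|lborel. (cmod (?V x))\<^sup>2"
    assume I: "finite I" "card I \<le> n" and u: "\<forall>i\<in>I. u i holomorphic_on UNIV"
      and E: "E \<in> sets borel" "E \<subseteq> {0..1}" "measure lborel E \<ge> \<gamma>"
      and mean: "\<forall>i\<in>I. (LINT t:{0..1}|lborel. (cmod (u i (3 * exp (2 * of_real pi * \<i> * of_real t))))\<^sup>2) \<le> A * ?B"
    note [measurable] = E(1)
    have cu: "continuous_on UNIV (u i)" if "i \<in> I" for i
      using u that holomorphic_on_imp_continuous_on by blast
    have contV: "continuous_on UNIV ?V"
      by (intro continuous_intros continuous_on_compose2[OF cu]) auto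
    then have [measurable]: "?V \<in> borel_measurable borel" by (rule borel_measurable_continuous_onI)
    have intV: "set_integrable lborel {0..1} (\<lambda>x. (cmod (?V x))\<^sup>2)"
      by (intro borel_integrable_atLeastAtMost' continuous_on_power continuous_on_norm continuous_on_subset[OF contV]) simp
    have intE: "set_integrable lborel E (\<lambda>x. (cmod (?V x))\<^sup>2)"
      using intV by (rule set_integrable_subset) (use E in auto)
    have B0: "?B \<ge> 0" unfolding set_lebesgue_integral_def by (rule Bochner_Integration.integral_nonneg) auto
    have E0: "(LINT x:E|lborel. (cmod (?V x))\<^sup>2) \<ge> 0"
      unfolding set_lebesgue_integral_def by (rule Bochner_Integration.integral_nonneg) auto
    show "\<epsilon>\<^sup>2 * \<gamma> / 2 * ?B \<le> (LINT x:E|lborel. (cmod (?V x))\<^sup>2)"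
    proof (cases "?B = 0")
      case True
      then show ?thesis using E0 by simp
    next
      case False
      then have "?B > 0" using B0 by simp
      define b where "b = sqrt ?B"
      have b: "b > 0" "b\<^sup>2 = ?B" using \<open>?B > 0\<close> by (auto simp: b_def)
      show ?thesis
      proof (rule ccontr)
        assume neg: "\<not> ?thesis"
        \<comment> \<open>The part of \<open>E\<close> on which the normalised sum exceeds \<open>\<epsilon>\<close>.\<close>
        define S where "S = {x\<in>E. cmod (?V x) > \<epsilon> * b}"
        have S[measurable]: "S \<in> sets borel" unfolding S_def by measurable
        have finS: "emeasure lborel S < \<infinity>"
        proof -
          have "S \<subseteq> {0..1}" unfolding S_def using E(2) by blast
          then have "emeasure lborel S \<le> emeasure lborel {0..1::real}" by (rule emeasure_mono) simp
          also have "\<dots> < \<infinity>" by simp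
          finally show ?thesis .
        qed
        have "(\<epsilon> * b)\<^sup>2 * measure lborel S = (LINT x:S|lborel. (\<epsilon> * b)\<^sup>2)"
          using finS by (simp add: set_integral_const)
        also have "\<dots> \<le> (LINT x:E|lborel. (cmod (?V x))\<^sup>2)"
          unfolding set_lebesgue_integral_def
        proof (rule Bochner_Integration.integral_mono)
          show "integrable lborel (\<lambda>x. indicat_real S x *\<^sub>R (\<epsilon> * b)\<^sup>2)"
            using finS by (auto intro!: integrable_scaleR_left simp del: scaleR_conv_of_real real_scaleR_def)
          show "integrable lborel (\<lambda>x. indicat_real E x *\<^sub>R (cmod (?V x))\<^sup>2)"
            using intE unfolding set_integrable_def .
          fix x
          have "(\<epsilon> * b)\<^sup>2 \<le> (cmod (?V x))\<^sup>2" if "x \<in> S"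
            using that \<open>\<epsilon> > 0\<close> \<open>b > 0\<close> unfolding S_def by (intro power_mono) auto
          then show "indicat_real S x *\<^sub>R (\<epsilon> * b)\<^sup>2 \<le> indicat_real E x *\<^sub>R (cmod (?V x))\<^sup>2"
            by (auto simp: indicator_def S_def)
        qed
        also have "\<dots> < \<epsilon>\<^sup>2 * \<gamma> / 2 * ?B" using neg by simp
        also have "\<dots> = (\<epsilon> * b)\<^sup>2 * (\<gamma> / 2)" using b by (simp add: power_mult_distrib)
        finally have "measure lborel S < \<gamma> / 2"
          using \<open>\<epsilon> > 0\<close> \<open>b > 0\<close> by (simp add: mult_less_cancel_left)
        moreover have "measure lborel E \<le> measure lborel S + measure lborel (E - S)"
        proof -
          have "measure lborel (S \<union> (E - S)) \<le> measure lborel S + measure lborel (E - S)"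
            by (rule measure_Un_le) auto
          moreover have "S \<union> (E - S) = E" by (auto simp: S_def)
          ultimately show ?thesis by simp
        qed
        ultimately have ES: "measure lborel (E - S) \<ge> \<gamma> / 2" using E(3) by linarith
        define v where "v i z = u i z / of_real b" for i z
        have Vv: "(\<Sum>i\<in>I. exp (\<i> * of_real (l i * x)) * v i (of_real x)) = ?V x / of_real b" for x
          by (simp add: v_def sum_divide_distrib)
        have bh: "bounded_hol (3 * sqrt A) (v i)" if "i \<in> I" for i
          unfolding bounded_hol_def
        proof (intro conjI ballI)
          have "u i holomorphic_on ball 0 2" using u that holomorphic_on_subset by blast
          then show "v i holomorphic_on ball 0 2" unfolding v_def using b(1) by (intro holomorphic_intros) auto
          fix z :: complex assume "z \<in> ball 0 2"
          then have "(cmod (u i z))\<^sup>2 \<le> 9 * (LINT t:{0..1}|lborel. (cmod (u i (3 * exp (2 * of_real pi * \<i> * of_real t))))\<^sup>2)"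
            using circle_mean_bound u that by simp
          also have "\<dots> \<le> 9 * (A * b\<^sup>2)" using mean that b(2) by simp
          also have "\<dots> = (3 * sqrt A * b)\<^sup>2" using \<open>A > 0\<close> by (simp add: power_mult_distrib)
          finally have "cmod (u i z) \<le> 3 * sqrt A * b"
            by (rule power2_le_imp_le) (use \<open>A > 0\<close> b(1) in auto)
          then show "cmod (v i z) \<le> 3 * sqrt A"
            using b(1) by (simp add: v_def norm_divide field_simps)
        qed
        have "cmod (?V x / of_real b) \<le> \<epsilon>" if "x \<in> E - S" for x
          using that b(1) by (auto simp: S_def norm_divide field_simps)
        then have "finite I \<and> card I \<le> n \<and> (\<forall>i\<in>I. bounded_hol (3 * sqrt A) (v i)) \<and>
          E - S \<in> sets borel \<and> E - S \<subseteq> {0..1} \<and> measure lborel (E - S) \<ge> \<gamma> / 2 \<and>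
          (\<forall>x\<in>E - S. cmod (\<Sum>i\<in>I. exp (\<i> * of_real (l i * x)) * v i (of_real x)) \<le> \<epsilon>)"
          using I bh E(2) ES unfolding Vv by auto
        from ER[THEN conjunct2, THEN spec, THEN spec, THEN spec, THEN spec, THEN mp, OF this]
        have small: "cmod (?V x / of_real b) \<le> 1 / 2" if "x \<in> {0..1}" for x
          using that unfolding Vv by blast
        have "?B \<le> (LINT x:{0..1::real}|lborel. b\<^sup>2 / 4)"
        proof (rule set_integral_mono)
          show "set_integrable lborel {0..1} (\<lambda>x. (cmod (?V x))\<^sup>2)" by (rule intV)
          show "set_integrable lborel {0..1::real} (\<lambda>x. b\<^sup>2 / 4)"
            by (rule borel_integrable_atLeastAtMost') simp
          fix x :: real assume "x \<in> {0..1}"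
          from small[OF this] have "cmod (?V x) \<le> b / 2" using b(1) by (simp add: norm_divide field_simps)
          then have "(cmod (?V x))\<^sup>2 \<le> (b / 2)\<^sup>2" by (intro power_mono) auto
          then show "(cmod (?V x))\<^sup>2 \<le> b\<^sup>2 / 4" by (simp add: power_divide)
        qed
        also have "\<dots> = b\<^sup>2 / 4" by (subst set_integral_const) auto
        also have "\<dots> = ?B / 4" unfolding b(2) ..
        finally show False using \<open>?B > 0\<close> by simp
      qed
    qed
  qed
qed

section \<open>Bessel functions of half-integer order\<close>

text \<open>The Taylor coefficients of the entire function \<open>(z/2)\<^bsup>-\<nu>\<^esup> J\<^sub>\<nu> z\<close> in powers of \<open>(z/2)\<^sup>2\<close>, for the order \<open>\<nu> = m - 1/2\<close>.\<close>

definition hbessel_coeff :: "nat \<Rightarrow> nat \<Rightarrow> real" where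
  "hbessel_coeff m n = (-1) ^ n / (fact n * Gamma (real n + real m + 1 / 2))"

definition hbessel :: "nat \<Rightarrow> complex \<Rightarrow> complex" where
  "hbessel m z = (\<Sum>n. of_real (hbessel_coeff m n) * (z / 2) ^ (2 * n))"

lemma Gamma_half_plus: "Gamma (real (Suc n) + 1 / 2) = (real n + 1 / 2) * Gamma (real n + 1 / 2)"
proof -
  have "Gamma ((real n + 1 / 2) + 1) = (real n + 1 / 2) * Gamma (real n + 1 / 2)"
    by (rule Gamma_plus1) (auto simp: nonpos_Ints_def)
  then show ?thesis by (simp add: algebra_simps)
qed

lemma Gamma_half_ge: "Gamma (real n + 1 / 2) \<ge> 1 / 2"
proof (cases n)
  case 0
  have "sqrt pi \<ge> sqrt 1" using pi_ge_two by (intro real_sqrt_le_mono) auto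
  then have "sqrt pi \<ge> 1 / 2" unfolding real_sqrt_one by linarith
  then show ?thesis unfolding 0 of_nat_0 add_0 Gamma_one_half_real .
next
  case (Suc k)
  have "Gamma (real (Suc k) + 1 / 2) \<ge> 1 / 2" for k
  proof (induction k)
    case 0
    have "sqrt pi \<ge> sqrt 1" using pi_ge_two by (intro real_sqrt_le_mono) auto
    then show ?case unfolding Gamma_half_plus of_nat_0 add_0 Gamma_one_half_real real_sqrt_one by linarith
  next
    case (Suc k)
    have "1 * (1 / 2) \<le> (real (Suc k) + 1 / 2) * Gamma (real (Suc k) + 1 / 2)"
      using Suc by (intro mult_mono) auto
    then show ?case unfolding Gamma_half_plus[of "Suc k"] by simp
  qed
  then show ?thesis using Suc by simp
qed

lemma hbessel_coeff_bound: "\<bar>hbessel_coeff m n\<bar> \<le> 2 / fact n"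
proof -
  have G: "Gamma (real n + real m + 1 / 2) \<ge> 1 / 2"
    using Gamma_half_ge[of "n + m"] by simp
  have "\<bar>hbessel_coeff m n\<bar> = 1 / (fact n * Gamma (real n + real m + 1 / 2))"
    using G by (simp add: hbessel_coeff_def abs_mult power_abs)
  also have "\<dots> \<le> 1 / (fact n * (1 / 2))"
    using G by (intro divide_left_mono mult_left_mono mult_pos_pos) auto
  finally show ?thesis by simp
qed

lemma hbessel_coeff_Suc_left: "hbessel_coeff m n = (real n + real m + 1 / 2) * hbessel_coeff (Suc m) n"
proof -
  have "Gamma (real n + real (Suc m) + 1 / 2) = (real n + real m + 1 / 2) * Gamma (real n + real m + 1 / 2)"
    using Gamma_half_plus[of "n + m"] by (simp add: algebra_simps)
  moreover have "real n + real m + 1 / 2 \<noteq> 0" by linarith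
  ultimately show ?thesis unfolding hbessel_coeff_def by simp
qed

lemma hbessel_coeff_Suc_right: "hbessel_coeff (Suc (Suc m)) n = - (real (Suc n) * hbessel_coeff (Suc m) (Suc n))"
proof -
  have "real (Suc n) + real (Suc m) + 1 / 2 = real n + real (Suc (Suc m)) + 1 / 2" by simp
  moreover have "a / (F * G) = - (S * (- 1 * a / (S * F * G)))" if "S \<noteq> 0" for a F G S :: real
    using that by simp
  ultimately show ?thesis unfolding hbessel_coeff_def power_Suc fact_Suc by (metis of_nat_0_eq_iff of_nat_fact of_nat_mult nat.distinct(1))
qed

lemma hbessel_sums: "(\<lambda>n. of_real (hbessel_coeff m n) * (z / 2) ^ (2 * n)) sums hbessel m z"
proof -
  have "summable (\<lambda>n. of_real (hbessel_coeff m n) * (z / 2) ^ (2 * n))"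
  proof (rule summable_comparison_test')
    have "summable (\<lambda>n. inverse (fact n) * (cmod (z/2) ^ 2) ^ n)" by (rule summable_exp)
    then show "summable (\<lambda>n. 2 * (inverse (fact n) * (cmod (z/2) ^ 2) ^ n))" by (rule summable_mult)
    fix n :: nat
    have "cmod (of_real (hbessel_coeff m n) * (z / 2) ^ (2 * n)) = \<bar>hbessel_coeff m n\<bar> * (cmod (z/2) ^ 2) ^ n"
      by (simp add: norm_mult norm_power power_mult norm_divide)
    also have "\<dots> \<le> 2 / fact n * (cmod (z/2) ^ 2) ^ n"
      by (intro mult_right_mono hbessel_coeff_bound) auto
    finally show "cmod (of_real (hbessel_coeff m n) * (z / 2) ^ (2 * n)) \<le> 2 * (inverse (fact n) * (cmod (z/2) ^ 2) ^ n)"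
      by (simp add: field_simps)
  qed
  then show ?thesis unfolding hbessel_def by (rule summable_sums)
qed

lemma entire_of_power_series:
  fixes f :: "complex \<Rightarrow> complex"
  assumes "\<And>w. (\<lambda>n. a n * w ^ n) sums f w"
  shows "f holomorphic_on UNIV"
proof -
  have "f holomorphic_on ball 0 r" for r
    by (rule power_series_holomorphic[of 0 r a]) (use assms in simp)
  then have "f holomorphic_on (\<Union>r\<in>{0<..}. ball 0 (r::real))"
    by (intro holomorphic_on_UN_open) auto
  moreover have "(\<Union>r\<in>{0<..}. ball 0 (r::real)) = (UNIV :: complex set)"
  proof (intro set_eqI iffI UNIV_I)
    fix x :: complex
    have "cmod x + 1 > 0" by (simp add: add_nonneg_pos)
    then show "x \<in> (\<Union>r\<in>{0<..}. ball 0 (r::real))" by (intro UN_I[of "cmod x + 1"]) auto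
  qed
  ultimately show ?thesis by simp
qed

lemma hbessel_entire: "hbessel m holomorphic_on UNIV"
proof -
  define f where "f w = (\<Sum>n. of_real (hbessel_coeff m n) * w ^ n)" for w :: complex
  have eq: "(z / 2) ^ (2 * n) = ((z / 2)\<^sup>2) ^ n" for z :: complex and n by (simp add: power_mult)
  have "f holomorphic_on UNIV"
  proof (rule entire_of_power_series)
    fix w :: complex
    have "(\<lambda>n. of_real (hbessel_coeff m n) * (2 * csqrt w / 2) ^ (2 * n)) sums hbessel m (2 * csqrt w)"
      by (rule hbessel_sums)
    then have "summable (\<lambda>n. of_real (hbessel_coeff m n) * w ^ n)"
      unfolding eq by (simp add: sums_iff)
    then show "(\<lambda>n. of_real (hbessel_coeff m n) * w ^ n) sums f w" unfolding f_def by (rule summable_sums)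
  qed
  moreover have "hbessel m = (\<lambda>z. f ((z / 2)\<^sup>2))" unfolding f_def hbessel_def eq ..
  moreover have "(f \<circ> (\<lambda>z. (z / 2)\<^sup>2)) holomorphic_on UNIV"
    by (rule holomorphic_on_compose_gen[OF _ \<open>f holomorphic_on UNIV\<close>]) (auto intro!: holomorphic_intros)
  ultimately show ?thesis by (simp add: o_def)
qed

text \<open>The three-term recurrence for \<open>J\<^sub>\<nu>\<close>; with the elementary cases below it makes every \<open>hbessel m\<close> elementary.\<close>

lemma hbessel_recurrence:
  "(z / 2)\<^sup>2 * hbessel (Suc (Suc m)) z = of_real (real m + 1 / 2) * hbessel (Suc m) z - hbessel m z"
proof -
  let ?t = "\<lambda>m n. of_real (hbessel_coeff m n) * (z / 2) ^ (2 * n)"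
  have R: "(\<lambda>n. of_real (real m + 1 / 2) * ?t (Suc m) n - ?t m n) sums
     (of_real (real m + 1 / 2) * hbessel (Suc m) z - hbessel m z)"
    by (intro sums_diff sums_mult hbessel_sums)
  have Rn: "of_real (real m + 1 / 2) * ?t (Suc m) n - ?t m n = - of_nat n * ?t (Suc m) n" for n
    unfolding hbessel_coeff_Suc_left[of m n] by (simp add: algebra_simps)
  have "(\<lambda>n. - of_nat (Suc n) * ?t (Suc m) (Suc n)) sums
     (of_real (real m + 1 / 2) * hbessel (Suc m) z - hbessel m z)"
    using R unfolding Rn by (subst sums_Suc_iff) simp
  moreover have "- of_nat (Suc n) * ?t (Suc m) (Suc n) = (z / 2)\<^sup>2 * ?t (Suc (Suc m)) n" for n
  proof -
    have "(z / 2) ^ (2 * Suc n) = (z / 2)\<^sup>2 * (z / 2) ^ (2 * n)" by (simp add: power2_eq_square)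
    then show ?thesis unfolding hbessel_coeff_Suc_right[of m n]
      by (simp only: of_real_minus of_real_mult of_real_of_nat_eq) (simp only: mult_ac mult_minus_left mult_minus_right)
  qed
  ultimately have "(\<lambda>n. (z / 2)\<^sup>2 * ?t (Suc (Suc m)) n) sums
     (of_real (real m + 1 / 2) * hbessel (Suc m) z - hbessel m z)" by (simp only:)
  moreover have "(\<lambda>n. (z / 2)\<^sup>2 * ?t (Suc (Suc m)) n) sums ((z / 2)\<^sup>2 * hbessel (Suc (Suc m)) z)"
    by (intro sums_mult hbessel_sums)
  ultimately show ?thesis using sums_unique2 by blast
qed

lemma Gamma_half_fact: "fact n * Gamma (real n + 1 / 2) * 4 ^ n = sqrt pi * fact (2 * n)"
proof (induction n)
  case 0 then show ?case using Gamma_one_half_real by simp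
next
  case (Suc n)
  have "fact (Suc n) * Gamma (real (Suc n) + 1 / 2) * 4 ^ Suc n =
    (4 * (real n + 1) * (real n + 1 / 2)) * (fact n * Gamma (real n + 1 / 2) * 4 ^ n)"
    unfolding Gamma_half_plus by (simp add: algebra_simps)
  also have "\<dots> = (2 * real n + 2) * (2 * real n + 1) * (sqrt pi * fact (2 * n))"
    unfolding Suc by (simp add: algebra_simps)
  also have "\<dots> = sqrt pi * fact (2 * Suc n)" by (simp add: algebra_simps)
  finally show ?case .
qed

lemma hbessel_coeff_0: "hbessel_coeff 0 n / 4 ^ n = (-1) ^ n / fact (2 * n) / sqrt pi"
proof -
  have "hbessel_coeff 0 n / 4 ^ n = (-1) ^ n / (fact n * Gamma (real n + 1 / 2) * 4 ^ n)"
    by (simp add: hbessel_coeff_def)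
  then show ?thesis unfolding Gamma_half_fact by simp
qed

lemma hbessel_coeff_1: "hbessel_coeff 1 n / 4 ^ n = 2 * (-1) ^ n / fact (2 * n + 1) / sqrt pi"
proof -
  have "hbessel_coeff 0 n / 4 ^ n = (2 * real n + 1) / 2 * (hbessel_coeff 1 n / 4 ^ n)"
    using hbessel_coeff_Suc_left[of 0 n] by (simp add: field_simps)
  then have "2 / (2 * real n + 1) * ((-1) ^ n / fact (2 * n) / sqrt pi) =
    2 / (2 * real n + 1) * ((2 * real n + 1) / 2 * (hbessel_coeff 1 n / 4 ^ n))"
    unfolding hbessel_coeff_0 by simp
  moreover have "2 * real n + 1 \<noteq> 0" by linarith
  ultimately have "hbessel_coeff 1 n / 4 ^ n = 2 / (2 * real n + 1) * ((-1) ^ n / fact (2 * n) / sqrt pi)" by simp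
  moreover have "fact (2 * n + 1) = (2 * real n + 1) * fact (2 * n)" by simp
  ultimately show ?thesis by (simp only:) simp
qed

text \<open>Order \<open>-1/2\<close>, where the Bessel function is a cosine.\<close>

lemma hbessel_0: "hbessel 0 z = cos z / of_real (sqrt pi)"
proof -
  have "(\<lambda>n. \<Sum>i\<in>{n * 2..<n * 2 + 2}. cos_coeff i *\<^sub>R z ^ i) sums cos z"
    by (rule sums_group) (use cos_converges[of z] in auto)
  moreover have "(\<Sum>i\<in>{n * 2..<n * 2 + 2}. cos_coeff i *\<^sub>R z ^ i) = of_real ((-1) ^ n / fact (2 * n)) * z ^ (2 * n)" for n
  proof -
    have "{n * 2..<n * 2 + 2} = {2 * n, 2 * n + 1}" by auto
    then show ?thesis by (simp add: cos_coeff_def scaleR_conv_of_real del: fact_Suc)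
  qed
  ultimately have "(\<lambda>n. of_real ((-1) ^ n / fact (2 * n)) * z ^ (2 * n)) sums cos z" by (simp only:)
  then have "(\<lambda>n. of_real ((-1) ^ n / fact (2 * n)) * z ^ (2 * n) / of_real (sqrt pi)) sums (cos z / of_real (sqrt pi))"
    by (rule sums_divide)
  moreover have "of_real ((-1) ^ n / fact (2 * n)) * z ^ (2 * n) / of_real (sqrt pi) = of_real (hbessel_coeff 0 n) * (z / 2) ^ (2 * n)" for n
  proof -
    have "of_real (hbessel_coeff 0 n) * (z / 2) ^ (2 * n) = of_real (hbessel_coeff 0 n / 4 ^ n) * z ^ (2 * n)"
      by (simp add: power_divide power_mult)
    also have "\<dots> = of_real ((-1) ^ n / fact (2 * n)) * z ^ (2 * n) / of_real (sqrt pi)"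
      unfolding hbessel_coeff_0 by simp
    finally show ?thesis ..
  qed
  ultimately have "(\<lambda>n. of_real (hbessel_coeff 0 n) * (z / 2) ^ (2 * n)) sums (cos z / of_real (sqrt pi))" by (simp only:)
  then show ?thesis using hbessel_sums[of 0 z] sums_unique2 by blast
qed

text \<open>Order \<open>1/2\<close>, where the Bessel function is a sine.\<close>

lemma hbessel_1: "z / 2 * hbessel 1 z = sin z / of_real (sqrt pi)"
proof -
  have "(\<lambda>n. \<Sum>i\<in>{n * 2..<n * 2 + 2}. sin_coeff i *\<^sub>R z ^ i) sums sin z"
    by (rule sums_group) (use sin_converges[of z] in auto)
  moreover have "(\<Sum>i\<in>{n * 2..<n * 2 + 2}. sin_coeff i *\<^sub>R z ^ i) = of_real ((-1) ^ n / fact (2 * n + 1)) * z ^ (2 * n + 1)" for n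
  proof -
    have "{n * 2..<n * 2 + 2} = {2 * n, 2 * n + 1}" by auto
    then show ?thesis by (simp add: sin_coeff_def scaleR_conv_of_real del: fact_Suc)
  qed
  ultimately have "(\<lambda>n. of_real ((-1) ^ n / fact (2 * n + 1)) * z ^ (2 * n + 1)) sums sin z" by (simp only:)
  then have "(\<lambda>n. of_real ((-1) ^ n / fact (2 * n + 1)) * z ^ (2 * n + 1) / of_real (sqrt pi)) sums (sin z / of_real (sqrt pi))"
    by (rule sums_divide)
  moreover have "of_real ((-1) ^ n / fact (2 * n + 1)) * z ^ (2 * n + 1) / of_real (sqrt pi) = z / 2 * (of_real (hbessel_coeff 1 n) * (z / 2) ^ (2 * n))" for n
  proof -
    have "z / 2 * (of_real (hbessel_coeff 1 n) * (z / 2) ^ (2 * n)) = of_real (hbessel_coeff 1 n / 4 ^ n) / 2 * z ^ (2 * n + 1)"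
    proof -
      have "(z / 2) ^ (2 * n) = z ^ (2 * n) / 4 ^ n" by (simp add: power_divide power_mult)
      then show ?thesis by (simp only:) (simp add: field_simps)
    qed
    also have "\<dots> = of_real ((-1) ^ n / fact (2 * n + 1)) * z ^ (2 * n + 1) / of_real (sqrt pi)"
      unfolding hbessel_coeff_1 by (simp del: fact_Suc)
    finally show ?thesis ..
  qed
  ultimately have "(\<lambda>n. z / 2 * (of_real (hbessel_coeff 1 n) * (z / 2) ^ (2 * n))) sums (sin z / of_real (sqrt pi))" by (simp only:)
  moreover have "(\<lambda>n. z / 2 * (of_real (hbessel_coeff 1 n) * (z / 2) ^ (2 * n))) sums (z / 2 * hbessel 1 z)"
    by (intro sums_mult hbessel_sums)
  ultimately show ?thesis using sums_unique2 by blast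
qed

section \<open>The Hankel kernel and its waves\<close>

text \<open>The kernel \<open>\<surd>(\<pi>w) J\<^sub>\<alpha> (2\<pi>w)\<close> of the Hankel transform of order \<open>\<alpha> = m + 1/2\<close>, an entire function.\<close>

definition hkernel :: "nat \<Rightarrow> complex \<Rightarrow> complex" where
  "hkernel m w = (of_real pi * w) ^ Suc m * hbessel (Suc m) (2 * of_real pi * w)"

abbreviation wave :: "complex \<Rightarrow> complex" where "wave w \<equiv> exp (2 * of_real pi * \<i> * w)"

lemma hkernel_entire: "hkernel m holomorphic_on UNIV"
proof -
  have "(hbessel (Suc m) \<circ> (\<lambda>w. 2 * of_real pi * w)) holomorphic_on UNIV"
    by (rule holomorphic_on_compose_gen[OF _ hbessel_entire]) (auto intro!: holomorphic_intros)
  then show ?thesis unfolding hkernel_def o_def by (intro holomorphic_intros)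
qed

lemma cos_wave: "cos (2 * of_real pi * w) = (wave w + wave (- w)) / 2" for w :: complex
  unfolding cos_exp_eq by (simp add: algebra_simps)

lemma sin_wave: "sin (2 * of_real pi * w) = (wave w - wave (- w)) / (2 * \<i>)" for w :: complex
  unfolding sin_exp_eq by (simp add: algebra_simps)

text \<open>The recurrence expresses each order through the two preceding ones, multiplying the polynomials of the
  earlier one by \<open>w\<^sup>2\<close> and those of the later one by a constant; so the degree grows by at most one per step.
  The induction starts from the sine and the cosine.\<close>

lemma hbessel_exp_poly:
  "\<exists>P Q :: complex poly. degree P \<le> m \<and> degree Q \<le> m \<and>
     (\<forall>w. (of_real pi * w) ^ (2 * m + 1) * hbessel (Suc m) (2 * of_real pi * w) =
        poly P w * wave w + poly Q w * wave (- w))"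
proof (induction m rule: less_induct)
  case (less m)
  define r where "r = complex_of_real (sqrt pi)"
  have r: "r \<noteq> 0" unfolding r_def by simp
  have b1: "of_real pi * w * hbessel 1 (2 * of_real pi * w) = (wave w - wave (- w)) / (2 * \<i>) / r" for w :: complex
    using hbessel_1[of "2 * of_real pi * w"] unfolding sin_wave r_def by simp
  have b0: "hbessel 0 (2 * of_real pi * w) = (wave w + wave (- w)) / 2 / r" for w :: complex
    unfolding hbessel_0 cos_wave r_def ..
  have rec: "(of_real pi * w)\<^sup>2 * hbessel (Suc (Suc k)) (2 * of_real pi * w) =
      of_real (real k + 1 / 2) * hbessel (Suc k) (2 * of_real pi * w) - hbessel k (2 * of_real pi * w)" for k w
    using hbessel_recurrence[of "2 * of_real pi * w" k] by simp
  consider "m = 0" | "m = 1" | k where "m = Suc (Suc k)"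
    by (metis One_nat_def not0_implies_Suc)
  then show ?case
  proof cases
    case 1
    have "(of_real pi * w) ^ (2 * m + 1) * hbessel (Suc m) (2 * of_real pi * w) =
      poly [:1 / (2 * \<i>) / r:] w * wave w + poly [:- 1 / (2 * \<i>) / r:] w * wave (- w)" for w
    proof -
      have "(of_real pi * w) ^ (2 * m + 1) * hbessel (Suc m) (2 * of_real pi * w) = of_real pi * w * hbessel 1 (2 * of_real pi * w)"
        using 1 by simp
      also have "\<dots> = (wave w - wave (- w)) / (2 * \<i>) / r" by (rule b1)
      also have "\<dots> = poly [:1 / (2 * \<i>) / r:] w * wave w + poly [:- 1 / (2 * \<i>) / r:] w * wave (- w)"
        by (simp add: diff_divide_distrib right_diff_distrib)
      finally show ?thesis .
    qed
    then show ?thesis using 1 by (intro exI[of _ "[:1 / (2 * \<i>) / r:]"] exI[of _ "[:- 1 / (2 * \<i>) / r:]"]) auto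
  next
    case 2
    let ?P = "[:1 / (2 * \<i>) / r / 2, - of_real pi / 2 / r:]" and ?Q = "[:- 1 / (2 * \<i>) / r / 2, - of_real pi / 2 / r:]"
    have "(of_real pi * w) ^ (2 * m + 1) * hbessel (Suc m) (2 * of_real pi * w) =
      poly ?P w * wave w + poly ?Q w * wave (- w)" for w
    proof -
      have "(of_real pi * w) ^ (2 * m + 1) * hbessel (Suc m) (2 * of_real pi * w) =
        of_real pi * w * ((of_real pi * w)\<^sup>2 * hbessel (Suc (Suc 0)) (2 * of_real pi * w))"
        using 2 by (simp add: power2_eq_square power3_eq_cube)
      also have "\<dots> = 1 / 2 * (of_real pi * w * hbessel 1 (2 * of_real pi * w)) - of_real pi * w * hbessel 0 (2 * of_real pi * w)"
        unfolding rec[of w 0] by (simp add: algebra_simps)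
      also have "\<dots> = poly ?P w * wave w + poly ?Q w * wave (- w)"
        unfolding b1 b0 by (simp add: field_simps r)
      finally show ?thesis .
    qed
    then show ?thesis using 2 by (intro exI[of _ ?P] exI[of _ ?Q]) auto
  next
    case 3
    from less.IH[of k] 3 obtain P Q where PQ: "degree P \<le> k" "degree Q \<le> k"
      "\<And>w. (of_real pi * w) ^ (2 * k + 1) * hbessel (Suc k) (2 * of_real pi * w) = poly P w * wave w + poly Q w * wave (- w)" by auto
    from less.IH[of "Suc k"] 3 obtain P' Q' where PQ': "degree P' \<le> Suc k" "degree Q' \<le> Suc k"
      "\<And>w. (of_real pi * w) ^ (2 * Suc k + 1) * hbessel (Suc (Suc k)) (2 * of_real pi * w) = poly P' w * wave w + poly Q' w * wave (- w)" by auto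
    define c where "c = complex_of_real (real (Suc k) + 1 / 2)"
    let ?s = "[:0, 0, (of_real pi)\<^sup>2:] :: complex poly"
    let ?F = "\<lambda>P P'. smult c P' - ?s * P"
    have deg: "degree (?F P P') \<le> m" if "degree P \<le> k" "degree P' \<le> Suc k" for P P'
    proof (rule degree_diff_le)
      show "degree (smult c P') \<le> m" using that 3 degree_smult_le[of c P'] by linarith
      have "degree (?s * P) \<le> degree ?s + degree P" by (rule degree_mult_le)
      also have "degree ?s \<le> 2" by simp
      finally show "degree (?s * P) \<le> m" using that 3 by linarith
    qed
    have "(of_real pi * w) ^ (2 * m + 1) * hbessel (Suc m) (2 * of_real pi * w) =
      poly (?F P P') w * wave w + poly (?F Q Q') w * wave (- w)" for w
    proof -
      let ?z = "of_real pi * w" and ?h = "\<lambda>k. hbessel k (2 * of_real pi * w)"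
      have "?z ^ (2 * m + 1) * ?h (Suc m) = ?z ^ (2 * Suc k + 1) * (?z\<^sup>2 * ?h (Suc (Suc (Suc k))))"
        using 3 by (simp add: power_add power2_eq_square)
      also have "\<dots> = c * (?z ^ (2 * Suc k + 1) * ?h (Suc (Suc k))) - ?z\<^sup>2 * (?z ^ (2 * k + 1) * ?h (Suc k))"
        unfolding rec[of w "Suc k"] c_def[symmetric] by (simp add: algebra_simps power2_eq_square)
      also have "\<dots> = poly (?F P P') w * wave w + poly (?F Q Q') w * wave (- w)"
        unfolding PQ(3) PQ'(3) by (simp add: algebra_simps power2_eq_square)
      finally show ?thesis .
    qed
    then show ?thesis using deg PQ PQ' by (intro exI[of _ "?F P P'"] exI[of _ "?F Q Q'"]) auto
  qed
qed

lemma hkernel_exp_poly: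
  "\<exists>P Q :: complex poly. degree P \<le> m \<and> degree Q \<le> m \<and>
     (\<forall>w. w ^ m * hkernel m w = poly P w * wave w + poly Q w * wave (- w))"
proof -
  obtain P Q where PQ: "degree P \<le> m" "degree Q \<le> m"
    "\<And>w. (of_real pi * w) ^ (2 * m + 1) * hbessel (Suc m) (2 * of_real pi * w) = poly P w * wave w + poly Q w * wave (- w)"
    using hbessel_exp_poly[of m] by blast
  let ?c = "1 / of_real pi ^ m :: complex"
  have "w ^ m * hkernel m w = poly (smult ?c P) w * wave w + poly (smult ?c Q) w * wave (- w)" for w
  proof -
    have "of_real pi ^ m * (w ^ m * hkernel m w) = (of_real pi * w) ^ (2 * m + 1) * hbessel (Suc m) (2 * of_real pi * w)"
    proof -
      have "(x * y) ^ (2 * m + 1) = x ^ m * (y ^ m * (x * y) ^ Suc m)" for x y :: complex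
      proof -
        have "2 * m + 1 = m + Suc m" by simp
        then show ?thesis by (simp only: power_add power_mult_distrib mult.assoc)
      qed
      then show ?thesis unfolding hkernel_def by (simp only: mult.assoc)
    qed
    then have "of_real pi ^ m * (w ^ m * hkernel m w) = poly P w * wave w + poly Q w * wave (- w)" unfolding PQ(3) .
    then have "w ^ m * hkernel m w = ?c * (poly P w * wave w + poly Q w * wave (- w))"
      by (simp add: field_simps)
    then show ?thesis by (simp add: algebra_simps)
  qed
  then show ?thesis using PQ by (intro exI[of _ "smult ?c P"] exI[of _ "smult ?c Q"]) (auto intro: order_trans[OF degree_smult_le])
qed

lemma cmod_wave_le:
  assumes "\<bar>Im w\<bar> \<le> H" shows "cmod (wave w) \<le> exp (2 * pi * H)"
proof -
  have "cmod (wave w) = exp (2 * pi * (- Im w))" by (simp add: norm_exp_eq_Re)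
  also have "2 * pi * (- Im w) \<le> 2 * pi * H" using assms by (intro mult_left_mono) auto
  finally show ?thesis by simp
qed

lemma poly_minus_top_bound:
  fixes P :: "complex poly"
  assumes "degree P \<le> m" "cmod w \<ge> 1"
  shows "cmod (poly P w - coeff P m * w ^ m) \<le> (\<Sum>i<m. cmod (coeff P i)) * (cmod w ^ m / cmod w)"
proof -
  have "poly P w = (\<Sum>i\<le>m. coeff P i * w ^ i)"
    unfolding poly_altdef using assms(1) by (intro sum.mono_neutral_left) (auto simp: coeff_eq_0)
  also have "\<dots> = (\<Sum>i<m. coeff P i * w ^ i) + coeff P m * w ^ m" by (simp flip: lessThan_Suc_atMost)
  finally have "poly P w - coeff P m * w ^ m = (\<Sum>i<m. coeff P i * w ^ i)" by simp
  also have "cmod \<dots> \<le> (\<Sum>i<m. cmod (coeff P i) * (cmod w ^ m / cmod w))"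
  proof (rule sum_norm_le)
    fix i assume i: "i \<in> {..<m}"
    have "cmod w ^ i * cmod w = cmod w ^ Suc i" by simp
    also have "\<dots> \<le> cmod w ^ m" using i assms(2) by (intro power_increasing) auto
    finally have "cmod w ^ i \<le> cmod w ^ m / cmod w" using assms(2) by (subst pos_le_divide_eq) auto
    then show "cmod (coeff P i * w ^ i) \<le> cmod (coeff P i) * (cmod w ^ m / cmod w)"
      unfolding norm_mult norm_power by (rule mult_left_mono) simp
  qed
  finally show ?thesis by (simp only: sum_distrib_right)
qed

text \<open>Far from the origin only the leading coefficients of the two polynomials matter, and each lower
  power gains a factor \<open>1/|w|\<close>; near the origin continuity suffices. The constants \<open>a\<close>, \<open>b\<close> do not
  depend on the width \<open>H\<close> of the strip.\<close>

lemma hkernel_asymptotics: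
  "\<exists>a b. \<forall>H. \<exists>C>0. \<forall>w. \<bar>Im w\<bar> \<le> H \<longrightarrow> cmod (hkernel m w - a * wave w - b * wave (- w)) \<le> C / (1 + cmod w)"
proof -
  obtain P Q where PQ: "degree P \<le> m" "degree Q \<le> m" "\<And>w. w ^ m * hkernel m w = poly P w * wave w + poly Q w * wave (- w)"
    using hkernel_exp_poly[of m] by blast
  define a b where "a = coeff P m" and "b = coeff Q m"
  define r where "r w = hkernel m w - a * wave w - b * wave (- w)" for w
  have "r holomorphic_on UNIV" unfolding r_def
    by (intro holomorphic_intros hkernel_entire)
  then have "continuous_on (cball 0 1) r" using holomorphic_on_imp_continuous_on continuous_on_subset by blast
  then have "bounded (r ` cball 0 1)" by (intro compact_imp_bounded compact_continuous_image) auto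
  then obtain B where B: "\<And>w. w \<in> cball 0 1 \<Longrightarrow> cmod (r w) \<le> B" unfolding bounded_iff by blast
  define S where "S = (\<Sum>i<m. cmod (coeff P i)) + (\<Sum>i<m. cmod (coeff Q i))"
  have "S \<ge> 0" unfolding S_def by (intro add_nonneg_nonneg sum_nonneg) auto
  have "\<exists>C>0. \<forall>w. \<bar>Im w\<bar> \<le> H \<longrightarrow> cmod (r w) \<le> C / (1 + cmod w)" for H
  proof -
    define M where "M = S * exp (2 * pi * H)"
    have "M \<ge> 0" unfolding M_def using \<open>S \<ge> 0\<close> by simp
    have "cmod (r w) \<le> 2 * (max B 0 + M + 1) / (1 + cmod w)" if H: "\<bar>Im w\<bar> \<le> H" for w
    proof (cases "cmod w \<le> 1")
      case True
      then have "cmod (r w) * (1 + cmod w) \<le> max B 0 * 2"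
        using B[of w] by (intro mult_mono) auto
      also have "\<dots> \<le> 2 * (max B 0 + M + 1)" using \<open>M \<ge> 0\<close> by simp
      finally show ?thesis by (simp add: pos_le_divide_eq add_pos_nonneg)
    next
      case False
      then have w: "cmod w \<ge> 1" by simp
      have "w ^ m * r w = (poly P w - a * w ^ m) * wave w + (poly Q w - b * w ^ m) * wave (- w)"
        unfolding r_def using PQ(3)[of w] by (simp add: algebra_simps)
      then have "cmod (w ^ m * r w) \<le> cmod ((poly P w - a * w ^ m) * wave w) + cmod ((poly Q w - b * w ^ m) * wave (- w))"
        using norm_triangle_ineq by metis
      also have "\<dots> \<le> (\<Sum>i<m. cmod (coeff P i)) * (cmod w ^ m / cmod w) * exp (2 * pi * H) +
         (\<Sum>i<m. cmod (coeff Q i)) * (cmod w ^ m / cmod w) * exp (2 * pi * H)"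
        unfolding norm_mult a_def b_def
        by (intro add_mono mult_mono poly_minus_top_bound PQ w cmod_wave_le mult_nonneg_nonneg sum_nonneg) (use H in auto)
      also have "\<dots> = cmod w ^ m * (M / cmod w)"
        unfolding M_def S_def by (simp add: algebra_simps add_divide_distrib)
      finally have "cmod w ^ m * cmod (r w) \<le> cmod w ^ m * (M / cmod w)" by (simp add: norm_mult norm_power)
      moreover have "cmod w ^ m > 0" using w by (intro zero_less_power) linarith
      ultimately have "cmod (r w) \<le> M / cmod w" by (simp only: mult_le_cancel_left_pos)
      also have "\<dots> \<le> 2 * (max B 0 + M + 1) / (1 + cmod w)"
      proof -
        have "M * (1 + cmod w) \<le> M * (2 * cmod w)" using w \<open>M \<ge> 0\<close> by (intro mult_left_mono) auto
        also have "\<dots> \<le> 2 * (max B 0 + M + 1) * cmod w"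
          using w by (simp add: algebra_simps)
        finally have "M * (1 + cmod w) \<le> 2 * (max B 0 + M + 1) * cmod w" .
        moreover have "cmod w > 0" "1 + cmod w > 0" using w by linarith+
        ultimately show ?thesis by (simp only: pos_divide_le_eq times_divide_eq_left pos_le_divide_eq)
      qed
      finally show ?thesis .
    qed
    moreover have "2 * (max B 0 + M + 1) > 0"
      using \<open>M \<ge> 0\<close> by (intro mult_pos_pos add_nonneg_pos add_nonneg_nonneg) auto
    ultimately show ?thesis by (intro exI[of _ "2 * (max B 0 + M + 1)"] conjI allI impI) assumption+
  qed
  then show ?thesis unfolding r_def by (intro exI[of _ a] exI[of _ b] allI) assumption
qed

section \<open>Integral inequalities\<close>

lemma integral_cauchy_schwarz:
  fixes f g :: "'a \<Rightarrow> real"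
  assumes [measurable]: "f \<in> borel_measurable M" "g \<in> borel_measurable M"
    and f2: "integrable M (\<lambda>x. (f x)\<^sup>2)" and g2: "integrable M (\<lambda>x. (g x)\<^sup>2)"
  shows "integrable M (\<lambda>x. f x * g x)"
    and "(\<integral>x. f x * g x \<partial>M)\<^sup>2 \<le> (\<integral>x. (f x)\<^sup>2 \<partial>M) * (\<integral>x. (g x)\<^sup>2 \<partial>M)"
proof -
  show int: "integrable M (\<lambda>x. f x * g x)"
  proof (rule Bochner_Integration.integrable_bound)
    show "integrable M (\<lambda>x. (f x)\<^sup>2 + (g x)\<^sup>2)" using f2 g2 by simp
    show "AE x in M. norm (f x * g x) \<le> norm ((f x)\<^sup>2 + (g x)\<^sup>2)"
    proof (intro AE_I2)
      fix x
      have "2 * (\<bar>f x\<bar> * \<bar>g x\<bar>) \<le> (f x)\<^sup>2 + (g x)\<^sup>2"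
        using sum_squares_bound[of "\<bar>f x\<bar>" "\<bar>g x\<bar>"] by (simp only: mult.assoc power2_abs)
      moreover have "0 \<le> \<bar>f x\<bar> * \<bar>g x\<bar>" by simp
      ultimately have "\<bar>f x\<bar> * \<bar>g x\<bar> \<le> (f x)\<^sup>2 + (g x)\<^sup>2" by linarith
      then show "norm (f x * g x) \<le> norm ((f x)\<^sup>2 + (g x)\<^sup>2)" by (simp add: abs_mult)
    qed
  qed simp
  have nn: "(\<integral>\<^sup>+x. ennreal \<bar>f x\<bar> * ennreal \<bar>g x\<bar> \<partial>M) = ennreal (\<integral>x. \<bar>f x * g x\<bar> \<partial>M)"
    using integrable_abs[OF int] by (subst nn_integral_eq_integral[symmetric]) (auto simp: abs_mult ennreal_mult)
  have nf: "(\<integral>\<^sup>+x. (ennreal \<bar>f x\<bar>)\<^sup>2 \<partial>M) = ennreal (\<integral>x. (f x)\<^sup>2 \<partial>M)"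
    using f2 by (subst nn_integral_eq_integral[symmetric]) (auto simp: ennreal_power)
  have ng: "(\<integral>\<^sup>+x. (ennreal \<bar>g x\<bar>)\<^sup>2 \<partial>M) = ennreal (\<integral>x. (g x)\<^sup>2 \<partial>M)"
    using g2 by (subst nn_integral_eq_integral[symmetric]) (auto simp: ennreal_power)
  have "ennreal (\<integral>x. \<bar>f x * g x\<bar> \<partial>M) ^ 2 \<le> ennreal (\<integral>x. (f x)\<^sup>2 \<partial>M) * ennreal (\<integral>x. (g x)\<^sup>2 \<partial>M)"
    unfolding nn[symmetric] nf[symmetric] ng[symmetric] by (rule Cauchy_Schwarz_nn_integral) measurable
  then have "ennreal ((\<integral>x. \<bar>f x * g x\<bar> \<partial>M)\<^sup>2) \<le> ennreal ((\<integral>x. (f x)\<^sup>2 \<partial>M) * (\<integral>x. (g x)\<^sup>2 \<partial>M))"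
    by (simp add: ennreal_power ennreal_mult)
  then have "(\<integral>x. \<bar>f x * g x\<bar> \<partial>M)\<^sup>2 \<le> (\<integral>x. (f x)\<^sup>2 \<partial>M) * (\<integral>x. (g x)\<^sup>2 \<partial>M)"
    by (subst (asm) ennreal_le_iff) auto
  moreover have "(\<integral>x. f x * g x \<partial>M)\<^sup>2 \<le> (\<integral>x. \<bar>f x * g x\<bar> \<partial>M)\<^sup>2"
    by (rule abs_le_square_iff[THEN iffD1]) (use integral_abs_bound[of M "\<lambda>x. f x * g x"] in simp)
  ultimately show "(\<integral>x. f x * g x \<partial>M)\<^sup>2 \<le> (\<integral>x. (f x)\<^sup>2 \<partial>M) * (\<integral>x. (g x)\<^sup>2 \<partial>M)" by linarith
qed

text \<open>For holomorphy of the local coefficients in the complexified position variable.\<close>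

lemma entire_parameter_integral:
  fixes \<Phi> :: "complex \<Rightarrow> complex" and G :: "real \<Rightarrow> complex" and s :: "real \<Rightarrow> real"
  assumes \<Phi>: "\<Phi> holomorphic_on UNIV" and G: "integrable lborel G"
    and [measurable]: "s \<in> borel_measurable borel" and s: "\<And>y. G y \<noteq> 0 \<Longrightarrow> \<bar>s y\<bar> \<le> b"
  shows "(\<lambda>w. LINT y|lborel. G y * \<Phi> (w * of_real (s y))) holomorphic_on UNIV"
proof (rule entire_of_power_series)
  have [measurable]: "G \<in> borel_measurable borel" using G by auto
  define \<phi> where "\<phi> n = (deriv ^^ n) \<Phi> 0 / fact n" for n
  have ps: "(\<lambda>n. \<phi> n * z ^ n) sums \<Phi> z" for z
    using holomorphic_power_series[of \<Phi> 0 "cmod z + 1" z] \<Phi> holomorphic_on_subset unfolding \<phi>_def by (fastforce simp: add_nonneg_pos)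
  have abs: "summable (\<lambda>n. cmod (\<phi> n) * r ^ n)" if "r \<ge> 0" for r
  proof -
    have "summable (\<lambda>n. \<phi> n * of_real (r + 1) ^ n)" using ps sums_summable by blast
    then have "summable (\<lambda>n. norm (\<phi> n * of_real r ^ n))"
    proof (rule powser_insidea)
      have "cmod (of_real r) = r" "cmod (of_real (r + 1)) = r + 1" using that by (simp_all only: norm_of_real)
      then show "norm (complex_of_real r) < norm (complex_of_real (r + 1))" by linarith
    qed
    then show ?thesis using that by (simp add: norm_mult norm_power)
  qed
  fix w :: complex
  let ?f = "\<lambda>n y. (\<phi> n * w ^ n) * (G y * of_real (s y) ^ n)"
  define r where "r = cmod w * \<bar>b\<bar>"
  have "r \<ge> 0" unfolding r_def by simp
  have bnd0: "cmod (G y * of_real (s y) ^ n) \<le> \<bar>b\<bar> ^ n * cmod (G y)" for n y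
  proof (cases "G y = 0")
    case False
    then have "\<bar>s y\<bar> ^ n \<le> \<bar>b\<bar> ^ n" using s[of y] by (intro power_mono) auto
    then show ?thesis unfolding norm_mult norm_power norm_of_real mult.commute[of "\<bar>b\<bar> ^ n"]
      by (rule mult_left_mono) simp
  qed simp
  have bnd: "cmod (?f n y) \<le> cmod (\<phi> n) * r ^ n * cmod (G y)" for n y
  proof -
    have "cmod (?f n y) \<le> cmod (\<phi> n) * cmod w ^ n * (\<bar>b\<bar> ^ n * cmod (G y))"
      unfolding norm_mult[of "\<phi> n * w ^ n"] norm_mult[of "\<phi> n"] norm_power by (intro mult_left_mono bnd0) auto
    then show ?thesis unfolding r_def power_mult_distrib by (simp only: mult.assoc)
  qed
  have int0: "integrable lborel (\<lambda>y. G y * of_real (s y) ^ n)" for n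
  proof (rule Bochner_Integration.integrable_bound)
    show "integrable lborel (\<lambda>y. \<bar>b\<bar> ^ n * cmod (G y))" using G by simp
    show "AE y in lborel. cmod (G y * of_real (s y) ^ n) \<le> norm (\<bar>b\<bar> ^ n * cmod (G y))"
      using bnd0[of _ n] by (intro AE_I2) (simp add: abs_mult)
  qed measurable
  then have int: "integrable lborel (?f n)" for n by (rule integrable_mult_right)
  have "(\<lambda>n. integral\<^sup>L lborel (?f n)) sums (\<integral>y. (\<Sum>n. ?f n y) \<partial>lborel)"
  proof (rule sums_integral[OF int])
    show "AE y in lborel. summable (\<lambda>n. norm (?f n y))"
    proof (rule AE_I2)
      fix y
      have "summable (\<lambda>n. cmod (\<phi> n) * r ^ n * cmod (G y))"
        by (intro summable_mult2 abs \<open>r \<ge> 0\<close>)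
      then show "summable (\<lambda>n. norm (?f n y))"
        by (rule summable_comparison_test') (use bnd in auto)
    qed
    have "summable (\<lambda>n. cmod (\<phi> n) * r ^ n * (\<integral>y. cmod (G y) \<partial>lborel))"
      by (intro summable_mult2 abs \<open>r \<ge> 0\<close>)
    then show "summable (\<lambda>n. \<integral>y. norm (?f n y) \<partial>lborel)"
    proof (rule summable_comparison_test')
      fix n :: nat
      have "norm (\<integral>y. norm (?f n y) \<partial>lborel) = (\<integral>y. norm (?f n y) \<partial>lborel)"
        by (simp add: Bochner_Integration.integral_nonneg)
      also have "\<dots> \<le> (\<integral>y. cmod (\<phi> n) * r ^ n * cmod (G y) \<partial>lborel)"
        by (rule Bochner_Integration.integral_mono) (use int G bnd in auto)
      also have "\<dots> = cmod (\<phi> n) * r ^ n * (\<integral>y. cmod (G y) \<partial>lborel)" by simp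
      finally show "norm (\<integral>y. norm (?f n y) \<partial>lborel) \<le> cmod (\<phi> n) * r ^ n * (\<integral>y. cmod (G y) \<partial>lborel)" .
    qed
  qed
  moreover have "integral\<^sup>L lborel (?f n) = (\<phi> n * (LINT y|lborel. G y * of_real (s y) ^ n)) * w ^ n" for n
    using integral_mult_right_zero[of lborel "\<phi> n * w ^ n" "\<lambda>y. G y * of_real (s y) ^ n"]
    by (simp only: mult.assoc mult.left_commute mult.commute)
  moreover have "(\<Sum>n. ?f n y) = G y * \<Phi> (w * of_real (s y))" for y
  proof -
    have "(\<lambda>n. G y * (\<phi> n * (w * of_real (s y)) ^ n)) sums (G y * \<Phi> (w * of_real (s y)))"
      by (intro sums_mult ps)
    moreover have "G y * (\<phi> n * (w * of_real (s y)) ^ n) = ?f n y" for n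
      by (simp add: power_mult_distrib)
    ultimately show ?thesis by (simp add: sums_iff)
  qed
  ultimately show "(\<lambda>n. (\<phi> n * (LINT y|lborel. G y * of_real (s y) ^ n)) * w ^ n) sums (LINT y|lborel. G y * \<Phi> (w * of_real (s y)))"
    by (simp only:)
qed

lemma unit_interval_exp_integral:
  fixes a :: real and k :: int
  shows "(LINT y:{a..a+1}|lborel. exp (2 * of_real pi * \<i> * of_int k * of_real y)) = (if k = 0 then 1 else 0)"
proof (cases "k = 0")
  case True
  then show ?thesis by (subst set_lebesgue_integral_cong[where g = "\<lambda>_. 1"]) (auto simp: set_integral_const)
next
  case False
  let ?c = "2 * of_real pi * \<i> * of_int k :: complex"
  have c: "?c \<noteq> 0" using False by simp
  have "((\<lambda>y. exp (?c * of_real y)) has_integral (exp (?c * of_real (a + 1)) / ?c - exp (?c * of_real a) / ?c)) {a..a+1}"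
  proof (rule fundamental_theorem_of_calculus)
    fix x :: real
    have "((\<lambda>z. exp (?c * z) / ?c) has_field_derivative exp (?c * of_real x)) (at (of_real x))"
      using c by (auto intro!: derivative_eq_intros)
    then show "((\<lambda>y. exp (?c * of_real y) / ?c) has_vector_derivative exp (?c * of_real x)) (at x within {a..a+1})"
      by (rule has_vector_derivative_real_field)
  qed simp
  moreover have "exp (?c * of_real (a + 1)) = exp (?c * of_real a)"
  proof -
    have "?c * of_real (a + 1) = ?c * of_real a + of_real (2 * of_int k * pi) * \<i>" by (simp add: algebra_simps)
    moreover have "exp (of_real (2 * of_int k * pi) * \<i>) = 1" by (rule exp_integer_2pi) simp
    ultimately show ?thesis by (simp only: exp_add mult_1_right)
  qed
  ultimately have hi: "((\<lambda>y. exp (?c * of_real y)) has_integral 0) {a..a+1}" by (simp only: diff_self)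
  have si: "set_integrable lborel {a..a+1} (\<lambda>y. exp (?c * of_real y))"
    by (intro borel_integrable_atLeastAtMost' continuous_intros)
  show ?thesis unfolding set_borel_integral_eq_integral(2)[OF si] integral_unique[OF hi] using False by simp
qed

text \<open>Expand the square of the distance from \<open>H\<close> to its partial Fourier sum on the unit interval.\<close>

lemma bessel_inequality_exp:
  fixes H :: "real \<Rightarrow> complex" and a :: real and \<sigma> :: int and n :: nat
  assumes [measurable]: "H \<in> borel_measurable borel" and H2: "integrable lborel (\<lambda>y. (cmod (H y))\<^sup>2)"
    and supp: "\<And>y. y \<notin> {a..a+1} \<Longrightarrow> H y = 0" and \<sigma>: "\<sigma> \<noteq> 0"
  shows "(\<Sum>j<n. (cmod (LINT y|lborel. H y * exp (2 * of_real pi * \<i> * of_int (\<sigma> * int j) * of_real y)))\<^sup>2)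
     \<le> (LINT y|lborel. (cmod (H y))\<^sup>2)"
proof -
  define e where "e j y = exp (2 * of_real pi * \<i> * of_int (\<sigma> * int j) * complex_of_real y)" for j y
  let ?I = "\<lambda>y. complex_of_real (indicator {a..a+1} y)"
  have [measurable]: "e j \<in> borel_measurable borel" for j unfolding e_def by measurable
  have e1: "cmod (e j y) = 1" for j y
  proof -
    have "e j y = exp (\<i> * of_real (2 * pi * of_int (\<sigma> * int j) * y))" by (simp add: e_def algebra_simps)
    then show ?thesis by (simp only: norm_exp_i_times)
  qed
  have ee: "e j y * cnj (e k y) = exp (2 * of_real pi * \<i> * of_int (\<sigma> * (int j - int k)) * of_real y)" for j k y
  proof -
    have "cnj (e k y) = exp (- (2 * of_real pi * \<i> * of_int (\<sigma> * int k) * complex_of_real y))"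
      unfolding e_def exp_cnj by simp
    then show ?thesis unfolding e_def by (simp add: exp_add[symmetric] algebra_simps)
  qed
  have I_int: "integrable lborel ?I"
  proof -
    have "integrable lborel (indicator {a..a+1} :: real \<Rightarrow> real)" by simp
    then show ?thesis by (rule integrable_of_real)
  qed
  have orth: "(LINT y|lborel. ?I y * (e j y * cnj (e k y))) = (if j = k then 1 else 0)" for j k
    using unit_interval_exp_integral[of a "\<sigma> * (int j - int k)"] \<sigma> unfolding ee set_lebesgue_integral_def
    by (simp add: scaleR_conv_of_real)
  have ee_int: "integrable lborel (\<lambda>y. ?I y * (e j y * cnj (e k y)))" for j k
  proof (rule Bochner_Integration.integrable_bound[OF I_int])
    show "(\<lambda>y. ?I y * (e j y * cnj (e k y))) \<in> borel_measurable lborel" unfolding ee by measurable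
  qed (auto simp: norm_mult e1)
  have H_int: "integrable lborel H"
  proof (rule Bochner_Integration.integrable_bound)
    show "integrable lborel (\<lambda>y. indicator {a..a+1} y + (cmod (H y))\<^sup>2)" using H2 by simp
    show "AE y in lborel. cmod (H y) \<le> norm (indicator {a..a+1} y + (cmod (H y))\<^sup>2)"
    proof (rule AE_I2)
      fix y
      have "cmod (H y) \<le> 1 + (cmod (H y))\<^sup>2"
      proof -
        have "2 * cmod (H y) \<le> 1 + (cmod (H y))\<^sup>2" using sum_squares_bound[of 1 "cmod (H y)"] by simp
        then show ?thesis using norm_ge_zero[of "H y"] by linarith
      qed
      then show "cmod (H y) \<le> norm (indicator {a..a+1} y + (cmod (H y))\<^sup>2)"
        using supp[of y] by (cases "y \<in> {a..a+1}") auto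
    qed
  qed simp
  have He_int: "integrable lborel (\<lambda>y. H y * e j y)" for j
    by (rule Bochner_Integration.integrable_bound[OF H_int]) (auto simp: norm_mult e1)
  define c where "c j = (LINT y|lborel. H y * e j y)" for j
  define P where "P y = (\<Sum>j<n. c j * cnj (e j y))" for y
  define S where "S = (\<Sum>j<n. (cmod (c j))\<^sup>2)"
  have HP: "H y * cnj (P y) = (\<Sum>j<n. cnj (c j) * (H y * e j y))" for y
    unfolding P_def by (simp add: sum_distrib_left cnj_sum algebra_simps)
  have HP_int: "integrable lborel (\<lambda>y. H y * cnj (P y))"
    unfolding HP by (intro Bochner_Integration.integrable_sum integrable_mult_right He_int)
  have HP_val: "(LINT y|lborel. H y * cnj (P y)) = of_real S"
  proof -
    have "(LINT y|lborel. H y * cnj (P y)) = (\<Sum>j<n. cnj (c j) * c j)"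
      unfolding HP c_def by (subst Bochner_Integration.integral_sum) (auto intro: integrable_mult_right He_int)
    also have "\<dots> = of_real S" unfolding S_def of_real_sum
      by (intro sum.cong refl) (simp only: complex_norm_square mult.commute)
    finally show ?thesis .
  qed
  have PP: "?I y * (P y * cnj (P y)) = (\<Sum>j<n. \<Sum>k<n. c j * cnj (c k) * (?I y * (e k y * cnj (e j y))))" for y
  proof -
    have "P y * cnj (P y) = (\<Sum>j<n. \<Sum>k<n. (c j * cnj (e j y)) * (cnj (c k) * e k y))"
      unfolding P_def cnj_sum complex_cnj_mult complex_cnj_cnj by (rule sum_product)
    then show ?thesis by (simp only: sum_distrib_left) (intro sum.cong refl, simp only: mult_ac)
  qed
  have PP_int: "integrable lborel (\<lambda>y. ?I y * (P y * cnj (P y)))"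
    unfolding PP by (intro Bochner_Integration.integrable_sum integrable_mult_right ee_int)
  have PP_val: "(LINT y|lborel. ?I y * (P y * cnj (P y))) = of_real S"
  proof -
    have "(LINT y|lborel. ?I y * (P y * cnj (P y))) = (\<Sum>j<n. \<Sum>k<n. c j * cnj (c k) * (if k = j then 1 else 0))"
      unfolding PP orth[symmetric]
      by (subst Bochner_Integration.integral_sum, intro Bochner_Integration.integrable_sum integrable_mult_right ee_int,
          intro sum.cong refl, subst Bochner_Integration.integral_sum, intro integrable_mult_right ee_int) simp
    also have "\<dots> = (\<Sum>j<n. c j * cnj (c j))" by (intro sum.cong refl) (simp add: if_distrib cong: if_cong)
    also have "\<dots> = of_real S" unfolding S_def of_real_sum
      by (intro sum.cong refl) (simp only: complex_norm_square)
    finally show ?thesis .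
  qed
  let ?D = "\<lambda>y. (cmod (H y))\<^sup>2 - 2 * Re (H y * cnj (P y)) + Re (?I y * (P y * cnj (P y)))"
  have "0 \<le> (LINT y|lborel. ?D y)"
  proof (rule Bochner_Integration.integral_nonneg)
    fix y
    show "0 \<le> ?D y"
    proof (cases "y \<in> {a..a+1}")
      case True
      have "(cmod (h - p))\<^sup>2 = (cmod h)\<^sup>2 - 2 * Re (h * cnj p) + Re (p * cnj p)" for h p
        unfolding cmod_power2 by (simp add: power2_eq_square algebra_simps)
      then have "?D y = (cmod (H y - P y))\<^sup>2"
        using True by simp
      then show ?thesis by simp
    next
      case False
      then show ?thesis using supp by simp
    qed
  qed
  also have "(LINT y|lborel. ?D y) = (LINT y|lborel. (cmod (H y))\<^sup>2) - 2 * Re (of_real S) + Re (of_real S)"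
  proof -
    have "(LINT y|lborel. f y - 2 * g y + h y) = (LINT y|lborel. f y) - 2 * (LINT y|lborel. g y) + (LINT y|lborel. h y)"
      if "integrable lborel f" "integrable lborel g" "integrable lborel h" for f g h :: "real \<Rightarrow> real"
      using that by simp
    from this[OF H2 integrable_Re[OF HP_int] integrable_Re[OF PP_int]]
    show ?thesis unfolding integral_Re[OF HP_int] integral_Re[OF PP_int] HP_val PP_val .
  qed
  finally have "S \<le> (LINT y|lborel. (cmod (H y))\<^sup>2)" by simp
  then show ?thesis unfolding S_def c_def e_def .
qed

text \<open>The sum over \<open>j\<close> of the kernel \<open>1 / (1 + (j + 1) y)\<close> with weight \<open>(j + 1)\<^bsup>-1/2\<^esup>\<close> telescopes to at
  most \<open>\<pi> / \<surd>y\<close>.\<close>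

lemma arctan_step:
  fixes y :: real and j :: nat
  assumes "y > 0"
  shows "sqrt y / (sqrt (real (Suc j)) * (1 + real (Suc j) * y)) \<le> 2 * (arctan (sqrt (real (Suc j) * y)) - arctan (sqrt (real j * y)))"
proof -
  let ?s1 = "sqrt (real (Suc j) * y)" and ?s0 = "sqrt (real j * y)"
  have lt: "?s0 < ?s1" using assms by simp
  have s1: "?s1 > 0" using assms by simp
  obtain z where z: "?s0 < z" "z < ?s1" "arctan ?s1 - arctan ?s0 = (?s1 - ?s0) * (1 / (1 + z\<^sup>2))"
  proof -
    have "DERIV arctan x :> 1 / (1 + x\<^sup>2)" for x :: real
      using DERIV_arctan[of x] by (simp add: inverse_eq_divide)
    from MVT2[OF lt this] that show ?thesis by auto
  qed
  have "z\<^sup>2 \<le> ?s1\<^sup>2" using z(1,2) assms by (intro power_mono) (auto intro: order_trans[OF _ less_imp_le[OF z(1)]])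
  then have "1 / (1 + real (Suc j) * y) \<le> 1 / (1 + z\<^sup>2)"
    using assms by (intro divide_left_mono mult_pos_pos add_pos_nonneg) auto
  moreover have diff: "?s1 - ?s0 \<ge> sqrt y / (2 * sqrt (real (Suc j)))"
  proof -
    have "(?s1 - ?s0) * (2 * ?s1) \<ge> (?s1 - ?s0) * (?s1 + ?s0)"
      using lt by (intro mult_left_mono) auto
    also have "(?s1 - ?s0) * (?s1 + ?s0) = ?s1\<^sup>2 - ?s0\<^sup>2" by (simp add: power2_eq_square algebra_simps)
    also have "\<dots> = y" using assms by (simp add: algebra_simps)
    finally have "?s1 - ?s0 \<ge> y / (2 * ?s1)" using s1 by (simp add: field_simps)
    also have "y / (2 * ?s1) = (y / sqrt y) / (2 * sqrt (real (Suc j)))"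
      unfolding real_sqrt_mult by (simp add: mult.commute mult.left_commute del: of_nat_Suc)
    also have "y / sqrt y = sqrt y" using assms by (simp add: real_div_sqrt)
    finally show ?thesis .
  qed
  ultimately have "sqrt y / (2 * sqrt (real (Suc j))) * (1 / (1 + real (Suc j) * y)) \<le> (?s1 - ?s0) * (1 / (1 + z\<^sup>2))"
    using assms lt by (intro mult_mono) auto
  then have 1: "sqrt y / (2 * sqrt (real (Suc j))) * (1 / (1 + real (Suc j) * y)) \<le> arctan ?s1 - arctan ?s0"
    unfolding z(3) .
  have 2: "sqrt y / (sqrt (real (Suc j)) * (1 + real (Suc j) * y)) =
    2 * (sqrt y / (2 * sqrt (real (Suc j))) * (1 / (1 + real (Suc j) * y)))" by simp
  show ?thesis unfolding 2 by (rule mult_left_mono[OF 1]) simp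
qed

text \<open>The companion of the telescoping sum, with the roles of the two variables exchanged.\<close>

lemma hilbert_kernel_integral:
  fixes c :: real assumes "c > 0"
  defines "k \<equiv> \<lambda>y. if y \<in> {0<..1} then 1 / ((1 + c * y) * sqrt y) else 0"
  shows "integrable lborel k" "(LINT y|lborel. k y) \<le> pi / sqrt c"
proof -
  have [measurable]: "k \<in> borel_measurable borel" unfolding k_def by measurable
  let ?F = "\<lambda>y. 2 * arctan (sqrt (c * y)) / sqrt c"
  have "(k has_integral (?F 1 - ?F 0)) {0..1}"
  proof (rule fundamental_theorem_of_calculus_interior)
    show "continuous_on {0..1} ?F" by (intro continuous_intros) (use assms in auto)
    fix y :: real assume y: "y \<in> {0<..<1}"
    have "(?F has_real_derivative 2 * (inverse (1 + (sqrt (c * y))\<^sup>2) * (inverse (sqrt (c * y)) / 2 * c)) / sqrt c) (at y)"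
    proof -
      have "c * y > 0" using y assms by simp
      then have "((\<lambda>y. sqrt (c * y)) has_real_derivative inverse (sqrt (c * y)) / 2 * c) (at y)"
        by (intro DERIV_chain2[where f = sqrt and g = "\<lambda>y. c * y"] DERIV_real_sqrt) (auto intro!: derivative_eq_intros)
      then show ?thesis
        by (intro DERIV_cdivide DERIV_cmult DERIV_chain2[OF DERIV_arctan])
    qed
    moreover have "2 * (inverse (1 + (sqrt (c * y))\<^sup>2) * (inverse (sqrt (c * y)) / 2 * c)) / sqrt c = k y"
    proof -
      have "c * y > 0" using y assms by simp
      then have "2 * (inverse (1 + (sqrt (c * y))\<^sup>2) * (inverse (sqrt (c * y)) / 2 * c)) / sqrt c =
        inverse (1 + c * y) * inverse (sqrt y) * (inverse (sqrt c) * (c / sqrt c))"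
        using y assms(1) by (simp add: real_sqrt_mult power_mult_distrib)
      also have "inverse (sqrt c) * (c / sqrt c) = 1" using assms by (simp add: real_div_sqrt)
      also have "inverse (1 + c * y) * inverse (sqrt y) * 1 = k y"
        using y by (simp add: k_def divide_inverse)
      finally show ?thesis .
    qed
    ultimately show "(?F has_vector_derivative k y) (at y)"
      by (simp add: has_real_derivative_iff_has_vector_derivative)
  qed simp
  then have "(k has_integral (?F 1 - ?F 0)) UNIV"
    by (rule has_integral_on_superset) (auto simp: k_def)
  then have nn: "integral\<^sup>N lborel k = ennreal (?F 1 - ?F 0)"
    using assms by (intro nn_integral_has_integral_lborel) (auto simp: k_def)
  have "?F 1 - ?F 0 \<ge> 0" using assms by simp
  have k0: "k y \<ge> 0" for y using assms by (auto simp: k_def)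
  from nn show "integrable lborel k"
    using k0 by (intro integrableI_nonneg) auto
  have "(LINT y|lborel. k y) = ?F 1 - ?F 0"
    using nn k0 \<open>?F 1 - ?F 0 \<ge> 0\<close> by (simp add: integral_eq_nn_integral)
  also have "\<dots> \<le> pi / sqrt c"
    using arctan_ubound[of "sqrt c"] assms by (simp add: divide_right_mono)
  finally show "(LINT y|lborel. k y) \<le> pi / sqrt c" .
qed

text \<open>Schur's test for a half-discrete Hilbert kernel, with weights \<open>(j + 1)\<^bsup>-1/2\<^esup>\<close> and \<open>y\<^bsup>-1/2\<^esup>\<close>.\<close>

lemma schur_discrete:
  fixes G :: "real \<Rightarrow> real"
  assumes [measurable]: "G \<in> borel_measurable borel" and G2: "integrable lborel (\<lambda>y. (G y)\<^sup>2)"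
    and supp: "\<And>y. G y \<noteq> 0 \<Longrightarrow> y \<in> {0<..1}"
  shows "integrable lborel (\<lambda>y. \<bar>G y\<bar> / (1 + real (Suc j) * y))"
    and "(\<Sum>j<n. (LINT y|lborel. \<bar>G y\<bar> / (1 + real (Suc j) * y))\<^sup>2) \<le> pi\<^sup>2 * (LINT y|lborel. (G y)\<^sup>2)"
proof -
  define k where "k j y = (if y \<in> {0<..1} then 1 / ((1 + real (Suc j) * y) * sqrt y) else 0)" for j :: nat and y :: real
  have k0: "k j y \<ge> 0" for j y by (auto simp: k_def)
  have [measurable]: "k j \<in> borel_measurable borel" for j unfolding k_def by measurable
  have k_int: "integrable lborel (k j)" "(LINT y|lborel. k j y) \<le> pi / sqrt (real (Suc j))" for j
    unfolding k_def using hilbert_kernel_integral[of "real (Suc j)"] by auto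
  define h where "h j y = sqrt (k j y)" for j y
  define g where "g j y = (if y \<in> {0<..1} then \<bar>G y\<bar> * sqrt (sqrt y / (1 + real (Suc j) * y)) else 0)" for j :: nat and y :: real
  have [measurable]: "h j \<in> borel_measurable borel" "g j \<in> borel_measurable borel" for j
    unfolding h_def g_def by measurable
  have h2: "(h j y)\<^sup>2 = k j y" for j y using k0[of j y] by (simp add: h_def)
  have g2: "(g j y)\<^sup>2 = (G y)\<^sup>2 * (sqrt y / (1 + real (Suc j) * y))" for j y
    using supp[of y] by (auto simp: g_def power_mult_distrib)
  have gh: "g j y * h j y = \<bar>G y\<bar> / (1 + real (Suc j) * y)" for j y
  proof (cases "y \<in> {0<..1}")
    case True
    then have y: "y > 0" by simp
    let ?q = "1 + real (Suc j) * y"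
    have q: "?q > 0" using y by (intro add_pos_nonneg) auto
    have "sqrt (sqrt y / ?q) * sqrt (1 / (?q * sqrt y)) = sqrt (sqrt y / ?q * (1 / (?q * sqrt y)))"
      by (rule real_sqrt_mult[symmetric])
    also have "sqrt y / ?q * (1 / (?q * sqrt y)) = (1 / ?q)\<^sup>2"
      using y q by (simp add: power2_eq_square divide_simps)
    also have "sqrt ((1 / ?q)\<^sup>2) = 1 / ?q" using q by simp
    finally show ?thesis using True by (simp add: g_def h_def k_def mult.assoc del: of_nat_Suc)
  next
    case False
    then show ?thesis using supp[of y] by (auto simp: g_def)
  qed
  have g_le: "(g j y)\<^sup>2 \<le> (G y)\<^sup>2" for j y
  proof (cases "G y = 0")
    case False
    then have y: "0 < y" "y \<le> 1" using supp by auto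
    have "sqrt y \<le> 1 + real (Suc j) * y"
      using y by (intro order_trans[OF real_sqrt_le_1_iff[THEN iffD2]]) auto
    then have "sqrt y / (1 + real (Suc j) * y) \<le> 1" using y by (simp add: divide_le_eq_1 add_pos_nonneg)
    then have "(G y)\<^sup>2 * (sqrt y / (1 + real (Suc j) * y)) \<le> (G y)\<^sup>2 * 1" by (intro mult_left_mono) auto
    then show ?thesis unfolding g2 by simp
  qed (simp add: g2)
  have g2_int: "integrable lborel (\<lambda>y. (g j y)\<^sup>2)" for j
    by (rule Bochner_Integration.integrable_bound[OF G2]) (use g_le in auto)
  have h2_int: "integrable lborel (\<lambda>y. (h j y)\<^sup>2)" for j unfolding h2 by (rule k_int)
  note CS = integral_cauchy_schwarz[of "g j" lborel "h j" for j, OF _ _ g2_int h2_int, unfolded gh]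
  show "integrable lborel (\<lambda>y. \<bar>G y\<bar> / (1 + real (Suc j) * y))"
    by (rule CS(1)) auto
  have one: "(LINT y|lborel. \<bar>G y\<bar> / (1 + real (Suc j) * y))\<^sup>2 \<le>
      (LINT y|lborel. pi / sqrt (real (Suc j)) * (g j y)\<^sup>2)" for j
  proof -
    have "(LINT y|lborel. \<bar>G y\<bar> / (1 + real (Suc j) * y))\<^sup>2 \<le> (LINT y|lborel. (g j y)\<^sup>2) * (LINT y|lborel. (h j y)\<^sup>2)"
      by (rule CS(2)) auto
    also have "\<dots> \<le> (LINT y|lborel. (g j y)\<^sup>2) * (pi / sqrt (real (Suc j)))"
      unfolding h2 by (intro mult_left_mono k_int Bochner_Integration.integral_nonneg) auto
    finally show ?thesis by (simp add: mult.commute)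
  qed
  have pt: "(\<Sum>j<n. pi / sqrt (real (Suc j)) * (g j y)\<^sup>2) \<le> pi\<^sup>2 * (G y)\<^sup>2" for y
  proof (cases "G y = 0")
    case False
    then have y: "0 < y" "y \<le> 1" using supp by auto
    have "(\<Sum>j<n. sqrt y / (sqrt (real (Suc j)) * (1 + real (Suc j) * y))) \<le>
       (\<Sum>j<n. 2 * (arctan (sqrt (real (Suc j) * y)) - arctan (sqrt (real j * y))))"
      by (intro sum_mono arctan_step y)
    also have "\<dots> = 2 * (arctan (sqrt (real n * y)) - arctan (sqrt (real 0 * y)))"
      unfolding sum_distrib_left[symmetric] by (subst sum_lessThan_telescope) simp
    also have "\<dots> \<le> pi" using arctan_ubound[of "sqrt (real n * y)"] by simp
    finally have S: "(\<Sum>j<n. sqrt y / (sqrt (real (Suc j)) * (1 + real (Suc j) * y))) \<le> pi" .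
    have "(\<Sum>j<n. pi / sqrt (real (Suc j)) * (g j y)\<^sup>2) =
      pi * (G y)\<^sup>2 * (\<Sum>j<n. sqrt y / (sqrt (real (Suc j)) * (1 + real (Suc j) * y)))"
      unfolding g2 sum_distrib_left by (intro sum.cong refl) simp
    also have "\<dots> \<le> pi * (G y)\<^sup>2 * pi" by (intro mult_left_mono S) auto
    finally show ?thesis by (simp add: power2_eq_square mult_ac)
  qed (simp add: g2)
  have "(\<Sum>j<n. (LINT y|lborel. \<bar>G y\<bar> / (1 + real (Suc j) * y))\<^sup>2) \<le>
     (\<Sum>j<n. (LINT y|lborel. pi / sqrt (real (Suc j)) * (g j y)\<^sup>2))"
    by (intro sum_mono one)
  also have "\<dots> = (LINT y|lborel. (\<Sum>j<n. pi / sqrt (real (Suc j)) * (g j y)\<^sup>2))"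
    by (rule Bochner_Integration.integral_sum[symmetric]) (intro integrable_mult_right g2_int)
  also have "\<dots> \<le> (LINT y|lborel. pi\<^sup>2 * (G y)\<^sup>2)"
    by (rule Bochner_Integration.integral_mono)
      (intro Bochner_Integration.integrable_sum integrable_mult_right g2_int, intro integrable_mult_right G2, rule pt)
  finally show "(\<Sum>j<n. (LINT y|lborel. \<bar>G y\<bar> / (1 + real (Suc j) * y))\<^sup>2) \<le> pi\<^sup>2 * (LINT y|lborel. (G y)\<^sup>2)" by simp
qed

lemma integrable_of_square_integrable:
  fixes G :: "real \<Rightarrow> 'a :: {banach, second_countable_topology}"
  assumes [measurable]: "G \<in> borel_measurable borel" "S \<in> sets borel" and fin: "emeasure lborel S < \<infinity>"
    and G2: "integrable lborel (\<lambda>y. (norm (G y))\<^sup>2)" and supp: "\<And>y. G y \<noteq> 0 \<Longrightarrow> y \<in> S"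
  shows "integrable lborel G"
proof (rule Bochner_Integration.integrable_bound)
  show "integrable lborel (\<lambda>y. indicator S y + (norm (G y))\<^sup>2)" using G2 fin by simp
  show "AE y in lborel. norm (G y) \<le> norm (indicator S y + (norm (G y))\<^sup>2)"
  proof (rule AE_I2)
    fix y
    have "2 * norm (G y) \<le> 1 + (norm (G y))\<^sup>2" using sum_squares_bound[of 1 "norm (G y)"] by simp
    then have "norm (G y) \<le> 1 + (norm (G y))\<^sup>2" using norm_ge_zero[of "G y"] by linarith
    then show "norm (G y) \<le> norm (indicator S y + (norm (G y))\<^sup>2)"
      using supp[of y] by (cases "G y = 0") auto
  qed
qed simp

text \<open>The additional factor has modulus at most \<open>e\<^bsup>12\<pi>\<^esup>\<close>, since \<open>|w| \<le> 3\<close> and \<open>0 \<le> y - b \<le> 2\<close> on the support.\<close>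

lemma bessel_inequality_modulated:
  fixes G :: "real \<Rightarrow> real" and a b :: real and \<sigma> :: int and w :: complex
  assumes [measurable]: "G \<in> borel_measurable borel" and G2: "integrable lborel (\<lambda>y. (G y)\<^sup>2)"
    and supp: "\<And>y. G y \<noteq> 0 \<Longrightarrow> y \<in> {a..a+1}" and \<sigma>: "\<sigma> \<in> {1, -1}" and w: "cmod w \<le> 3" and b: "a - 1 \<le> b" "b \<le> a"
  shows "(\<Sum>j<n. (cmod (LINT y|lborel. of_real (G y) * (wave (of_int \<sigma> * of_nat j * of_real y) * wave (of_int \<sigma> * (w * of_real (y - b))))))\<^sup>2)
     \<le> exp (24 * pi) * (LINT y|lborel. (G y)\<^sup>2)"
proof -
  define H where "H y = of_real (G y) * wave (of_int \<sigma> * (w * of_real (y - b)))" for y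
  have [measurable]: "H \<in> borel_measurable borel" unfolding H_def by measurable
  have wv: "cmod (wave (of_int \<sigma> * (w * of_real (y - b)))) \<le> exp (12 * pi)" if "G y \<noteq> 0" for y
  proof -
    have "\<bar>Im (of_int \<sigma> * (w * of_real (y - b)))\<bar> \<le> cmod (of_int \<sigma> * (w * of_real (y - b)))" by (rule abs_Im_le_cmod)
    also have "\<dots> = cmod w * \<bar>y - b\<bar>" using \<sigma> by (auto simp: norm_mult simp flip: of_real_diff)
    also have "\<dots> \<le> 3 * 2" using supp[OF that] b w by (intro mult_mono) auto
    finally have "\<bar>Im (of_int \<sigma> * (w * of_real (y - b)))\<bar> \<le> 3 * 2" .
    from cmod_wave_le[OF this]
    have "cmod (wave (of_int \<sigma> * (w * of_real (y - b)))) \<le> exp (2 * pi * (3 * 2))" .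
    moreover have "2 * pi * (3 * 2) = 12 * pi" by simp
    ultimately show ?thesis by (simp only:)
  qed
  have H_le: "(cmod (H y))\<^sup>2 \<le> exp (24 * pi) * (G y)\<^sup>2" for y
  proof (cases "G y = 0")
    case False
    have "(cmod (H y))\<^sup>2 \<le> (\<bar>G y\<bar> * exp (12 * pi))\<^sup>2"
      unfolding H_def norm_mult norm_of_real using wv[OF False] by (intro power_mono mult_left_mono) auto
    also have "\<dots> = exp (24 * pi) * (G y)\<^sup>2"
      by (simp add: power_mult_distrib mult.commute flip: exp_double)
    finally show ?thesis .
  qed (simp add: H_def)
  have H2: "integrable lborel (\<lambda>y. (cmod (H y))\<^sup>2)"
    by (rule Bochner_Integration.integrable_bound[of _ "\<lambda>y. exp (24 * pi) * (G y)\<^sup>2"]) (use G2 H_le in auto)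
  have eq: "of_real (G y) * (wave (of_int \<sigma> * of_nat j * of_real y) * wave (of_int \<sigma> * (w * of_real (y - b)))) =
     H y * exp (2 * of_real pi * \<i> * of_int (\<sigma> * int j) * of_real y)" for y j
    by (simp add: H_def mult_ac)
  have "(\<Sum>j<n. (cmod (LINT y|lborel. H y * exp (2 * of_real pi * \<i> * of_int (\<sigma> * int j) * of_real y)))\<^sup>2)
     \<le> (LINT y|lborel. (cmod (H y))\<^sup>2)"
    by (rule bessel_inequality_exp[where a = a]) (use H2 supp \<sigma> in \<open>auto simp: H_def\<close>)
  also have "\<dots> \<le> (LINT y|lborel. exp (24 * pi) * (G y)\<^sup>2)"
    by (rule Bochner_Integration.integral_mono[OF H2]) (use G2 H_le in auto)
  finally show ?thesis unfolding eq by simp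
qed

section \<open>Low frequencies\<close>

text \<open>For \<open>|w| \<le> 3\<close> the point \<open>j + w\<close> is comparable with \<open>j + 1\<close> from above; from below only after adding
  a constant, because \<open>j + w\<close> may vanish for small \<open>j\<close>.\<close>

lemma shifted_point_bounds:
  fixes w :: complex and j :: nat
  assumes w: "cmod w \<le> 3"
  shows "cmod (of_nat j + w) \<le> 4 * real (Suc j)"
    and "0 \<le> y \<Longrightarrow> y \<le> 1 \<Longrightarrow> 1 + real (Suc j) * y \<le> 8 * (1 + cmod (of_nat j + w) * y)"
proof -
  have "cmod (of_nat j + w) \<le> real j + cmod w" by (rule order_trans[OF norm_triangle_ineq]) simp
  then show "cmod (of_nat j + w) \<le> 4 * real (Suc j)" using w by simp
  assume y: "0 \<le> y" "y \<le> 1"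
  have lower: "cmod (of_nat j + w) \<ge> real j - 3"
    using norm_diff_ineq[of "of_nat j :: complex" w] w by simp
  show "1 + real (Suc j) * y \<le> 8 * (1 + cmod (of_nat j + w) * y)"
  proof (cases "j \<le> 6")
    case True
    then have "real (Suc j) * y \<le> 7 * 1" using y by (intro mult_mono) auto
    moreover have "0 \<le> cmod (of_nat j + w) * y" using y by simp
    moreover have "1 + p \<le> 8 * (1 + q)" if "p \<le> 7 * 1" "0 \<le> q" for p q :: real using that by simp
    ultimately show ?thesis by blast
  next
    case False
    then have "real (Suc j) \<le> 8 * cmod (of_nat j + w)" using lower by linarith
    then have "real (Suc j) * y \<le> 8 * cmod (of_nat j + w) * y" using y by (intro mult_right_mono) auto
    then show ?thesis by simp
  qed
qed

lemma cmod_sum3_square: "(cmod (x + y + z))\<^sup>2 \<le> 3 * ((cmod x)\<^sup>2 + (cmod y)\<^sup>2 + (cmod z)\<^sup>2)"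
proof -
  have "(cmod (x + y + z))\<^sup>2 \<le> (cmod x + cmod y + cmod z)\<^sup>2"
    by (intro power_mono order_trans[OF norm_triangle_ineq] add_right_mono norm_triangle_ineq) auto
  also have "\<dots> \<le> 3 * ((cmod x)\<^sup>2 + (cmod y)\<^sup>2 + (cmod z)\<^sup>2)"
    using sum_squares_bound[of "cmod x" "cmod y"] sum_squares_bound[of "cmod x" "cmod z"] sum_squares_bound[of "cmod y" "cmod z"]
    by (simp add: power2_eq_square algebra_simps)
  finally show ?thesis .
qed

text \<open>For \<open>y \<le> 1\<close> dividing the polynomials by powers of \<open>y\<close> is not affordable. Instead, the kernel is replaced by its
  asymptotics: the two pure waves are controlled by the Bessel inequality for Fourier series, and the
  remainder of size \<open>1 / (1 + |w|)\<close> by Schur's test.\<close>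

lemma low_frequency_bound:
  "\<exists>D>0. \<forall>(G :: real \<Rightarrow> real) n w. G \<in> borel_measurable borel \<and> integrable lborel (\<lambda>y. (G y)\<^sup>2) \<and>
     (\<forall>y. G y \<noteq> 0 \<longrightarrow> y \<in> {0<..1}) \<and> cmod w \<le> 3 \<longrightarrow>
     (\<Sum>j<n. (cmod (((of_nat j + w) / of_nat (Suc j)) ^ m *
        (LINT y|lborel. of_real (G y) * hkernel m ((of_nat j + w) * of_real y))))\<^sup>2) \<le> D * (LINT y|lborel. (G y)\<^sup>2)"
proof -
  obtain a b where ab: "\<And>H. \<exists>C>0. \<forall>w. \<bar>Im w\<bar> \<le> H \<longrightarrow> cmod (hkernel m w - a * wave w - b * wave (- w)) \<le> C / (1 + cmod w)"
    using hkernel_asymptotics[of m] by blast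
  from ab[of 3] obtain C where CC: "C > 0 \<and> (\<forall>w. \<bar>Im w\<bar> \<le> 3 \<longrightarrow> cmod (hkernel m w - a * wave w - b * wave (- w)) \<le> C / (1 + cmod w))"
    by (rule exE)
  have "C > 0" using CC by (rule conjunct1)
  have Cb: "cmod (hkernel m w - a * wave w - b * wave (- w)) \<le> C / (1 + cmod w)" if "\<bar>Im w\<bar> \<le> 3" for w
    using CC[THEN conjunct2, THEN spec, THEN mp, OF that] .
  define D where "D = 16 ^ m * (3 * ((cmod a)\<^sup>2 * exp (24 * pi) + (cmod b)\<^sup>2 * exp (24 * pi) + (8 * C)\<^sup>2 * pi\<^sup>2)) + 1"
  have "D > 0" unfolding D_def by (intro add_nonneg_pos mult_nonneg_nonneg add_nonneg_nonneg) auto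
  show ?thesis
  proof (intro exI[of _ D] conjI allI impI \<open>D > 0\<close>, elim conjE)
    fix G :: "real \<Rightarrow> real" and n and w :: complex
    assume [measurable]: "G \<in> borel_measurable borel" and G2: "integrable lborel (\<lambda>y. (G y)\<^sup>2)"
      and supp: "\<forall>y. G y \<noteq> 0 \<longrightarrow> y \<in> {0<..1}" and w: "cmod w \<le> 3"
    let ?N = "LINT y|lborel. (G y)\<^sup>2"
    have N0: "?N \<ge> 0" by (rule Bochner_Integration.integral_nonneg) auto
    define z where "z j = of_nat j + w" for j :: nat
    define r where "r x = hkernel m x - a * wave x - b * wave (- x)" for x
    have hk[measurable]: "hkernel m \<in> borel_measurable borel"
      by (intro borel_measurable_continuous_onI holomorphic_on_imp_continuous_on hkernel_entire)
    have [measurable]: "r \<in> borel_measurable borel" unfolding r_def by measurable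
    have Gint: "integrable lborel (\<lambda>y. complex_of_real (G y))"
      by (rule integrable_of_square_integrable[of _ "{0<..1}"]) (use G2 supp in auto)
    have Im_le: "\<bar>Im (z j * of_real y)\<bar> \<le> 3" if "G y \<noteq> 0" for j y
    proof -
      have y: "0 < y" "y \<le> 1" using supp that by auto
      have "\<bar>Im (z j * of_real y)\<bar> = \<bar>Im w\<bar> * y" using y by (simp add: z_def abs_mult)
      also have "\<dots> \<le> cmod w * 1" using y by (intro mult_mono abs_Im_le_cmod) auto
      finally show ?thesis using w by simp
    qed
    define U where "U \<sigma> j = (LINT y|lborel. of_real (G y) * (wave (of_int \<sigma> * of_nat j * of_real y) * wave (of_int \<sigma> * (w * of_real (y - 0)))))"
      for \<sigma> :: int and j :: nat
    have wz: "wave (of_int \<sigma> * of_nat j * of_real y) * wave (of_int \<sigma> * (w * of_real (y - 0))) = wave (of_int \<sigma> * (z j * of_real y))" for \<sigma> :: int and j y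
      unfolding exp_add[symmetric] z_def by (simp add: algebra_simps)
    have U_int: "integrable lborel (\<lambda>y. of_real (G y) * wave (of_int \<sigma> * (z j * of_real y)))" if "\<sigma> \<in> {1, -1}" for \<sigma> :: int and j
    proof (rule Bochner_Integration.integrable_bound)
      show "integrable lborel (\<lambda>y. complex_of_real (G y) * of_real (exp (2 * pi * 3)))" using Gint by (rule integrable_mult_left)
      show "AE y in lborel. cmod (of_real (G y) * wave (of_int \<sigma> * (z j * of_real y))) \<le> norm (complex_of_real (G y) * of_real (exp (2 * pi * 3)))"
      proof (rule AE_I2)
        fix y
        have "cmod (wave (of_int \<sigma> * (z j * of_real y))) \<le> exp (2 * pi * 3)" if "G y \<noteq> 0"
          using Im_le[OF that, of j] \<open>\<sigma> \<in> {1, -1}\<close> by (intro cmod_wave_le) auto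
        then show "cmod (of_real (G y) * wave (of_int \<sigma> * (z j * of_real y))) \<le> norm (complex_of_real (G y) * of_real (exp (2 * pi * 3)))"
          unfolding norm_mult norm_of_real by (cases "G y = 0") (auto intro!: mult_left_mono)
      qed
    qed measurable
    have U_bound: "(\<Sum>j<n. (cmod (U \<sigma> j))\<^sup>2) \<le> exp (24 * pi) * ?N" if "\<sigma> \<in> {1, -1}" for \<sigma>
      unfolding U_def by (rule bessel_inequality_modulated[where a = 0]) (use that supp w G2 in force)+
    have r_le: "cmod (of_real (G y) * r (z j * of_real y)) \<le> 8 * C * (\<bar>G y\<bar> / (1 + real (Suc j) * y))" for j y
    proof (cases "G y = 0")
      case False
      then have y: "0 < y" "y \<le> 1" using supp by auto
      have zy: "cmod (z j * of_real y) = cmod (z j) * y" using y by (simp add: norm_mult)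
      have p: "1 + real (Suc j) * y > 0" "1 + cmod (z j) * y > 0" using y by (auto intro!: add_pos_nonneg)
      have "cmod (r (z j * of_real y)) \<le> C / (1 + cmod (z j) * y)"
        using Cb[OF Im_le[OF False, of j]] unfolding r_def zy .
      also have "\<dots> \<le> 8 * C / (1 + real (Suc j) * y)"
      proof -
        have "C * (1 + real (Suc j) * y) \<le> C * (8 * (1 + cmod (z j) * y))"
          using shifted_point_bounds(2)[OF w, of y j] y \<open>C > 0\<close> unfolding z_def by (intro mult_left_mono) auto
        then show ?thesis using p by (simp add: divide_simps mult_ac)
      qed
      finally have "\<bar>G y\<bar> * cmod (r (z j * of_real y)) \<le> \<bar>G y\<bar> * (8 * C / (1 + real (Suc j) * y))"
        by (rule mult_left_mono) simp
      then show ?thesis unfolding norm_mult norm_of_real by (simp only: times_divide_eq_right mult_ac)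
    qed simp
    note S = schur_discrete[of G, OF _ G2]
    have S_int: "integrable lborel (\<lambda>y. \<bar>G y\<bar> / (1 + real (Suc j) * y))" for j
      by (rule S(1)) (use supp in auto)
    have r_int: "integrable lborel (\<lambda>y. of_real (G y) * r (z j * of_real y))" for j
    proof (rule Bochner_Integration.integrable_bound)
      show "integrable lborel (\<lambda>y. 8 * C * (\<bar>G y\<bar> / (1 + real (Suc j) * y)))" using S_int by (rule integrable_mult_right)
      show "AE y in lborel. cmod (of_real (G y) * r (z j * of_real y)) \<le> norm (8 * C * (\<bar>G y\<bar> / (1 + real (Suc j) * y)))"
        unfolding real_norm_def by (intro AE_I2 order_trans[OF r_le] abs_ge_self)
    qed measurable
    define V where "V j = (LINT y|lborel. of_real (G y) * r (z j * of_real y))" for j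
    have V_le: "(cmod (V j))\<^sup>2 \<le> (8 * C)\<^sup>2 * (LINT y|lborel. \<bar>G y\<bar> / (1 + real (Suc j) * y))\<^sup>2" for j
    proof -
      have "cmod (V j) \<le> (LINT y|lborel. cmod (of_real (G y) * r (z j * of_real y)))"
        unfolding V_def by (rule integral_norm_bound)
      also have "\<dots> \<le> (LINT y|lborel. 8 * C * (\<bar>G y\<bar> / (1 + real (Suc j) * y)))"
        by (rule Bochner_Integration.integral_mono[OF integrable_norm[OF r_int] integrable_mult_right[OF S_int] r_le])
      also have "\<dots> = 8 * C * (LINT y|lborel. \<bar>G y\<bar> / (1 + real (Suc j) * y))" by (rule integral_mult_right_zero)
      finally have "(cmod (V j))\<^sup>2 \<le> (8 * C * (LINT y|lborel. \<bar>G y\<bar> / (1 + real (Suc j) * y)))\<^sup>2"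
        by (intro power_mono) auto
      then show ?thesis by (simp only: power_mult_distrib)
    qed
    have V_bound: "(\<Sum>j<n. (cmod (V j))\<^sup>2) \<le> (8 * C)\<^sup>2 * (pi\<^sup>2 * ?N)"
    proof -
      have "(\<Sum>j<n. (cmod (V j))\<^sup>2) \<le> (8 * C)\<^sup>2 * (\<Sum>j<n. (LINT y|lborel. \<bar>G y\<bar> / (1 + real (Suc j) * y))\<^sup>2)"
        unfolding sum_distrib_left by (intro sum_mono V_le)
      also have "\<dots> \<le> (8 * C)\<^sup>2 * (pi\<^sup>2 * ?N)"
        by (intro mult_left_mono S(2)) (use supp in auto)
      finally show ?thesis .
    qed
    have split: "(LINT y|lborel. of_real (G y) * hkernel m (z j * of_real y)) = a * U 1 j + b * U (-1) j + V j" for j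
    proof -
      have "of_real (G y) * hkernel m (z j * of_real y) = a * (of_real (G y) * wave (of_int 1 * (z j * of_real y))) +
         b * (of_real (G y) * wave (of_int (-1) * (z j * of_real y))) + of_real (G y) * r (z j * of_real y)" for y
        unfolding r_def by (simp add: algebra_simps)
      moreover have "(LINT y|lborel. a * f y + b * g y + h y) = a * (LINT y|lborel. f y) + b * (LINT y|lborel. g y) + (LINT y|lborel. h y)"
        if "integrable lborel f" "integrable lborel g" "integrable lborel h" for f g h :: "real \<Rightarrow> complex"
        using that by simp
      note this[OF U_int[of 1 j] U_int[of "-1" j] r_int[of j]]
      ultimately show ?thesis unfolding U_def V_def wz by simp
    qed
    have fac: "(cmod ((z j / of_nat (Suc j)) ^ m))\<^sup>2 \<le> 16 ^ m" for j
    proof -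
      have "cmod (z j / of_nat (Suc j)) \<le> 4"
        using shifted_point_bounds(1)[OF w, of j] unfolding z_def by (simp add: norm_divide divide_le_eq del: of_nat_Suc)
      then have "cmod (z j / of_nat (Suc j)) ^ (m * 2) \<le> 4 ^ (m * 2)" by (intro power_mono) auto
      also have "(4::real) ^ (m * 2) = 16 ^ m" by (simp add: power_mult mult.commute[of m])
      finally show ?thesis by (simp add: norm_power power_mult)
    qed
    have "(\<Sum>j<n. (cmod ((z j / of_nat (Suc j)) ^ m * (LINT y|lborel. of_real (G y) * hkernel m (z j * of_real y))))\<^sup>2)
      \<le> (\<Sum>j<n. 16 ^ m * (3 * ((cmod a)\<^sup>2 * (cmod (U 1 j))\<^sup>2 + (cmod b)\<^sup>2 * (cmod (U (-1) j))\<^sup>2 + (cmod (V j))\<^sup>2)))"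
    proof (rule sum_mono)
      fix j
      have "(cmod (a * U 1 j + b * U (-1) j + V j))\<^sup>2 \<le>
        3 * ((cmod a)\<^sup>2 * (cmod (U 1 j))\<^sup>2 + (cmod b)\<^sup>2 * (cmod (U (-1) j))\<^sup>2 + (cmod (V j))\<^sup>2)"
        using cmod_sum3_square[of "a * U 1 j" "b * U (-1) j" "V j"] by (simp only: norm_mult power_mult_distrib)
      then show "(cmod ((z j / of_nat (Suc j)) ^ m * (LINT y|lborel. of_real (G y) * hkernel m (z j * of_real y))))\<^sup>2
        \<le> 16 ^ m * (3 * ((cmod a)\<^sup>2 * (cmod (U 1 j))\<^sup>2 + (cmod b)\<^sup>2 * (cmod (U (-1) j))\<^sup>2 + (cmod (V j))\<^sup>2))"
        unfolding split norm_mult power_mult_distrib using fac[of j] by (intro mult_mono) auto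
    qed
    also have "\<dots> = 16 ^ m * (3 * ((cmod a)\<^sup>2 * (\<Sum>j<n. (cmod (U 1 j))\<^sup>2) + (cmod b)\<^sup>2 * (\<Sum>j<n. (cmod (U (-1) j))\<^sup>2) + (\<Sum>j<n. (cmod (V j))\<^sup>2)))"
      by (simp only: sum_distrib_left[symmetric] sum.distrib)
    also have "\<dots> \<le> 16 ^ m * (3 * ((cmod a)\<^sup>2 * (exp (24 * pi) * ?N) + (cmod b)\<^sup>2 * (exp (24 * pi) * ?N) + (8 * C)\<^sup>2 * (pi\<^sup>2 * ?N)))"
      by (intro mult_left_mono add_mono U_bound V_bound) auto
    also have "\<dots> = (D - 1) * ?N" unfolding D_def by (simp add: algebra_simps)
    also have "\<dots> \<le> D * ?N" using N0 by (intro mult_right_mono) auto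
    finally show "(\<Sum>j<n. (cmod (((of_nat j + w) / of_nat (Suc j)) ^ m *
        (LINT y|lborel. of_real (G y) * hkernel m ((of_nat j + w) * of_real y))))\<^sup>2) \<le> D * ?N"
      unfolding z_def .
  qed
qed

section \<open>High frequencies\<close>

text \<open>The contribution of one wave \<open>e\<^bsup>2\<pi>i\<sigma>xy\<^esup>\<close> at \<open>x = j + w\<close>, with the oscillation \<open>e\<^bsup>2\<pi>i\<sigma>wa\<^esup>\<close> of the left end point
  \<open>a\<close> taken out and with the polynomial \<open>P (x y) / y\<^sup>m\<close> expanded into monomials in \<open>x\<close>.\<close>

definition high_piece :: "nat \<Rightarrow> complex poly \<Rightarrow> (real \<Rightarrow> real) \<Rightarrow> real \<Rightarrow> int \<Rightarrow> nat \<Rightarrow> complex \<Rightarrow> complex" where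
  "high_piece m P G a \<sigma> j w = (\<Sum>l\<le>m. coeff P l * ((of_nat j + w) ^ l / of_nat (Suc j) ^ m) *
     (LINT y|lborel. of_real (G y / y ^ (m - l)) * (wave (of_int \<sigma> * of_nat j * of_real y) * wave (of_int \<sigma> * (w * of_real (y - a))))))"

lemma divided_square_integrable:
  fixes G :: "real \<Rightarrow> real"
  assumes [measurable]: "G \<in> borel_measurable borel" and G2: "integrable lborel (\<lambda>y. (G y)\<^sup>2)"
    and supp: "\<And>y. G y \<noteq> 0 \<Longrightarrow> y \<ge> 1"
  shows "integrable lborel (\<lambda>y. (G y / y ^ n)\<^sup>2)" "(LINT y|lborel. (G y / y ^ n)\<^sup>2) \<le> (LINT y|lborel. (G y)\<^sup>2)"
proof -
  have le: "(G y / y ^ n)\<^sup>2 \<le> (G y)\<^sup>2" for y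
  proof (cases "G y = 0")
    case False
    then have "y ^ n \<ge> 1" using supp by simp
    then have "\<bar>G y / y ^ n\<bar> \<le> \<bar>G y\<bar>" by (simp add: divide_le_eq mult_le_cancel_left1)
    then show ?thesis by (rule abs_le_square_iff[THEN iffD1])
  qed simp
  show int: "integrable lborel (\<lambda>y. (G y / y ^ n)\<^sup>2)"
    by (rule Bochner_Integration.integrable_bound[OF G2]) (use le in auto)
  show "(LINT y|lborel. (G y / y ^ n)\<^sup>2) \<le> (LINT y|lborel. (G y)\<^sup>2)"
    by (rule Bochner_Integration.integral_mono[OF int G2 le])
qed

context
  fixes G :: "real \<Rightarrow> real" and a :: real and \<sigma> :: int
  assumes Gm[measurable]: "G \<in> borel_measurable borel" and G2: "integrable lborel (\<lambda>y. (G y)\<^sup>2)"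
    and supp: "\<And>y. G y \<noteq> 0 \<Longrightarrow> y \<in> {a..a+1} \<and> y \<ge> 1" and \<sigma>: "\<sigma> \<in> {1, -1}"
begin

lemma high_divided_integrable: "integrable lborel (\<lambda>y. complex_of_real (G y / y ^ n))"
proof (rule integrable_of_square_integrable[of _ "{a..a+1}"])
  show "integrable lborel (\<lambda>y. (cmod (complex_of_real (G y / y ^ n)))\<^sup>2)"
    unfolding norm_of_real power2_abs using divided_square_integrable(1)[OF Gm G2, of n] supp by blast
qed (use supp in auto)

lemma high_modulated_integrable:
  "integrable lborel (\<lambda>y. complex_of_real (G y / y ^ n) * wave (of_int \<sigma> * of_nat j * of_real y))"
proof (rule Bochner_Integration.integrable_bound[OF high_divided_integrable])
  show "AE y in lborel. cmod (complex_of_real (G y / y ^ n) * wave (of_int \<sigma> * of_nat j * of_real y)) \<le> cmod (complex_of_real (G y / y ^ n))"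
  proof (rule AE_I2)
    fix y
    have "cmod (wave (of_int \<sigma> * of_nat j * of_real y)) \<le> exp (2 * pi * 0)" by (rule cmod_wave_le) simp
    then have "cmod (complex_of_real (G y / y ^ n)) * cmod (wave (of_int \<sigma> * of_nat j * of_real y)) \<le> cmod (complex_of_real (G y / y ^ n)) * 1"
      by (intro mult_left_mono) auto
    then show "cmod (complex_of_real (G y / y ^ n) * wave (of_int \<sigma> * of_nat j * of_real y)) \<le> cmod (complex_of_real (G y / y ^ n))"
      unfolding norm_mult by (simp only: mult_1_right)
  qed
qed measurable

lemma high_full_integrable:
  "integrable lborel (\<lambda>y. complex_of_real (G y / y ^ n) * (wave (of_int \<sigma> * of_nat j * of_real y) * wave (of_int \<sigma> * (w * of_real (y - a)))))"
proof (rule Bochner_Integration.integrable_bound)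
  let ?B = "exp (2 * pi * cmod w)"
  show "integrable lborel (\<lambda>y. (complex_of_real (G y / y ^ n) * wave (of_int \<sigma> * of_nat j * of_real y)) * of_real ?B)"
    by (rule integrable_mult_left[OF high_modulated_integrable])
  show "AE y in lborel. cmod (complex_of_real (G y / y ^ n) * (wave (of_int \<sigma> * of_nat j * of_real y) * wave (of_int \<sigma> * (w * of_real (y - a)))))
    \<le> cmod ((complex_of_real (G y / y ^ n) * wave (of_int \<sigma> * of_nat j * of_real y)) * of_real ?B)"
  proof (rule AE_I2)
    fix y
    have "cmod (wave (of_int \<sigma> * (w * of_real (y - a)))) \<le> ?B" if "G y \<noteq> 0"
    proof (rule cmod_wave_le)
      have "\<bar>Im (of_int \<sigma> * (w * of_real (y - a)))\<bar> \<le> cmod (of_int \<sigma> * (w * of_real (y - a)))" by (rule abs_Im_le_cmod)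
      also have "\<dots> = cmod w * \<bar>y - a\<bar>" using \<sigma> by (auto simp: norm_mult simp flip: of_real_diff)
      also have "\<dots> \<le> cmod w * 1" using supp[OF that] by (intro mult_left_mono) auto
      finally show "\<bar>Im (of_int \<sigma> * (w * of_real (y - a)))\<bar> \<le> cmod w" by simp
    qed
    then show "cmod (complex_of_real (G y / y ^ n) * (wave (of_int \<sigma> * of_nat j * of_real y) * wave (of_int \<sigma> * (w * of_real (y - a)))))
      \<le> cmod ((complex_of_real (G y / y ^ n) * wave (of_int \<sigma> * of_nat j * of_real y)) * of_real ?B)"
      unfolding norm_mult mult.assoc[symmetric] by (cases "G y = 0") (auto intro!: mult_left_mono)
  qed
qed measurable

lemma high_piece_entire: "high_piece m P G a \<sigma> j holomorphic_on UNIV"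
proof -
  have "(\<lambda>w. LINT y|lborel. of_real (G y / y ^ n) * (wave (of_int \<sigma> * of_nat j * of_real y) * wave (of_int \<sigma> * (w * of_real (y - a))))) holomorphic_on UNIV" for n
    unfolding mult.assoc[symmetric, of "of_real _" "wave _" "wave _"]
  proof (rule entire_parameter_integral[where \<Phi> = "\<lambda>v. wave (of_int \<sigma> * v)" and b = 1])
    show "(\<lambda>v. wave (of_int \<sigma> * v)) holomorphic_on UNIV" by (intro holomorphic_intros)
    show "integrable lborel (\<lambda>y. complex_of_real (G y / y ^ n) * wave (of_int \<sigma> * of_nat j * of_real y))"
      by (rule high_modulated_integrable)
    show "(\<lambda>y. y - a) \<in> borel_measurable borel" by measurable
    fix y assume "complex_of_real (G y / y ^ n) * wave (of_int \<sigma> * of_nat j * of_real y) \<noteq> 0"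
    then have "G y \<noteq> 0" by auto
    from supp[OF this] show "\<bar>y - a\<bar> \<le> 1" by auto
  qed
  then show ?thesis unfolding high_piece_def
    by (intro holomorphic_intros) auto
qed

text \<open>Each monomial is at most \<open>4\<^sup>m\<close> after division by \<open>(j + 1)\<^sup>m\<close>, and for fixed \<open>l\<close> the integrals over
  all \<open>j\<close> are modulated Fourier coefficients of \<open>G y / y\<^bsup>m-l\<^esup>\<close>, whose norm is at most that of \<open>G\<close> since \<open>y \<ge> 1\<close>.\<close>

lemma high_piece_bound:
  assumes w: "cmod w \<le> 3"
  shows "(\<Sum>j<n. (cmod (high_piece m P G a \<sigma> j w))\<^sup>2) \<le>
     real (Suc m) * (\<Sum>l\<le>m. (cmod (coeff P l))\<^sup>2 * 16 ^ m * exp (24 * pi)) * (LINT y|lborel. (G y)\<^sup>2)"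
proof -
  let ?N = "LINT y|lborel. (G y)\<^sup>2"
  define V where "V l j = (LINT y|lborel. of_real (G y / y ^ (m - l)) * (wave (of_int \<sigma> * of_nat j * of_real y) * wave (of_int \<sigma> * (w * of_real (y - a)))))" for l j
  have V: "(\<Sum>j<n. (cmod (V l j))\<^sup>2) \<le> exp (24 * pi) * ?N" for l
  proof -
    have supp1: "G y \<noteq> 0 \<Longrightarrow> 1 \<le> y" for y using supp by blast
    have "(\<Sum>j<n. (cmod (V l j))\<^sup>2) \<le> exp (24 * pi) * (LINT y|lborel. (G y / y ^ (m - l))\<^sup>2)"
      unfolding V_def
    proof (rule bessel_inequality_modulated[where a = a])
      show "integrable lborel (\<lambda>y. (G y / y ^ (m - l))\<^sup>2)"
        by (rule divided_square_integrable(1)[OF Gm G2 supp1])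
      show "y \<in> {a..a + 1}" if "G y / y ^ (m - l) \<noteq> 0" for y
      proof -
        have "G y \<noteq> 0" using that by auto
        then show ?thesis using supp by blast
      qed
    qed (use \<sigma> w in auto)
    also have "\<dots> \<le> exp (24 * pi) * ?N"
      by (intro mult_left_mono divided_square_integrable(2)[OF Gm G2 supp1]) auto
    finally show ?thesis .
  qed
  have fac: "(cmod ((of_nat j + w) ^ l / of_nat (Suc j) ^ m))\<^sup>2 \<le> 16 ^ m" if "l \<le> m" for j l
  proof -
    have "cmod ((of_nat j + w) ^ l / of_nat (Suc j) ^ m) = cmod (of_nat j + w) ^ l / real (Suc j) ^ m"
      by (simp add: norm_divide norm_power del: of_nat_Suc)
    also have "\<dots> \<le> (4 * real (Suc j)) ^ l / real (Suc j) ^ m"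
      using shifted_point_bounds(1)[OF w] by (intro divide_right_mono power_mono) auto
    also have "\<dots> \<le> (4 * real (Suc j)) ^ m / real (Suc j) ^ m"
      using that by (intro divide_right_mono power_increasing) auto
    also have "\<dots> = 4 ^ m" by (simp add: power_mult_distrib del: of_nat_Suc)
    finally have "(cmod ((of_nat j + w) ^ l / of_nat (Suc j) ^ m))\<^sup>2 \<le> (4 ^ m)\<^sup>2" by (intro power_mono) auto
    also have "(4 ^ m)\<^sup>2 = (16 :: real) ^ m" by (simp add: power2_eq_square flip: power_mult_distrib)
    finally show ?thesis .
  qed
  have "(\<Sum>j<n. (cmod (high_piece m P G a \<sigma> j w))\<^sup>2) \<le> (\<Sum>j<n. real (Suc m) * (\<Sum>l\<le>m. (cmod (coeff P l))\<^sup>2 * 16 ^ m * (cmod (V l j))\<^sup>2))"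
  proof (rule sum_mono)
    fix j
    let ?x = "\<lambda>l. coeff P l * ((of_nat j + w) ^ l / of_nat (Suc j) ^ m) * V l j"
    have "(cmod (high_piece m P G a \<sigma> j w))\<^sup>2 \<le> (\<Sum>l\<le>m. cmod (?x l))\<^sup>2"
      unfolding high_piece_def V_def by (intro power_mono norm_sum) auto
    also have "\<dots> \<le> (\<Sum>l\<le>m. (cmod (?x l))\<^sup>2) * card {..m}"
      by (rule sum_squared_le_sum_of_squares)
    also have "\<dots> \<le> (\<Sum>l\<le>m. (cmod (coeff P l))\<^sup>2 * 16 ^ m * (cmod (V l j))\<^sup>2) * card {..m}"
    proof (intro mult_right_mono sum_mono)
      fix l assume "l \<in> {..m}"
      then show "(cmod (?x l))\<^sup>2 \<le> (cmod (coeff P l))\<^sup>2 * 16 ^ m * (cmod (V l j))\<^sup>2"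
        unfolding norm_mult power_mult_distrib using fac[of l j] by (intro mult_right_mono mult_left_mono) auto
    qed simp
    finally show "(cmod (high_piece m P G a \<sigma> j w))\<^sup>2 \<le> real (Suc m) * (\<Sum>l\<le>m. (cmod (coeff P l))\<^sup>2 * 16 ^ m * (cmod (V l j))\<^sup>2)"
      by (simp add: mult.commute)
  qed
  also have "\<dots> = real (Suc m) * (\<Sum>l\<le>m. (cmod (coeff P l))\<^sup>2 * 16 ^ m * (\<Sum>j<n. (cmod (V l j))\<^sup>2))"
    unfolding sum_distrib_left[symmetric] by (subst sum.swap) (simp only: sum_distrib_left)
  also have "\<dots> \<le> real (Suc m) * (\<Sum>l\<le>m. (cmod (coeff P l))\<^sup>2 * 16 ^ m * (exp (24 * pi) * ?N))"
    by (intro mult_left_mono sum_mono V) auto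
  also have "\<dots> = real (Suc m) * (\<Sum>l\<le>m. (cmod (coeff P l))\<^sup>2 * 16 ^ m * exp (24 * pi)) * ?N"
    by (simp only: mult.assoc sum_distrib_right)
  finally show ?thesis .
qed

end

text \<open>Insert the representation of \<open>w\<^sup>m K w\<close> by waves at \<open>(j + w) y\<close>. The power of the first factor on the left is exactly
  what turns \<open>K\<close> into polynomials times waves.\<close>

lemma hkernel_high_decomposition:
  fixes G :: "real \<Rightarrow> real" and a :: real
  assumes Gm[measurable]: "G \<in> borel_measurable borel" and G2: "integrable lborel (\<lambda>y. (G y)\<^sup>2)"
    and supp: "\<And>y. G y \<noteq> 0 \<Longrightarrow> y \<in> {a..a+1} \<and> y \<ge> 1"
    and deg: "degree P \<le> m" "degree Q \<le> m"
    and PQ: "\<And>w. w ^ m * hkernel m w = poly P w * wave w + poly Q w * wave (- w)"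
  shows "((of_nat j + w) / of_nat (Suc j)) ^ m * (LINT y|lborel. of_real (G y) * hkernel m ((of_nat j + w) * of_real y)) =
     wave (w * of_real a) * high_piece m P G a 1 j w + wave (- (w * of_real a)) * high_piece m Q G a (-1) j w"
proof -
  define z where "z = of_nat j + w"
  define e where "e \<sigma> y = wave (of_int \<sigma> * of_nat j * of_real y) * wave (of_int \<sigma> * (w * of_real (y - a)))" for \<sigma> :: int and y :: real
  have int: "integrable lborel (\<lambda>y. of_real (G y / y ^ n) * e \<sigma> y)" if "\<sigma> \<in> {1, -1}" for \<sigma> n
    unfolding e_def by (rule high_full_integrable[OF Gm G2 supp that])
  have piece: "high_piece m R G a \<sigma> j w = (LINT y|lborel. (\<Sum>l\<le>m. coeff R l * (z ^ l / of_nat (Suc j) ^ m) * (of_real (G y / y ^ (m - l)) * e \<sigma> y)))"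
    if "\<sigma> \<in> {1, -1}" for R \<sigma>
  proof -
    have "(LINT y|lborel. (\<Sum>l\<le>m. coeff R l * (z ^ l / of_nat (Suc j) ^ m) * (of_real (G y / y ^ (m - l)) * e \<sigma> y))) =
      (\<Sum>l\<le>m. (LINT y|lborel. coeff R l * (z ^ l / of_nat (Suc j) ^ m) * (of_real (G y / y ^ (m - l)) * e \<sigma> y)))"
      by (rule Bochner_Integration.integral_sum) (intro integrable_mult_right int[OF that])
    then show ?thesis unfolding high_piece_def z_def[symmetric] e_def[symmetric] integral_mult_right_zero by (rule sym)
  qed
  have piece_int: "integrable lborel (\<lambda>y. (\<Sum>l\<le>m. coeff R l * (z ^ l / of_nat (Suc j) ^ m) * (of_real (G y / y ^ (m - l)) * e \<sigma> y)))"
    if "\<sigma> \<in> {1, -1}" for R \<sigma>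
    by (intro Bochner_Integration.integrable_sum integrable_mult_right int[OF that])
  have poly_eq: "(\<Sum>l\<le>m. coeff R l * (z ^ l / of_nat (Suc j) ^ m) * (of_real (G y / y ^ (m - l)) * e \<sigma> y)) =
      of_real (G y) * poly R (z * of_real y) / of_real y ^ m / of_nat (Suc j) ^ m * e \<sigma> y"
    if "degree R \<le> m" "y \<ge> 1" for R \<sigma> y
  proof -
    have "poly R (z * of_real y) = (\<Sum>l\<le>m. coeff R l * (z * of_real y) ^ l)"
      unfolding poly_altdef using that(1) by (intro sum.mono_neutral_left) (auto simp: coeff_eq_0)
    then have "of_real (G y) * poly R (z * of_real y) / of_real y ^ m / of_nat (Suc j) ^ m * e \<sigma> y =
      (\<Sum>l\<le>m. of_real (G y) * (coeff R l * (z * of_real y) ^ l) / of_real y ^ m / of_nat (Suc j) ^ m * e \<sigma> y)"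
      by (simp only: sum_distrib_left sum_distrib_right sum_divide_distrib)
    also have "\<dots> = (\<Sum>l\<le>m. coeff R l * (z ^ l / of_nat (Suc j) ^ m) * (of_real (G y / y ^ (m - l)) * e \<sigma> y))"
    proof (rule sum.cong[OF refl])
      fix l assume "l \<in> {..m}"
      then have "complex_of_real y ^ m = of_real y ^ l * of_real y ^ (m - l)" by (simp flip: power_add)
      moreover have "complex_of_real y \<noteq> 0" using that(2) by simp
      ultimately show "of_real (G y) * (coeff R l * (z * of_real y) ^ l) / of_real y ^ m / of_nat (Suc j) ^ m * e \<sigma> y =
         coeff R l * (z ^ l / of_nat (Suc j) ^ m) * (of_real (G y / y ^ (m - l)) * e \<sigma> y)"
        by (simp add: power_mult_distrib field_simps del: of_nat_Suc)
    qed
    finally show ?thesis ..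
  qed
  have e_wave: "wave (of_int \<sigma> * (w * of_real a)) * e \<sigma> y = wave (of_int \<sigma> * (z * of_real y))" for \<sigma> :: int and y
    unfolding e_def z_def exp_add[symmetric] by (simp add: algebra_simps)
  have pt: "(z / of_nat (Suc j)) ^ m * (of_real (G y) * hkernel m (z * of_real y)) =
     wave (w * of_real a) * (\<Sum>l\<le>m. coeff P l * (z ^ l / of_nat (Suc j) ^ m) * (of_real (G y / y ^ (m - l)) * e 1 y)) +
     wave (- (w * of_real a)) * (\<Sum>l\<le>m. coeff Q l * (z ^ l / of_nat (Suc j) ^ m) * (of_real (G y / y ^ (m - l)) * e (-1) y))" for y
  proof (cases "G y = 0")
    case False
    then have y: "y \<ge> 1" using supp by blast
    have w1: "wave (w * of_real a) * e 1 y = wave (z * of_real y)" using e_wave[of 1 y] by simp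
    have w2: "wave (- (w * of_real a)) * e (-1) y = wave (- (z * of_real y))" using e_wave[of "-1" y] by simp
    have "wave (w * of_real a) * (of_real (G y) * poly P (z * of_real y) / of_real y ^ m / of_nat (Suc j) ^ m * e 1 y) +
       wave (- (w * of_real a)) * (of_real (G y) * poly Q (z * of_real y) / of_real y ^ m / of_nat (Suc j) ^ m * e (-1) y) =
       of_real (G y) / of_real y ^ m / of_nat (Suc j) ^ m * (poly P (z * of_real y) * (wave (w * of_real a) * e 1 y) +
         poly Q (z * of_real y) * (wave (- (w * of_real a)) * e (-1) y))"
      by (simp add: algebra_simps del: of_nat_Suc)
    also have "\<dots> = of_real (G y) / of_real y ^ m / of_nat (Suc j) ^ m * ((z * of_real y) ^ m * hkernel m (z * of_real y))"
      unfolding w1 w2 PQ ..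
    also have "\<dots> = (z / of_nat (Suc j)) ^ m * (of_real (G y) * hkernel m (z * of_real y))"
      using y by (simp add: power_mult_distrib power_divide del: of_nat_Suc)
    finally show ?thesis unfolding poly_eq[OF deg(1) y] poly_eq[OF deg(2) y] ..
  qed simp
  have "(z / of_nat (Suc j)) ^ m * (LINT y|lborel. of_real (G y) * hkernel m (z * of_real y)) =
     (LINT y|lborel. (z / of_nat (Suc j)) ^ m * (of_real (G y) * hkernel m (z * of_real y)))"
    by (rule integral_mult_right_zero[symmetric])
  also have "\<dots> = wave (w * of_real a) * high_piece m P G a 1 j w + wave (- (w * of_real a)) * high_piece m Q G a (-1) j w"
  proof -
    have "(LINT y|lborel. c * f y + d * g y) = c * (LINT y|lborel. f y) + d * (LINT y|lborel. g y)"
      if "integrable lborel f" "integrable lborel g" for c d and f g :: "real \<Rightarrow> complex"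
      using that by simp
    from this[OF piece_int[of 1 P] piece_int[of "-1" Q], of "wave (w * of_real a)" "wave (- (w * of_real a))"]
    show ?thesis unfolding pt piece[of 1 P, OF insertI1] piece[of "-1" Q, OF insertI2[OF singletonI]] by simp
  qed
  finally show ?thesis unfolding z_def .
qed

section \<open>Frequency decomposition of the Hankel transform\<close>

text \<open>The Hankel transform for the half-integer order \<open>m + 1/2\<close>, extended to complex arguments.\<close>

definition hk_transform :: "nat \<Rightarrow> (real \<Rightarrow> real) \<Rightarrow> complex \<Rightarrow> complex" where
  "hk_transform m G z = (LINT y|lborel. of_real (G y) * hkernel m (z * of_real y))"

lemma hkernel_measurable [measurable]: "hkernel m \<in> borel_measurable borel"
  by (intro borel_measurable_continuous_onI holomorphic_on_imp_continuous_on hkernel_entire)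

lemma hk_transform_entire:
  assumes "integrable lborel (\<lambda>y. complex_of_real (G y))" and "\<And>y. G y \<noteq> 0 \<Longrightarrow> \<bar>y\<bar> \<le> R"
  shows "hk_transform m G holomorphic_on UNIV"
  unfolding hk_transform_def
  by (rule entire_parameter_integral[OF hkernel_entire assms(1), where b = R]) (use assms(2) in auto)

lemma hkernel_integrable:
  assumes G: "integrable lborel (\<lambda>y. complex_of_real (G y))" and supp: "\<And>y. G y \<noteq> 0 \<Longrightarrow> \<bar>y\<bar> \<le> R"
  shows "integrable lborel (\<lambda>y. of_real (G y) * hkernel m (z * of_real y))"
proof -
  have [measurable]: "(\<lambda>y. complex_of_real (G y)) \<in> borel_measurable borel"
    using borel_measurable_integrable[OF G] by simp
  have "continuous_on (cball 0 (cmod z * \<bar>R\<bar>)) (hkernel m)"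
    using holomorphic_on_imp_continuous_on[OF hkernel_entire] continuous_on_subset by blast
  then have "bounded (hkernel m ` cball 0 (cmod z * \<bar>R\<bar>))" by (intro compact_imp_bounded compact_continuous_image) auto
  then obtain B where B: "\<And>x. x \<in> cball 0 (cmod z * \<bar>R\<bar>) \<Longrightarrow> cmod (hkernel m x) \<le> B" unfolding bounded_iff by blast
  show ?thesis
  proof (rule Bochner_Integration.integrable_bound)
    show "integrable lborel (\<lambda>y. complex_of_real (G y) * of_real B)" using G by (rule integrable_mult_left)
    show "AE y in lborel. cmod (of_real (G y) * hkernel m (z * of_real y)) \<le> cmod (complex_of_real (G y) * of_real B)"
    proof (rule AE_I2)
      fix y
      have "cmod (hkernel m (z * of_real y)) \<le> \<bar>B\<bar>" if "G y \<noteq> 0"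
      proof -
        have "z * of_real y \<in> cball 0 (cmod z * \<bar>R\<bar>)"
          using supp[OF that] by (auto simp: norm_mult intro!: mult_left_mono)
        then show ?thesis using B abs_ge_self order_trans by blast
      qed
      then show "cmod (of_real (G y) * hkernel m (z * of_real y)) \<le> cmod (complex_of_real (G y) * of_real B)"
        unfolding norm_mult norm_of_real by (cases "G y = 0") (auto intro!: mult_left_mono)
    qed
  qed measurable
qed

text \<open>Index \<open>0\<close> collects the frequencies below \<open>1\<close>. The remaining pieces are cut disjointly, each \<open>y\<close> going to
  the first interval that contains it, because the closed unit intervals may overlap.\<close>

definition freq_piece :: "(nat \<Rightarrow> real) \<Rightarrow> (real \<Rightarrow> real) \<Rightarrow> nat \<Rightarrow> real \<Rightarrow> real" where
  "freq_piece a G k y = (if (if k = 0 then y \<le> 1 else y > 1 \<and> y \<in> {a k..a k + 1} \<and> (\<forall>i\<in>{1..<k}. y \<notin> {a i..a i + 1})) then G y else 0)"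

lemma freq_piece_measurable [measurable]:
  assumes [measurable]: "G \<in> borel_measurable borel"
  shows "freq_piece a G k \<in> borel_measurable borel"
  unfolding freq_piece_def by (cases "k = 0") (simp_all, measurable)

lemma sum_freq_piece:
  assumes "G y \<noteq> 0 \<Longrightarrow> \<exists>k\<in>{1..N}. y \<in> {a k..a k + 1}"
  shows "(\<Sum>k\<le>N. freq_piece a G k y) = G y"
proof (cases "G y = 0")
  case True
  then have "freq_piece a G k y = 0" for k by (simp add: freq_piece_def)
  then show ?thesis using True by simp
next
  case False
  define K where "K = (if y \<le> 1 then 0 else LEAST k. k \<ge> 1 \<and> y \<in> {a k..a k + 1})"
  have ex: "\<exists>k. k \<ge> 1 \<and> y \<in> {a k..a k + 1}" using assms False by auto
  have "K \<le> N"
  proof -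
    obtain k where "k \<in> {1..N}" "y \<in> {a k..a k + 1}" using assms False by blast
    then show ?thesis unfolding K_def using Least_le[of "\<lambda>k. k \<ge> 1 \<and> y \<in> {a k..a k + 1}" k] by auto
  qed
  have "freq_piece a G k y = (if k = K then G y else 0)" for k
  proof (cases "y \<le> 1")
    case True
    then show ?thesis by (simp add: freq_piece_def K_def)
  next
    case gt: False
    have L: "K \<ge> 1 \<and> y \<in> {a K..a K + 1}" unfolding K_def using gt LeastI_ex[OF ex] by simp
    have not: "\<not> (i \<ge> 1 \<and> y \<in> {a i..a i + 1})" if "i < K" for i
      using that unfolding K_def if_not_P[OF gt] by (rule not_less_Least)
    show ?thesis
    proof (cases "k = K")
      case True
      then show ?thesis using L not gt by (auto simp: freq_piece_def)
    next
      case False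
      have "k < K \<or> K < k" using False by auto
      then show ?thesis using L not gt False by (auto simp: freq_piece_def)
    qed
  qed
  then show ?thesis using \<open>K \<le> N\<close> by simp
qed

lemma freq_piece_square:
  assumes [measurable]: "G \<in> borel_measurable borel" and G2: "integrable lborel (\<lambda>y. (G y)\<^sup>2)"
  shows "integrable lborel (\<lambda>y. (freq_piece a G k y)\<^sup>2)" "(LINT y|lborel. (freq_piece a G k y)\<^sup>2) \<le> (LINT y|lborel. (G y)\<^sup>2)"
proof -
  have le: "(freq_piece a G k y)\<^sup>2 \<le> (G y)\<^sup>2" for y by (simp add: freq_piece_def)
  show int: "integrable lborel (\<lambda>y. (freq_piece a G k y)\<^sup>2)"
    by (rule Bochner_Integration.integrable_bound[OF G2]) (use le in auto)
  show "(LINT y|lborel. (freq_piece a G k y)\<^sup>2) \<le> (LINT y|lborel. (G y)\<^sup>2)"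
    by (rule Bochner_Integration.integral_mono[OF int G2 le])
qed

text \<open>The index \<open>(k, \<sigma>)\<close> stands for the interval \<open>k\<close> and the direction \<open>\<sigma>\<close> of the wave. The low frequencies
  are assigned the zero frequency and are split evenly between the two directions, which keeps the index
  set a product. The constant \<open>D\<close> precedes the positions \<open>a\<close>: this is the uniformity of the theorem.\<close>

lemma frequency_decomposition:
  "\<exists>D>0. \<forall>a G. (\<forall>k\<in>{1..N}. a k \<ge> 0) \<and> G \<in> borel_measurable borel \<and> integrable lborel (\<lambda>y. (G y)\<^sup>2) \<and>
     (\<forall>y. G y \<noteq> 0 \<longrightarrow> y > 0 \<and> (\<exists>k\<in>{1..N}. y \<in> {a k..a k + 1})) \<longrightarrow>
     (\<exists>(l :: nat \<times> int \<Rightarrow> real) (u :: nat \<Rightarrow> nat \<times> int \<Rightarrow> complex \<Rightarrow> complex).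
        (\<forall>j i. i \<in> {..N} \<times> {1, -1} \<longrightarrow> u j i holomorphic_on UNIV) \<and>
        (\<forall>j t. ((of_nat j + of_real t) / of_nat (Suc j)) ^ m * hk_transform m G (of_nat j + of_real t) =
           (\<Sum>i\<in>{..N} \<times> {1, -1}. exp (\<i> * of_real (l i * t)) * u j i (of_real t))) \<and>
        (\<forall>i\<in>{..N} \<times> {1, -1}. \<forall>n w. cmod w \<le> 3 \<longrightarrow> (\<Sum>j<n. (cmod (u j i w))\<^sup>2) \<le> D * (LINT y|lborel. (G y)\<^sup>2)))"
proof -
  obtain P Q where deg: "degree P \<le> m" "degree Q \<le> m" and PQ: "\<And>w. w ^ m * hkernel m w = poly P w * wave w + poly Q w * wave (- w)"
    using hkernel_exp_poly[of m] by blast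
  from low_frequency_bound[of m] obtain D0 where
    low: "D0 > 0 \<and> (\<forall>(G :: real \<Rightarrow> real) n w. G \<in> borel_measurable borel \<and> integrable lborel (\<lambda>y. (G y)\<^sup>2) \<and>
     (\<forall>y. G y \<noteq> 0 \<longrightarrow> y \<in> {0<..1}) \<and> cmod w \<le> 3 \<longrightarrow>
     (\<Sum>j<n. (cmod (((of_nat j + w) / of_nat (Suc j)) ^ m *
        (LINT y|lborel. of_real (G y) * hkernel m ((of_nat j + w) * of_real y))))\<^sup>2) \<le> D0 * (LINT y|lborel. (G y)\<^sup>2))"
    by (rule exE)
  define hb where "hb R = real (Suc m) * (\<Sum>l\<le>m. (cmod (coeff R l))\<^sup>2 * 16 ^ m * exp (24 * pi))" for R :: "complex poly"
  have hb0: "hb R \<ge> 0" for R unfolding hb_def by (intro mult_nonneg_nonneg sum_nonneg) auto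
  define D where "D = D0 + hb P + hb Q"
  have "D > 0" unfolding D_def using low hb0[of P] hb0[of Q] by linarith
  show ?thesis
  proof (intro exI[of _ D] conjI allI impI \<open>D > 0\<close>, elim conjE)
    fix a :: "nat \<Rightarrow> real" and G :: "real \<Rightarrow> real"
    assume a: "\<forall>k\<in>{1..N}. a k \<ge> 0" and Gm[measurable]: "G \<in> borel_measurable borel" and G2: "integrable lborel (\<lambda>y. (G y)\<^sup>2)"
      and supp: "\<forall>y. G y \<noteq> 0 \<longrightarrow> y > 0 \<and> (\<exists>k\<in>{1..N}. y \<in> {a k..a k + 1})"
    let ?N = "LINT y|lborel. (G y)\<^sup>2" and ?G = "freq_piece a G"
    have N0: "?N \<ge> 0" by (rule Bochner_Integration.integral_nonneg) auto
    have supp0: "y \<in> {0<..1}" if "?G 0 y \<noteq> 0" for y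
      using that supp by (auto simp: freq_piece_def split: if_splits)
    have suppk: "y \<in> {a k..a k + 1} \<and> y \<ge> 1" if "?G k y \<noteq> 0" "k \<noteq> 0" for k y
      using that by (auto simp: freq_piece_def split: if_splits)
    have Gk_int: "integrable lborel (\<lambda>y. complex_of_real (?G k y))" for k
    proof (rule integrable_of_square_integrable[of _ "if k = 0 then {0..1} else {a k..a k + 1}"])
      show "integrable lborel (\<lambda>y. (cmod (complex_of_real (?G k y)))\<^sup>2)"
        unfolding norm_of_real power2_abs by (rule freq_piece_square(1)[OF Gm G2])
      show "y \<in> (if k = 0 then {0..1} else {a k..a k + 1})" if "complex_of_real (?G k y) \<noteq> 0" for y
        using that supp0[of y] suppk[of k y] by (cases "k = 0") auto
    qed auto
    have Gk_R: "\<bar>y\<bar> \<le> \<bar>a k\<bar> + 1" if "?G k y \<noteq> 0" for k y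
      using that supp0[of y] suppk[of k y] by (cases "k = 0") auto
    have sum_G: "(\<Sum>k\<le>N. ?G k y) = G y" for y by (rule sum_freq_piece) (use supp in blast)
    have hk_sum: "hk_transform m G z = (\<Sum>k\<le>N. hk_transform m (?G k) z)" for z
    proof -
      have "(LINT y|lborel. (\<Sum>k\<le>N. of_real (?G k y) * hkernel m (z * of_real y))) = (\<Sum>k\<le>N. hk_transform m (?G k) z)"
        unfolding hk_transform_def by (rule Bochner_Integration.integral_sum) (rule hkernel_integrable[OF Gk_int Gk_R])
      then show ?thesis unfolding hk_transform_def sum_distrib_right[symmetric] of_real_sum[symmetric] sum_G .
    qed
    define low where "low j w = ((of_nat j + w) / of_nat (Suc j)) ^ m * hk_transform m (?G 0) (of_nat j + w)" for j :: nat and w :: complex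
    define u where "u j i = (if fst i = 0 then (\<lambda>w. 1 / 2 * low j w) else high_piece m (if snd i = 1 then P else Q) (?G (fst i)) (a (fst i)) (snd i) j)"
      for j and i :: "nat \<times> int"
    define l where "l i = (if fst i = 0 then 0 else 2 * pi * of_int (snd i) * a (fst i))" for i :: "nat \<times> int"
    have holo: "u j i holomorphic_on UNIV" if "i \<in> {..N} \<times> {1, -1}" for i j
    proof (cases "fst i = 0")
      case True
      have "(hk_transform m (?G 0) \<circ> (\<lambda>w. of_nat j + w)) holomorphic_on UNIV"
        by (rule holomorphic_on_compose_gen[OF _ hk_transform_entire[OF Gk_int Gk_R]]) (auto intro!: holomorphic_intros)
      then have "low j holomorphic_on UNIV" unfolding low_def o_def by (intro holomorphic_intros) auto
      then show ?thesis using True unfolding u_def by (auto intro!: holomorphic_intros)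
    next
      case False
      have "high_piece m R (?G (fst i)) (a (fst i)) (snd i) j holomorphic_on UNIV" for R
        by (rule high_piece_entire) (use freq_piece_square(1)[OF Gm G2] suppk False that in auto)
      then show ?thesis using False unfolding u_def by simp
    qed
    have bound: "(\<Sum>j<n. (cmod (u j i w))\<^sup>2) \<le> D * ?N" if i: "i \<in> {..N} \<times> {1, -1}" and w: "cmod w \<le> 3" for i n w
    proof (cases "fst i = 0")
      case True
      have "(\<Sum>j<n. (cmod (u j i w))\<^sup>2) \<le> (\<Sum>j<n. (cmod (low j w))\<^sup>2)"
      proof (rule sum_mono)
        fix j
        have "cmod (u j i w) \<le> cmod (low j w)" using True unfolding u_def by (simp add: norm_mult)
        then show "(cmod (u j i w))\<^sup>2 \<le> (cmod (low j w))\<^sup>2" by (intro power_mono) auto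
      qed
      also have "\<dots> \<le> D0 * (LINT y|lborel. (?G 0 y)\<^sup>2)"
        unfolding low_def hk_transform_def
        by (rule low[THEN conjunct2, rule_format]) (use freq_piece_square(1)[OF Gm G2] supp0 w in auto)
      also have "\<dots> \<le> D0 * ?N" using low by (intro mult_left_mono freq_piece_square(2)[OF Gm G2]) auto
      also have "\<dots> \<le> D * ?N" using N0 hb0[of P] hb0[of Q] unfolding D_def by (intro mult_right_mono) auto
      finally show ?thesis .
    next
      case False
      define R where "R = (if snd i = 1 then P else Q)"
      have "(\<Sum>j<n. (cmod (u j i w))\<^sup>2) \<le> hb R * (LINT y|lborel. (?G (fst i) y)\<^sup>2)"
        using False unfolding u_def R_def[symmetric] hb_def if_not_P[OF False]
        by (intro high_piece_bound) (use freq_piece_square(1)[OF Gm G2] suppk False i w in auto)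
      also have "\<dots> \<le> hb R * ?N" by (intro mult_left_mono freq_piece_square(2)[OF Gm G2] hb0)
      also have "\<dots> \<le> D * ?N" using N0 hb0[of P] hb0[of Q] low unfolding D_def R_def by (intro mult_right_mono) auto
      finally show ?thesis .
    qed
    have split: "((of_nat j + of_real t) / of_nat (Suc j)) ^ m * hk_transform m G (of_nat j + of_real t) =
       (\<Sum>i\<in>{..N} \<times> {1, -1}. exp (\<i> * of_real (l i * t)) * u j i (of_real t))" for j t
    proof -
      let ?c = "((of_nat j + of_real t) / of_nat (Suc j)) ^ m :: complex"
      let ?s = "\<lambda>i. exp (\<i> * of_real (l i * t)) * u j i (of_real t)"
      have each: "?c * hk_transform m (?G k) (of_nat j + of_real t) = ?s (k, 1) + ?s (k, -1)" for k
      proof (cases "k = 0")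
        case True
        then show ?thesis by (simp add: l_def u_def low_def)
      next
        case False
        have "?c * hk_transform m (?G k) (of_nat j + of_real t) =
          wave (of_real t * of_real (a k)) * high_piece m P (?G k) (a k) 1 j (of_real t) +
          wave (- (of_real t * of_real (a k))) * high_piece m Q (?G k) (a k) (-1) j (of_real t)"
          unfolding hk_transform_def
          by (rule hkernel_high_decomposition[OF _ freq_piece_square(1)[OF Gm G2] suppk deg PQ]) (use False in auto)
        moreover have "wave (of_real t * of_real (a k)) = exp (\<i> * of_real (l (k, 1) * t))"
          "wave (- (of_real t * of_real (a k))) = exp (\<i> * of_real (l (k, -1) * t))"
          using False by (simp_all add: l_def mult_ac)
        ultimately show ?thesis using False by (simp add: u_def)
      qed
      have "?c * hk_transform m G (of_nat j + of_real t) = (\<Sum>k\<le>N. ?s (k, 1) + ?s (k, -1))"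
        unfolding hk_sum sum_distrib_left each ..
      also have "\<dots> = (\<Sum>k\<le>N. \<Sum>\<sigma>\<in>{1, -1}. ?s (k, \<sigma>))" by simp
      also have "\<dots> = (\<Sum>i\<in>{..N} \<times> {1, -1}. ?s i)"
        by (simp only: sum.cartesian_product split_def prod.collapse)
      finally show ?thesis .
    qed
    show "\<exists>(l :: nat \<times> int \<Rightarrow> real) (u :: nat \<Rightarrow> nat \<times> int \<Rightarrow> complex \<Rightarrow> complex).
        (\<forall>j i. i \<in> {..N} \<times> {1, -1} \<longrightarrow> u j i holomorphic_on UNIV) \<and>
        (\<forall>j t. ((of_nat j + of_real t) / of_nat (Suc j)) ^ m * hk_transform m G (of_nat j + of_real t) =
           (\<Sum>i\<in>{..N} \<times> {1, -1}. exp (\<i> * of_real (l i * t)) * u j i (of_real t))) \<and>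
        (\<forall>i\<in>{..N} \<times> {1, -1}. \<forall>n w. cmod w \<le> 3 \<longrightarrow> (\<Sum>j<n. (cmod (u j i w))\<^sup>2) \<le> D * ?N)"
      by (intro exI[of _ l] exI[of _ u] conjI allI impI ballI holo bound split)
  qed
qed

section \<open>From unit intervals to the half-line\<close>

lemma unit_interval_shift_integral:
  fixes h :: "real \<Rightarrow> real"
  assumes [measurable]: "h \<in> borel_measurable borel"
  shows "(LINT t:{0..1}|lborel. h (real j + t)) = (LINT x:{real j..<real (Suc j)}|lborel. h x)"
proof -
  have "(LINT x:{real j..<real (Suc j)}|lborel. h x) = (LINT x|lborel. indicator {real j..real j + 1} x * h x)"
    unfolding set_lebesgue_integral_def
  proof (rule integral_cong_AE)
    have "AE x in lborel. x \<noteq> real j + 1" by (rule AE_lborel_singleton)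
    then show "AE x in lborel. indicat_real {real j..<real (Suc j)} x *\<^sub>R h x = indicator {real j..real j + 1} x * h x"
      by eventually_elim (auto simp: indicator_def)
  qed auto
  also have "\<dots> = \<bar>1\<bar> *\<^sub>R (LINT t|lborel. indicator {real j..real j + 1} (real j + 1 * t) * h (real j + 1 * t))"
    by (rule lborel_integral_real_affine) simp
  also have "\<dots> = (LINT t:{0..1}|lborel. h (real j + t))"
    unfolding set_lebesgue_integral_def by (auto intro!: Bochner_Integration.integral_cong simp: indicator_def)
  finally show ?thesis ..
qed

lemma half_line_integral_as_sum:
  fixes h :: "real \<Rightarrow> real"
  assumes [measurable]: "h \<in> borel_measurable borel" and int: "set_integrable lborel {0..} h"
  shows "(\<Sum>j<n. (LINT t:{0..1}|lborel. h (real j + t))) = (LINT x:{0..<real n}|lborel. h x)"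
    and "(\<lambda>n. LINT x:{0..<real n}|lborel. h x) \<longlonglongrightarrow> (LINT x:{0..}|lborel. h x)"
proof -
  have intn: "set_integrable lborel S h" if "S \<in> sets borel" "S \<subseteq> {0..}" for S
    by (rule set_integrable_subset[OF int]) (use that in auto)
  show "(\<Sum>j<n. (LINT t:{0..1}|lborel. h (real j + t))) = (LINT x:{0..<real n}|lborel. h x)"
  proof (induction n)
    case 0
    then show ?case by (simp add: set_lebesgue_integral_def)
  next
    case (Suc n)
    have "{0..<real (Suc n)} = {0..<real n} \<union> {real n..<real (Suc n)}" by auto
    then have "(LINT x:{0..<real (Suc n)}|lborel. h x) = (LINT x:{0..<real n}|lborel. h x) + (LINT x:{real n..<real (Suc n)}|lborel. h x)"
      by (simp only:) (rule set_integral_Un, auto intro!: intn)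
    then show ?case using Suc unit_interval_shift_integral[of h n] by simp
  qed
  show "(\<lambda>n. LINT x:{0..<real n}|lborel. h x) \<longlonglongrightarrow> (LINT x:{0..}|lborel. h x)"
    unfolding set_lebesgue_integral_def
  proof (rule integral_dominated_convergence[where w = "\<lambda>x. norm (indicator {0..} x *\<^sub>R h x)"])
    show "integrable lborel (\<lambda>x. norm (indicator {0..} x *\<^sub>R h x))"
      using int unfolding set_integrable_def by (rule integrable_norm)
    show "AE x in lborel. (\<lambda>n. indicat_real {0..<real n} x *\<^sub>R h x) \<longlonglongrightarrow> indicat_real {0..} x *\<^sub>R h x"
    proof (rule AE_I2)
      fix x
      obtain N :: nat where N: "real N > x" using reals_Archimedean2 by blast
      have "indicat_real {0..<real n} x = indicat_real {0..} x" if "n \<ge> N" for n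
        using N that by (auto simp: indicator_def)
      then show "(\<lambda>n. indicat_real {0..<real n} x *\<^sub>R h x) \<longlonglongrightarrow> indicat_real {0..} x *\<^sub>R h x"
        by (intro tendsto_eventually) (auto simp: eventually_sequentially)
    qed
    show "AE x in lborel. norm (indicat_real {0..<real n} x *\<^sub>R h x) \<le> norm (indicator {0..} x *\<^sub>R h x)" for n
      by (auto simp: indicator_def)
  qed measurable
qed

lemma hkernel_real_bounded: "\<exists>K>0. \<forall>x::real. cmod (hkernel m (of_real x)) \<le> K"
proof -
  obtain a b where ab: "\<And>H. \<exists>C>0. \<forall>w. \<bar>Im w\<bar> \<le> H \<longrightarrow> cmod (hkernel m w - a * wave w - b * wave (- w)) \<le> C / (1 + cmod w)"
    using hkernel_asymptotics[of m] by blast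
  from ab[of 0] obtain C where CC: "C > 0 \<and> (\<forall>w. \<bar>Im w\<bar> \<le> 0 \<longrightarrow> cmod (hkernel m w - a * wave w - b * wave (- w)) \<le> C / (1 + cmod w))"
    by (rule exE)
  have "C > 0" using CC by (rule conjunct1)
  have "cmod (hkernel m (of_real x)) \<le> C + cmod a + cmod b" for x :: real
  proof -
    let ?w = "complex_of_real x"
    have "\<bar>Im ?w\<bar> \<le> 0" by simp
    from CC[THEN conjunct2, THEN spec, THEN mp, OF this]
    have "cmod (hkernel m ?w - a * wave ?w - b * wave (- ?w)) \<le> C / (1 + cmod ?w)" .
    also have "\<dots> \<le> C / 1" using \<open>C > 0\<close> by (intro divide_left_mono) (auto intro!: add_pos_nonneg)
    finally have 1: "cmod (hkernel m ?w - a * wave ?w - b * wave (- ?w)) \<le> C" by simp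
    have e: "cmod (wave ?w) \<le> 1" "cmod (wave (- ?w)) \<le> 1" using cmod_wave_le[of ?w 0] cmod_wave_le[of "- ?w" 0] by simp_all
    have "hkernel m ?w = (hkernel m ?w - a * wave ?w - b * wave (- ?w)) + a * wave ?w + b * wave (- ?w)" by simp
    also have "cmod \<dots> \<le> cmod (hkernel m ?w - a * wave ?w - b * wave (- ?w)) + cmod (a * wave ?w) + cmod (b * wave (- ?w))"
      by (intro order_trans[OF norm_triangle_ineq] add_right_mono norm_triangle_ineq)
    also have "\<dots> \<le> C + cmod a * 1 + cmod b * 1"
      unfolding norm_mult using 1 e by (intro add_mono mult_left_mono) auto
    finally show ?thesis by simp
  qed
  moreover have "C + cmod a + cmod b > 0" using \<open>C > 0\<close> by (intro add_pos_nonneg) auto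
  ultimately show ?thesis by blast
qed

text \<open>The kernel is bounded on the real line and the support of \<open>G\<close> has measure at most \<open>N\<close>.\<close>

lemma hk_transform_sup_bound:
  fixes N :: nat
  shows "\<exists>K>0. \<forall>(a :: nat \<Rightarrow> real) G x. G \<in> borel_measurable borel \<and> integrable lborel (\<lambda>y. (G y)\<^sup>2) \<and>
     (\<forall>y. G y \<noteq> 0 \<longrightarrow> (\<exists>k\<in>{1..N}. y \<in> {a k..a k + (1::real)})) \<longrightarrow>
     (cmod (hk_transform m G (of_real x)))\<^sup>2 \<le> K * (LINT y|lborel. (G y)\<^sup>2)"
proof -
  obtain K where K: "K > 0" "\<And>x::real. cmod (hkernel m (of_real x)) \<le> K" using hkernel_real_bounded[of m] by blast
  have pos: "K\<^sup>2 * real (Suc N) > 0" using K by simp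
  show ?thesis
  proof (intro exI[of _ "K\<^sup>2 * real (Suc N)"] conjI allI impI pos, elim conjE)
    fix a :: "nat \<Rightarrow> real" and G :: "real \<Rightarrow> real" and x :: real
    assume [measurable]: "G \<in> borel_measurable borel" and G2: "integrable lborel (\<lambda>y. (G y)\<^sup>2)"
      and supp: "\<forall>y. G y \<noteq> 0 \<longrightarrow> (\<exists>k\<in>{1..N}. y \<in> {a k..a k + (1::real)})"
    define S where "S = (\<Union>k\<in>{1..N}. {a k..a k + 1})"
    have S[measurable]: "S \<in> sets borel" unfolding S_def by auto
    have "emeasure lborel S \<le> (\<Sum>k\<in>{1..N}. emeasure lborel {a k..a k + 1})"
      unfolding S_def by (rule emeasure_subadditive_finite) auto
    also have "\<dots> = of_nat N" by simp
    finally have eS: "emeasure lborel S \<le> of_nat N" .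
    also have "\<dots> < \<infinity>" by (simp add: of_nat_less_top)
    finally have fin: "emeasure lborel S < \<infinity>" .
    have mS: "measure lborel S \<le> real N"
      using eS by (simp add: measure_def enn2real_leI ennreal_of_nat_eq_real_of_nat)
    have CS: "integrable lborel (\<lambda>y. indicat_real S y * \<bar>G y\<bar>)"
      "(LINT y|lborel. indicat_real S y * \<bar>G y\<bar>)\<^sup>2 \<le> (LINT y|lborel. (indicat_real S y)\<^sup>2) * (LINT y|lborel. \<bar>G y\<bar>\<^sup>2)"
    proof -
      have i2: "integrable lborel (\<lambda>y. (indicat_real S y)\<^sup>2)"
      proof -
        have "(indicat_real S y)\<^sup>2 = indicat_real S y" for y by (simp add: indicator_def)
        then show ?thesis using fin by simp
      qed
      show "integrable lborel (\<lambda>y. indicat_real S y * \<bar>G y\<bar>)"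
        by (rule integral_cauchy_schwarz(1)[OF _ _ i2]) (use G2 in auto)
      show "(LINT y|lborel. indicat_real S y * \<bar>G y\<bar>)\<^sup>2 \<le> (LINT y|lborel. (indicat_real S y)\<^sup>2) * (LINT y|lborel. \<bar>G y\<bar>\<^sup>2)"
        by (rule integral_cauchy_schwarz(2)[OF _ _ i2]) (use G2 in auto)
    qed
    have ind2: "(LINT y|lborel. (indicat_real S y)\<^sup>2) = measure lborel S"
    proof -
      have "(indicat_real S y)\<^sup>2 = indicat_real S y" for y by (simp add: indicator_def)
      then show ?thesis by simp
    qed
    have SG: "indicat_real S y * \<bar>G y\<bar> = \<bar>G y\<bar>" for y
      using supp unfolding S_def indicator_def by (cases "G y = 0") auto
    have "cmod (hk_transform m G (of_real x)) \<le> (LINT y|lborel. K * (indicat_real S y * \<bar>G y\<bar>))"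
      unfolding hk_transform_def
    proof (rule order_trans[OF integral_norm_bound], rule integral_mono_AE')
      show "integrable lborel (\<lambda>y. K * (indicat_real S y * \<bar>G y\<bar>))" using CS(1) by (rule integrable_mult_right)
      show "AE y in lborel. cmod (of_real (G y) * hkernel m (of_real x * of_real y)) \<le> K * (indicat_real S y * \<bar>G y\<bar>)"
      proof (rule AE_I2)
        fix y
        have "cmod (hkernel m (of_real x * of_real y)) \<le> K" using K(2)[of "x * y"] by simp
        then show "cmod (of_real (G y) * hkernel m (of_real x * of_real y)) \<le> K * (indicat_real S y * \<bar>G y\<bar>)"
          unfolding SG norm_mult norm_of_real mult.commute[of K] by (rule mult_left_mono) simp
      qed
      show "AE y in lborel. 0 \<le> K * (indicat_real S y * \<bar>G y\<bar>)" using K(1) by simp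
    qed
    also have "\<dots> = K * (LINT y|lborel. indicat_real S y * \<bar>G y\<bar>)" by (rule integral_mult_right_zero)
    finally have "(cmod (hk_transform m G (of_real x)))\<^sup>2 \<le> (K * (LINT y|lborel. indicat_real S y * \<bar>G y\<bar>))\<^sup>2"
      by (rule power_mono) simp
    also have "\<dots> \<le> K\<^sup>2 * (real N * (LINT y|lborel. (G y)\<^sup>2))"
      unfolding power_mult_distrib
    proof (rule mult_left_mono)
      have "(LINT y|lborel. indicat_real S y * \<bar>G y\<bar>)\<^sup>2 \<le> measure lborel S * (LINT y|lborel. (G y)\<^sup>2)"
        using CS(2) unfolding ind2 by simp
      also have "\<dots> \<le> real N * (LINT y|lborel. (G y)\<^sup>2)"
        by (intro mult_right_mono mS Bochner_Integration.integral_nonneg) auto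
      finally show "(LINT y|lborel. indicat_real S y * \<bar>G y\<bar>)\<^sup>2 \<le> real N * (LINT y|lborel. (G y)\<^sup>2)" .
    qed simp
    also have "\<dots> \<le> K\<^sup>2 * (real (Suc N) * (LINT y|lborel. (G y)\<^sup>2))"
      by (intro mult_left_mono mult_right_mono Bochner_Integration.integral_nonneg) auto
    finally show "(cmod (hk_transform m G (of_real x)))\<^sup>2 \<le> K\<^sup>2 * real (Suc N) * (LINT y|lborel. (G y)\<^sup>2)"
      by (simp only: mult.assoc)
  qed
qed

text \<open>The hypothesis \<open>\<parallel>G\<parallel>\<^sup>2 \<le> c0 \<parallel>F\<parallel>\<^sup>2\<close> for \<open>F = hk_transform m G\<close> permits discarding contributions of size
  \<open>\<parallel>F\<parallel>\<^sup>2 / 4\<close> twice: an initial interval \<open>[0, \<rho>]\<close>, on which the factor \<open>(x / (j + 1))\<^sup>m\<close> degenerates, and the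
  unit intervals on which some coefficient is large compared with \<open>F\<close>. On the other unit intervals the
  local estimate applies.\<close>

lemma relative_density_estimate:
  fixes m N :: nat and \<gamma> c0 :: real
  assumes "\<gamma> > 0" "c0 > 0"
  shows "\<exists>C>0. \<forall>(E :: real set) (a :: nat \<Rightarrow> real) (G :: real \<Rightarrow> real).
     E \<in> sets borel \<and> (\<forall>j::nat. measure lborel (E \<inter> {real j..real j + 1}) \<ge> \<gamma>) \<and>
     (\<forall>k\<in>{1..N}. a k \<ge> 0) \<and> G \<in> borel_measurable borel \<and> integrable lborel (\<lambda>y. (G y)\<^sup>2) \<and>
     (\<forall>y. G y \<noteq> 0 \<longrightarrow> y > 0 \<and> (\<exists>k\<in>{1..N}. y \<in> {a k..a k + 1})) \<and>
     set_integrable lborel {0..} (\<lambda>x. (cmod (hk_transform m G (of_real x)))\<^sup>2) \<and>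
     (LINT y|lborel. (G y)\<^sup>2) \<le> c0 * (LINT x:{0..}|lborel. (cmod (hk_transform m G (of_real x)))\<^sup>2) \<longrightarrow>
     (LINT x:{0..}|lborel. (cmod (hk_transform m G (of_real x)))\<^sup>2) \<le>
       C * (LINT x:E \<inter> {0..}|lborel. (cmod (hk_transform m G (of_real x)))\<^sup>2)"
proof -
  define J :: "(nat \<times> int) set" where "J = {..N} \<times> {1, -1}"
  have J: "finite J" unfolding J_def by simp
  from frequency_decomposition[of N m, folded J_def] obtain D where
    DD: "D > 0 \<and> (\<forall>a G. (\<forall>k\<in>{1..N}. a k \<ge> 0) \<and> G \<in> borel_measurable borel \<and> integrable lborel (\<lambda>y. (G y)\<^sup>2) \<and>
     (\<forall>y. G y \<noteq> 0 \<longrightarrow> y > 0 \<and> (\<exists>k\<in>{1..N}. y \<in> {a k..a k + 1})) \<longrightarrow>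
     (\<exists>(l :: nat \<times> int \<Rightarrow> real) (u :: nat \<Rightarrow> nat \<times> int \<Rightarrow> complex \<Rightarrow> complex).
        (\<forall>j i. i \<in> J \<longrightarrow> u j i holomorphic_on UNIV) \<and>
        (\<forall>j t. ((of_nat j + of_real t) / of_nat (Suc j)) ^ m * hk_transform m G (of_nat j + of_real t) =
           (\<Sum>i\<in>J. exp (\<i> * of_real (l i * t)) * u j i (of_real t))) \<and>
        (\<forall>i\<in>J. \<forall>n w. cmod w \<le> 3 \<longrightarrow> (\<Sum>j<n. (cmod (u j i w))\<^sup>2) \<le> D * (LINT y|lborel. (G y)\<^sup>2))))" by (rule exE)
  from hk_transform_sup_bound[of N m] obtain F0 where
    F0: "F0 > 0 \<and> (\<forall>(a :: nat \<Rightarrow> real) G x. G \<in> borel_measurable borel \<and> integrable lborel (\<lambda>y. (G y)\<^sup>2) \<and>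
     (\<forall>y. G y \<noteq> 0 \<longrightarrow> (\<exists>k\<in>{1..N}. y \<in> {a k..a k + (1::real)})) \<longrightarrow>
     (cmod (hk_transform m G (of_real x)))\<^sup>2 \<le> F0 * (LINT y|lborel. (G y)\<^sup>2))" by (rule exE)
  have "D > 0" "F0 > 0" using DD F0 by blast+
  \<comment> \<open>Small enough for the interval \<open>[0, \<rho>]\<close> to carry at most a quarter of the total mass.\<close>
  define \<rho> where "\<rho> = 1 / (4 * F0 * c0 + 2)"
  have den: "4 * F0 * c0 + 2 > 2" using \<open>F0 > 0\<close> assms by simp
  have \<rho>: "0 < \<rho>" "\<rho> \<le> 1 / 2" "\<rho> * F0 * c0 \<le> 1 / 4"
  proof -
    let ?d = "4 * F0 * c0 + 2"
    have d: "?d > 2" by (rule den)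
    show "0 < \<rho>" unfolding \<rho>_def using d by (intro divide_pos_pos) linarith+
    show "\<rho> \<le> 1 / 2" unfolding \<rho>_def using d by (intro divide_left_mono mult_pos_pos) linarith+
    have "1 * (4 * F0 * c0) \<le> 1 * ?d" by simp
    then have "F0 * c0 / ?d \<le> 1 / 4" using d by (subst pos_divide_le_eq) linarith+
    then show "\<rho> * F0 * c0 \<le> 1 / 4" unfolding \<rho>_def by simp
  qed
  define r where "r = (1 / \<rho> ^ m)\<^sup>2"
  have r: "r > 0" unfolding r_def using \<rho> by simp
  \<comment> \<open>Large enough for the unit intervals on which a coefficient exceeds \<open>A\<close> times the mass to carry at most
    another quarter.\<close>
  define A where "A = 4 * r * (real (card J) + 1) * D * c0"
  have "A > 0" unfolding A_def using r \<open>D > 0\<close> assms by (intro mult_pos_pos) auto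
  from local_L2_estimate[OF \<open>A > 0\<close> assms(1), of "card J"] obtain c where
    LL: "c > 0 \<and> (\<forall>(I :: (nat \<times> int) set) l u E. finite I \<and> card I \<le> card J \<and> (\<forall>i\<in>I. u i holomorphic_on UNIV) \<and>
     E \<in> sets borel \<and> E \<subseteq> {0..1} \<and> measure lborel E \<ge> \<gamma> \<and>
     (\<forall>i\<in>I. (LINT t:{0..1}|lborel. (cmod (u i (3 * exp (2 * of_real pi * \<i> * of_real t))))\<^sup>2) \<le>
        A * (LINT x:{0..1}|lborel. (cmod (\<Sum>i\<in>I. exp (\<i> * of_real (l i * x)) * u i (of_real x)))\<^sup>2)) \<longrightarrow>
     c * (LINT x:{0..1}|lborel. (cmod (\<Sum>i\<in>I. exp (\<i> * of_real (l i * x)) * u i (of_real x)))\<^sup>2) \<le>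
       (LINT x:E|lborel. (cmod (\<Sum>i\<in>I. exp (\<i> * of_real (l i * x)) * u i (of_real x)))\<^sup>2))" by (rule exE)
  have "c > 0" using LL by (rule conjunct1)
  have Cpos: "2 * r / c > 0" using r \<open>c > 0\<close> by simp
  show ?thesis
  proof (intro exI[of _ "2 * r / c"] conjI allI impI Cpos, elim conjE)
    fix E :: "real set" and a :: "nat \<Rightarrow> real" and G :: "real \<Rightarrow> real"
    let ?N = "LINT y|lborel. (G y)\<^sup>2"
    define h where "h x = (cmod (hk_transform m G (of_real x)))\<^sup>2" for x :: real
    let ?T = "LINT x:{0..}|lborel. (cmod (hk_transform m G (of_real x)))\<^sup>2"
    let ?X = "LINT x:E \<inter> {0..}|lborel. (cmod (hk_transform m G (of_real x)))\<^sup>2"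
    assume E[measurable]: "E \<in> sets borel" and dens: "\<forall>j::nat. measure lborel (E \<inter> {real j..real j + 1}) \<ge> \<gamma>"
      and a: "\<forall>k\<in>{1..N}. a k \<ge> 0" and Gm[measurable]: "G \<in> borel_measurable borel" and G2: "integrable lborel (\<lambda>y. (G y)\<^sup>2)"
      and supp: "\<forall>y. G y \<noteq> 0 \<longrightarrow> y > 0 \<and> (\<exists>k\<in>{1..N}. y \<in> {a k..a k + 1})"
      and Tint: "set_integrable lborel {0..} (\<lambda>x. (cmod (hk_transform m G (of_real x)))\<^sup>2)" and GT: "?N \<le> c0 * ?T"
    have N0: "?N \<ge> 0" by (rule Bochner_Integration.integral_nonneg) auto
    let ?P = "\<lambda>(l :: nat \<times> int \<Rightarrow> real) (u :: nat \<Rightarrow> nat \<times> int \<Rightarrow> complex \<Rightarrow> complex). (\<forall>j i. i \<in> J \<longrightarrow> u j i holomorphic_on UNIV) \<and>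
        (\<forall>j t. ((of_nat j + of_real t) / of_nat (Suc j)) ^ m * hk_transform m G (of_nat j + of_real t) =
           (\<Sum>i\<in>J. exp (\<i> * of_real (l i * t)) * u j i (of_real t))) \<and>
        (\<forall>i\<in>J. \<forall>n w. cmod w \<le> 3 \<longrightarrow> (\<Sum>j<n. (cmod (u j i w))\<^sup>2) \<le> D * ?N)"
    from DD[THEN conjunct2, THEN spec, THEN spec, THEN mp, OF conjI, OF a conjI, OF Gm conjI, OF G2 supp]
    obtain l where "\<exists>u. ?P l u" by (rule exE)
    then obtain u where LU: "?P l u" by (rule exE)
    note u = LU[THEN conjunct1, rule_format] and dec = LU[THEN conjunct2, THEN conjunct1, rule_format]
      and ub = LU[THEN conjunct2, THEN conjunct2, rule_format]
    define v where "v j t = (\<Sum>i\<in>J. exp (\<i> * of_real (l i * t)) * u j i (of_real t))" for j :: nat and t :: real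
    define b where "b j = (LINT t:{0..1}|lborel. (cmod (v j t))\<^sup>2)" for j
    define M where "M j i = (LINT t:{0..1}|lborel. (cmod (u j i (3 * exp (2 * of_real pi * \<i> * of_real t))))\<^sup>2)" for j i
    have ucont: "continuous_on UNIV (u j i)" if "i \<in> J" for j i
      using u[OF that] holomorphic_on_imp_continuous_on by blast
    have vcont: "continuous_on UNIV (v j)" for j
      unfolding v_def by (intro continuous_intros continuous_on_compose2[OF ucont]) auto
    have [measurable]: "v j \<in> borel_measurable borel" for j by (rule borel_measurable_continuous_onI[OF vcont])
    have vint: "set_integrable lborel {0..1} (\<lambda>t. (cmod (v j t))\<^sup>2)" for j
      by (intro borel_integrable_atLeastAtMost' continuous_on_power continuous_on_norm continuous_on_subset[OF vcont]) simp
    have b0: "b j \<ge> 0" for j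
      unfolding b_def set_lebesgue_integral_def by (rule Bochner_Integration.integral_nonneg) auto
    have M0: "M j i \<ge> 0" for j i
      unfolding M_def set_lebesgue_integral_def by (rule Bochner_Integration.integral_nonneg) auto
    have hv: "hk_transform m G (of_real (real j + t)) = hk_transform m G (of_nat j + of_real t)" for j t by simp
    have vh: "(cmod (v j t))\<^sup>2 = ((\<bar>real j + t\<bar> / real (Suc j)) ^ m)\<^sup>2 * h (real j + t)" for j t
    proof -
      have "cmod ((of_nat j + of_real t) / of_nat (Suc j)) = \<bar>real j + t\<bar> / real (Suc j)"
      proof -
        have "(of_nat j + of_real t) / of_nat (Suc j) = complex_of_real ((real j + t) / real (Suc j))" by simp
        then show ?thesis by (simp only: norm_of_real abs_divide abs_of_nat)
      qed
      then show ?thesis unfolding v_def dec[symmetric] h_def hv norm_mult norm_power power_mult_distrib by simp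
    qed
    have h0: "h x \<ge> 0" for x by (simp add: h_def)
    have Ghol: "hk_transform m G holomorphic_on UNIV"
    proof (rule hk_transform_entire[where R = "\<Sum>k\<in>{1..N}. a k + 1"])
      have R: "\<bar>y\<bar> \<le> (\<Sum>k\<in>{1..N}. a k + 1)" if Gy: "G y \<noteq> 0" for y
      proof -
        obtain k where k: "k \<in> {1..N}" "y \<in> {a k..a k + 1}" "y > 0" using supp Gy by blast
        then have "\<bar>y\<bar> \<le> a k + 1" by auto
        also have "\<dots> \<le> (\<Sum>k\<in>{1..N}. a k + 1)" by (rule member_le_sum) (use k a in auto)
        finally show ?thesis .
      qed
      then show "\<bar>y\<bar> \<le> (\<Sum>k\<in>{1..N}. a k + 1)" if "G y \<noteq> 0" for y using that by blast
      show "integrable lborel (\<lambda>y. complex_of_real (G y))"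
      proof (rule integrable_of_square_integrable[of _ "{0..\<Sum>k\<in>{1..N}. a k + 1}"])
        show "integrable lborel (\<lambda>y. (cmod (complex_of_real (G y)))\<^sup>2)" using G2 unfolding norm_of_real power2_abs .
        fix y assume "complex_of_real (G y) \<noteq> 0"
        then have "G y \<noteq> 0" by simp
        then show "y \<in> {0..\<Sum>k\<in>{1..N}. a k + 1}" using R[of y] supp by auto
      qed (auto simp: emeasure_lborel_Icc_eq)
    qed
    have hcont: "continuous_on UNIV h" unfolding h_def
      by (intro continuous_intros continuous_on_compose2[OF holomorphic_on_imp_continuous_on[OF Ghol]]) auto
    have hm[measurable]: "h \<in> borel_measurable borel" by (rule borel_measurable_continuous_onI[OF hcont])
    have hint: "set_integrable lborel {0..1} (\<lambda>t. h (real j + t))" for j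
      by (intro borel_integrable_atLeastAtMost' continuous_on_compose2[OF hcont] continuous_intros) auto
    have sup: "h x \<le> F0 * ?N" for x
      unfolding h_def by (rule F0[THEN conjunct2, THEN spec[of _ a], THEN spec[of _ G], THEN spec[of _ x], THEN mp]) (use G2 supp in auto)
    define q where "q j = (LINT t:{0..1}|lborel. h (real j + t))" for j
    define e where "e j = (LINT t:{0..1}|lborel. indicat_real E (real j + t) * h (real j + t))" for j

    \<comment> \<open>Away from \<open>[0, \<rho>]\<close> the factor \<open>(x / (j + 1))\<^sup>m\<close> is at least \<open>\<rho>\<^sup>m\<close>.\<close>
    have pt: "h (real j + t) \<le> r * (cmod (v j t))\<^sup>2" if "t \<in> {0..1}" "j \<noteq> 0 \<or> \<rho> \<le> t" for j t
    proof -
      have x: "\<rho> \<le> \<bar>real j + t\<bar> / real (Suc j)"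
      proof (cases "j = 0")
        case True then show ?thesis using that by auto
      next
        case False
        have "\<rho> * real (Suc j) \<le> 1 / 2 * real (Suc j)" using \<rho> by (intro mult_right_mono) auto
        also have "\<dots> \<le> \<bar>real j + t\<bar>" using False that(1) by simp
        finally show ?thesis by (simp add: pos_le_divide_eq del: of_nat_Suc)
      qed
      have "\<rho> ^ m \<le> (\<bar>real j + t\<bar> / real (Suc j)) ^ m" using x \<rho> by (intro power_mono) auto
      then have "(\<rho> ^ m)\<^sup>2 \<le> ((\<bar>real j + t\<bar> / real (Suc j)) ^ m)\<^sup>2" by (rule power_mono) (use \<rho> in simp)
      then have "r * (\<rho> ^ m)\<^sup>2 * h (real j + t) \<le> r * ((\<bar>real j + t\<bar> / real (Suc j)) ^ m)\<^sup>2 * h (real j + t)"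
        using r h0 by (intro mult_right_mono mult_left_mono) auto
      moreover have "r * (\<rho> ^ m)\<^sup>2 = 1" unfolding r_def using \<rho> by (simp add: power_divide)
      ultimately show ?thesis unfolding vh by (simp add: mult.assoc)
    qed
    have q_le: "q j \<le> (if j = 0 then \<rho> * F0 * ?N else 0) + r * b j" for j
    proof -
      let ?z = "if j = 0 then F0 * ?N else 0"
      have "q j \<le> (LINT t:{0..1}|lborel. ?z * indicator {0..\<rho>} t + r * (cmod (v j t))\<^sup>2)"
        unfolding q_def
      proof (rule set_integral_mono[OF hint])
        have i1: "set_integrable lborel {0..1} (\<lambda>t. ?z * indicat_real {0..\<rho>} t)"
        proof (rule set_integrable_mult_right)
          have "set_integrable lborel ({0..1} \<inter> {0..\<rho>}) (\<lambda>t. 1 :: real)"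
            by (rule set_integrable_subset[of _ "{0..1}"]) (auto intro!: borel_integrable_atLeastAtMost')
          then show "set_integrable lborel {0..1} (indicat_real {0..\<rho>})"
            unfolding set_integrable_def indicator_inter_arith real_scaleR_def mult_1_right .
        qed
        show "set_integrable lborel {0..1} (\<lambda>t. ?z * indicat_real {0..\<rho>} t + r * (cmod (v j t))\<^sup>2)"
          by (intro set_integral_add(1)[OF i1] set_integrable_mult_right vint)
        fix t :: real assume t: "t \<in> {0..1}"
        show "h (real j + t) \<le> ?z * indicat_real {0..\<rho>} t + r * (cmod (v j t))\<^sup>2"
        proof (cases "j \<noteq> 0 \<or> \<rho> \<le> t")
          case True
          have "0 \<le> ?z * indicat_real {0..\<rho>} t" using \<open>F0 > 0\<close> N0 by (auto simp: indicator_def)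
          then show ?thesis using pt[OF t True] by linarith
        next
          case False
          then have "?z * indicat_real {0..\<rho>} t = F0 * ?N" using t by auto
          then show ?thesis using sup[of "real j + t"] r by (simp add: add_increasing2)
        qed
      qed
      also have "\<dots> = ?z * measure lborel ({0..1} \<inter> {0..\<rho>}) + r * b j"
      proof -
        have i2: "integrable lborel (\<lambda>t. indicat_real ({0..1} \<inter> {0..\<rho>}) t)"
          by (rule integrable_real_indicator) (auto simp: emeasure_lborel_Icc_eq)
        have i3: "integrable lborel (\<lambda>t. indicat_real {0..1} t *\<^sub>R (cmod (v j t))\<^sup>2)" using vint unfolding set_integrable_def .
        have "(LINT t:{0..1}|lborel. ?z * indicator {0..\<rho>} t + r * (cmod (v j t))\<^sup>2) =
          (LINT t|lborel. ?z * indicat_real ({0..1} \<inter> {0..\<rho>}) t + r * (indicat_real {0..1} t *\<^sub>R (cmod (v j t))\<^sup>2))"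
          unfolding set_lebesgue_integral_def by (intro Bochner_Integration.integral_cong refl) (simp add: indicator_inter_arith algebra_simps del: Int_atLeastAtMost)
        also have "\<dots> = ?z * (LINT t|lborel. indicat_real ({0..1} \<inter> {0..\<rho>}) t) + r * (LINT t|lborel. indicat_real {0..1} t *\<^sub>R (cmod (v j t))\<^sup>2)"
          by (subst Bochner_Integration.integral_add[OF integrable_mult_right[OF i2] integrable_mult_right[OF i3]])
            (simp only: integral_mult_right_zero)
        finally show ?thesis unfolding b_def set_lebesgue_integral_def by simp
      qed
      also have "{0..1} \<inter> {0..\<rho>} = {0..\<rho>}" using \<rho> by auto
      also have "?z * measure lborel {0..\<rho>} = (if j = 0 then \<rho> * F0 * ?N else 0)" using \<rho> by simp
      finally show ?thesis .
    qed
    have MD: "(\<Sum>j<n. M j i) \<le> D * ?N" if "i \<in> J" for n i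
    proof -
      have ci: "set_integrable lborel {0..1} (\<lambda>t. (cmod (u j i (3 * exp (2 * of_real pi * \<i> * of_real t))))\<^sup>2)" for j
        by (intro borel_integrable_atLeastAtMost' continuous_intros continuous_on_compose2[OF ucont[OF that]]) auto
      have "(\<Sum>j<n. M j i) = (LINT t:{0..1}|lborel. (\<Sum>j<n. (cmod (u j i (3 * exp (2 * of_real pi * \<i> * of_real t))))\<^sup>2))"
        unfolding M_def set_lebesgue_integral_def scaleR_sum_right
        by (rule Bochner_Integration.integral_sum[symmetric]) (rule ci[unfolded set_integrable_def])
      also have "\<dots> \<le> (LINT t:{0..1::real}|lborel. D * ?N)"
      proof (rule set_integral_mono)
        show "set_integrable lborel {0..1} (\<lambda>t. (\<Sum>j<n. (cmod (u j i (3 * exp (2 * of_real pi * \<i> * of_real t))))\<^sup>2))"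
          unfolding set_integrable_def scaleR_sum_right
          by (rule Bochner_Integration.integrable_sum) (rule ci[unfolded set_integrable_def])
        show "set_integrable lborel {0..1::real} (\<lambda>t. D * ?N)" by (rule borel_integrable_atLeastAtMost') simp
        show "(\<Sum>j<n. (cmod (u j i (3 * exp (2 * of_real pi * \<i> * of_real t))))\<^sup>2) \<le> D * ?N" for t
          by (rule ub[OF that]) (simp add: norm_mult norm_exp_eq_Re)
      qed
      also have "\<dots> = D * ?N" by (subst set_integral_const) auto
      finally show ?thesis .
    qed
    \<comment> \<open>Either the local estimate applies to the \<open>j\<close>-th interval, or its mass is dominated by a coefficient.\<close>
    have good: "b j \<le> (1 / A) * (\<Sum>i\<in>J. M j i) + (1 / c) * e j" for j
    proof (cases "\<forall>i\<in>J. M j i \<le> A * b j")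
      case True
      define Ej where "Ej = {t\<in>{0..1}. real j + t \<in> E}"
      have Ej[measurable]: "Ej \<in> sets borel" unfolding Ej_def by measurable
      have "measure lborel Ej \<ge> \<gamma>"
      proof -
        have "emeasure lborel (E \<inter> {real j..real j + 1}) = (\<integral>\<^sup>+x. indicator (E \<inter> {real j..real j + 1}) x \<partial>lborel)" by simp
        also have "\<dots> = ennreal \<bar>1\<bar> * (\<integral>\<^sup>+t. indicator (E \<inter> {real j..real j + 1}) (real j + 1 * t) \<partial>lborel)"
          by (rule nn_integral_real_affine) auto
        also have "(\<integral>\<^sup>+t. indicator (E \<inter> {real j..real j + 1}) (real j + 1 * t) \<partial>lborel) = (\<integral>\<^sup>+t. indicator Ej t \<partial>lborel)"
          by (intro nn_integral_cong) (auto simp: indicator_def Ej_def)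
        finally have "emeasure lborel (E \<inter> {real j..real j + 1}) = emeasure lborel Ej" by simp
        then show ?thesis using dens unfolding measure_def by metis
      qed
      have "finite J \<and> card J \<le> card J \<and> (\<forall>i\<in>J. u j i holomorphic_on UNIV) \<and>
         Ej \<in> sets borel \<and> Ej \<subseteq> {0..1} \<and> measure lborel Ej \<ge> \<gamma> \<and>
         (\<forall>i\<in>J. (LINT t:{0..1}|lborel. (cmod (u j i (3 * exp (2 * of_real pi * \<i> * of_real t))))\<^sup>2) \<le>
          A * (LINT x:{0..1}|lborel. (cmod (\<Sum>i\<in>J. exp (\<i> * of_real (l i * x)) * u j i (of_real x)))\<^sup>2))"
        using J u Ej \<open>measure lborel Ej \<ge> \<gamma>\<close> True unfolding M_def b_def v_def Ej_def by auto
      from LL[THEN conjunct2, THEN spec, THEN spec, THEN spec, THEN spec, THEN mp, OF this]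
      have "c * b j \<le> (LINT t:Ej|lborel. (cmod (v j t))\<^sup>2)" unfolding b_def v_def .
      also have "\<dots> \<le> e j"
        unfolding e_def set_lebesgue_integral_def
      proof (rule Bochner_Integration.integral_mono)
        show "integrable lborel (\<lambda>t. indicat_real Ej t *\<^sub>R (cmod (v j t))\<^sup>2)"
        proof -
          have "set_integrable lborel Ej (\<lambda>t. (cmod (v j t))\<^sup>2)"
            by (rule set_integrable_subset[OF vint]) (use Ej in \<open>auto simp: Ej_def\<close>)
          then show ?thesis unfolding set_integrable_def .
        qed
        have "integrable lborel (\<lambda>t. indicat_real {0..1} t *\<^sub>R h (real j + t))" using hint unfolding set_integrable_def .
        then show "integrable lborel (\<lambda>t. indicat_real {0..1} t *\<^sub>R (indicat_real E (real j + t) * h (real j + t)))"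
          by (rule Bochner_Integration.integrable_bound) (auto simp: indicator_def)
        fix t
        show "indicat_real Ej t *\<^sub>R (cmod (v j t))\<^sup>2 \<le> indicat_real {0..1} t *\<^sub>R (indicat_real E (real j + t) * h (real j + t))"
        proof (cases "t \<in> Ej")
          case True
          then have t: "0 \<le> t" "t \<le> 1" "real j + t \<in> E" unfolding Ej_def by auto
          have "(\<bar>real j + t\<bar> / real (Suc j)) ^ m \<le> 1 ^ m" using t by (intro power_mono) (auto simp: divide_le_eq_1)
          then have "((\<bar>real j + t\<bar> / real (Suc j)) ^ m)\<^sup>2 \<le> 1\<^sup>2" by (intro power_mono) auto
          then have "((\<bar>real j + t\<bar> / real (Suc j)) ^ m)\<^sup>2 * h (real j + t) \<le> 1 * h (real j + t)"
            using h0 by (intro mult_right_mono) auto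
          then show ?thesis using True t unfolding vh by simp
        next
          case False
          then show ?thesis using h0 by (simp add: indicator_def)
        qed
      qed
      finally have "b j \<le> (1 / c) * e j" using \<open>c > 0\<close> by (simp add: field_simps)
      moreover have "0 \<le> (1 / A) * (\<Sum>i\<in>J. M j i)" using \<open>A > 0\<close> M0 by (intro mult_nonneg_nonneg sum_nonneg) auto
      ultimately show ?thesis by linarith
    next
      case False
      then obtain i where i: "i \<in> J" "M j i > A * b j" by force
      have "A * b j \<le> (\<Sum>i\<in>J. M j i)"
        using i member_le_sum[of i J "M j"] M0 J by force
      then have "b j \<le> (1 / A) * (\<Sum>i\<in>J. M j i)" using \<open>A > 0\<close> by (simp add: field_simps)
      moreover have "0 \<le> e j" unfolding e_def set_lebesgue_integral_def
        using h0 by (intro Bochner_Integration.integral_nonneg) (auto simp: indicator_def)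
      ultimately show ?thesis using \<open>c > 0\<close> by (simp add: add_increasing2)
    qed
    have Eint: "set_integrable lborel {0..} (\<lambda>x. indicat_real E x * h x)"
      using Tint unfolding h_def[symmetric] set_integrable_def
      by (rule Bochner_Integration.integrable_bound) (auto simp: indicator_def)
    have XE: "?X = (LINT x:{0..}|lborel. indicat_real E x * h x)"
      unfolding set_lebesgue_integral_def h_def by (intro Bochner_Integration.integral_cong refl) (auto simp: indicator_def)
    have X_ge: "(LINT x:{0..<real n}|lborel. indicat_real E x * h x) \<le> ?X" for n
    proof -
      have 1: "integrable lborel (\<lambda>x. indicat_real {0..} x *\<^sub>R (indicat_real E x * h x))"
        using Eint unfolding set_integrable_def .
      then have 2: "integrable lborel (\<lambda>x. indicat_real {0..<real n} x *\<^sub>R (indicat_real E x * h x))"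
        by (rule Bochner_Integration.integrable_bound) (auto simp: indicator_def)
      have "(LINT x|lborel. indicat_real {0..<real n} x *\<^sub>R (indicat_real E x * h x)) \<le>
        (LINT x|lborel. indicat_real {0..} x *\<^sub>R (indicat_real E x * h x))"
        by (rule Bochner_Integration.integral_mono[OF 2 1]) (use h0 in \<open>auto simp: indicator_def\<close>)
      then show ?thesis using XE unfolding set_lebesgue_integral_def[of lborel "{0..<real n}"] set_lebesgue_integral_def[of lborel "{0..}"] by linarith
    qed
    have T: "?T = (LINT x:{0..}|lborel. h x)" unfolding h_def ..
    have T0: "?T \<ge> 0" unfolding set_lebesgue_integral_def by (rule Bochner_Integration.integral_nonneg) auto
    have partial: "(LINT x:{0..<real n}|lborel. h x) \<le> ?T / 2 + r / c * ?X" for n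
    proof -
      have Tint': "set_integrable lborel {0..} h" using Tint unfolding h_def .
      have "(LINT x:{0..<real n}|lborel. h x) = (\<Sum>j<n. q j)"
        unfolding q_def by (rule half_line_integral_as_sum(1)[OF hm Tint', symmetric])
      also have "\<dots> \<le> (\<Sum>j<n. (if j = 0 then \<rho> * F0 * ?N else 0) + r * ((1 / A) * (\<Sum>i\<in>J. M j i) + (1 / c) * e j))"
        using r by (intro sum_mono order_trans[OF q_le] add_left_mono mult_left_mono good) auto
      also have "\<dots> = (\<Sum>j<n. (if j = 0 then \<rho> * F0 * ?N else 0)) + r * ((1 / A) * (\<Sum>j<n. \<Sum>i\<in>J. M j i) + (1 / c) * (\<Sum>j<n. e j))"
        by (simp only: sum.distrib sum_distrib_left[symmetric])
      also have "\<dots> \<le> \<rho> * F0 * ?N + r * ((1 / A) * (real (card J) * (D * ?N)) + (1 / c) * ?X)"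
      proof (intro add_mono mult_left_mono)
        show "(\<Sum>j<n. (if j = 0 then \<rho> * F0 * ?N else 0)) \<le> \<rho> * F0 * ?N"
          using \<rho> \<open>F0 > 0\<close> N0 by (simp add: sum.delta)
        have "(\<Sum>j<n. \<Sum>i\<in>J. M j i) = (\<Sum>i\<in>J. \<Sum>j<n. M j i)" by (rule sum.swap)
        also have "\<dots> \<le> (\<Sum>i\<in>J. D * ?N)" by (intro sum_mono MD)
        finally show "(\<Sum>j<n. \<Sum>i\<in>J. M j i) \<le> real (card J) * (D * ?N)" by simp
        have "(\<Sum>j<n. e j) = (LINT x:{0..<real n}|lborel. indicat_real E x * h x)"
          unfolding e_def by (rule half_line_integral_as_sum(1)) (use Eint in auto)
        then show "(\<Sum>j<n. e j) \<le> ?X" using X_ge by simp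
      qed (use r \<open>A > 0\<close> \<open>c > 0\<close> in auto)
      also have "\<dots> = \<rho> * F0 * ?N + r * (real (card J) * D) / A * ?N + r / c * ?X"
        by (simp add: algebra_simps)
      also have "\<dots> \<le> \<rho> * F0 * (c0 * ?T) + r * (real (card J) * D) / A * (c0 * ?T) + r / c * ?X"
      proof (intro add_mono order_refl)
        show "\<rho> * F0 * ?N \<le> \<rho> * F0 * (c0 * ?T)"
          by (rule mult_left_mono[OF GT]) (use \<rho> \<open>F0 > 0\<close> in simp)
        show "r * (real (card J) * D) / A * ?N \<le> r * (real (card J) * D) / A * (c0 * ?T)"
          by (rule mult_left_mono[OF GT]) (use r \<open>A > 0\<close> \<open>D > 0\<close> in simp)
      qed
      also have "\<dots> = (\<rho> * F0 * c0) * ?T + (r * (real (card J) * D) / A * c0) * ?T + r / c * ?X" by simp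
      also have "\<dots> \<le> 1 / 4 * ?T + 1 / 4 * ?T + r / c * ?X"
      proof (intro add_mono[OF _ order_refl] add_mono mult_right_mono \<rho>(3) T0)
        have "4 * (r * (real (card J) * D) * c0) \<le> A"
        proof -
          have "real (card J) * (r * D * c0) \<le> (real (card J) + 1) * (r * D * c0)"
            using r \<open>D > 0\<close> assms by (intro mult_right_mono) auto
          then have "4 * (real (card J) * (r * D * c0)) \<le> 4 * ((real (card J) + 1) * (r * D * c0))"
            by (rule mult_left_mono) simp
          then show ?thesis unfolding A_def by (simp only: mult_ac)
        qed
        then show "r * (real (card J) * D) / A * c0 \<le> 1 / 4" using \<open>A > 0\<close> by (simp add: field_simps)
      qed
      finally show ?thesis by simp
    qed
    have Tint': "set_integrable lborel {0..} h" using Tint unfolding h_def .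
    have "(LINT x:{0..}|lborel. h x) \<le> ?T / 2 + r / c * ?X"
      by (rule LIMSEQ_le_const2[OF half_line_integral_as_sum(2)[OF hm Tint']]) (use partial in blast)
    moreover have "2 * r / c * ?X = 2 * (r / c * ?X)" by simp
    ultimately show "?T \<le> 2 * r / c * ?X" using T by linarith
  qed
qed

section \<open>The weighted half-line\<close>

lemma bessel_j_hbessel: "complex_of_real (bessel_j (real m + 1 / 2) x) = of_real (Gamma (real m + 3 / 2)) * hbessel (Suc m) (of_real x)"
proof -
  have c: "(-1) ^ n / (fact n * Gamma (real n + (real m + 1 / 2) + 1)) = hbessel_coeff (Suc m) n" for n
    unfolding hbessel_coeff_def by (simp add: algebra_simps)
  have S: "(\<lambda>n. complex_of_real (hbessel_coeff (Suc m) n * (x / 2) ^ (2 * n))) sums hbessel (Suc m) (of_real x)"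
    using hbessel_sums[of "Suc m" "of_real x"] by simp
  have R: "(\<lambda>n. hbessel_coeff (Suc m) n * (x / 2) ^ (2 * n)) sums Re (hbessel (Suc m) (of_real x))"
    using sums_Re[OF S] by simp
  have "complex_of_real (\<Sum>n. hbessel_coeff (Suc m) n * (x / 2) ^ (2 * n)) = of_real (Re (hbessel (Suc m) (of_real x)))"
    using sums_unique[OF R] by simp
  also have "\<dots> = hbessel (Suc m) (of_real x)" by (rule sums_unique2[OF sums_of_real[OF R] S])
  finally have "complex_of_real (\<Sum>n. hbessel_coeff (Suc m) n * (x / 2) ^ (2 * n)) = hbessel (Suc m) (of_real x)" .
  moreover have "real m + 1 / 2 + 1 = real m + 3 / 2" by simp
  ultimately show ?thesis unfolding bessel_j_def c by (simp only: of_real_mult)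
qed

lemma bessel_j_bounded: "\<exists>B>0. \<forall>x\<ge>0. \<bar>bessel_j (real m + 1 / 2) x\<bar> \<le> B"
proof -
  obtain K where K: "K > 0" "\<And>x::real. cmod (hkernel m (of_real x)) \<le> K" using hkernel_real_bounded[of m] by blast
  have "continuous_on (cball 0 2) (hbessel (Suc m))"
    using holomorphic_on_imp_continuous_on[OF hbessel_entire] continuous_on_subset by blast
  then have "bounded (hbessel (Suc m) ` cball 0 2)" by (intro compact_imp_bounded compact_continuous_image) auto
  then obtain B where B: "\<And>z. z \<in> cball 0 2 \<Longrightarrow> cmod (hbessel (Suc m) z) \<le> B" unfolding bounded_iff by blast
  have h: "cmod (hbessel (Suc m) (of_real x)) \<le> K + \<bar>B\<bar>" if "x \<ge> 0" for x :: real
  proof (cases "x \<le> 2")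
    case True
    then have "cmod (hbessel (Suc m) (of_real x)) \<le> B" using that by (intro B) auto
    then show ?thesis using K by linarith
  next
    case False
    then have x: "x / 2 \<ge> 1" by simp
    have "cmod (hkernel m (of_real (x / (2 * pi)))) = (x / 2) ^ Suc m * cmod (hbessel (Suc m) (of_real x))"
    proof -
      have "complex_of_real pi * of_real (x / (2 * pi)) = of_real (x / 2)" "2 * complex_of_real pi * of_real (x / (2 * pi)) = of_real x" by simp_all
      then show ?thesis using x unfolding hkernel_def norm_mult norm_power by (simp only: norm_of_real) simp
    qed
    also have "\<dots> \<ge> 1 * cmod (hbessel (Suc m) (of_real x))"
      using x by (intro mult_right_mono one_le_power) auto
    finally have "cmod (hbessel (Suc m) (of_real x)) \<le> K" using K(2)[of "x / (2 * pi)"] by linarith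
    then show ?thesis by simp
  qed
  let ?G = "\<bar>Gamma (real m + 3 / 2)\<bar> :: real"
  have "\<bar>bessel_j (real m + 1 / 2) x\<bar> \<le> ?G * (K + \<bar>B\<bar>) + 1" if "x \<ge> 0" for x
  proof -
    have "\<bar>bessel_j (real m + 1 / 2) x\<bar> = cmod (complex_of_real (bessel_j (real m + 1 / 2) x))" by (simp only: norm_of_real)
    also have "\<dots> = ?G * cmod (hbessel (Suc m) (of_real x))" unfolding bessel_j_hbessel norm_mult norm_of_real ..
    also have "\<dots> \<le> ?G * (K + \<bar>B\<bar>)" using h[OF that] by (intro mult_left_mono) auto
    finally show ?thesis by simp
  qed
  moreover have "?G * (K + \<bar>B\<bar>) + 1 > 0" using K by (intro add_nonneg_pos mult_nonneg_nonneg) auto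
  ultimately show ?thesis by blast
qed

lemma bessel_j_measurable [measurable]: "bessel_j (real m + 1 / 2) \<in> borel_measurable borel"
proof -
  have "bessel_j (real m + 1 / 2) = (\<lambda>x. Re (of_real (Gamma (real m + 3 / 2)) * hbessel (Suc m) (complex_of_real x)))"
    unfolding bessel_j_hbessel[symmetric] by simp
  moreover have "continuous_on UNIV (\<lambda>x. Re (of_real (Gamma (real m + 3 / 2)) * hbessel (Suc m) (complex_of_real x)))"
    by (intro continuous_intros continuous_on_compose2[OF holomorphic_on_imp_continuous_on[OF hbessel_entire]]) auto
  ultimately show ?thesis by (simp only: borel_measurable_continuous_onI)
qed

text \<open>The density of the measure, with the half-integer powers of \<open>\<pi>\<close> written as powers of \<open>\<surd>\<pi>\<close>.\<close>

definition fb_weight :: "nat \<Rightarrow> real \<Rightarrow> real" where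
  "fb_weight m x = 2 * sqrt pi ^ (2 * m + 3) / Gamma (real m + 3 / 2) * x ^ (2 * m + 2)"

abbreviation fbM :: "nat \<Rightarrow> real measure" where "fbM m \<equiv> fb_measure (real m + 1 / 2)"

lemma Gamma_pos_half: "Gamma (real m + 3 / 2) > (0::real)"
  by (rule Gamma_real_pos) (simp add: add_nonneg_pos)

lemma powr_half_odd: "x > 0 \<Longrightarrow> x powr (real m + 3 / 2) = sqrt x ^ (2 * m + 3)"
proof -
  assume x: "x > 0"
  have "x powr (real m + 3 / 2) = x powr (real (2 * m + 3) * (1 / 2))" by (simp add: algebra_simps)
  also have "\<dots> = (x powr (1 / 2)) powr real (2 * m + 3)" by (simp add: powr_powr mult.commute)
  also have "\<dots> = sqrt x ^ (2 * m + 3)" using x by (simp only: powr_half_sqrt powr_realpow real_sqrt_gt_zero less_imp_le)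
  finally show ?thesis .
qed

lemma measurable_lebesgue_on_borel: "f \<in> borel \<rightarrow>\<^sub>M N \<Longrightarrow> f \<in> lebesgue_on S \<rightarrow>\<^sub>M N" for f :: "real \<Rightarrow> 'b"
  by (intro measurable_restrict_space1 measurable_completion) simp

lemma fb_weight_measurable [measurable]: "fb_weight m \<in> borel_measurable borel"
  unfolding fb_weight_def by measurable

lemma fbM_density: "fbM m = density (lebesgue_on {0..}) (\<lambda>x. ennreal (fb_weight m x))"
  unfolding fb_measure_def
proof (rule density_cong)
  show "(\<lambda>x. ennreal (fb_weight m x)) \<in> borel_measurable (lebesgue_on {0..})"
    by (rule measurable_lebesgue_on_borel) measurable
  have eq: "2 * pi powr (real m + 1 / 2 + 1) / Gamma (real m + 1 / 2 + 1) * x powr (2 * (real m + 1 / 2) + 1) = fb_weight m x" if "x \<ge> 0" for x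
  proof -
    have "real m + 1 / 2 + 1 = real m + 3 / 2" by simp
    moreover have "x powr (2 * (real m + 1 / 2) + 1) = x ^ (2 * m + 2)"
    proof -
      have "2 * (real m + 1 / 2) + 1 = real (2 * m + 2)" by simp
      then show ?thesis using that powr_realpow[of x "2 * m + 2"] by (cases "x = 0") auto
    qed
    ultimately show ?thesis unfolding fb_weight_def by (simp only: powr_half_odd[OF pi_gt_zero])
  qed
  show "AE x in lebesgue_on {0..}. ennreal (2 * pi powr (real m + 1 / 2 + 1) / Gamma (real m + 1 / 2 + 1) * x powr (2 * (real m + 1 / 2) + 1)) = ennreal (fb_weight m x)"
  proof (rule AE_I2)
    fix x assume "x \<in> space (lebesgue_on {0::real..})"
    then have "x \<ge> 0" by simp
    then show "ennreal (2 * pi powr (real m + 1 / 2 + 1) / Gamma (real m + 1 / 2 + 1) * x powr (2 * (real m + 1 / 2) + 1)) = ennreal (fb_weight m x)"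
      by (simp only: eq)
  qed
  have "(\<lambda>x. ennreal (2 * pi powr (real m + 1 / 2 + 1) / Gamma (real m + 1 / 2 + 1) * x powr (2 * (real m + 1 / 2) + 1))) \<in> borel_measurable borel"
    by measurable
  then show "(\<lambda>x. ennreal (2 * pi powr (real m + 1 / 2 + 1) / Gamma (real m + 1 / 2 + 1) * x powr (2 * (real m + 1 / 2) + 1))) \<in> borel_measurable (lebesgue_on {0..})"
    by (rule measurable_lebesgue_on_borel)
qed

lemma sets_fbM [simp, measurable_cong]: "sets (fbM m) = sets (lebesgue_on {0..})" and space_fbM [simp]: "space (fbM m) = {0..}"
  by (simp_all add: fb_measure_def)

lemma fb_weight_nonneg: "x \<ge> 0 \<Longrightarrow> fb_weight m x \<ge> 0"
  unfolding fb_weight_def using Gamma_pos_half[of m] by (intro mult_nonneg_nonneg divide_nonneg_nonneg) auto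

lemma fb_weight_pos: "x > 0 \<Longrightarrow> fb_weight m x > 0"
  unfolding fb_weight_def using Gamma_pos_half[of m] by (intro mult_pos_pos divide_pos_pos) auto

lemma borel_measurable_fbM: "f \<in> borel_measurable borel \<Longrightarrow> f \<in> borel_measurable (fbM m)"
proof -
  assume "f \<in> borel_measurable borel"
  then have "f \<in> borel_measurable (lebesgue_on {0..})" by (rule measurable_lebesgue_on_borel)
  then show ?thesis by (simp add: measurable_def)
qed

lemma fbM_borel_integral:
  fixes f :: "real \<Rightarrow> real"
  assumes f[measurable]: "f \<in> borel_measurable borel"
  shows "integrable (fbM m) f \<longleftrightarrow> set_integrable lborel {0..} (\<lambda>x. fb_weight m x * f x)"
    and "integral\<^sup>L (fbM m) f = (LINT x:{0..}|lborel. fb_weight m x * f x)"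
proof -
  have fm: "f \<in> borel_measurable (lebesgue_on {0..})" using borel_measurable_fbM[OF f, of m] by (simp add: measurable_def)
  have wm: "fb_weight m \<in> borel_measurable (lebesgue_on {0..})" using borel_measurable_fbM[OF fb_weight_measurable, of m m] by (simp add: measurable_def)
  have w0: "AE x in lebesgue_on {0..}. 0 \<le> fb_weight m x" by (rule AE_I2) (simp add: fb_weight_nonneg)
  have wf: "(\<lambda>x. indicator {0..} x *\<^sub>R (fb_weight m x * f x)) \<in> borel_measurable lborel" by measurable
  show "integrable (fbM m) f \<longleftrightarrow> set_integrable lborel {0..} (\<lambda>x. fb_weight m x * f x)"
    unfolding fbM_density integrable_density[OF fm wm w0] set_integrable_def
    using integrable_restrict_space[of "{0..}" lebesgue "\<lambda>x. fb_weight m x *\<^sub>R f x"] integrable_completion[OF wf]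
    by simp
  show "integral\<^sup>L (fbM m) f = (LINT x:{0..}|lborel. fb_weight m x * f x)"
    unfolding fbM_density integral_density[OF fm wm w0] set_lebesgue_integral_def
    using integral_restrict_space[of "{0..}" lebesgue "\<lambda>x. fb_weight m x *\<^sub>R f x"] integral_completion[OF wf]
    by simp
qed

text \<open>The density vanishes only at the origin.\<close>

lemma AE_fbM: "(AE x in fbM m. P x) \<longleftrightarrow> (AE x in lebesgue_on {0..}. x \<noteq> 0 \<longrightarrow> P x)"
proof -
  have "(AE x in fbM m. P x) \<longleftrightarrow> (AE x in lebesgue_on {0..}. 0 < ennreal (fb_weight m x) \<longrightarrow> P x)"
    unfolding fbM_density by (rule AE_density) (rule measurable_lebesgue_on_borel, measurable)
  also have "\<dots> \<longleftrightarrow> (AE x in lebesgue_on {0..}. x \<noteq> 0 \<longrightarrow> P x)"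
  proof (rule AE_cong)
    fix x assume "x \<in> space (lebesgue_on {0::real..})"
    then have "x \<ge> 0" by simp
    then have "0 < ennreal (fb_weight m x) \<longleftrightarrow> x \<noteq> 0"
      using fb_weight_pos[of x m] by (cases "x = 0") (auto simp: fb_weight_def)
    then show "(0 < ennreal (fb_weight m x) \<longrightarrow> P x) = (x \<noteq> 0 \<longrightarrow> P x)" by simp
  qed
  finally show ?thesis .
qed

lemma AE_fbM_of_lborel: "(AE x in lborel. P x) \<Longrightarrow> (AE x in fbM m. P x)"
proof -
  assume "AE x in lborel. P x"
  then have "AE x in lebesgue. P x" by (rule AE_completion)
  then have "AE x in lebesgue_on {0..}. P x" by (subst AE_restrict_space_iff) auto
  then show ?thesis unfolding AE_fbM by eventually_elim simp
qed

lemma fbM_borel_version: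
  fixes f :: "real \<Rightarrow> real"
  assumes "f \<in> borel_measurable (fbM m)"
  obtains f' where "f' \<in> borel_measurable borel" "AE x in fbM m. f x = f' x"
proof -
  have "f \<in> borel_measurable (lebesgue_on {0..})" using assms by (simp add: measurable_def)
  then have "(\<lambda>x. if x \<in> {0..} then f x else 0) \<in> borel_measurable lebesgue"
    by (subst borel_measurable_if) auto
  then obtain f' where f': "f' \<in> borel_measurable lborel" "AE x in lborel. (if x \<in> {0..} then f x else 0) = f' x"
    using completion_ex_borel_measurable_real by blast
  from AE_fbM_of_lborel[OF f'(2)] have "AE x in fbM m. (if x \<in> {0..} then f x else 0) = f' x" .
  moreover have "AE x in fbM m. x \<in> {0..}" using AE_space[of "fbM m"] by simp
  ultimately have "AE x in fbM m. f x = f' x" by eventually_elim simp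
  then show ?thesis using that f'(1) by simp
qed

lemma fbM_finite_interval: "integrable (fbM m) (indicat_real {0..real n})" "emeasure (fbM m) {0..real n} < \<infinity>"
proof -
  have "set_integrable lborel {0..real n} (fb_weight m)"
    unfolding fb_weight_def by (intro borel_integrable_atLeastAtMost' continuous_on_mult continuous_on_const continuous_on_power continuous_on_id)
  moreover have eq: "indicat_real {0..real n} x *\<^sub>R fb_weight m x = indicat_real {0..} x *\<^sub>R (fb_weight m x * indicat_real {0..real n} x)" for x
    by (simp add: indicator_def)
  ultimately show "integrable (fbM m) (indicat_real {0..real n})"
    by (subst fbM_borel_integral(1)) (measurable, simp only: set_integrable_def eq)
  then show "emeasure (fbM m) {0..real n} < \<infinity>"
    by (subst (asm) integrable_indicator_iff) (simp add: Int_absorb2 Int_absorb1 atLeastAtMost_subseteq_atLeastLessThan_iff Int_commute)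
qed

lemma sigma_finite_fbM: "sigma_finite_measure (fbM m)"
proof
  let ?A = "range (\<lambda>n::nat. {0..real n})"
  have "\<Union>?A = {0..}" using real_arch_simple by (auto intro!: real_arch_simple)
  moreover have "?A \<subseteq> sets (fbM m)" by (auto simp: sets_restrict_space_iff)
  ultimately show "\<exists>A. countable A \<and> A \<subseteq> sets (fbM m) \<and> \<Union>A = space (fbM m) \<and> (\<forall>a\<in>A. emeasure (fbM m) a \<noteq> \<infinity>)"
    using fbM_finite_interval(2)[of m] by (intro exI[of _ ?A]) (auto simp: less_top)
qed

section \<open>Gaussians under the Fourier-Bessel transform\<close>

definition gauss :: "real \<Rightarrow> real \<Rightarrow> real" where "gauss s x = exp (- (pi * s * x\<^sup>2))"

text \<open>The integral \<open>s\<^bsup>-(m + 3/2)\<^esup>\<close> of \<open>gauss s\<close> against the weighted measure.\<close>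

definition gauss_mass :: "nat \<Rightarrow> real \<Rightarrow> real" where "gauss_mass m s = 1 / sqrt s ^ (2 * m + 3)"

lemma gauss_measurable [measurable]: "gauss s \<in> borel_measurable borel"
  unfolding gauss_def by measurable

lemma gauss_mult: "gauss s x * gauss t x = gauss (s + t) x"
  unfolding gauss_def exp_add[symmetric] by (simp add: algebra_simps)

lemma gauss_pos: "gauss s x > 0" and gauss_le_1: "s \<ge> 0 \<Longrightarrow> gauss s x \<le> 1"
  by (simp_all add: gauss_def)

lemma half_line_gaussian_moment:
  assumes s: "s > 0"
  shows "has_bochner_integral lborel (\<lambda>x. indicator {0..} x *\<^sub>R (gauss s x * x ^ (2 * k)))
    (Gamma (real k + 1 / 2) / (2 * sqrt (pi * s) ^ (2 * k + 1)))"
proof -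
  define c where "c = sqrt (pi * s)"
  have c: "c > 0" "c\<^sup>2 = pi * s" using s by (simp_all add: c_def)
  then have c0: "c \<noteq> 0" "c ^ (2 * k) \<noteq> 0" "\<bar>c\<bar> = c" by simp_all
  have V: "(sqrt pi / 2) * (fact (2 * k) / (2 ^ (2 * k) * fact k)) = Gamma (real k + 1 / 2) / 2"
  proof -
    have "Gamma (real k + 1 / 2) = sqrt pi * fact (2 * k) / (fact k * 4 ^ k)"
      using Gamma_half_fact[of k] by (simp add: field_simps)
    moreover have "(2::real) ^ (2 * k) = 4 ^ k" by (simp add: power_mult)
    ultimately show ?thesis by (simp add: mult.commute)
  qed
  have "has_bochner_integral lborel (\<lambda>x. indicator {0..} (0 + c * x) *\<^sub>R (exp (- (0 + c * x)\<^sup>2) * (0 + c * x) ^ (2 * k))) ((Gamma (real k + 1 / 2) / 2) /\<^sub>R \<bar>c\<bar>)"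
    using gaussian_moment_even_pos[of k] c(1) unfolding V
    by (subst lborel_has_bochner_integral_real_affine_iff[symmetric]) auto
  then have "has_bochner_integral lborel (\<lambda>x. (1 / c ^ (2 * k)) * (indicator {0..} (0 + c * x) *\<^sub>R (exp (- (0 + c * x)\<^sup>2) * (0 + c * x) ^ (2 * k))))
     ((1 / c ^ (2 * k)) * ((Gamma (real k + 1 / 2) / 2) /\<^sub>R \<bar>c\<bar>))"
    by (rule has_bochner_integral_mult_right)
  moreover have "(1 / c ^ (2 * k)) * (indicator {0..} (0 + c * x) *\<^sub>R (exp (- (0 + c * x)\<^sup>2) * (0 + c * x) ^ (2 * k))) =
     indicator {0..} x *\<^sub>R (gauss s x * x ^ (2 * k))" for x
  proof -
    have "indicat_real {0..} (0 + c * x) = indicator {0..} x" 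
      unfolding indicator_def using c(1) zero_le_mult_iff[of c x] by auto
    moreover have "exp (- (0 + c * x)\<^sup>2) = gauss s x" using c(2) by (simp add: gauss_def power_mult_distrib)
    moreover have "(0 + c * x) ^ (2 * k) = c ^ (2 * k) * x ^ (2 * k)" by (simp only: add_0 power_mult_distrib)
    ultimately have "(1 / c ^ (2 * k)) * (indicator {0..} (0 + c * x) *\<^sub>R (exp (- (0 + c * x)\<^sup>2) * (0 + c * x) ^ (2 * k))) =
      (1 / c ^ (2 * k)) * (indicator {0..} x *\<^sub>R (gauss s x * (c ^ (2 * k) * x ^ (2 * k))))" by (simp only:)
    also have "\<dots> = ((1 / c ^ (2 * k)) * c ^ (2 * k)) * (indicator {0..} x *\<^sub>R (gauss s x * x ^ (2 * k)))"
      by (simp only: real_scaleR_def mult_ac)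
    also have "(1 / c ^ (2 * k)) * c ^ (2 * k) = 1" using c0(2) unfolding times_divide_eq_left mult_1 by (rule divide_self)
    finally show ?thesis by (simp only: mult_1)
  qed
  moreover have "(1 / c ^ (2 * k)) * ((Gamma (real k + 1 / 2) / 2) /\<^sub>R \<bar>c\<bar>) = Gamma (real k + 1 / 2) / (2 * c ^ (2 * k + 1))"
  proof -
    have "(1 / q) * ((G / 2) /\<^sub>R d) = G / (2 * (q * d))" for G q d :: real
      unfolding real_scaleR_def divide_inverse inverse_mult_distrib mult_1 by (simp only: mult_ac)
    moreover have "c ^ (2 * k + 1) = c ^ (2 * k) * c" by simp
    ultimately show ?thesis unfolding c0(3) by (simp only:)
  qed
  ultimately show ?thesis unfolding c_def by (simp only:)
qed

lemma gaussian_moment_fbM: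
  assumes s: "s > 0"
  shows "integrable (fbM m) (\<lambda>x. gauss s x * x ^ (2 * n))"
    and "(\<integral>x. gauss s x * x ^ (2 * n) \<partial>fbM m) = Gamma (real n + real m + 3 / 2) / Gamma (real m + 3 / 2) * (gauss_mass m s / (pi * s) ^ n)"
proof -
  let ?k = "n + m + 1" and ?C = "2 * sqrt pi ^ (2 * m + 3) / Gamma (real m + 3 / 2)"
  have eq: "indicat_real {0..} x *\<^sub>R (fb_weight m x * (gauss s x * x ^ (2 * n))) = ?C * (indicator {0..} x *\<^sub>R (gauss s x * x ^ (2 * ?k)))" for x
  proof -
    have "x ^ (2 * ?k) = x ^ (2 * m + 2) * x ^ (2 * n)" unfolding power_add[symmetric] by (simp add: algebra_simps)
    then show ?thesis unfolding fb_weight_def real_scaleR_def by (simp only: mult_ac)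
  qed
  have H: "has_bochner_integral lborel (\<lambda>x. indicat_real {0..} x *\<^sub>R (fb_weight m x * (gauss s x * x ^ (2 * n))))
     (?C * (Gamma (real ?k + 1 / 2) / (2 * sqrt (pi * s) ^ (2 * ?k + 1))))"
    unfolding eq by (rule has_bochner_integral_mult_right) (rule half_line_gaussian_moment[OF s])
  show "integrable (fbM m) (\<lambda>x. gauss s x * x ^ (2 * n))"
    using H by (subst fbM_borel_integral(1)) (auto simp: set_integrable_def has_bochner_integral_iff)
  have "(\<integral>x. gauss s x * x ^ (2 * n) \<partial>fbM m) = ?C * (Gamma (real ?k + 1 / 2) / (2 * sqrt (pi * s) ^ (2 * ?k + 1)))"
    using H by (subst fbM_borel_integral(2)) (auto simp: set_lebesgue_integral_def has_bochner_integral_iff)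
  also have "\<dots> = Gamma (real n + real m + 3 / 2) / Gamma (real m + 3 / 2) * (gauss_mass m s / (pi * s) ^ n)"
  proof -
    have "real ?k + 1 / 2 = real n + real m + 3 / 2" by simp
    moreover have "sqrt (pi * s) ^ (2 * ?k + 1) = sqrt pi ^ (2 * m + 3) * sqrt s ^ (2 * m + 3) * (pi * s) ^ n"
    proof -
      have "2 * ?k + 1 = (2 * m + 3) + 2 * n" by simp
      then have "sqrt (pi * s) ^ (2 * ?k + 1) = sqrt (pi * s) ^ (2 * m + 3) * (sqrt (pi * s))\<^sup>2 ^ n"
        by (simp only: power_add power_mult)
      then show ?thesis using s by (simp add: real_sqrt_mult power_mult_distrib)
    qed
    moreover have "2 * p / g * (G / (2 * (p * q * r))) = G / g * (1 / q / r)" if "p \<noteq> 0" for p g G q r :: real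
      using that by (simp add: divide_simps)
    moreover have "sqrt pi ^ (2 * m + 3) \<noteq> 0" by simp
    ultimately show ?thesis unfolding gauss_mass_def by (simp only: not_False_eq_True)
  qed
  finally show "(\<integral>x. gauss s x * x ^ (2 * n) \<partial>fbM m) = Gamma (real n + real m + 3 / 2) / Gamma (real m + 3 / 2) * (gauss_mass m s / (pi * s) ^ n)" .
qed

lemma gauss_integrable: "s > 0 \<Longrightarrow> integrable (fbM m) (gauss s)"
  and gauss_integral: "s > 0 \<Longrightarrow> (\<integral>x. gauss s x \<partial>fbM m) = gauss_mass m s"
  using gaussian_moment_fbM[of s m 0] Gamma_pos_half[of m] by simp_all

text \<open>Integrate the power series of the Bessel function term by term; the Gaussian moments cancel the Gamma
  factors of the coefficients and an exponential series remains.\<close>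

lemma gauss_transform:
  assumes s: "s > 0"
  shows "fb_integral (real m + 1 / 2) (gauss s) y = gauss_mass m s * gauss (1 / s) y"
proof -
  let ?G = "Gamma (real m + 3 / 2) :: real"
  let ?b = "\<lambda>n. ?G * hbessel_coeff (Suc m) n * (pi * y) ^ (2 * n)"
  let ?f = "\<lambda>n x. ?b n * (gauss s x * x ^ (2 * n))"
  have j: "(\<lambda>n. ?G * (hbessel_coeff (Suc m) n * (pi * x * y) ^ (2 * n))) sums bessel_j (real m + 1 / 2) (2 * pi * x * y)" for x
  proof -
    have "(\<lambda>n. of_real ?G * (of_real (hbessel_coeff (Suc m) n) * (complex_of_real (2 * pi * x * y) / 2) ^ (2 * n))) sums
      (of_real ?G * hbessel (Suc m) (of_real (2 * pi * x * y)))" by (intro sums_mult hbessel_sums)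
    then have "(\<lambda>n. of_real ?G * (of_real (hbessel_coeff (Suc m) n) * (complex_of_real (2 * pi * x * y) / 2) ^ (2 * n))) sums
      of_real (bessel_j (real m + 1 / 2) (2 * pi * x * y))" unfolding bessel_j_hbessel .
    from sums_Re[OF this] show ?thesis by (simp add: mult.assoc)
  qed
  have fj: "(\<lambda>n. ?f n x) sums (gauss s x * bessel_j (real m + 1 / 2) (2 * pi * x * y))" for x
  proof -
    have "?f n x = gauss s x * (?G * (hbessel_coeff (Suc m) n * (pi * x * y) ^ (2 * n)))" for n
      by (simp add: power_mult_distrib mult_ac)
    then show ?thesis using sums_mult[OF j[of x], of "gauss s x"] by (simp only:)
  qed
  have int: "integrable (fbM m) (?f n)" for n by (intro integrable_mult_right gaussian_moment_fbM(1)[OF s])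
  have coeff: "?G * hbessel_coeff (Suc m) n * (Gamma (real n + real m + 3 / 2) / ?G) = (-1) ^ n / fact n" for n
  proof -
    have "real n + real (Suc m) + 1 / 2 = real n + real m + 3 / 2" by simp
    moreover have "Gamma (real n + real m + 3 / 2) > (0 :: real)" by (rule Gamma_real_pos) (simp add: add_nonneg_pos)
    ultimately show ?thesis unfolding hbessel_coeff_def using Gamma_pos_half[of m]
      by (simp only:) (simp add: less_imp_neq[symmetric])
  qed
  have pw: "(pi * y) ^ (2 * n) / (pi * s) ^ n = (pi * (1 / s) * y\<^sup>2) ^ n" for n
    
  proof -
    have "pi * (1 / s) * y\<^sup>2 = (pi * y)\<^sup>2 / (pi * s)" using s by (simp add: power2_eq_square)
    then show ?thesis by (simp only: power_divide power_mult)
  qed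
  have val: "integral\<^sup>L (fbM m) (?f n) = gauss_mass m s * ((-1) ^ n / fact n * (pi * (1 / s) * y\<^sup>2) ^ n)" for n
  proof -
    have "integral\<^sup>L (fbM m) (?f n) = ?b n * (Gamma (real n + real m + 3 / 2) / ?G * (gauss_mass m s / (pi * s) ^ n))"
      unfolding integral_mult_right_zero gaussian_moment_fbM(2)[OF s] ..
    also have "\<dots> = (?G * hbessel_coeff (Suc m) n * (Gamma (real n + real m + 3 / 2) / ?G)) * (gauss_mass m s * ((pi * y) ^ (2 * n) / (pi * s) ^ n))"
      by (simp only: times_divide_eq_left times_divide_eq_right mult_ac)
    finally show ?thesis unfolding coeff pw by (simp only: mult_ac)
  qed
  have absval: "(\<integral>x. norm (?f n x) \<partial>fbM m) = gauss_mass m s * (1 / fact n * (pi * (1 / s) * y\<^sup>2) ^ n)" for n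
  proof -
    have "norm (?f n x) = \<bar>?b n\<bar> * (gauss s x * x ^ (2 * n))" for x
      using gauss_pos[of s x] by (simp add: abs_mult power_abs[symmetric] power_mult)
    then have "(\<integral>x. norm (?f n x) \<partial>fbM m) = \<bar>?b n\<bar> * (\<integral>x. gauss s x * x ^ (2 * n) \<partial>fbM m)" by simp
    also have "\<dots> = \<bar>?b n * (\<integral>x. gauss s x * x ^ (2 * n) \<partial>fbM m)\<bar>"
    proof -
      have "(\<integral>x. gauss s x * x ^ (2 * n) \<partial>fbM m) \<ge> 0"
        by (rule Bochner_Integration.integral_nonneg) (simp add: less_imp_le[OF gauss_pos] power_mult)
      then show ?thesis by (simp add: abs_mult)
    qed
    also have "?b n * (\<integral>x. gauss s x * x ^ (2 * n) \<partial>fbM m) = integral\<^sup>L (fbM m) (?f n)" by simp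
    also have "\<bar>integral\<^sup>L (fbM m) (?f n)\<bar> = gauss_mass m s * (1 / fact n * (pi * (1 / s) * y\<^sup>2) ^ n)"
      unfolding val using s by (simp add: abs_mult power_abs gauss_mass_def)
    finally show ?thesis .
  qed
  have "(\<lambda>n. integral\<^sup>L (fbM m) (?f n)) sums (\<integral>x. (\<Sum>n. ?f n x) \<partial>fbM m)"
  proof (rule sums_integral[OF int])
    show "AE x in fbM m. summable (\<lambda>n. norm (?f n x))"
    proof (rule AE_I2)
      fix x
      have "summable (\<lambda>n. \<bar>?G\<bar> * gauss s x * (2 * (inverse (fact n) * ((pi * x * y)\<^sup>2) ^ n)))"
        by (intro summable_mult summable_exp)
      then show "summable (\<lambda>n. norm (?f n x))"
      proof (rule summable_comparison_test')
        fix n :: nat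
        have "norm (norm (?f n x)) = \<bar>?G\<bar> * gauss s x * (\<bar>hbessel_coeff (Suc m) n\<bar> * ((pi * x * y)\<^sup>2) ^ n)"
        proof -
          have "((pi * x * y)\<^sup>2) ^ n = (pi * y) ^ (2 * n) * x ^ (2 * n)"
            unfolding power_mult power_mult_distrib[symmetric] by (simp add: mult_ac)
          moreover have "\<bar>(pi * y) ^ (2 * n)\<bar> = (pi * y) ^ (2 * n)" "\<bar>x ^ (2 * n)\<bar> = x ^ (2 * n)" by simp_all
          ultimately show ?thesis using gauss_pos[of s x]
            by (simp only: real_norm_def abs_mult abs_abs abs_of_pos mult_ac)
        qed
        also have "\<dots> \<le> \<bar>?G\<bar> * gauss s x * (2 / fact n * ((pi * x * y)\<^sup>2) ^ n)"
          using gauss_pos[of s x] by (intro mult_left_mono mult_right_mono hbessel_coeff_bound) auto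
        finally show "norm (norm (?f n x)) \<le> \<bar>?G\<bar> * gauss s x * (2 * (inverse (fact n) * ((pi * x * y)\<^sup>2) ^ n))"
          by (simp only: divide_inverse mult.assoc)
      qed
    qed
    have "summable (\<lambda>n. gauss_mass m s * (inverse (fact n) * (pi * (1 / s) * y\<^sup>2) ^ n))"
      by (intro summable_mult summable_exp)
    then show "summable (\<lambda>n. \<integral>x. norm (?f n x) \<partial>fbM m)" unfolding absval by (simp add: divide_inverse)
  qed
  then have "(\<lambda>n. integral\<^sup>L (fbM m) (?f n)) sums fb_integral (real m + 1 / 2) (gauss s) y"
    unfolding fb_integral_def sums_unique[OF fj, symmetric] .
  moreover have "(\<lambda>n. gauss_mass m s * ((-1) ^ n / fact n * (pi * (1 / s) * y\<^sup>2) ^ n)) sums (gauss_mass m s * gauss (1 / s) y)"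
  proof -
    have "(\<lambda>n. (- (pi * (1 / s) * y\<^sup>2)) ^ n /\<^sub>R fact n) sums exp (- (pi * (1 / s) * y\<^sup>2))" by (rule exp_converges)
    moreover have "(- (pi * (1 / s) * y\<^sup>2)) ^ n /\<^sub>R fact n = (-1) ^ n / fact n * (pi * (1 / s) * y\<^sup>2) ^ n" for n
      unfolding power_minus[of "pi * (1 / s) * y\<^sup>2"] by (simp add: divide_inverse)
    ultimately show ?thesis unfolding gauss_def by (intro sums_mult) (simp only:)
  qed
  ultimately show ?thesis unfolding val using sums_unique2 by blast
qed

text \<open>The first identity says that the transform preserves the inner product of \<open>gauss s\<close> and \<open>gauss t\<close>, the
  second that applying it twice to \<open>gauss s\<close> gives \<open>gauss s\<close> back.\<close>

lemma gauss_mass_dual: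
  assumes "s > 0" "t > 0"
  shows "gauss_mass m s * gauss_mass m t * gauss_mass m (1 / s + 1 / t) = gauss_mass m (s + t)"
    and "gauss_mass m s * gauss_mass m (1 / s) = 1"
proof -
  have "sqrt s * sqrt t * sqrt (1 / s + 1 / t) = sqrt (s + t)"
  proof -
    have "s * t * (1 / s + 1 / t) = s + t" using assms by (simp add: field_simps)
    then show ?thesis by (metis real_sqrt_mult)
  qed
  then have "(sqrt s * sqrt t * sqrt (1 / s + 1 / t)) ^ (2 * m + 3) = sqrt (s + t) ^ (2 * m + 3)" by simp
  then show "gauss_mass m s * gauss_mass m t * gauss_mass m (1 / s + 1 / t) = gauss_mass m (s + t)"
    unfolding gauss_mass_def power_mult_distrib by simp
  have "sqrt s * sqrt (1 / s) = 1" using assms by (simp flip: real_sqrt_mult)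
  then have "(sqrt s * sqrt (1 / s)) ^ (2 * m + 3) = 1" by simp
  then show "gauss_mass m s * gauss_mass m (1 / s) = 1"
    unfolding gauss_mass_def power_mult_distrib by simp
qed

section \<open>Density of Gaussian combinations\<close>

text \<open>Natural exponents suffice: such sums are the polynomials without constant term in \<open>gauss 1\<close>.\<close>

definition gauss_sum :: "(nat \<Rightarrow> real) \<Rightarrow> nat \<Rightarrow> real \<Rightarrow> real" where
  "gauss_sum a n x = (\<Sum>i<n. a i * gauss (real (Suc i)) x)"

definition gauss_approximable :: "nat \<Rightarrow> (real \<Rightarrow> real) \<Rightarrow> bool" where
  "gauss_approximable m h \<longleftrightarrow> (\<forall>e>0. \<exists>a n. (\<integral>x. (h x - gauss_sum a n x)\<^sup>2 \<partial>fbM m) < e)"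

lemma square_integrable_scale_add:
  fixes f g :: "'a \<Rightarrow> real"
  assumes [measurable]: "f \<in> borel_measurable M" "g \<in> borel_measurable M"
    and f: "integrable M (\<lambda>x. (f x)\<^sup>2)" and g: "integrable M (\<lambda>x. (g x)\<^sup>2)"
  shows "integrable M (\<lambda>x. (f x + c * g x)\<^sup>2)"
proof (rule Bochner_Integration.integrable_bound)
  show "integrable M (\<lambda>x. 2 * (f x)\<^sup>2 + 2 * (c\<^sup>2 * (g x)\<^sup>2))" using f g by simp
  have "(a + b)\<^sup>2 \<le> 2 * a\<^sup>2 + 2 * b\<^sup>2" for a b :: real using zero_le_power2[of "a - b"] by (simp add: power2_eq_square algebra_simps)
  from this[of "f _" "c * g _"] show "AE x in M. norm ((f x + c * g x)\<^sup>2) \<le> norm (2 * (f x)\<^sup>2 + 2 * (c\<^sup>2 * (g x)\<^sup>2))"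
    by (simp add: power_mult_distrib)
qed measurable

lemma square_integrable_diff:
  fixes f g :: "'a \<Rightarrow> real"
  assumes "f \<in> borel_measurable M" "g \<in> borel_measurable M"
    and "integrable M (\<lambda>x. (f x)\<^sup>2)" and "integrable M (\<lambda>x. (g x)\<^sup>2)"
  shows "integrable M (\<lambda>x. (f x - g x)\<^sup>2)"
  using square_integrable_scale_add[OF assms, of "-1"] by simp

lemma square_distance_triangle:
  fixes f g h :: "'a \<Rightarrow> real"
  assumes m: "f \<in> borel_measurable M" "g \<in> borel_measurable M" "h \<in> borel_measurable M"
    and i: "integrable M (\<lambda>x. (f x)\<^sup>2)" "integrable M (\<lambda>x. (g x)\<^sup>2)" "integrable M (\<lambda>x. (h x)\<^sup>2)"
  shows "(\<integral>x. (f x - h x)\<^sup>2 \<partial>M) \<le> 2 * (\<integral>x. (f x - g x)\<^sup>2 \<partial>M) + 2 * (\<integral>x. (g x - h x)\<^sup>2 \<partial>M)"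
proof -
  note d = square_integrable_diff[OF m(1,2) i(1,2)] square_integrable_diff[OF m(2,3) i(2,3)] square_integrable_diff[OF m(1,3) i(1,3)]
  have "(\<integral>x. (f x - h x)\<^sup>2 \<partial>M) \<le> (\<integral>x. 2 * (f x - g x)\<^sup>2 + 2 * (g x - h x)\<^sup>2 \<partial>M)"
  proof (rule integral_mono[OF d(3)])
    show "integrable M (\<lambda>x. 2 * (f x - g x)\<^sup>2 + 2 * (g x - h x)\<^sup>2)" using d by simp
    fix x
    show "(f x - h x)\<^sup>2 \<le> 2 * (f x - g x)\<^sup>2 + 2 * (g x - h x)\<^sup>2"
      using zero_le_power2[of "(f x - g x) - (g x - h x)"] by (simp add: power2_eq_square algebra_simps)
  qed
  also have "\<dots> = 2 * (\<integral>x. (f x - g x)\<^sup>2 \<partial>M) + 2 * (\<integral>x. (g x - h x)\<^sup>2 \<partial>M)" using d by simp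
  finally show ?thesis .
qed

lemma gauss_fbM_measurable [measurable]: "gauss s \<in> borel_measurable (fbM m)"
  by (rule borel_measurable_fbM) simp

lemma gauss_square: "(gauss s x)\<^sup>2 = gauss (2 * s) x"
  by (simp add: power2_eq_square gauss_mult)

lemma gauss_square_integrable: "s > 0 \<Longrightarrow> integrable (fbM m) (\<lambda>x. (gauss s x)\<^sup>2)"
  unfolding gauss_square by (rule gauss_integrable) simp

lemma gauss_sum_measurable [measurable]: "gauss_sum a n \<in> borel_measurable (fbM m)"
  unfolding gauss_sum_def[abs_def] by measurable

lemma gauss_sum_square_integrable: "integrable (fbM m) (\<lambda>x. (gauss_sum a n x)\<^sup>2)"
proof (induction n)
  case 0
  show ?case by (simp add: gauss_sum_def)
next
  case (Suc n)
  have "integrable (fbM m) (\<lambda>x. (gauss_sum a n x + a n * gauss (real (Suc n)) x)\<^sup>2)"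
    by (rule square_integrable_scale_add[OF _ _ Suc gauss_square_integrable]) simp_all
  then show ?case by (simp add: gauss_sum_def)
qed

lemma gauss_approximable_limit:
  assumes m: "h \<in> borel_measurable (fbM m)" "\<And>i::nat. H i \<in> borel_measurable (fbM m)"
    and i: "integrable (fbM m) (\<lambda>x. (h x)\<^sup>2)" "\<And>i. integrable (fbM m) (\<lambda>x. (H i x)\<^sup>2)"
    and lim: "(\<lambda>i. \<integral>x. (h x - H i x)\<^sup>2 \<partial>fbM m) \<longlonglongrightarrow> 0"
    and H: "\<And>i. gauss_approximable m (H i)"
  shows "gauss_approximable m h"
  unfolding gauss_approximable_def
proof (intro allI impI)
  fix e :: real assume e: "e > 0"
  have "eventually (\<lambda>i. (\<integral>x. (h x - H i x)\<^sup>2 \<partial>fbM m) < e / 4) sequentially"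
    using lim by (rule order_tendstoD(2)) (use e in simp)
  then obtain i where i': "(\<integral>x. (h x - H i x)\<^sup>2 \<partial>fbM m) < e / 4" by (auto simp: eventually_sequentially)
  have "e / 4 > 0" using e by simp
  then obtain a n where an: "(\<integral>x. (H i x - gauss_sum a n x)\<^sup>2 \<partial>fbM m) < e / 4"
    using H[of i] unfolding gauss_approximable_def by blast
  have "(\<integral>x. (h x - gauss_sum a n x)\<^sup>2 \<partial>fbM m) < e"
    using square_distance_triangle[OF m(1) m(2)[of i] gauss_sum_measurable i(1) i(2)[of i] gauss_sum_square_integrable, of a n] i' an by linarith
  then show "\<exists>a n. (\<integral>x. (h x - gauss_sum a n x)\<^sup>2 \<partial>fbM m) < e" by blast
qed

text \<open>In the variable \<open>v = gauss 1 x\<close> the function becomes \<open>v K v\<close> with \<open>K\<close> continuous on \<open>[0, 1]\<close>, because it vanishes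
  for small \<open>v\<close>. A polynomial uniformly close to \<open>K\<close> gives an error that is a multiple of \<open>gauss 1\<close>, small in
  \<open>L\<^sup>2\<close>.\<close>

lemma continuous_gauss_approximable:
  assumes k: "continuous_on UNIV k" and R: "R > 0" "\<And>x. x \<ge> R \<Longrightarrow> k x = 0"
  shows "gauss_approximable m k"
  unfolding gauss_approximable_def
proof (intro allI impI)
  fix e :: real assume e: "e > 0"
  define v0 where "v0 = gauss 1 R"
  have v0: "0 < v0" "v0 \<le> 1" unfolding v0_def by (simp_all add: gauss_pos gauss_le_1)
  \<comment> \<open>The maximum with \<open>v0\<close> changes nothing for \<open>x \<le> R\<close>; for \<open>x > R\<close> it makes the value \<open>k R = 0\<close>.\<close>
  define K where "K v = k (sqrt (- ln (max v v0) / pi)) / max v v0" for v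
  have mx: "max v v0 > 0" for v using v0 by (simp add: less_max_iff_disj)
  have contK: "continuous_on {0..1} K"
    unfolding K_def
    by (intro continuous_intros continuous_on_compose2[OF k]) (use mx less_imp_neq[OF mx, symmetric] in auto)
  define d where "d = sqrt (e / (gauss_mass m 2 + 1))"
  have mass: "gauss_mass m 2 > 0" unfolding gauss_mass_def by simp
  then have d: "d > 0" "d\<^sup>2 = e / (gauss_mass m 2 + 1)" unfolding d_def using e by simp_all
  obtain p where p: "real_polynomial_function p" "\<And>v. v \<in> {0..1} \<Longrightarrow> \<bar>K v - p v\<bar> < d"
    using Stone_Weierstrass_real_polynomial_function[OF compact_Icc contK d(1)] by blast
  obtain a n where an: "p = (\<lambda>v. \<Sum>i\<le>n. a i * v ^ i)" using p(1) unfolding real_polynomial_function_iff_sum by blast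
  have kK: "k x = gauss 1 x * K (gauss 1 x)" if x: "x \<ge> 0" for x
  proof (cases "x \<le> R")
    case True
    then have "x\<^sup>2 \<le> R\<^sup>2" using x by (intro power_mono)
    then have "v0 \<le> gauss 1 x" unfolding v0_def gauss_def by simp
    then have "max (gauss 1 x) v0 = gauss 1 x" by simp
    moreover have "sqrt (- ln (gauss 1 x) / pi) = x" using x by (simp add: gauss_def)
    ultimately show ?thesis unfolding K_def using gauss_pos[of 1 x] by simp
  next
    case False
    then have "R\<^sup>2 \<le> x\<^sup>2" using R(1) by (intro power_mono) auto
    then have "gauss 1 x \<le> v0" unfolding v0_def gauss_def by simp
    then have "max (gauss 1 x) v0 = v0" by simp
    moreover have "sqrt (- ln v0 / pi) = R" using R(1) by (simp add: v0_def gauss_def)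
    ultimately show ?thesis unfolding K_def using False R(2) by simp
  qed
  have pw: "gauss 1 x ^ Suc i = gauss (real (Suc i)) x" for x i
    unfolding gauss_def exp_of_nat_mult[symmetric] by (simp add: algebra_simps)
  have gs: "gauss 1 x * p (gauss 1 x) = gauss_sum a (Suc n) x" for x
  proof -
    have "gauss 1 x * (a i * gauss 1 x ^ i) = a i * gauss (real (Suc i)) x" for i
      unfolding pw[symmetric] by simp
    then show ?thesis unfolding an gauss_sum_def sum_distrib_left lessThan_Suc_atMost by (simp only:)
  qed
  have bnd: "(k x - gauss_sum a (Suc n) x)\<^sup>2 \<le> d\<^sup>2 * gauss 2 x" if x: "x \<ge> 0" for x
  proof -
    have "gauss 1 x \<in> {0..1}" using gauss_pos[of 1 x] gauss_le_1[of 1 x] by simp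
    then have "\<bar>K (gauss 1 x) - p (gauss 1 x)\<bar> \<le> d" using p(2) less_imp_le by blast
    then have "(K (gauss 1 x) - p (gauss 1 x))\<^sup>2 \<le> d\<^sup>2" using d(1) by (simp add: abs_le_square_iff[symmetric])
    then have "(gauss 1 x)\<^sup>2 * (K (gauss 1 x) - p (gauss 1 x))\<^sup>2 \<le> (gauss 1 x)\<^sup>2 * d\<^sup>2" by (rule mult_left_mono) simp
    moreover have "k x - gauss_sum a (Suc n) x = gauss 1 x * (K (gauss 1 x) - p (gauss 1 x))"
      unfolding gs[symmetric] kK[OF x] by (simp only: right_diff_distrib)
    ultimately show ?thesis unfolding gauss_square by (simp add: power_mult_distrib gauss_square mult.commute)
  qed
  have "(\<integral>x. (k x - gauss_sum a (Suc n) x)\<^sup>2 \<partial>fbM m) \<le> (\<integral>x. d\<^sup>2 * gauss 2 x \<partial>fbM m)"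
  proof (rule integral_mono')
    show "integrable (fbM m) (\<lambda>x. d\<^sup>2 * gauss 2 x)" by (intro integrable_mult_right gauss_integrable) simp
    show "d\<^sup>2 * gauss 2 x \<ge> 0" for x using gauss_pos[of 2 x] by simp
    show "(k x - gauss_sum a (Suc n) x)\<^sup>2 \<le> d\<^sup>2 * gauss 2 x" if "x \<in> space (fbM m)" for x using that bnd by simp
  qed
  also have "\<dots> = e * (gauss_mass m 2 / (gauss_mass m 2 + 1))" by (simp add: gauss_integral d(2))
  also have "\<dots> < e * 1" using mass e by (intro mult_strict_left_mono) simp_all
  finally show "\<exists>a n. (\<integral>x. (k x - gauss_sum a n x)\<^sup>2 \<partial>fbM m) < e" by auto
qed

lemma clip_le:
  fixes B x :: real
  assumes "B \<ge> 0"
  shows "\<bar>max (- B) (min B x)\<bar> \<le> \<bar>x\<bar>" "\<bar>max (- B) (min B x)\<bar> \<le> B"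
  using assms by (auto simp: max_def min_def)

text \<open>A measurable function is almost everywhere a limit of continuous functions. Clipping them to the range
  of \<open>b\<close> and cutting them off beyond \<open>R + 1\<close> makes dominated convergence applicable.\<close>

lemma bounded_gauss_approximable:
  fixes R :: nat
  assumes b: "b \<in> borel_measurable borel" and B: "\<And>x. \<bar>b x\<bar> \<le> B" and R: "\<And>x. x > real R \<Longrightarrow> b x = 0"
  shows "gauss_approximable m b"
proof -
  have B0: "B \<ge> 0" using B[of 0] abs_ge_zero order_trans by blast
  have "b \<in> borel_measurable lebesgue" using b by (intro measurable_completion) simp
  then have "b measurable_on UNIV" by (rule lebesgue_measurable_imp_measurable_on) simp
  then obtain Z c where Z: "negligible Z" and c: "\<And>n. continuous_on UNIV (c n)"
    and lim: "\<And>x. x \<notin> Z \<Longrightarrow> (\<lambda>n. c n x) \<longlonglongrightarrow> b x"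
    unfolding measurable_on_def by auto
  define H where "H n x = max (- B) (min B (c n x)) * max 0 (min 1 (real (Suc R) - x))" for n :: nat and x
  have contH: "continuous_on UNIV (H n)" for n
    unfolding H_def by (intro continuous_intros c)
  have Hb: "\<bar>H n x\<bar> \<le> B" for n x
  proof -
    have "\<bar>H n x\<bar> \<le> B * 1" unfolding H_def abs_mult using clip_le(2)[OF B0] B0 by (intro mult_mono) auto
    then show ?thesis by simp
  qed
  have H0: "H n x = 0" if "x \<ge> real (Suc R)" for n x unfolding H_def using that by simp
  have meas: "H n \<in> borel_measurable (fbM m)" for n
    by (intro borel_measurable_fbM borel_measurable_continuous_onI contH)
  have bm: "b \<in> borel_measurable (fbM m)" by (rule borel_measurable_fbM) fact
  \<comment> \<open>The bound \<open>2 B\<close> serves for \<open>b\<close>, for its approximants and for their difference.\<close>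
  have fin: "integrable (fbM m) (\<lambda>x. (2 * B)\<^sup>2 * indicator {0..real (Suc R)} x)"
    by (intro integrable_mult_right fbM_finite_interval(1))
  have dom: "(u x)\<^sup>2 \<le> (2 * B)\<^sup>2 * indicator {0..real (Suc R)} x" if "\<bar>u x\<bar> \<le> 2 * B" "x > real (Suc R) \<Longrightarrow> u x = 0" "x \<ge> 0" for u x
  proof (cases "x > real (Suc R)")
    case False
    have "(u x)\<^sup>2 \<le> (2 * B)\<^sup>2" using that(1) by (rule abs_le_square_iff[THEN iffD1, OF order_trans]) simp
    then show ?thesis using False that(3) by simp
  qed (use that(2) in simp)
  have sqH: "integrable (fbM m) (\<lambda>x. (H n x)\<^sup>2)" for n
  proof (rule Bochner_Integration.integrable_bound[OF fin])
    have "(H n x)\<^sup>2 \<le> (2 * B)\<^sup>2 * indicator {0..real (Suc R)} x" if "x \<ge> 0" for x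
      by (rule dom) (use Hb[of n x] B0 H0[of x n] that in auto)
    then show "AE x in fbM m. norm ((H n x)\<^sup>2) \<le> norm ((2 * B)\<^sup>2 * indicat_real {0..real (Suc R)} x)"
      by (intro AE_I2) simp
  qed (intro borel_measurable_power meas)
  have sqb: "integrable (fbM m) (\<lambda>x. (b x)\<^sup>2)"
  proof (rule Bochner_Integration.integrable_bound[OF fin])
    have "(b x)\<^sup>2 \<le> (2 * B)\<^sup>2 * indicator {0..real (Suc R)} x" if "x \<ge> 0" for x
      by (rule dom) (use B[of x] B0 R[of x] that in auto)
    then show "AE x in fbM m. norm ((b x)\<^sup>2) \<le> norm ((2 * B)\<^sup>2 * indicat_real {0..real (Suc R)} x)"
      by (intro AE_I2) simp
  qed (intro borel_measurable_power bm)
  have "(\<lambda>n. \<integral>x. (b x - H n x)\<^sup>2 \<partial>fbM m) \<longlonglongrightarrow> (\<integral>x. 0 \<partial>fbM m)"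
  proof (rule integral_dominated_convergence[OF _ _ fin])
    show "(\<lambda>x. (b x - H n x)\<^sup>2) \<in> borel_measurable (fbM m)" for n by (intro borel_measurable_power borel_measurable_diff bm meas)
    have "(b x - H n x)\<^sup>2 \<le> (2 * B)\<^sup>2 * indicator {0..real (Suc R)} x" if "x \<ge> 0" for x n
      by (rule dom) (use B[of x] Hb[of n x] R[of x] H0[of x n] that in auto)
    then show "AE x in fbM m. norm ((b x - H n x)\<^sup>2) \<le> (2 * B)\<^sup>2 * indicat_real {0..real (Suc R)} x" for n
      by (intro AE_I2) simp
    have lm: "(\<lambda>n. (b x - H n x)\<^sup>2) \<longlonglongrightarrow> 0" if x: "x \<notin> Z" for x
    proof -
      have "(\<lambda>n. H n x) \<longlonglongrightarrow> max (- B) (min B (b x)) * max 0 (min 1 (real (Suc R) - x))"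
        unfolding H_def by (intro tendsto_intros lim x)
      moreover have "max (- B) (min B (b x)) * max 0 (min 1 (real (Suc R) - x)) = b x"
      proof (cases "x > real R")
        case True
        then show ?thesis using R[of x] B0 by simp
      next
        case False
        then show ?thesis using B[of x] by (simp add: abs_le_iff max_def min_def)
      qed
      ultimately have "(\<lambda>n. (b x - H n x)\<^sup>2) \<longlonglongrightarrow> (b x - b x)\<^sup>2" by (intro tendsto_intros) simp
      then show ?thesis by simp
    qed
    have "Z \<in> null_sets lebesgue" using Z by (simp add: negligible_iff_null_sets)
    then have "AE x in lebesgue. x \<notin> Z" by (rule AE_not_in)
    then have "AE x in lborel. x \<notin> Z" by (simp add: AE_completion_iff)
    then have "AE x in fbM m. x \<notin> Z" by (rule AE_fbM_of_lborel)
    then show "AE x in fbM m. (\<lambda>n. (b x - H n x)\<^sup>2) \<longlonglongrightarrow> 0" by eventually_elim (rule lm)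
  qed simp
  then have "(\<lambda>n. \<integral>x. (b x - H n x)\<^sup>2 \<partial>fbM m) \<longlonglongrightarrow> 0" by simp
  then have lim: "(\<lambda>n. \<integral>x. (b x - H n x)\<^sup>2 \<partial>fbM m) \<longlonglongrightarrow> 0" .
  have ap: "gauss_approximable m (H n)" for n
    by (rule continuous_gauss_approximable[OF contH, of "real (Suc R)"]) (use H0 in auto)
  show ?thesis by (rule gauss_approximable_limit[where H = H, OF bm meas sqb sqH lim ap])
qed

lemma gauss_approximable_cong_AE:
  assumes "AE x in fbM m. h x = h' x" "h \<in> borel_measurable (fbM m)" "h' \<in> borel_measurable (fbM m)" "gauss_approximable m h'"
  shows "gauss_approximable m h"
proof -
  have "(\<integral>x. (h x - gauss_sum a n x)\<^sup>2 \<partial>fbM m) = (\<integral>x. (h' x - gauss_sum a n x)\<^sup>2 \<partial>fbM m)" for a n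
  proof (rule integral_cong_AE)
    show "AE x in fbM m. (h x - gauss_sum a n x)\<^sup>2 = (h' x - gauss_sum a n x)\<^sup>2" using assms(1) by eventually_elim simp
  qed (intro borel_measurable_power borel_measurable_diff assms gauss_sum_measurable)+
  then show ?thesis using assms(4) by (simp add: gauss_approximable_def)
qed

text \<open>Truncate the values and the support at height and radius \<open>j\<close>.\<close>

lemma square_integrable_gauss_approximable:
  assumes g: "g \<in> borel_measurable (fbM m)" and sq: "integrable (fbM m) (\<lambda>x. (g x)\<^sup>2)"
  shows "gauss_approximable m g"
proof -
  obtain g' where g'[measurable]: "g' \<in> borel_measurable borel" and eq: "AE x in fbM m. g x = g' x"
    using fbM_borel_version[OF g] by blast
  have gm: "g' \<in> borel_measurable (fbM m)" by (rule borel_measurable_fbM) fact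
  have sq': "integrable (fbM m) (\<lambda>x. (g' x)\<^sup>2)"
  proof -
    have "AE x in fbM m. (g x)\<^sup>2 = (g' x)\<^sup>2" using eq by eventually_elim simp
    then show ?thesis using sq integrable_cong_AE[OF borel_measurable_power[OF g] borel_measurable_power[OF gm]] by blast
  qed
  define H where "H j x = max (- real j) (min (real j) (g' x)) * indicator {..real j} x" for j :: nat and x
  have Hm[measurable]: "H j \<in> borel_measurable borel" for j unfolding H_def by measurable
  have Hm': "H j \<in> borel_measurable (fbM m)" for j by (rule borel_measurable_fbM) simp
  have Hg: "\<bar>H j x\<bar> \<le> \<bar>g' x\<bar>" for j x
    unfolding H_def abs_mult using clip_le(1)[of "real j" "g' x"] by (simp add: indicator_def)
  have Hj: "\<bar>H j x\<bar> \<le> real j" for j x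
    unfolding H_def abs_mult using clip_le(2)[of "real j" "g' x"] by (simp add: indicator_def)
  have ap: "gauss_approximable m (H j)" for j
    by (rule bounded_gauss_approximable[OF Hm Hj, of j]) (simp_all add: H_def)
  have sqH: "integrable (fbM m) (\<lambda>x. (H j x)\<^sup>2)" for j
    using sq' by (rule Bochner_Integration.integrable_bound) (use Hm' Hg in \<open>simp_all add: abs_le_square_iff[symmetric]\<close>)
  have lim: "(\<lambda>j. \<integral>x. (g' x - H j x)\<^sup>2 \<partial>fbM m) \<longlonglongrightarrow> (\<integral>x. 0 \<partial>fbM m)"
  proof (rule integral_dominated_convergence)
    show "integrable (fbM m) (\<lambda>x. 4 * (g' x)\<^sup>2)" using sq' by simp
    have "norm ((g' x - H j x)\<^sup>2) \<le> 4 * (g' x)\<^sup>2" for j x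
    proof -
      have "\<bar>g' x - H j x\<bar> \<le> \<bar>2 * g' x\<bar>" using Hg[of j x] by linarith
      then show ?thesis by (simp add: abs_le_square_iff power_mult_distrib)
    qed
    then show "AE x in fbM m. norm ((g' x - H j x)\<^sup>2) \<le> 4 * (g' x)\<^sup>2" for j by simp
    have "(\<lambda>j. (g' x - H j x)\<^sup>2) \<longlonglongrightarrow> 0" for x
    proof (rule tendsto_eventually)
      obtain J :: nat where J: "max \<bar>x\<bar> \<bar>g' x\<bar> \<le> real J" using real_arch_simple by blast
      have "(g' x - H j x)\<^sup>2 = 0" if "j \<ge> J" for j
      proof -
        have "real j \<ge> \<bar>x\<bar>" "real j \<ge> \<bar>g' x\<bar>" using J that by linarith+
        then show ?thesis unfolding H_def by (simp add: abs_le_iff max_def min_def)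
      qed
      then show "eventually (\<lambda>j. (g' x - H j x)\<^sup>2 = 0) sequentially" unfolding eventually_sequentially by blast
    qed
    then show "AE x in fbM m. (\<lambda>j. (g' x - H j x)\<^sup>2) \<longlonglongrightarrow> 0" by simp
  qed (intro borel_measurable_power borel_measurable_diff borel_measurable_const gm Hm')+
  have "gauss_approximable m g'"
    by (rule gauss_approximable_limit[where H = H, OF gm Hm' sq' sqH lim[unfolded integral_zero] ap])
  then show ?thesis by (rule gauss_approximable_cong_AE[OF eq g gm])
qed

section \<open>Plancherel bound and inversion\<close>

lemma abs_gauss: "\<bar>gauss s x\<bar> = gauss s x"
  by (rule abs_of_pos) (rule gauss_pos)

lemma abs_powr_two: "\<bar>x\<bar> powr 2 = (x::real)\<^sup>2"
  by (simp add: powr_numeral)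

lemma fb_space_2_iff: "u \<in> fb_space (real m + 1 / 2) 2 \<longleftrightarrow> u \<in> borel_measurable (fbM m) \<and> integrable (fbM m) (\<lambda>x. (u x)\<^sup>2)"
  unfolding fb_space_def abs_powr_two by simp

lemma fb_norm_2: "fb_norm (real m + 1 / 2) 2 u = sqrt (\<integral>x. (u x)\<^sup>2 \<partial>fbM m)"
proof -
  have "(LINT x:{0..}|fbM m. (u x)\<^sup>2) = (\<integral>x. (u x)\<^sup>2 \<partial>fbM m)"
    unfolding set_lebesgue_integral_def by (rule Bochner_Integration.integral_cong) simp_all
  moreover have "(\<integral>x. (u x)\<^sup>2 \<partial>fbM m) \<ge> 0" by simp
  ultimately show ?thesis unfolding fb_norm_on_def abs_powr_two by (simp add: powr_half_sqrt)
qed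

lemma fb_norm_2_tendsto_0:
  assumes "(\<lambda>n. fb_norm (real m + 1 / 2) 2 (u n)) \<longlonglongrightarrow> 0"
  shows "(\<lambda>n. \<integral>x. (u n x)\<^sup>2 \<partial>fbM m) \<longlonglongrightarrow> 0"
proof -
  have "(\<lambda>n. (sqrt (\<integral>x. (u n x)\<^sup>2 \<partial>fbM m))\<^sup>2) \<longlonglongrightarrow> 0\<^sup>2"
    using assms unfolding fb_norm_2 by (rule tendsto_power)
  then show ?thesis by simp
qed

lemma square_pairing_tendsto:
  fixes u w :: "'a \<Rightarrow> real"
  assumes u: "\<And>n::nat. U n \<in> borel_measurable M" "u \<in> borel_measurable M" "w \<in> borel_measurable M"
    and sq: "\<And>n. integrable M (\<lambda>x. (U n x)\<^sup>2)" "integrable M (\<lambda>x. (u x)\<^sup>2)" "integrable M (\<lambda>x. (w x)\<^sup>2)"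
    and lim: "(\<lambda>n. \<integral>x. (U n x - u x)\<^sup>2 \<partial>M) \<longlonglongrightarrow> 0"
  shows "(\<lambda>n. \<integral>x. U n x * w x \<partial>M) \<longlonglongrightarrow> (\<integral>x. u x * w x \<partial>M)"
proof -
  have d: "(\<lambda>x. U n x - u x) \<in> borel_measurable M" for n using u by measurable
  have ds: "integrable M (\<lambda>x. (U n x - u x)\<^sup>2)" for n by (rule square_integrable_diff[OF u(1,2) sq(1,2)])
  have "(\<lambda>n. (\<integral>x. U n x * w x \<partial>M) - (\<integral>x. u x * w x \<partial>M)) \<longlonglongrightarrow> 0"
  proof (rule Lim_null_comparison)
    have "\<bar>(\<integral>x. U n x * w x \<partial>M) - (\<integral>x. u x * w x \<partial>M)\<bar> \<le> sqrt ((\<integral>x. (U n x - u x)\<^sup>2 \<partial>M) * (\<integral>x. (w x)\<^sup>2 \<partial>M))" for n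
    proof -
      have "(\<integral>x. U n x * w x \<partial>M) - (\<integral>x. u x * w x \<partial>M) = (\<integral>x. (U n x - u x) * w x \<partial>M)"
        using integral_cauchy_schwarz(1)[OF u(1,3) sq(1,3), of n] integral_cauchy_schwarz(1)[OF u(2,3) sq(2,3)]
        by (simp add: left_diff_distrib)
      then show ?thesis using integral_cauchy_schwarz(2)[OF d u(3) ds sq(3), of n]
        by (simp add: real_le_rsqrt)
    qed
    then show "eventually (\<lambda>n. norm ((\<integral>x. U n x * w x \<partial>M) - (\<integral>x. u x * w x \<partial>M)) \<le> sqrt ((\<integral>x. (U n x - u x)\<^sup>2 \<partial>M) * (\<integral>x. (w x)\<^sup>2 \<partial>M))) sequentially"
      by simp
    have "(\<lambda>n. sqrt ((\<integral>x. (U n x - u x)\<^sup>2 \<partial>M) * (\<integral>x. (w x)\<^sup>2 \<partial>M))) \<longlonglongrightarrow> sqrt (0 * (\<integral>x. (w x)\<^sup>2 \<partial>M))"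
      by (intro tendsto_intros lim)
    then show "(\<lambda>n. sqrt ((\<integral>x. (U n x - u x)\<^sup>2 \<partial>M) * (\<integral>x. (w x)\<^sup>2 \<partial>M))) \<longlonglongrightarrow> 0" by simp
  qed
  then show ?thesis by (simp add: LIM_zero_cancel)
qed

lemma fb_integral_bounded_measurable:
  assumes h: "integrable (fbM m) h"
  shows "fb_integral (real m + 1 / 2) h \<in> borel_measurable (fbM m)"
    and "\<exists>B. \<forall>y\<ge>0. \<bar>fb_integral (real m + 1 / 2) h y\<bar> \<le> B"
proof -
  interpret sigma_finite_measure "fbM m" by (rule sigma_finite_fbM)
  have hm[measurable]: "h \<in> borel_measurable (fbM m)" using h by simp
  have [measurable]: "(\<lambda>x. x) \<in> borel_measurable (fbM m)" by (rule borel_measurable_fbM) simp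
  show "fb_integral (real m + 1 / 2) h \<in> borel_measurable (fbM m)"
    unfolding fb_integral_def[abs_def] by measurable
  obtain B where B: "B > 0" "\<And>x. x \<ge> 0 \<Longrightarrow> \<bar>bessel_j (real m + 1 / 2) x\<bar> \<le> B" using bessel_j_bounded[of m] by blast
  have "\<bar>fb_integral (real m + 1 / 2) h y\<bar> \<le> (\<integral>x. \<bar>h x\<bar> * B \<partial>fbM m)" if y: "y \<ge> 0" for y
  proof -
    have le: "\<bar>h x * bessel_j (real m + 1 / 2) (2 * pi * x * y)\<bar> \<le> \<bar>h x\<bar> * B" if "x \<ge> 0" for x
      unfolding abs_mult using y that by (intro mult_left_mono B(2)) auto
    have i: "integrable (fbM m) (\<lambda>x. \<bar>h x\<bar> * B)" using h by simp
    have "norm (fb_integral (real m + 1 / 2) h y) \<le> (\<integral>x. norm (h x * bessel_j (real m + 1 / 2) (2 * pi * x * y)) \<partial>fbM m)"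
      unfolding fb_integral_def by (rule integral_norm_bound)
    also have "\<dots> \<le> (\<integral>x. \<bar>h x\<bar> * B \<partial>fbM m)" using le B(1) by (intro integral_mono' i) auto
    finally show ?thesis by simp
  qed
  then show "\<exists>B. \<forall>y\<ge>0. \<bar>fb_integral (real m + 1 / 2) h y\<bar> \<le> B" by blast
qed

text \<open>Fubini's theorem, with the kernel bounded, and the explicit transform of the Gaussian.\<close>

lemma fb_integral_gauss_pairing:
  assumes h: "integrable (fbM m) h" and s: "s > 0"
  shows "(\<integral>y. fb_integral (real m + 1 / 2) h y * gauss s y \<partial>fbM m) = gauss_mass m s * (\<integral>x. h x * gauss (1 / s) x \<partial>fbM m)"
proof -
  interpret sigma_finite_measure "fbM m" by (rule sigma_finite_fbM)
  interpret P: pair_sigma_finite "fbM m" "fbM m" by unfold_locales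
  let ?j = "bessel_j (real m + 1 / 2)"
  let ?F = "\<lambda>x y. h x * ?j (2 * pi * x * y) * gauss s y"
  have hm[measurable]: "h \<in> borel_measurable (fbM m)" using h by simp
  have [measurable]: "(\<lambda>x. x) \<in> borel_measurable (fbM m)" by (rule borel_measurable_fbM) simp
  obtain B where B: "B > 0" "\<And>x. x \<ge> 0 \<Longrightarrow> \<bar>?j x\<bar> \<le> B" using bessel_j_bounded[of m] by blast
  have Fm[measurable]: "case_prod ?F \<in> borel_measurable (fbM m \<Otimes>\<^sub>M fbM m)" by measurable
  have le: "norm (?F x y) \<le> \<bar>h x\<bar> * B * gauss s y" if "x \<ge> 0" "y \<ge> 0" for x y
    unfolding real_norm_def abs_mult abs_gauss using that gauss_pos[of s y] B(1)
    by (intro mult_right_mono mult_left_mono B(2)) auto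
  have iy: "integrable (fbM m) (\<lambda>y. \<bar>h x\<bar> * B * gauss s y)" for x by (intro integrable_mult_right gauss_integrable s)
  have Fi: "integrable (fbM m \<Otimes>\<^sub>M fbM m) (case_prod ?F)"
  proof (rule P.Fubini_integrable[OF Fm])
    show "integrable (fbM m) (\<lambda>x. \<integral>y. norm (case_prod ?F (x, y)) \<partial>fbM m)"
    proof (rule Bochner_Integration.integrable_bound)
      show "integrable (fbM m) (\<lambda>x. \<bar>h x\<bar> * B * gauss_mass m s)" using h by simp
      show "(\<lambda>x. \<integral>y. norm (case_prod ?F (x, y)) \<partial>fbM m) \<in> borel_measurable (fbM m)" by measurable
      show "AE x in fbM m. norm (\<integral>y. norm (case_prod ?F (x, y)) \<partial>fbM m) \<le> norm (\<bar>h x\<bar> * B * gauss_mass m s)"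
      proof (rule AE_I2)
        fix x assume x: "x \<in> space (fbM m)"
        have "(\<integral>y. norm (?F x y) \<partial>fbM m) \<le> (\<integral>y. \<bar>h x\<bar> * B * gauss s y \<partial>fbM m)"
        proof (rule integral_mono'[OF iy])
          show "0 \<le> \<bar>h x\<bar> * B * gauss s y" for y using B(1) gauss_pos[of s y] by simp
        qed (use le x in simp)
        also have "\<dots> = \<bar>h x\<bar> * B * gauss_mass m s" by (simp add: gauss_integral[OF s])
        finally have "(\<integral>y. norm (?F x y) \<partial>fbM m) \<le> \<bar>h x\<bar> * B * gauss_mass m s" .
        moreover have "(\<integral>y. norm (?F x y) \<partial>fbM m) \<ge> 0" by simp
        ultimately show "norm (\<integral>y. norm (case_prod ?F (x, y)) \<partial>fbM m) \<le> norm (\<bar>h x\<bar> * B * gauss_mass m s)"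
          unfolding prod.case real_norm_def by linarith
      qed
    qed
    show "AE x in fbM m. integrable (fbM m) (\<lambda>y. case_prod ?F (x, y))"
    proof (rule AE_I2)
      fix x assume x: "x \<in> space (fbM m)"
      show "integrable (fbM m) (\<lambda>y. case_prod ?F (x, y))"
      proof (rule Bochner_Integration.integrable_bound[OF iy[of x]])
        show "AE y in fbM m. norm (case_prod ?F (x, y)) \<le> norm (\<bar>h x\<bar> * B * gauss s y)"
        proof (rule AE_I2)
          fix y assume "y \<in> space (fbM m)"
          then have "x \<ge> 0" "y \<ge> 0" using x by simp_all
          then show "norm (case_prod ?F (x, y)) \<le> norm (\<bar>h x\<bar> * B * gauss s y)"
            unfolding prod.case real_norm_def[of "\<bar>h x\<bar> * B * gauss s y"] by (rule order_trans[OF le abs_ge_self])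
        qed
      qed (use x in measurable)
    qed
  qed
  have "(\<integral>y. fb_integral (real m + 1 / 2) h y * gauss s y \<partial>fbM m) = (\<integral>y. (\<integral>x. ?F x y \<partial>fbM m) \<partial>fbM m)"
    unfolding fb_integral_def by simp
  also have "\<dots> = (\<integral>x. (\<integral>y. ?F x y \<partial>fbM m) \<partial>fbM m)" by (rule P.Fubini_integral[OF Fi])
  also have "(\<lambda>x. \<integral>y. ?F x y \<partial>fbM m) = (\<lambda>x. gauss_mass m s * (h x * gauss (1 / s) x))"
  proof
    fix x
    have "(\<integral>y. ?F x y \<partial>fbM m) = (\<integral>y. h x * (gauss s y * ?j (2 * pi * y * x)) \<partial>fbM m)"
      by (simp only: mult_ac)
    also have "\<dots> = h x * fb_integral (real m + 1 / 2) (gauss s) x" unfolding fb_integral_def by (rule integral_mult_right_zero)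
    finally show "(\<integral>y. ?F x y \<partial>fbM m) = gauss_mass m s * (h x * gauss (1 / s) x)"
      unfolding gauss_transform[OF s] by (simp only: mult_ac)
  qed
  finally show ?thesis by simp
qed

text \<open>All that is used of the \<open>L\<^sup>2\<close> extension: the identity passes to the limit along the sequence that
  defines it.\<close>

lemma fb_transform_gauss_pairing:
  assumes T: "has_fb_transform (real m + 1 / 2) f g" and s: "s > 0"
  shows "(\<integral>y. g y * gauss s y \<partial>fbM m) = gauss_mass m s * (\<integral>x. f x * gauss (1 / s) x \<partial>fbM m)"
proof -
  let ?T = "fb_integral (real m + 1 / 2)"
  obtain h where h: "\<And>n. h n \<in> fb_space (real m + 1 / 2) 1" "\<And>n. h n \<in> fb_space (real m + 1 / 2) 2"
     "\<And>n. ?T (h n) \<in> fb_space (real m + 1 / 2) 2"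
    and lim: "(\<lambda>n. fb_norm (real m + 1 / 2) 2 (\<lambda>x. h n x - f x)) \<longlonglongrightarrow> 0"
       "(\<lambda>n. fb_norm (real m + 1 / 2) 2 (\<lambda>y. ?T (h n) y - g y)) \<longlonglongrightarrow> 0"
    using T unfolding has_fb_transform_def by blast
  have f: "f \<in> fb_space (real m + 1 / 2) 2" and g: "g \<in> fb_space (real m + 1 / 2) 2" using T unfolding has_fb_transform_def by blast+
  have h1: "integrable (fbM m) (h n)" for n
    using h(1)[of n] unfolding fb_space_def by (auto simp: integrable_abs_iff)
  have s': "1 / s > 0" using s by simp
  have "(\<lambda>n. \<integral>x. h n x * gauss (1 / s) x \<partial>fbM m) \<longlonglongrightarrow> (\<integral>x. f x * gauss (1 / s) x \<partial>fbM m)"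
    using h(2) f gauss_square_integrable[OF s'] fb_norm_2_tendsto_0[OF lim(1)] unfolding fb_space_2_iff
    by (intro square_pairing_tendsto) auto
  then have "(\<lambda>n. gauss_mass m s * (\<integral>x. h n x * gauss (1 / s) x \<partial>fbM m)) \<longlonglongrightarrow> gauss_mass m s * (\<integral>x. f x * gauss (1 / s) x \<partial>fbM m)"
    by (rule tendsto_mult_left)
  moreover have "(\<lambda>n. \<integral>y. ?T (h n) y * gauss s y \<partial>fbM m) \<longlonglongrightarrow> (\<integral>y. g y * gauss s y \<partial>fbM m)"
    using h(3) g gauss_square_integrable[OF s] fb_norm_2_tendsto_0[OF lim(2)] unfolding fb_space_2_iff
    by (intro square_pairing_tendsto) auto
  ultimately show ?thesis unfolding fb_integral_gauss_pairing[OF h1 s] using LIMSEQ_unique by blast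
qed

lemma gauss_combination_square_integral:
  fixes c p :: "nat \<Rightarrow> real"
  assumes p: "\<And>i. p i > 0"
  shows "(\<integral>x. (\<Sum>i<n. c i * gauss (p i) x)\<^sup>2 \<partial>fbM m) = (\<Sum>i<n. \<Sum>k<n. c i * c k * gauss_mass m (p i + p k))"
    and "integrable (fbM m) (\<lambda>x. (\<Sum>i<n. c i * gauss (p i) x)\<^sup>2)"
proof -
  have eq: "(\<Sum>i<n. c i * gauss (p i) x)\<^sup>2 = (\<Sum>i<n. \<Sum>k<n. c i * c k * gauss (p i + p k) x)" for x
  proof -
    have "(c i * gauss (p i) x) * (c k * gauss (p k) x) = c i * c k * gauss (p i + p k) x" for i k
      unfolding gauss_mult[symmetric] by (simp only: mult_ac)
    then show ?thesis unfolding power2_eq_square sum_product by (simp only:)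
  qed
  have pp: "p i + p k > 0" for i k by (rule add_pos_pos[OF p p])
  note i = integrable_mult_right[OF gauss_integrable[OF pp]]
  show "integrable (fbM m) (\<lambda>x. (\<Sum>i<n. c i * gauss (p i) x)\<^sup>2)"
    unfolding eq by (intro Bochner_Integration.integrable_sum i)
  show "(\<integral>x. (\<Sum>i<n. c i * gauss (p i) x)\<^sup>2 \<partial>fbM m) = (\<Sum>i<n. \<Sum>k<n. c i * c k * gauss_mass m (p i + p k))"
  proof -
    have "(\<integral>x. (\<Sum>i<n. c i * gauss (p i) x)\<^sup>2 \<partial>fbM m) = (\<Sum>i<n. \<integral>x. (\<Sum>k<n. c i * c k * gauss (p i + p k) x) \<partial>fbM m)"
      unfolding eq by (intro Bochner_Integration.integral_sum Bochner_Integration.integrable_sum i)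
    also have "\<dots> = (\<Sum>i<n. \<Sum>k<n. \<integral>x. c i * c k * gauss (p i + p k) x \<partial>fbM m)"
      by (intro sum.cong refl Bochner_Integration.integral_sum i)
    finally show ?thesis unfolding integral_mult_right_zero gauss_integral[OF pp] .
  qed
qed

text \<open>Approximate \<open>g\<close> by a Gaussian combination \<open>\<Theta>\<close>. With \<open>q\<close> its transform, \<open>\<langle>g, \<Theta>\<rangle> = \<langle>f, q\<rangle>\<close> and \<open>\<parallel>q\<parallel> = \<parallel>\<Theta>\<parallel>\<close>, so
  \<open>\<parallel>g\<parallel>\<^sup>2 - \<parallel>g - \<Theta>\<parallel>\<^sup>2 = \<parallel>f\<parallel>\<^sup>2 - \<parallel>f - q\<parallel>\<^sup>2 \<le> \<parallel>f\<parallel>\<^sup>2\<close>.\<close>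

lemma fb_transform_norm_le:
  assumes T: "has_fb_transform (real m + 1 / 2) f g"
  shows "(\<integral>x. (g x)\<^sup>2 \<partial>fbM m) \<le> (\<integral>x. (f x)\<^sup>2 \<partial>fbM m)"
proof (rule field_le_epsilon)
  fix e :: real assume e: "e > 0"
  have f: "f \<in> borel_measurable (fbM m)" "integrable (fbM m) (\<lambda>x. (f x)\<^sup>2)"
    and g: "g \<in> borel_measurable (fbM m)" "integrable (fbM m) (\<lambda>x. (g x)\<^sup>2)"
    using T unfolding has_fb_transform_def fb_space_2_iff by blast+
  obtain a n where an: "(\<integral>x. (g x - gauss_sum a n x)\<^sup>2 \<partial>fbM m) < e"
    using square_integrable_gauss_approximable[OF g] e unfolding gauss_approximable_def by blast
  let ?\<Theta> = "gauss_sum a n"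
  define q where "q x = (\<Sum>i<n. (a i * gauss_mass m (real (Suc i))) * gauss (1 / real (Suc i)) x)" for x
  have qm: "q \<in> borel_measurable (fbM m)" unfolding q_def[abs_def] by measurable
  have qi: "integrable (fbM m) (\<lambda>x. (q x)\<^sup>2)" unfolding q_def by (rule gauss_combination_square_integral(2)) simp
  have \<Theta>i: "integrable (fbM m) (\<lambda>x. (?\<Theta> x)\<^sup>2)" by (rule gauss_sum_square_integrable)
  have same: "(\<integral>x. (q x)\<^sup>2 \<partial>fbM m) = (\<integral>x. (?\<Theta> x)\<^sup>2 \<partial>fbM m)"
  proof -
    have "(a i * gauss_mass m (real (Suc i))) * (a k * gauss_mass m (real (Suc k))) * gauss_mass m (1 / real (Suc i) + 1 / real (Suc k)) =
      a i * a k * gauss_mass m (real (Suc i) + real (Suc k))" for i k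
      unfolding gauss_mass_dual(1)[of "real (Suc i)" "real (Suc k)", OF of_nat_0_less_iff[THEN iffD2] of_nat_0_less_iff[THEN iffD2], OF zero_less_Suc zero_less_Suc, symmetric]
      by (simp only: mult_ac)
    then show ?thesis unfolding q_def gauss_sum_def
      by (subst (1 2) gauss_combination_square_integral(1)) (simp_all only: of_nat_0_less_iff zero_less_Suc zero_less_divide_1_iff)
  qed
  have pair: "(\<integral>x. g x * ?\<Theta> x \<partial>fbM m) = (\<integral>x. f x * q x \<partial>fbM m)"
  proof -
    have s: "real (Suc i) > 0" "1 / real (Suc i) > 0" for i by simp_all
    note ig = integral_cauchy_schwarz(1)[OF g(1) gauss_fbM_measurable g(2) gauss_square_integrable[OF s(1)]]
    note if' = integral_cauchy_schwarz(1)[OF f(1) gauss_fbM_measurable f(2) gauss_square_integrable[OF s(2)]]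
    have "(\<integral>x. g x * ?\<Theta> x \<partial>fbM m) = (\<integral>x. (\<Sum>i<n. a i * (g x * gauss (real (Suc i)) x)) \<partial>fbM m)"
      unfolding gauss_sum_def sum_distrib_left by (simp only: mult_ac)
    also have "\<dots> = (\<Sum>i<n. \<integral>x. a i * (g x * gauss (real (Suc i)) x) \<partial>fbM m)"
      by (intro Bochner_Integration.integral_sum integrable_mult_right ig)
    also have "\<dots> = (\<Sum>i<n. \<integral>x. (a i * gauss_mass m (real (Suc i))) * (f x * gauss (1 / real (Suc i)) x) \<partial>fbM m)"
      unfolding integral_mult_right_zero fb_transform_gauss_pairing[OF T s(1)] by (simp only: mult_ac)
    also have "\<dots> = (\<integral>x. (\<Sum>i<n. (a i * gauss_mass m (real (Suc i))) * (f x * gauss (1 / real (Suc i)) x)) \<partial>fbM m)"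
      by (intro Bochner_Integration.integral_sum[symmetric] integrable_mult_right if')
    also have "\<dots> = (\<integral>x. f x * q x \<partial>fbM m)" unfolding q_def sum_distrib_left by (simp only: mult_ac)
    finally show ?thesis .
  qed
  have expand: "(\<integral>x. (u x - v x)\<^sup>2 \<partial>fbM m) = (\<integral>x. (u x)\<^sup>2 \<partial>fbM m) + (\<integral>x. (v x)\<^sup>2 \<partial>fbM m) - 2 * (\<integral>x. u x * v x \<partial>fbM m)"
    if "u \<in> borel_measurable (fbM m)" "v \<in> borel_measurable (fbM m)" "integrable (fbM m) (\<lambda>x. (u x)\<^sup>2)" "integrable (fbM m) (\<lambda>x. (v x)\<^sup>2)" for u v :: "real \<Rightarrow> real"
    using integral_cauchy_schwarz(1)[OF that] that(3,4) by (simp add: power2_diff mult.assoc)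
  have "0 \<le> (\<integral>x. (f x - q x)\<^sup>2 \<partial>fbM m)" by simp
  with an show "(\<integral>x. (g x)\<^sup>2 \<partial>fbM m) \<le> (\<integral>x. (f x)\<^sup>2 \<partial>fbM m) + e"
    unfolding expand[OF f(1) qm f(2) qi] expand[OF g(1) gauss_sum_measurable g(2) \<Theta>i] same pair by linarith
qed

text \<open>A function orthogonal to a dense subspace is closest to zero in it.\<close>

lemma orthogonal_to_gauss_imp_zero:
  assumes u: "u \<in> borel_measurable (fbM m)" "integrable (fbM m) (\<lambda>x. (u x)\<^sup>2)"
    and orth: "\<And>i. (\<integral>x. u x * gauss (real (Suc i)) x \<partial>fbM m) = 0"
  shows "AE x in fbM m. u x = 0"
proof -
  have "(\<integral>x. (u x)\<^sup>2 \<partial>fbM m) \<le> 0 + e" if e: "e > 0" for e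
  proof -
    obtain a n where an: "(\<integral>x. (u x - gauss_sum a n x)\<^sup>2 \<partial>fbM m) < e"
      using square_integrable_gauss_approximable[OF u] e unfolding gauss_approximable_def by blast
    have s: "real (Suc i) > 0" for i by simp
    note iu = integral_cauchy_schwarz(1)[OF u(1) gauss_fbM_measurable u(2) gauss_square_integrable[OF s]]
    have "(\<integral>x. u x * gauss_sum a n x \<partial>fbM m) = (\<integral>x. (\<Sum>i<n. a i * (u x * gauss (real (Suc i)) x)) \<partial>fbM m)"
      unfolding gauss_sum_def sum_distrib_left by (simp only: mult_ac)
    also have "\<dots> = (\<Sum>i<n. \<integral>x. a i * (u x * gauss (real (Suc i)) x) \<partial>fbM m)"
      by (intro Bochner_Integration.integral_sum integrable_mult_right iu)
    also have "\<dots> = 0" unfolding integral_mult_right_zero orth by simp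
    finally have "(\<integral>x. (u x - gauss_sum a n x)\<^sup>2 \<partial>fbM m) = (\<integral>x. (u x)\<^sup>2 \<partial>fbM m) + (\<integral>x. (gauss_sum a n x)\<^sup>2 \<partial>fbM m)"
      using integral_cauchy_schwarz(1)[OF u(1) gauss_sum_measurable u(2) gauss_sum_square_integrable] u(2) gauss_sum_square_integrable[of m a n]
      by (simp add: power2_diff mult.assoc)
    moreover have "(\<integral>x. (gauss_sum a n x)\<^sup>2 \<partial>fbM m) \<ge> 0" by simp
    ultimately show ?thesis using an by linarith
  qed
  then have "(\<integral>x. (u x)\<^sup>2 \<partial>fbM m) \<le> 0" by (rule field_le_epsilon)
  moreover have "(\<integral>x. (u x)\<^sup>2 \<partial>fbM m) \<ge> 0" by simp
  ultimately have "(\<integral>x. (u x)\<^sup>2 \<partial>fbM m) = 0" by linarith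
  then have "AE x in fbM m. (u x)\<^sup>2 = 0" using integral_nonneg_eq_0_iff_AE[OF u(2)] by simp
  then show ?thesis by eventually_elim simp
qed

text \<open>Both sides have the same pairing with every Gaussian, because the transform applied twice fixes Gaussians.\<close>

lemma fb_inversion:
  assumes T: "has_fb_transform (real m + 1 / 2) f g" and g1: "integrable (fbM m) g"
  shows "AE x in fbM m. f x = fb_integral (real m + 1 / 2) g x"
proof -
  let ?T = "fb_integral (real m + 1 / 2) g"
  have f: "f \<in> borel_measurable (fbM m)" "integrable (fbM m) (\<lambda>x. (f x)\<^sup>2)"
    using T unfolding has_fb_transform_def fb_space_2_iff by blast+
  have Tm: "?T \<in> borel_measurable (fbM m)" by (rule fb_integral_bounded_measurable(1)[OF g1])
  obtain B where B: "\<And>y. y \<ge> 0 \<Longrightarrow> \<bar>?T y\<bar> \<le> B" using fb_integral_bounded_measurable(2)[OF g1] by blast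
  have Tg: "integrable (fbM m) (\<lambda>x. (?T x * gauss t x)\<^sup>2)" and Tg1: "integrable (fbM m) (\<lambda>x. ?T x * gauss t x)" if t: "t > 0" for t
  proof -
    have "integrable (fbM m) (\<lambda>x. B\<^sup>2 * gauss (2 * t) x)" using t by (intro integrable_mult_right gauss_integrable) simp
    then show "integrable (fbM m) (\<lambda>x. (?T x * gauss t x)\<^sup>2)"
    proof (rule Bochner_Integration.integrable_bound)
      have "(?T x)\<^sup>2 * gauss (2 * t) x \<le> B\<^sup>2 * gauss (2 * t) x" if "x \<ge> 0" for x
        using power_mono[OF B[OF that] abs_ge_zero, of 2] gauss_pos[of "2 * t" x] by (intro mult_right_mono) auto
      then show "AE x in fbM m. norm ((?T x * gauss t x)\<^sup>2) \<le> norm (B\<^sup>2 * gauss (2 * t) x)"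
        by (intro AE_I2) (simp add: power_mult_distrib gauss_square abs_mult abs_gauss)
    qed (intro borel_measurable_power borel_measurable_times Tm gauss_fbM_measurable)
    have "integrable (fbM m) (\<lambda>x. B * gauss t x)" using t by (intro integrable_mult_right gauss_integrable)
    then show "integrable (fbM m) (\<lambda>x. ?T x * gauss t x)"
    proof (rule Bochner_Integration.integrable_bound)
      have "\<bar>?T x\<bar> * gauss t x \<le> \<bar>B\<bar> * gauss t x" if "x \<ge> 0" for x
        using B[OF that] gauss_pos[of t x] by (intro mult_right_mono) (auto intro: order_trans[OF _ abs_ge_self])
      then show "AE x in fbM m. norm (?T x * gauss t x) \<le> norm (B * gauss t x)"
        by (intro AE_I2) (simp add: abs_mult abs_gauss)
    qed (intro borel_measurable_power borel_measurable_times Tm gauss_fbM_measurable)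
  qed
  \<comment> \<open>The difference itself need not be known to be square-integrable, as \<open>?T\<close> is so far only bounded; one
    Gaussian factor repairs this and is absorbed into the exponent of the test function.\<close>
  define u where "u x = ?T x * gauss 1 x - f x * gauss 1 x" for x
  have um: "u \<in> borel_measurable (fbM m)" unfolding u_def[abs_def] using Tm f(1) by measurable
  have "integrable (fbM m) (\<lambda>x. (f x * gauss 1 x)\<^sup>2)"
  proof (rule Bochner_Integration.integrable_bound[OF f(2)])
    have "(f x)\<^sup>2 * gauss 2 x \<le> (f x)\<^sup>2 * 1" for x by (intro mult_left_mono gauss_le_1) auto
    then show "AE x in fbM m. norm ((f x * gauss 1 x)\<^sup>2) \<le> norm ((f x)\<^sup>2)"
      by (intro AE_I2) (simp add: power_mult_distrib gauss_square abs_mult abs_gauss)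
  qed (intro borel_measurable_power borel_measurable_times f(1) gauss_fbM_measurable)
  then have us: "integrable (fbM m) (\<lambda>x. (u x)\<^sup>2)"
    unfolding u_def using Tm f(1) Tg[of 1] by (intro square_integrable_diff) simp_all
  have "(\<integral>x. u x * gauss (real (Suc i)) x \<partial>fbM m) = 0" for i
  proof -
    let ?s = "real (Suc (Suc i))"
    have s: "?s > 0" "1 / ?s > 0" by simp_all
    have "u x * gauss (real (Suc i)) x = ?T x * gauss ?s x - f x * gauss ?s x" for x
    proof -
      have "gauss ?s x = gauss 1 x * gauss (real (Suc i)) x" unfolding gauss_mult by simp
      then show ?thesis unfolding u_def by (simp only: left_diff_distrib mult.assoc)
    qed
    then have "(\<integral>x. u x * gauss (real (Suc i)) x \<partial>fbM m) = (\<integral>x. ?T x * gauss ?s x \<partial>fbM m) - (\<integral>x. f x * gauss ?s x \<partial>fbM m)"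
      using Tg1[OF s(1)] integral_cauchy_schwarz(1)[OF f(1) gauss_fbM_measurable f(2) gauss_square_integrable[OF s(1)]]
      by (simp only: Bochner_Integration.integral_diff)
    also have "(\<integral>x. ?T x * gauss ?s x \<partial>fbM m) = gauss_mass m ?s * (gauss_mass m (1 / ?s) * (\<integral>x. f x * gauss (1 / (1 / ?s)) x \<partial>fbM m))"
      unfolding fb_integral_gauss_pairing[OF g1 s(1)] fb_transform_gauss_pairing[OF T s(2)] ..
    also have "\<dots> = (gauss_mass m ?s * gauss_mass m (1 / ?s)) * (\<integral>x. f x * gauss ?s x \<partial>fbM m)"
      by (simp only: mult.assoc div_by_1 divide_divide_eq_right mult_1)
    finally show ?thesis unfolding gauss_mass_dual(2)[OF s(1) s(1)] by simp
  qed
  then have "AE x in fbM m. u x = 0" by (rule orthogonal_to_gauss_imp_zero[OF um us])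
  then show ?thesis
  proof eventually_elim
    case (elim x)
    then show ?case using gauss_pos[of 1 x] by (simp add: u_def flip: left_diff_distrib)
  qed
qed

section \<open>Reduction to the Hankel transform\<close>

abbreviation fb_const :: "nat \<Rightarrow> real" where "fb_const m \<equiv> 2 * sqrt pi ^ (2 * m + 3) / Gamma (real m + 3 / 2)"

lemma fb_const_pos: "fb_const m > 0"
  using Gamma_pos_half[of m] by (intro divide_pos_pos mult_pos_pos zero_less_power) simp_all

lemma power_Suc_squared: "((y::real) ^ Suc m)\<^sup>2 = y ^ (2 * m + 2)"
proof -
  have "Suc m * 2 = 2 * m + 2" by simp
  then show ?thesis by (metis power_mult)
qed

lemma fb_integral_borel:
  assumes g[measurable]: "g \<in> borel_measurable borel"
  shows "fb_integral (real m + 1 / 2) g \<in> borel_measurable borel"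
proof -
  interpret sigma_finite_measure "fbM m" by (rule sigma_finite_fbM)
  have [measurable]: "(\<lambda>x. x) \<in> borel_measurable (fbM m)" "g \<in> borel_measurable (fbM m)"
    by (rule borel_measurable_fbM, simp)+
  show ?thesis unfolding fb_integral_def[abs_def] by measurable
qed

lemma fbM_measure_bounds:
  assumes A: "A \<in> sets borel" "A \<subseteq> {l..u}" and l: "0 \<le> l"
  shows "fb_const m * l ^ (2 * m + 2) * measure lborel A \<le> measure (fbM m) A"
    and "measure (fbM m) A \<le> fb_const m * u ^ (2 * m + 2) * measure lborel A"
proof -
  have A'[measurable]: "A \<in> sets borel" by fact
  have fin: "emeasure lborel A < \<infinity>"
  proof -
    have "emeasure lborel A \<le> emeasure lborel {l..u}" using A by (intro emeasure_mono) auto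
    also have "\<dots> < \<infinity>" by (simp add: emeasure_lborel_Icc_eq)
    finally show ?thesis .
  qed
  have "A \<subseteq> {0..}" using A(2) l by auto
  then have "measure (fbM m) A = (\<integral>x. indicator A x \<partial>fbM m)" by (simp add: Int_absorb2)
  also have "\<dots> = (\<integral>x. indicator {0..} x *\<^sub>R (fb_weight m x * indicator A x) \<partial>lborel)"
    by (subst fbM_borel_integral(2)) (simp_all add: set_lebesgue_integral_def)
  finally have eq: "measure (fbM m) A = (\<integral>x. indicator {0..} x *\<^sub>R (fb_weight m x * indicator A x) \<partial>lborel)" .
  have iA: "integrable lborel (\<lambda>x. v * indicat_real A x)" for v using A(1) fin by (intro integrable_mult_right integrable_real_indicator) auto
  have vA: "(\<integral>x. v * indicat_real A x \<partial>lborel) = v * measure lborel A" for v by simp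
  have w: "fb_const m * l ^ (2 * m + 2) \<le> fb_weight m x" "fb_weight m x \<le> fb_const m * u ^ (2 * m + 2)" if "x \<in> A" for x
  proof -
    have x: "l \<le> x" "x \<le> u" "0 \<le> x" using that A(2) l by auto
    show "fb_const m * l ^ (2 * m + 2) \<le> fb_weight m x" "fb_weight m x \<le> fb_const m * u ^ (2 * m + 2)"
      unfolding fb_weight_def by (intro mult_left_mono power_mono x l less_imp_le[OF fb_const_pos])+
  qed
  have up: "indicator {0..} x *\<^sub>R (fb_weight m x * indicator A x) \<le> (fb_const m * u ^ (2 * m + 2)) * indicator A x"
   and lo: "(fb_const m * l ^ (2 * m + 2)) * indicator A x \<le> indicator {0..} x *\<^sub>R (fb_weight m x * indicator A x)"
   and nn: "0 \<le> indicator {0..} x *\<^sub>R (fb_weight m x * indicat_real A x)" for x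
    using w[of x] \<open>A \<subseteq> {0..}\<close> fb_weight_nonneg[of x m] by (auto simp: indicator_def)
  have iw: "integrable lborel (\<lambda>x. indicator {0..} x *\<^sub>R (fb_weight m x * indicat_real A x))"
  proof (rule Bochner_Integration.integrable_bound[OF iA[of "fb_const m * u ^ (2 * m + 2)"]])
    show "AE x in lborel. norm (indicator {0..} x *\<^sub>R (fb_weight m x * indicat_real A x)) \<le> norm ((fb_const m * u ^ (2 * m + 2)) * indicat_real A x)"
      unfolding real_norm_def abs_of_nonneg[OF nn] by (intro AE_I2 order_trans[OF up abs_ge_self])
  qed measurable
  show "fb_const m * l ^ (2 * m + 2) * measure lborel A \<le> measure (fbM m) A"
    unfolding eq vA[symmetric] by (rule integral_mono[OF iA iw lo])
  show "measure (fbM m) A \<le> fb_const m * u ^ (2 * m + 2) * measure lborel A"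
    unfolding eq vA[symmetric] by (rule integral_mono[OF iw iA up])
qed

text \<open>On \<open>[j, j + 1]\<close> the weight is at most that at \<open>j + 1\<close>, and on the right half at least
  \<open>2\<^bsup>-(2m + 2)\<^esup>\<close> times that, so weighted density implies density for Lebesgue measure.\<close>

lemma fb_relatively_dense_measure:
  assumes E: "fb_relatively_dense (real m + 1 / 2) \<gamma> E" "E \<in> sets (fbM m)" and \<gamma>: "\<gamma> > 0"
    and E': "E' \<in> sets borel" "AE x in fbM m. x \<in> E \<longleftrightarrow> x \<in> E'"
  shows "measure lborel (E' \<inter> {real j..real j + 1}) \<ge> \<gamma> / 2 ^ (2 * m + 3)"
proof -
  let ?J = "{real j..real j + 1}" and ?H = "{real j + 1 / 2..real j + 1}"
  let ?p = "2 * m + 2"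
  have J: "?J \<in> sets (fbM m)" by (auto simp: sets_restrict_space_iff)
  have EJ': "E' \<inter> ?J \<in> sets borel" using E'(1) by simp
  then have EJ'': "E' \<inter> ?J \<in> sets (fbM m)" 
  proof -
    have "E' \<inter> ?J \<in> sets lebesgue" using EJ' by (intro sets_completionI_sets) simp
    moreover have "E' \<inter> ?J \<subseteq> {0..}" by auto
    ultimately show ?thesis by (simp add: sets_restrict_space_iff)
  qed
  have "measure (fbM m) (E \<inter> ?J) = measure (fbM m) (E' \<inter> ?J)"
  proof (rule measure_eq_AE)
    show "AE x in fbM m. x \<in> E \<inter> ?J \<longleftrightarrow> x \<in> E' \<inter> ?J" using E'(2) by eventually_elim simp
  qed (use E(2) J EJ'' in simp_all)
  moreover have "measure (fbM m) (E' \<inter> ?J) \<le> fb_const m * (real j + 1) ^ ?p * measure lborel (E' \<inter> ?J)"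
    using EJ' by (rule fbM_measure_bounds(2)) auto
  moreover have "fb_const m * (real j + 1 / 2) ^ ?p * (1 / 2) \<le> measure (fbM m) ?J"
  proof -
    have "fb_const m * (real j + 1 / 2) ^ ?p * measure lborel ?H \<le> measure (fbM m) ?H"
      by (rule fbM_measure_bounds(1)) auto
    also have "\<dots> \<le> measure (fbM m) ?J"
    proof (rule measure_mono_fmeasurable)
      show "?J \<in> fmeasurable (fbM m)"
      proof (rule fmeasurableI)
        have "emeasure (fbM m) ?J \<le> emeasure (fbM m) {0..real (Suc j)}"
          by (rule emeasure_mono) (auto simp: sets_restrict_space_iff)
        also have "\<dots> < \<infinity>" by (rule fbM_finite_interval(2))
        finally show "emeasure (fbM m) ?J < \<infinity>" .
      qed (rule J)
    qed (auto simp: sets_restrict_space_iff)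
    finally show ?thesis by simp
  qed
  moreover have "\<gamma> * measure (fbM m) ?J \<le> measure (fbM m) (E \<inter> ?J)"
    using E(1) unfolding fb_relatively_dense_def by simp
  moreover have "fb_const m * ((real j + 1) / 2) ^ ?p * (1 / 2) \<le> fb_const m * (real j + 1 / 2) ^ ?p * (1 / 2)"
    using fb_const_pos[of m] by (intro mult_left_mono mult_right_mono power_mono) auto
  ultimately have "\<gamma> * (fb_const m * ((real j + 1) / 2) ^ ?p * (1 / 2)) \<le> fb_const m * (real j + 1) ^ ?p * measure lborel (E' \<inter> ?J)"
    using \<gamma> by (smt (verit, best) mult_left_mono)
  moreover have "\<gamma> * (fb_const m * ((real j + 1) / 2) ^ ?p * (1 / 2)) = (fb_const m * (real j + 1) ^ ?p) * (\<gamma> / 2 ^ (2 * m + 3))"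
  proof -
    have "(2::real) ^ (2 * m + 3) = 2 ^ ?p * 2" by (simp add: numeral_3_eq_3)
    moreover have "g * (c * (q / t) * (1 / 2)) = (c * q) * (g / (t * 2))" for g c q t :: real by simp
    ultimately show ?thesis unfolding power_divide by (simp only:)
  qed
  moreover have "fb_const m * (real j + 1) ^ ?p > 0" using fb_const_pos[of m] by (intro mult_pos_pos zero_less_power) simp_all
  ultimately show ?thesis by (metis mult_le_cancel_left_pos)
qed

lemma interval_of_length_one:
  assumes I: "is_interval I" "I \<subseteq> {0..}" "measure lborel I = 1"
  obtains a :: real where "a \<ge> 0" "I \<subseteq> {a..a + 1}"
proof
  have ne: "I \<noteq> {}" using I(3) by auto
  have Is: "I \<in> sets lborel" using I(3) measure_notin_sets[of I lborel] by fastforce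
  have fin: "emeasure lborel I \<noteq> \<infinity>" using I(3) by (auto simp: measure_def)
  have bdd: "bdd_below I" using I(2) by (intro bdd_belowI[of _ 0]) auto
  show "Inf I \<ge> 0" using ne I(2) by (intro cInf_greatest) auto
  show "I \<subseteq> {Inf I..Inf I + 1}"
  proof
    fix x assume x: "x \<in> I"
    have "Inf I \<le> x" by (rule cInf_lower[OF x bdd])
    moreover have "x \<le> Inf I + 1"
    proof (rule ccontr)
      assume "\<not> x \<le> Inf I + 1"
      then have "Inf I < x - 1" by simp
      then obtain y where y: "y \<in> I" "y < x - 1" using cInf_less_iff[OF ne bdd] by blast
      then have "{y..x} \<subseteq> I" using mem_is_interval_1_I[OF I(1) y(1) x] by auto
      then have "measure lborel {y..x} \<le> measure lborel I"
        using Is fin by (intro measure_mono_fmeasurable fmeasurableI) (auto simp: less_top)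
      then show False using y(2) I(3) by simp
    qed
    ultimately show "x \<in> {Inf I..Inf I + 1}" by simp
  qed
qed

text \<open>The substitution \<open>G y = y\<^bsup>m+1\<^esup> g y\<close> absorbs the weight.\<close>

lemma fb_square_integral_profile:
  fixes m :: nat and g :: "real \<Rightarrow> real"
  assumes g[measurable]: "g \<in> borel_measurable borel"
  defines "G \<equiv> \<lambda>y. indicator {0..} y * (y ^ Suc m * g y)"
  shows "integrable (fbM m) (\<lambda>x. (g x)\<^sup>2) \<longleftrightarrow> integrable lborel (\<lambda>y. (G y)\<^sup>2)"
    and "(\<integral>x. (g x)\<^sup>2 \<partial>fbM m) = fb_const m * (\<integral>y. (G y)\<^sup>2 \<partial>lborel)"
proof -
  have eq: "indicator {0..} y *\<^sub>R (fb_weight m y * (g y)\<^sup>2) = fb_const m * (G y)\<^sup>2" for y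
  proof -
    have "(G y)\<^sup>2 = indicator {0..} y * (y ^ (2 * m + 2) * (g y)\<^sup>2)"
      unfolding G_def power_mult_distrib power_Suc_squared by (simp add: indicator_def)
    then show ?thesis unfolding fb_weight_def real_scaleR_def by (simp only: mult_ac)
  qed
  have c: "fb_const m \<noteq> 0" using fb_const_pos[of m] by linarith
  have m: "(\<lambda>x. (g x)\<^sup>2) \<in> borel_measurable borel" by measurable
  show "integrable (fbM m) (\<lambda>x. (g x)\<^sup>2) \<longleftrightarrow> integrable lborel (\<lambda>y. (G y)\<^sup>2)"
    unfolding fbM_borel_integral(1)[OF m] set_integrable_def eq using c by (simp only: integrable_mult_left_iff simp_thms)
  show "(\<integral>x. (g x)\<^sup>2 \<partial>fbM m) = fb_const m * (\<integral>y. (G y)\<^sup>2 \<partial>lborel)"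
    unfolding fbM_borel_integral(2)[OF m] set_lebesgue_integral_def eq by (rule integral_mult_right_zero)
qed

text \<open>The same substitution on both sides turns the Fourier-Bessel integral into the Hankel transform.\<close>

lemma fb_integral_hk_transform:
  fixes g :: "real \<Rightarrow> real"
  assumes g[measurable]: "g \<in> borel_measurable borel"
  shows "hk_transform m (\<lambda>y. indicator {0..} y * (y ^ Suc m * g y)) (of_real x) =
     of_real (x ^ Suc m * (pi ^ Suc m / (Gamma (real m + 3 / 2) * fb_const m)) * fb_integral (real m + 1 / 2) g x)"
proof -
  let ?j = "bessel_j (real m + 1 / 2)" and ?\<Gamma> = "Gamma (real m + 3 / 2) :: real"
  let ?k = "x ^ Suc m * (pi ^ Suc m / (?\<Gamma> * fb_const m))"
  have \<Gamma>: "?\<Gamma> \<noteq> 0" using Gamma_pos_half[of m] by linarith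
  have c: "fb_const m \<noteq> 0" using fb_const_pos[of m] by linarith
  have hk: "hkernel m (of_real x * of_real y) = of_real ((pi * (x * y)) ^ Suc m * (?j (2 * pi * y * x) / ?\<Gamma>))" for y
  proof -
    have A: "hbessel (Suc m) (complex_of_real (2 * pi * y * x)) = of_real (?j (2 * pi * y * x)) / of_real ?\<Gamma>"
      unfolding bessel_j_hbessel using \<Gamma> by simp
    have B: "2 * complex_of_real pi * (of_real x * of_real y) = of_real (2 * pi * y * x)" by simp
    show ?thesis unfolding hkernel_def B A by simp
  qed
  have point: "of_real (indicator {0..} y * (y ^ Suc m * g y)) * hkernel m (of_real x * of_real y) =
     complex_of_real (?k * (indicator {0..} y *\<^sub>R (fb_weight m y * (g y * ?j (2 * pi * y * x)))))" for y
  proof -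
    have w: "fb_weight m y = fb_const m * (y ^ Suc m * y ^ Suc m)"
      unfolding fb_weight_def power_Suc_squared[symmetric] power2_eq_square ..
    have al: "i * (p * v) * ((q * (z * p)) * (j / G)) = z * (q / (G * k)) * (i * (k * (p * p) * (v * j)))"
      if "G \<noteq> 0" "k \<noteq> 0" for i p v q z j G k :: real
      using that by (simp add: divide_simps)
    show ?thesis
      unfolding hk unfolding of_real_mult[symmetric] power_mult_distrib w real_scaleR_def
      by (rule arg_cong[where f = of_real], rule al[OF \<Gamma> c])
  qed
  have m: "(\<lambda>y. g y * ?j (2 * pi * y * x)) \<in> borel_measurable borel" by measurable
  show ?thesis
    unfolding hk_transform_def point integral_complex_of_real integral_mult_right_zero fb_integral_def
      fbM_borel_integral(2)[OF m] set_lebesgue_integral_def ..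
qed

theorem theorem1p8:
  fixes \<alpha> \<gamma> :: real and N :: nat
  assumes "\<exists>m::nat. \<alpha> - 1 / 2 = real m"
    and "\<gamma> > 0"
    and "N \<ge> 1"
  shows "\<exists>C>0. \<forall>(E :: real set) (I :: nat \<Rightarrow> real set) (f :: real \<Rightarrow> real) (g :: real \<Rightarrow> real).
    E \<in> sets (fb_measure \<alpha>) \<and> fb_relatively_dense \<alpha> \<gamma> E \<and>
    (\<forall>k\<in>{1..N}. is_interval (I k) \<and> I k \<subseteq> {0..} \<and> measure lborel (I k) = 1) \<and>
    disjoint_family_on I {1..N} \<and>
    f \<in> fb_space \<alpha> 2 \<and> has_fb_transform \<alpha> f g \<and> fb_supp_in \<alpha> g (\<Union>k\<in>{1..N}. I k)
    \<longrightarrow> fb_norm \<alpha> 2 f \<le> C * fb_norm_on \<alpha> 2 E f"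
proof -
  obtain m :: nat where "\<alpha> - 1 / 2 = real m" using assms(1) by blast
  then have \<alpha>: "\<alpha> = real m + 1 / 2" by simp
  let ?T = "fb_integral (real m + 1 / 2)"
  \<comment> \<open>\<open>|hk_transform m G x| = x\<^bsup>m+1\<^esup> \<kappa> |f x|\<close>, hence the constant \<open>1 / \<kappa>\<^sup>2\<close> in the norm comparison.\<close>
  define \<kappa> where "\<kappa> = pi ^ Suc m / (Gamma (real m + 3 / 2) * fb_const m)"
  have \<kappa>: "\<kappa> > 0" unfolding \<kappa>_def using Gamma_pos_half[of m] fb_const_pos[of m] by (intro divide_pos_pos mult_pos_pos zero_less_power) simp_all
  have "\<gamma> / 2 ^ (2 * m + 3) > 0" "1 / \<kappa>\<^sup>2 > 0" using assms(2) \<kappa> by simp_all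
  from relative_density_estimate[OF this, of N m]
  obtain C where "C > 0 \<and> (\<forall>(E :: real set) (a :: nat \<Rightarrow> real) (G :: real \<Rightarrow> real).
     E \<in> sets borel \<and> (\<forall>j::nat. measure lborel (E \<inter> {real j..real j + 1}) \<ge> \<gamma> / 2 ^ (2 * m + 3)) \<and>
     (\<forall>k\<in>{1..N}. a k \<ge> 0) \<and> G \<in> borel_measurable borel \<and> integrable lborel (\<lambda>y. (G y)\<^sup>2) \<and>
     (\<forall>y. G y \<noteq> 0 \<longrightarrow> y > 0 \<and> (\<exists>k\<in>{1..N}. y \<in> {a k..a k + 1})) \<and>
     set_integrable lborel {0..} (\<lambda>x. (cmod (hk_transform m G (of_real x)))\<^sup>2) \<and>
     (LINT y|lborel. (G y)\<^sup>2) \<le> (1 / \<kappa>\<^sup>2) * (LINT x:{0..}|lborel. (cmod (hk_transform m G (of_real x)))\<^sup>2) \<longrightarrow>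
     (LINT x:{0..}|lborel. (cmod (hk_transform m G (of_real x)))\<^sup>2) \<le>
       C * (LINT x:E \<inter> {0..}|lborel. (cmod (hk_transform m G (of_real x)))\<^sup>2))" ..
  note C = this[THEN conjunct1] and est = this[THEN conjunct2]
  have main: "fb_norm (real m + 1 / 2) 2 f \<le> sqrt C * fb_norm_on (real m + 1 / 2) 2 E f"
    if E: "E \<in> sets (fbM m)" "fb_relatively_dense (real m + 1 / 2) \<gamma> E"
      and I: "\<forall>k\<in>{1..N}. is_interval (I k) \<and> I k \<subseteq> {0..} \<and> measure lborel (I k) = 1"
      and T: "has_fb_transform (real m + 1 / 2) f g" and supp: "fb_supp_in (real m + 1 / 2) g (\<Union>k\<in>{1..N}. I k)" for E I f g
  proof -
    have f: "f \<in> borel_measurable (fbM m)" "integrable (fbM m) (\<lambda>x. (f x)\<^sup>2)"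
      and g: "g \<in> borel_measurable (fbM m)" "integrable (fbM m) (\<lambda>x. (g x)\<^sup>2)"
      using T unfolding has_fb_transform_def fb_space_2_iff by blast+
    have "\<forall>k\<in>{1..N}. \<exists>a::real. a \<ge> 0 \<and> I k \<subseteq> {a..a + 1}" using I interval_of_length_one by metis
    then obtain a where a: "\<And>k. k \<in> {1..N} \<Longrightarrow> a k \<ge> 0 \<and> I k \<subseteq> {a k..a k + 1}" by metis
    \<comment> \<open>The origin is a null set and is removed because the profile is required to live on \<open>y > 0\<close>.\<close>
    define S where "S = {0<..} \<inter> (\<Union>k\<in>{1..N}. {a k..a k + 1})"
    have S[measurable]: "S \<in> sets borel" unfolding S_def by simp
    obtain g' where g'[measurable]: "g' \<in> borel_measurable borel" and gg': "AE x in fbM m. g x = g' x"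
      using fbM_borel_version[OF g(1)] by blast
    define q where "q y = indicator S y * g' y" for y
    have q[measurable]: "q \<in> borel_measurable borel" unfolding q_def[abs_def] by measurable
    have qm: "q \<in> borel_measurable (fbM m)" by (rule borel_measurable_fbM) simp
    have "AE x in fbM m. x \<noteq> 0" unfolding AE_fbM by simp
    then have gq: "AE x in fbM m. g x = q x"
      using gg' supp[unfolded fb_supp_in_def] AE_space
    proof eventually_elim
      case (elim x)
      then show ?case
      proof (cases "x \<in> (\<Union>k\<in>{1..N}. I k)")
        case True
        then have "x \<in> S" using a elim(1,4) unfolding S_def by fastforce
        then show ?thesis using elim(2) by (simp add: q_def)
      next
        case False
        then have "g x = 0" using elim(3) by blast
        then show ?thesis using elim(2) by (simp add: q_def)
      qed
    qed
    have q2: "integrable (fbM m) (\<lambda>x. (q x)\<^sup>2)" and q2': "(\<integral>x. (q x)\<^sup>2 \<partial>fbM m) = (\<integral>x. (g x)\<^sup>2 \<partial>fbM m)"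
    proof -
      have ae: "AE x in fbM m. (g x)\<^sup>2 = (q x)\<^sup>2" using gq by eventually_elim simp
      note ms = borel_measurable_power[OF g(1), of 2] borel_measurable_power[OF qm, of 2]
      show "integrable (fbM m) (\<lambda>x. (q x)\<^sup>2)" using integrable_cong_AE[OF ms ae] g(2) by simp
      show "(\<integral>x. (q x)\<^sup>2 \<partial>fbM m) = (\<integral>x. (g x)\<^sup>2 \<partial>fbM m)" by (rule integral_cong_AE[OF ms ae, symmetric])
    qed
    have q1: "integrable (fbM m) q"
    proof -
      obtain K :: nat where K: "\<And>k. k \<in> {1..N} \<Longrightarrow> a k + 1 \<le> real K"
      proof -
        obtain K :: nat where "(\<Sum>k\<in>{1..N}. a k + 1) \<le> real K" using real_arch_simple by blast
        moreover have "a k + 1 \<le> (\<Sum>k\<in>{1..N}. a k + 1)" if "k \<in> {1..N}" for k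
          by (rule member_le_sum[OF that]) (use a in \<open>auto intro: add_nonneg_nonneg\<close>)
        ultimately show thesis by (meson that order_trans)
      qed
      have SK: "S \<subseteq> {0..real K}" using K unfolding S_def by fastforce
      have Sm: "indicat_real S \<in> borel_measurable (fbM m)" by (rule borel_measurable_fbM) simp
      have "integrable (fbM m) (\<lambda>x. (indicat_real S x)\<^sup>2)"
      proof (rule Bochner_Integration.integrable_bound[OF fbM_finite_interval(1)[of m K]])
        show "AE x in fbM m. norm ((indicat_real S x)\<^sup>2) \<le> norm (indicat_real {0..real K} x)"
          using SK by (intro AE_I2) (auto simp: indicator_def)
      qed (intro borel_measurable_power Sm)
      from integral_cauchy_schwarz(1)[OF qm Sm q2 this]
      have "integrable (fbM m) (\<lambda>x. q x * indicat_real S x)" .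
      moreover have "(\<lambda>x. q x * indicat_real S x) = q" unfolding q_def by (auto simp: indicator_def)
      ultimately show ?thesis by simp
    qed
    then have g1: "integrable (fbM m) g" using integrable_cong_AE[OF g(1) qm gq] by simp
    have Tgq: "?T g x = ?T q x" for x
    proof -
      have [measurable]: "(\<lambda>t. bessel_j (real m + 1 / 2) (2 * pi * t * x)) \<in> borel_measurable (fbM m)"
        by (rule borel_measurable_fbM) measurable
      show ?thesis unfolding fb_integral_def
      proof (rule integral_cong_AE)
        show "AE t in fbM m. g t * bessel_j (real m + 1 / 2) (2 * pi * t * x) = q t * bessel_j (real m + 1 / 2) (2 * pi * t * x)"
          using gq by eventually_elim simp
      qed (use g(1) qm in measurable)
    qed
    have fT: "AE x in fbM m. f x = ?T q x" using fb_inversion[OF T g1] unfolding Tgq .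
    define G where "G = (\<lambda>y. indicator {0..} y * (y ^ Suc m * q y))"
    have Gm: "G \<in> borel_measurable borel" unfolding G_def by measurable
    have Gi: "integrable lborel (\<lambda>y. (G y)\<^sup>2)" unfolding G_def using fb_square_integral_profile(1)[OF q] q2 by simp
    have Tm[measurable]: "?T q \<in> borel_measurable borel" by (rule fb_integral_borel[OF q])
    have Tm': "?T q \<in> borel_measurable (fbM m)" by (rule borel_measurable_fbM[OF Tm])
    have hk: "(cmod (hk_transform m G (of_real x)))\<^sup>2 = (x ^ Suc m * \<kappa> * ?T q x)\<^sup>2" for x
      unfolding G_def fb_integral_hk_transform[OF q] \<kappa>_def[symmetric] norm_of_real by simp
    have w: "fb_weight m x * (?T q x)\<^sup>2 = fb_const m / \<kappa>\<^sup>2 * (cmod (hk_transform m G (of_real x)))\<^sup>2" for x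
    proof -
      have sq: "(x ^ Suc m * \<kappa> * ?T q x)\<^sup>2 = x ^ (2 * m + 2) * \<kappa>\<^sup>2 * (?T q x)\<^sup>2"
        by (simp only: power_mult_distrib power_Suc_squared)
      have al: "c * p * t = c / k * (p * k * t)" if "k \<noteq> 0" for c p t k :: real using that by simp
      have "\<kappa>\<^sup>2 \<noteq> 0" using \<kappa> by simp
      then show ?thesis unfolding hk sq fb_weight_def by (rule al)
    qed
    define d where "d = fb_const m / \<kappa>\<^sup>2"
    have d: "d > 0" unfolding d_def using fb_const_pos[of m] \<kappa> by simp
    have over: "(\<integral>x. indicator A x * (f x)\<^sup>2 \<partial>fbM m) = d * (LINT x:A \<inter> {0..}|lborel. (cmod (hk_transform m G (of_real x)))\<^sup>2)"
      if A[measurable]: "A \<in> sets borel" for A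
    proof -
      have Am: "indicat_real A \<in> borel_measurable (fbM m)" by (rule borel_measurable_fbM) simp
      have "(\<integral>x. indicator A x * (f x)\<^sup>2 \<partial>fbM m) = (\<integral>x. indicator A x * (?T q x)\<^sup>2 \<partial>fbM m)"
      proof (rule integral_cong_AE)
        show "AE x in fbM m. indicat_real A x * (f x)\<^sup>2 = indicator A x * (?T q x)\<^sup>2" using fT by eventually_elim simp
      qed (intro borel_measurable_times borel_measurable_power Am f(1) Tm')+
      also have "\<dots> = (LINT x:{0..}|lborel. fb_weight m x * (indicator A x * (?T q x)\<^sup>2))"
        by (rule fbM_borel_integral(2)) measurable
      also have "\<dots> = (\<integral>x. d * (indicator (A \<inter> {0..}) x *\<^sub>R (cmod (hk_transform m G (of_real x)))\<^sup>2) \<partial>lborel)"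
        unfolding set_lebesgue_integral_def
      proof (rule Bochner_Integration.integral_cong[OF refl])
        fix x
        have "fb_weight m x * (indicat_real A x * (?T q x)\<^sup>2) = d * (indicat_real A x * (cmod (hk_transform m G (of_real x)))\<^sup>2)"
          using w[of x] unfolding d_def[symmetric] by (simp add: indicator_def)
        then show "indicat_real {0..} x *\<^sub>R (fb_weight m x * (indicat_real A x * (?T q x)\<^sup>2)) =
            d * (indicat_real (A \<inter> {0..}) x *\<^sub>R (cmod (hk_transform m G (of_real x)))\<^sup>2)"
          by (simp add: indicator_def)
      qed
      finally show ?thesis unfolding set_lebesgue_integral_def by simp
    qed
    have all: "(\<integral>x. (f x)\<^sup>2 \<partial>fbM m) = d * (LINT x:{0..}|lborel. (cmod (hk_transform m G (of_real x)))\<^sup>2)"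
      using over[of UNIV] by simp
    have hki: "set_integrable lborel {0..} (\<lambda>x. (cmod (hk_transform m G (of_real x)))\<^sup>2)"
    proof -
      have "AE x in fbM m. (f x)\<^sup>2 = (?T q x)\<^sup>2" using fT by eventually_elim simp
      then have "integrable (fbM m) (\<lambda>x. (?T q x)\<^sup>2)"
        using integrable_cong_AE[OF borel_measurable_power[OF f(1)] borel_measurable_power[OF Tm']] f(2) by blast
      then have "set_integrable lborel {0..} (\<lambda>x. fb_weight m x * (?T q x)\<^sup>2)"
        by (subst (asm) fbM_borel_integral(1)) measurable
      then have "set_integrable lborel {0..} (\<lambda>x. d * (cmod (hk_transform m G (of_real x)))\<^sup>2)" unfolding w d_def .
      then show ?thesis using d by (subst (asm) set_integrable_mult_right_iff) auto
    qed
    have nle: "(LINT y|lborel. (G y)\<^sup>2) \<le> (1 / \<kappa>\<^sup>2) * (LINT x:{0..}|lborel. (cmod (hk_transform m G (of_real x)))\<^sup>2)"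
    proof -
      have "fb_const m * (LINT y|lborel. (G y)\<^sup>2) = (\<integral>x. (g x)\<^sup>2 \<partial>fbM m)"
        unfolding G_def fb_square_integral_profile(2)[OF q, symmetric] by (rule q2')
      also have "\<dots> \<le> (\<integral>x. (f x)\<^sup>2 \<partial>fbM m)" by (rule fb_transform_norm_le[OF T])
      also have "\<dots> = fb_const m * ((1 / \<kappa>\<^sup>2) * (LINT x:{0..}|lborel. (cmod (hk_transform m G (of_real x)))\<^sup>2))"
        unfolding all d_def by simp
      finally show ?thesis using fb_const_pos[of m] by (simp only: mult_le_cancel_left_pos)
    qed
    have Gs: "\<forall>y. G y \<noteq> 0 \<longrightarrow> y > 0 \<and> (\<exists>k\<in>{1..N}. y \<in> {a k..a k + 1})"
      unfolding G_def q_def S_def by (auto simp: indicator_def split: if_splits)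
    \<comment> \<open>A Borel set that differs from \<open>E\<close> by a null set.\<close>
    define E' where "E' = main_part lborel E"
    have EL: "E \<in> sets lebesgue" using E(1) by (auto simp: sets_restrict_space_iff)
    then have E'm: "E' \<in> sets borel" unfolding E'_def using main_part_sets[of E lborel] by simp
    have "AE x in lborel. x \<in> E' \<longleftrightarrow> x \<in> E" unfolding E'_def by (rule AE_in_main_part[OF EL])
    then have EE': "AE x in fbM m. x \<in> E \<longleftrightarrow> x \<in> E'" by (intro AE_fbM_of_lborel) (simp add: eq_commute)
    have "(LINT x:{0..}|lborel. (cmod (hk_transform m G (of_real x)))\<^sup>2) \<le> C * (LINT x:E' \<inter> {0..}|lborel. (cmod (hk_transform m G (of_real x)))\<^sup>2)"
    proof (rule est[THEN spec, of E', THEN spec, of a, THEN spec, of G, THEN mp], intro conjI)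
      show "\<forall>j::nat. measure lborel (E' \<inter> {real j..real j + 1}) \<ge> \<gamma> / 2 ^ (2 * m + 3)"
        using fb_relatively_dense_measure[OF E(2,1) assms(2) E'm EE'] by blast
      show "\<forall>k\<in>{1..N}. a k \<ge> 0" using a by blast
    qed (fact E'm Gm Gi Gs hki nle)+
    then have "(\<integral>x. (f x)\<^sup>2 \<partial>fbM m) \<le> C * (\<integral>x. indicator E' x * (f x)\<^sup>2 \<partial>fbM m)"
      unfolding all over[OF E'm] using d by (simp add: mult.left_commute)
    also have "(\<integral>x. indicator E' x * (f x)\<^sup>2 \<partial>fbM m) = (LINT x:E|fbM m. (f x)\<^sup>2)"
      unfolding set_lebesgue_integral_def
    proof (rule integral_cong_AE)
      show "AE x in fbM m. indicat_real E' x * (f x)\<^sup>2 = indicat_real E x *\<^sub>R (f x)\<^sup>2"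
        using EE' by eventually_elim (simp add: indicator_def)
      have "indicat_real E' \<in> borel_measurable (fbM m)" using E'm by (intro borel_measurable_fbM) simp
      then show "(\<lambda>x. indicat_real E' x * (f x)\<^sup>2) \<in> borel_measurable (fbM m)"
        by (intro borel_measurable_times borel_measurable_power f(1))
      have "indicat_real E \<in> borel_measurable (fbM m)" by (rule borel_measurable_indicator[OF E(1)])
      then show "(\<lambda>x. indicat_real E x *\<^sub>R (f x)\<^sup>2) \<in> borel_measurable (fbM m)"
        unfolding real_scaleR_def by (intro borel_measurable_times borel_measurable_power f(1))
    qed
    finally have fin: "(\<integral>x. (f x)\<^sup>2 \<partial>fbM m) \<le> C * (LINT x:E|fbM m. (f x)\<^sup>2)" .
    have "(LINT x:E|fbM m. (f x)\<^sup>2) \<ge> 0" unfolding set_lebesgue_integral_def by simp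
    then have "fb_norm_on (real m + 1 / 2) 2 E f = sqrt (LINT x:E|fbM m. (f x)\<^sup>2)"
      unfolding fb_norm_on_def abs_powr_two by (simp add: powr_half_sqrt)
    then show ?thesis unfolding fb_norm_2 using fin by (simp flip: real_sqrt_mult)
  qed
  show ?thesis unfolding \<alpha>
  proof (intro exI[of _ "sqrt C"] conjI allI impI)
    show "sqrt C > 0" using C by simp
  qed (elim conjE, rule main)
qed

end
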